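(* Let $\varphi\in L^2(\mathbb{R})$ and let $\Lambda\subset\mathbb{R}\times\widehat{\mathbb{R}}$ be a lattice whose density is rational, such that $(\varphi,\Lambda)=\{\pi(\lambda)\varphi\}_{\lambda\in\Lambda}$ is a Riesz basis for its closed linear span $\mathcal{G}(\varphi,\Lambda)$. (1) If $\varphi\in S_0(\mathbb{R})$, then $\pi(u,\eta)\varphi\notin\mathcal{G}(\varphi,\Lambda)$ for all $(u,\eta)\in(\mathbb{R}\times\widehat{\mathbb{R}})\setminus\Lambda$. (2) In the case $\Lambda=\alpha\mathbb{Z}\times\beta\mathbb{Z}$, the same conclusion, namely $\pi(u,\eta)\varphi\notin\mathcal{G}(\varphi,\Lambda)$ for all $(u,\eta)\in(\mathbb{R}\times\widehat{\mathbb{R}})\setminus\Lambda$, holds when the condition $\varphi\in S_0(\mathbb{R})$ is replaced with the weaker condition that the Zak transform $$Z_\alpha\varphi(x,\omega)=\sum_{n\in\mathbb{Z}}\varphi(x+n\alpha)\,e^{-2\pi i\omega n\alpha}$$ is continuous on $\mathbb{R}\times\widehat{\mathbb{R}}$.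
   Context: $\widehat{\mathbb{R}}$ denotes the dual group of $\mathbb{R}$, identified with $\mathbb{R}$. For $u\in\mathbb{R}$, $\eta\in\widehat{\mathbb{R}}$, define the unitary operators on $L^2(\mathbb{R})$: translation $T_uf(x)=f(x-u)$, modulation $M_\eta f(x)=e^{2\pi i\eta x}f(x)$, and time-frequency shift $\pi(u,\eta)=M_\eta T_u$. A lattice is a set $\Lambda=R\mathbb{Z}^2\subset\mathbb{R}\times\widehat{\mathbb{R}}$ with $R\in\mathbb{R}^{2\times 2}$; its density is $|\det R|^{-1}$ if $R$ has full rank, and $0$ otherwise. For $\varphi\in L^2(\mathbb{R})$, the Gabor system is $(\varphi,\Lambda)=\{\pi(\lambda)\varphi\}_{\lambda\in\Lambda}$ and the Gabor space $\mathcal{G}(\varphi,\Lambda)$ is the closure in $L^2(\mathbb{R})$ of $\mathrm{span}\{\pi(\lambda)\varphi:\lambda\in\Lambda\}$. The Feichtinger algebra is $$S_0(\mathbb{R})=\Big\{f\in L^2(\mathbb{R}):\ Vf(t,\nu)=\int_{\mathbb{R}} f(x)\,e^{-(x-t)^2}e^{2\pi i x\nu}\,dx\ \text{ satisfies } Vf\in L^1(\mathbb{R}^2)\Big\}.$$ For $\alpha>0$ the Zak transform $Z_\alpha$ is densely defined on $L^2(\mathbb{R})$ by $Z_\alpha f(x,\omega)=\sum_{k\in\mathbb{Z}}f(x+\alpha k)e^{-2\pi i\alpha k\omega}$, $(x,\omega)\in\mathbb{R}\times\widehat{\mathbb{R}}$; it extends by continuity to all of $L^2(\mathbb{R})$,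 with values in locally square-integrable functions. As usual, functions in $L^2$ are identified when equal almost everywhere. In (2), $\alpha,\beta>0$. *)

theory Defs
  imports "HOL-Analysis.Analysis"
begin

(* Elements of L^2(R) are represented by Borel measurable functions; every class of
   Lebesgue measurable functions modulo null sets has such a representative, and all
   notions below depend on the class only. *)

definition L2 :: "(real \<Rightarrow> complex) set" where
  "L2 = {f. f \<in> borel_measurable lborel \<and> integrable lborel (\<lambda>x. (norm (f x))\<^sup>2)}"

definition L2_norm :: "(real \<Rightarrow> complex) \<Rightarrow> real" where
  "L2_norm f = sqrt (\<integral>x. (norm (f x))\<^sup>2 \<partial>lborel)"

definition L2_closure :: "(real \<Rightarrow> complex) set \<Rightarrow> (real \<Rightarrow> complex) set" where
  "L2_closure S = {g \<in> L2. \<forall>\<epsilon>>0. \<exists>h\<in>S. L2_norm (\<lambda>x. g x - h x) < \<epsilon>}"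

definition lin_span :: "'i set \<Rightarrow> ('i \<Rightarrow> real \<Rightarrow> complex) \<Rightarrow> (real \<Rightarrow> complex) set" where
  "lin_span I f = {(\<lambda>x. \<Sum>i\<in>F. c i * f i x) |F c. finite F \<and> F \<subseteq> I}"

definition riesz_basis ::
    "'i set \<Rightarrow> ('i \<Rightarrow> real \<Rightarrow> complex) \<Rightarrow> (real \<Rightarrow> complex) set \<Rightarrow> bool" where
  "riesz_basis I f H \<longleftrightarrow>
     (\<forall>i\<in>I. f i \<in> L2) \<and>
     H = L2_closure (lin_span I f) \<and>
     (\<exists>A>0. \<exists>B>0. \<forall>F c. finite F \<longrightarrow> F \<subseteq> I \<longrightarrow>
        A * (\<Sum>i\<in>F. (norm (c i))\<^sup>2) \<le> (L2_norm (\<lambda>x. \<Sum>i\<in>F. c i * f i x))\<^sup>2 \<and>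
        (L2_norm (\<lambda>x. \<Sum>i\<in>F. c i * f i x))\<^sup>2 \<le> B * (\<Sum>i\<in>F. (norm (c i))\<^sup>2))"

definition translation :: "real \<Rightarrow> (real \<Rightarrow> complex) \<Rightarrow> real \<Rightarrow> complex" where
  "translation u f = (\<lambda>x. f (x - u))"

definition modulation :: "real \<Rightarrow> (real \<Rightarrow> complex) \<Rightarrow> real \<Rightarrow> complex" where
  "modulation \<eta> f = (\<lambda>x. cis (2 * pi * \<eta> * x) * f x)"

definition tf_shift :: "real \<times> real \<Rightarrow> (real \<Rightarrow> complex) \<Rightarrow> real \<Rightarrow> complex" where
  "tf_shift p f = modulation (snd p) (translation (fst p) f)"

definition lattice :: "real^2^2 \<Rightarrow> (real \<times> real) set" where
  "lattice R = {((R *v z) $ 1, (R *v z) $ 2) |z. \<forall>i. z $ i \<in> \<int>}"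

(* Although written in terms of R, this is determined by the set "lattice R". *)
definition lattice_density :: "real^2^2 \<Rightarrow> real" where
  "lattice_density R = (if rank R = 2 then inverse \<bar>det R\<bar> else 0)"

definition gabor_space :: "(real \<Rightarrow> complex) \<Rightarrow> (real \<times> real) set \<Rightarrow> (real \<Rightarrow> complex) set" where
  "gabor_space \<phi> \<Lambda> = L2_closure (lin_span \<Lambda> (\<lambda>p. tf_shift p \<phi>))"

definition gauss_stft :: "(real \<Rightarrow> complex) \<Rightarrow> real \<times> real \<Rightarrow> complex" where
  "gauss_stft f = (\<lambda>(t, \<nu>). \<integral>x. f x * of_real (exp (- (x - t)\<^sup>2)) * cis (2 * pi * x * \<nu>) \<partial>lborel)"

definition feichtinger_algebra :: "(real \<Rightarrow> complex) set" where
  "feichtinger_algebra = {f \<in> L2. integrable lborel (gauss_stft f)}"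

definition zak_series :: "real \<Rightarrow> (real \<Rightarrow> complex) \<Rightarrow> real \<times> real \<Rightarrow> complex" where
  "zak_series \<alpha> f = (\<lambda>(x, \<omega>). \<Sum>\<^sub>\<infinity>k::int.
     f (x + \<alpha> * of_int k) * cis (- (2 * pi * \<alpha> * of_int k * \<omega>)))"

(* F is a representative of the Zak transform of f: the extension by continuity, from
   L^2(R) to L^2_loc(R^2), of zak_series on the dense subspace of functions with bounded
   support (where the series is a finite sum at every point).  F is determined up to null
   sets, and different approximating sequences give the same F.  Local square
   integrability of F follows from the last conjunct. *)
definition has_zak_transform ::
    "real \<Rightarrow> (real \<Rightarrow> complex) \<Rightarrow> (real \<times> real \<Rightarrow> complex) \<Rightarrow> bool" where
  "has_zak_transform \<alpha> f F \<longleftrightarrow>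
     F \<in> borel_measurable lborel \<and>
     (\<exists>s. (\<forall>n::nat. s n \<in> L2 \<and> bounded {x. s n x \<noteq> 0}) \<and>
          (\<lambda>n. L2_norm (\<lambda>x. s n x - f x)) \<longlonglongrightarrow> 0 \<and>
          (\<forall>K. compact K \<longrightarrow>
             (\<lambda>n. \<integral>\<^sup>+p\<in>K. ennreal ((norm (zak_series \<alpha> (s n) p - F p))\<^sup>2) \<partial>lborel)
               \<longlonglongrightarrow> 0))"

(* Continuity of an element of L^2_loc means having a continuous representative. *)
definition zak_transform_continuous :: "real \<Rightarrow> (real \<Rightarrow> complex) \<Rightarrow> bool" where
  "zak_transform_continuous \<alpha> f \<longleftrightarrow> (\<exists>F. has_zak_transform \<alpha> f F \<and> continuous_on UNIV F)"

end

theory Submission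
  imports Defs "Jordan_Normal_Form.Determinant" "HOL-Probability.Probability"
begin

text \<open>Let \<open>v\<^sub>1, v\<^sub>2\<close> be a basis of the lattice, with symplectic area \<open>\<theta> = P/Q\<close> in lowest terms, let \<open>\<rho>(\<mu>)\<close> be the
  symmetrised time-frequency shifts and \<open>\<psi>\<^sub>x = \<rho>(x\<^sub>1 v\<^sub>1 + x\<^sub>2 v\<^sub>2) \<phi>\<close> for real \<open>x\<close>. Shifts by the sublattice spanned by
  \<open>v\<^sub>1\<close> and \<open>Q v\<^sub>2\<close> commute up to sign with the lattice, so the inner products disintegrate over a torus: there is
  a bracket \<open>K\<^sub>z(x, y)\<close> with integral \<open>\<langle>\<psi>\<^sub>x, \<psi>\<^sub>y\<rangle>\<close> over \<open>z\<close>. The regularity hypotheses serve only to make \<open>K\<close> jointly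
  continuous in \<open>(x, z)\<close>. The Riesz bound makes the \<open>Q \<times> Q\<close> Gram matrix of the points \<open>b\<^sub>t = (0, t)\<close> invertible in
  every fibre, and \<open>\<psi>\<^sub>x\<close> lies in the Gabor space only if \<open>K\<^sub>z(x, \<sqdot>)\<close> is a combination of the \<open>K\<^sub>z(b\<^sub>t, \<sqdot>)\<close> for all \<open>z\<close>.
  Such \<open>x\<close> form a group \<open>Gam\<close>, and for \<open>x\<close> in it the determinant of the matrix \<open>K\<^sub>z(x + b\<^sub>r, b\<^sub>s)\<close> (with phases) is
  a nowhere vanishing function of \<open>z\<close>, multiplicative in \<open>x\<close> up to a translation of \<open>z\<close>. Coprimality of \<open>P\<close> and \<open>Q\<close>
  gives it the periods \<open>(1/Q, 0)\<close> and \<open>(0, 1)\<close>. Its winding numbers, normalised at \<open>x = 0\<close>, are homomorphisms from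
  \<open>Gam\<close> to the integers that vanish near 0 and are the coordinates on lattice points; Dirichlet approximation then
  forces \<open>Gam\<close> to be the lattice.

  For a continuous Zak transform \<open>K\<close> is a finite sum of products of Zak transforms. For \<open>\<phi>\<close> in the Feichtinger
  algebra \<open>K\<close> is a series in values of the ambiguity function, whose absolute convergence follows from Moyal's formula
  with a Gaussian window. A lattice of rank at most one is embedded into a full lattice of rational area by adding
  very distant generators, which perturbs the lower Riesz bound only slightly.\<close>

section \<open>Determinants of function matrices\<close>

text \<open>Why the period 1/Q: the shift by v1 multiplies each of the Q rows of the matrix by
  e(z1), so along the period (1, 0) the determinant at v1 winds Q times, which would only place the
  first coordinate of a point of \<open>Gam\<close> in (1/Q)Z. Shifting all points by v2 moves the
  fibre from z to z - (theta, 0) and renumbers the generators cyclically; so theta = P/Q is a period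
  as well, and together with the period 1 it gives 1/Q, along which v1 winds exactly once. The
  obstacle is that \<open>Gam\<close> is only known to be a group: it could be dense, and an
  additive map from it to the integers need not be linear. Continuity in x supplies the rigidity,
  since it makes the map vanish near 0; continuity in z gives winding numbers a meaning and turns
  vanishing integrals into statements about every single fibre. The passage from inner products to
  fibres is elementary: shifts by v1 and Q v2 act on the fibre at z as the scalars e(z1) and e(z2),
  so trigonometric polynomials concentrated at one z can be applied inside the Hilbert
  space.\<close>

definition dt :: "nat \<Rightarrow> (nat \<Rightarrow> nat \<Rightarrow> complex) \<Rightarrow> complex" where
  "dt n M = Determinant.det (Matrix.mat n n (\<lambda>(i, j). M i j))"

lemma dt_cong: "(\<And>i j. i < n \<Longrightarrow> j < n \<Longrightarrow> M i j = M' i j) \<Longrightarrow> dt n M = dt n M'"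
  unfolding dt_def by (rule arg_cong[of _ _ Determinant.det]) (auto intro!: eq_matI)

lemma dt_mult: "dt n (\<lambda>i j. \<Sum>k<n. A i k * B k j) = dt n A * dt n B"
proof -
  have "Matrix.mat n n (\<lambda>(i, j). \<Sum>k<n. A i k * B k j) =
     Matrix.mat n n (\<lambda>(i, j). A i j) * Matrix.mat n n (\<lambda>(i, j). B i j)"
    by (rule eq_matI) (auto simp: scalar_prod_def lessThan_atLeast0 intro!: sum.cong)
  then show ?thesis
    unfolding dt_def by (simp add: det_mult[of _ n])
qed

lemma dt_diag: "dt n (\<lambda>i j. if i = j then d i else 0) = (\<Prod>i<n. d i)"
proof -
  have "dt n (\<lambda>i j. if i = j then d i else 0) =
      prod_list (diag_mat (Matrix.mat n n (\<lambda>(i, j). if i = j then d i else 0)))"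
    unfolding dt_def by (rule det_upper_triangular[of _ n]) auto
  also have "\<dots> = (\<Prod>i<n. d i)"
    unfolding diag_mat_def lessThan_atLeast0
    by (simp add: prod.distinct_set_conv_list[of "[0..<n]", simplified])
       (rule arg_cong[of _ _ prod_list], auto)
  finally show ?thesis .
qed

lemma dt_scale_rows: "dt n (\<lambda>i j. d i * M i j) = (\<Prod>i<n. d i) * dt n M"
  unfolding dt_diag[symmetric] dt_mult[symmetric]
  by (rule dt_cong) (simp add: if_distrib[of "\<lambda>x. x * _"] sum.delta cong: if_cong)

text \<open>Rows stand for fibres of points and are combined linearly, so the null vector has to act
  from the left; hence the passage to the transpose.\<close>

lemma dt_eq_0D:
  assumes "dt n M = 0"
  obtains v where "\<exists>i<n. v i \<noteq> 0" "\<And>j. j < n \<Longrightarrow> (\<Sum>i<n. v i * M i j) = 0"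
proof -
  define A where "A = Matrix.mat n n (\<lambda>(i, j). M i j)"
  have A: "transpose_mat A \<in> carrier_mat n n" by (simp add: A_def)
  have "Determinant.det (transpose_mat A) = 0"
    using assms by (subst det_transpose[of _ n]) (auto simp: A_def dt_def)
  then obtain v where v: "v \<in> carrier_vec n" "v \<noteq> 0\<^sub>v n" "transpose_mat A *\<^sub>v v = 0\<^sub>v n"
    using det_0_iff_vec_prod_zero_field[OF A] by auto
  show ?thesis
  proof (rule that)
    show "\<exists>i<n. vec_index v i \<noteq> 0"
    proof (rule ccontr)
      assume "\<not> ?thesis"
      then have "v = 0\<^sub>v n" using v(1) by (intro eq_vecI) auto
      with v(2) show False by simp
    qed
    fix j assume j: "j < n"
    have "vec_index (transpose_mat A *\<^sub>v v) j = 0" using v(3) j by simp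
    then show "(\<Sum>i<n. vec_index v i * M i j) = 0"
      using j v(1) by (auto simp: A_def scalar_prod_def lessThan_atLeast0 mult.commute intro!: sum.cong)
  qed
qed

text \<open>Solvability alone would not suffice later: coefficients written as quotients of
  determinants are continuous in every parameter on which the entries depend continuously.\<close>

lemma dt_cramer:
  assumes "dt n M \<noteq> 0" "j < n"
  shows "(\<Sum>t<n. dt n (\<lambda>i j. if i = t then y j else M i j) / dt n M * M t j) = y j"
proof -
  define A where "A = Matrix.mat n n (\<lambda>(i, j). M j i)"
  have A: "A \<in> carrier_mat n n" by (simp add: A_def)
  have tr: "dt n M = Determinant.det (Matrix.mat n n (\<lambda>(i, j). M j i))" for M :: "nat \<Rightarrow> nat \<Rightarrow> complex"
    unfolding dt_def by (subst det_transpose[symmetric, of _ n]) 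
      (auto intro!: arg_cong[of _ _ Determinant.det] eq_matI)
  have d: "Determinant.det A \<noteq> 0" using assms(1) tr[of M] by (simp add: A_def)
  obtain B where B: "B \<in> carrier_mat n n" "A * B = 1\<^sub>m n"
    using det_non_zero_imp_unit[OF A d, of UNIV] 
    unfolding Units_def ring_mat_def by auto
  define x where "x = B *\<^sub>v Matrix.vec n y"
  have x: "x \<in> carrier_vec n" using B by (auto simp: x_def)
  have Ax: "A *\<^sub>v x = Matrix.vec n y"
    unfolding x_def using A B 
    by (subst assoc_mult_mat_vec[symmetric, of _ n n _ n]) auto
  have xt: "dt n (\<lambda>i j. if i = t then y j else M i j) / dt n M = vec_index x t" if t: "t < n" for t
  proof -
    have "dt n (\<lambda>i j. if i = t then y j else M i j) = Determinant.det (replace_col A (A *\<^sub>v x) t)"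
      unfolding tr Ax replace_col_def 
      by (rule arg_cong[of _ _ Determinant.det]) (auto simp: A_def intro!: eq_matI)
    also have "\<dots> = vec_index x t * Determinant.det A" by (rule cramer_lemma_mat[OF A x t])
    finally show ?thesis using d tr[of M] by (simp add: A_def)
  qed
  have "(\<Sum>t<n. dt n (\<lambda>i j. if i = t then y j else M i j) / dt n M * M t j) = (\<Sum>t<n. vec_index x t * M t j)"
    by (intro sum.cong refl) (simp only: xt lessThan_iff)
  also have "\<dots> = vec_index (A *\<^sub>v x) j"
    using assms(2) x by (auto simp: A_def scalar_prod_def lessThan_atLeast0 mult.commute intro!: sum.cong)
  finally show ?thesis using Ax assms(2) by simp
qed

lemma continuous_on_dt:
  fixes M :: "'a::topological_space \<Rightarrow> nat \<Rightarrow> nat \<Rightarrow> complex"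
  assumes "\<And>i j. i < n \<Longrightarrow> j < n \<Longrightarrow> continuous_on S (\<lambda>z. M z i j)"
  shows "continuous_on S (\<lambda>z. dt n (M z))"
proof -
  \<comment> \<open>The Leibniz formula. The guard with default 0 makes every factor continuous in
    \<open>z\<close>, without reference to the fact that \<open>p\<close> permutes the
    indices.\<close>
  have *: "dt n (M z) = (\<Sum> p | p permutes {0..<n}. signof p * (\<Prod>i = 0..<n. if i < n \<and> p i < n then M z i (p i) else 0))" for z
  proof -
    have "dt n (M z) = (\<Sum> p | p permutes {0..<n}. signof p * (\<Prod>i = 0..<n. Matrix.mat n n (\<lambda>(i, j). M z i j) $$ (i, p i)))"
      unfolding dt_def by (subst det_def'[of _ n]) auto
    also have "\<dots> = (\<Sum> p | p permutes {0..<n}. signof p * (\<Prod>i = 0..<n. if i < n \<and> p i < n then M z i (p i) else 0))"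
    proof (intro sum.cong refl arg_cong2[of _ _ _ _ "(*)"] prod.cong)
      fix p i assume "p \<in> {p. p permutes {0..<n}}" "i \<in> {0..<n}"
      then have "p i \<in> {0..<n}" "i < n" using permutes_in_image[of p "{0..<n}" i] by auto
      then show "Matrix.mat n n (\<lambda>(i, j). M z i j) $$ (i, p i) = (if i < n \<and> p i < n then M z i (p i) else 0)"
        by simp
    qed
    finally show ?thesis .
  qed
  have "continuous_on S (\<lambda>z. if i < n \<and> k < n then M z i k else 0)" for i k
    using assms[of i k] by (cases "i < n \<and> k < n") auto
  then show ?thesis unfolding * by (intro continuous_intros)
qed

section \<open>Exponentials and winding numbers\<close>

definition ee :: "real \<Rightarrow> complex" where "ee t = cis (2 * pi * t)"

lemma ee_add: "ee (s + t) = ee s * ee t"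
  by (simp add: ee_def cis_mult distrib_left)

lemma ee_0 [simp]: "ee 0 = 1" by (simp add: ee_def)

lemma ee_of_int [simp]: "ee (of_int n) = 1"
  by (simp add: ee_def)

lemma ee_of_nat [simp]: "ee (of_nat n) = 1"
  using ee_of_int[of "int n"] by simp

lemma norm_ee [simp]: "norm (ee t) = 1" by (simp add: ee_def)

lemma ee_nz [simp]: "ee t \<noteq> 0" by (simp add: ee_def)

lemma cnj_ee: "cnj (ee t) = ee (- t)" by (simp add: ee_def cis_cnj)

lemma ee_minus: "ee (- t) = inverse (ee t)" by (simp add: ee_def)

lemma ee_diff: "ee (s - t) = ee s * ee (- t)"
  using ee_add[of s "- t"] by simp

lemma ee_cong: "s - t = of_int n \<Longrightarrow> ee s = ee t"
  using ee_add[of t "of_int n"] by (simp add: algebra_simps)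

lemma ee_eq_1_iff: "ee t = 1 \<longleftrightarrow> t \<in> \<int>"
proof
  assume "ee t = 1"
  then have "cos (2 * pi * t) = 1" by (simp add: ee_def complex_eq_iff)
  then obtain n where "2 * pi * t = of_int n * 2 * pi" unfolding cos_one_2pi_int by auto
  then have "t = of_int n" by simp
  then show "t \<in> \<int>" by simp
next
  assume "t \<in> \<int>" then show "ee t = 1" by (auto elim: Ints_cases)
qed

lemma ee_power: "ee t ^ n = ee (of_nat n * t)"
  by (induction n) (simp_all add: ee_add distrib_right)

lemma continuous_on_ee [continuous_intros]:
  "continuous_on S f \<Longrightarrow> continuous_on S (\<lambda>x. ee (f x))"
  unfolding ee_def by (intro continuous_intros)

lemma isCont_ee: "isCont ee x"
  using continuous_on_ee[of UNIV "\<lambda>x. x"] by (simp add: continuous_on_eq_continuous_at)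

lemma borel_measurable_ee [measurable]: "ee \<in> borel_measurable borel"
  by (intro borel_measurable_continuous_onI continuous_intros)

section \<open>Winding numbers through continuous logarithms\<close>

lemma two_pi_ii_int:
  assumes "exp (a::complex) = exp b"
  obtains n :: int where "a = b + of_real (2 * pi * of_int n) * \<i>"
  using assms unfolding exp_eq by (auto simp: mult_ac)

text \<open>Two logarithms of the same number differ by a multiple of 2 pi i, so the range of
  \<open>f\<close> has gaps of at least 2 pi and connectedness leaves a single value.\<close>

lemma continuous_exp_const_diff:
  fixes f :: "'a::real_normed_vector \<Rightarrow> complex"
  assumes c: "continuous_on UNIV f" and e: "\<And>z. exp (f z) = c"
  shows "f z = f z'"
proof -
  have "(\<lambda>z. f z) constant_on UNIV"
  proof (rule continuous_discrete_range_constant[OF connected_UNIV c])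
    fix x :: 'a
    show "\<exists>e>0. \<forall>y. y \<in> UNIV \<and> f y \<noteq> f x \<longrightarrow> e \<le> norm (f y - f x)"
    proof (intro exI[of _ "2 * pi"] conjI allI impI)
      fix y assume y: "y \<in> UNIV \<and> f y \<noteq> f x"
      have "exp (f y) = exp (f x)" using e by simp
      then obtain n :: int where n: "f y = f x + of_real (2 * pi * of_int n) * \<i>" by (rule two_pi_ii_int)
      with y have "n \<noteq> 0" by auto
      then have "1 \<le> \<bar>real_of_int n\<bar>" by linarith
      then show "2 * pi \<le> norm (f y - f x)" by (simp add: n norm_mult abs_mult)
    qed simp
  qed
  then show ?thesis unfolding constant_on_def by (metis UNIV_I)
qed

text \<open>The winding number along the closed loop from z to z + T, encoded by a logarithm on the
  whole space. Products, translations and comparison with 1 then become elementary operations on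
  logarithms, with no path integral.\<close>

definition winds :: "('a::real_normed_vector \<Rightarrow> complex) \<Rightarrow> 'a \<Rightarrow> int \<Rightarrow> bool" where
  "winds g T n \<longleftrightarrow> (\<exists>L. continuous_on UNIV L \<and> (\<forall>z. g z = exp (L z)) \<and>
     (\<forall>z. L (z + T) = L z + of_real (2 * pi * of_int n) * \<i>))"

text \<open>A normed space is contractible, so a global logarithm exists; its increment over the
  period is a continuous logarithm of 1 and therefore constant.\<close>

lemma winds_exists:
  fixes g :: "'a::real_normed_vector \<Rightarrow> complex"
  assumes c: "continuous_on UNIV g" and nz: "\<And>z. g z \<noteq> 0" and p: "\<And>z. g (z + T) = g z"
  shows "\<exists>n. winds g T n"
proof -
  obtain L where L: "continuous_on UNIV L" "\<And>z. g z = exp (L z)"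
    using continuous_logarithm_on_contractible[OF c contractible_UNIV] nz by (metis UNIV_I)
  have cL: "continuous_on UNIV (\<lambda>z. L (z + T) - L z)"
    by (intro continuous_intros continuous_on_compose2[OF L(1)]) auto
  have ex: "exp (L (z + T) - L z) = 1" for z
    using L(2)[of z] L(2)[of "z + T"] p[of z] by (simp add: exp_diff)
  have "exp (L (0 + T) - L 0) = exp 0" using ex[of 0] by simp
  then obtain n :: int where n: "L (0 + T) - L 0 = 0 + of_real (2 * pi * of_int n) * \<i>"
    by (rule two_pi_ii_int)
  have "L (z + T) - L z = of_real (2 * pi * of_int n) * \<i>" for z
    using continuous_exp_const_diff[OF cL ex, of z 0] n by simp
  then have "L (z + T) = L z + of_real (2 * pi * of_int n) * \<i>" for z
    by (metis add.commute diff_add_cancel)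
  then show ?thesis unfolding winds_def using L by blast
qed

lemma winds_unique:
  assumes "winds g T n" "winds g T m"
  shows "n = m"
proof -
  obtain L where L: "continuous_on UNIV L" "\<And>z. g z = exp (L z)"
     "\<And>z. L (z + T) = L z + of_real (2 * pi * of_int n) * \<i>"
    using assms(1) unfolding winds_def by blast
  obtain L' where L': "continuous_on UNIV L'" "\<And>z. g z = exp (L' z)"
     "\<And>z. L' (z + T) = L' z + of_real (2 * pi * of_int m) * \<i>"
    using assms(2) unfolding winds_def by blast
  have c: "continuous_on UNIV (\<lambda>z. L z - L' z)" using L(1) L'(1) by (intro continuous_intros)
  have e: "exp (L z - L' z) = 1" for z
    using L(2)[of z] L'(2)[of z] by (simp add: exp_diff)
  have "L (0 + T) - L' (0 + T) = L 0 - L' 0"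
    by (rule continuous_exp_const_diff[OF c e])
  then have "complex_of_real (2 * pi * of_int n) * \<i> = of_real (2 * pi * of_int m) * \<i>"
    unfolding L(3) L'(3) by (simp add: algebra_simps)
  then show "n = m" by simp
qed

lemma winds_mult:
  assumes "winds g T n" "winds h T m"
  shows "winds (\<lambda>z. g z * h z) T (n + m)"
proof -
  obtain L where L: "continuous_on UNIV L" "\<And>z. g z = exp (L z)"
     "\<And>z. L (z + T) = L z + of_real (2 * pi * of_int n) * \<i>"
    using assms(1) unfolding winds_def by blast
  obtain L' where L': "continuous_on UNIV L'" "\<And>z. h z = exp (L' z)"
     "\<And>z. L' (z + T) = L' z + of_real (2 * pi * of_int m) * \<i>"
    using assms(2) unfolding winds_def by blast
  show ?thesis unfolding winds_def
    by (rule exI[of _ "\<lambda>z. L z + L' z"])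
       (auto intro!: continuous_intros L(1) L'(1) simp: L(2,3) L'(2,3) exp_add algebra_simps)
qed

lemma winds_shift:
  assumes "winds g T n"
  shows "winds (\<lambda>z. g (z + w)) T n"
proof -
  obtain L where L: "continuous_on UNIV L" "\<And>z. g z = exp (L z)"
     "\<And>z. L (z + T) = L z + of_real (2 * pi * of_int n) * \<i>"
    using assms(1) unfolding winds_def by blast
  have "L (z + T + w) = L (z + w) + of_real (2 * pi * of_int n) * \<i>" for z
    using L(3)[of "z + w"] by (simp add: algebra_simps)
  then show ?thesis unfolding winds_def
    by (intro exI[of _ "\<lambda>z. L (z + w)"])
       (auto intro!: continuous_intros continuous_on_compose2[OF L(1)] simp: L(2))
qed

lemma winds_const: "c \<noteq> 0 \<Longrightarrow> winds (\<lambda>_. c) T 0"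
  unfolding winds_def by (rule exI[of _ "\<lambda>_. Ln c"]) auto

lemma winds_cmult:
  assumes "winds g T n" "c \<noteq> 0"
  shows "winds (\<lambda>z. c * g z) T n"
  using winds_mult[OF winds_const[OF assms(2)] assms(1)] by simp

lemma winds_ee:
  assumes "continuous_on UNIV l" "\<And>z. l (z + T) = l z + of_int n"
  shows "winds (\<lambda>z. ee (l z)) T n"
  unfolding winds_def
  by (rule exI[of _ "\<lambda>z. of_real (2 * pi * l z) * \<i>"])
     (auto intro!: continuous_intros assms simp: ee_def cis_conv_exp assms(2) algebra_simps)

text \<open>All values lie in the right half plane, where the principal branch is continuous, and it
  inherits the period.\<close>

lemma winds_near_1:
  assumes c: "continuous_on UNIV g" and p: "\<And>z. g (z + T) = g z"
    and "\<And>z. norm (g z - 1) < 1"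
  shows "winds g T 0"
proof -
  have re: "Re (g z) > 0" for z
  proof -
    have "\<bar>Re (g z - 1)\<bar> \<le> norm (g z - 1)" by (rule abs_Re_le_cmod)
    with assms(3)[of z] show ?thesis by auto
  qed
  then have np: "g z \<notin> \<real>\<^sub>\<le>\<^sub>0" for z
    using re[of z] unfolding complex_nonpos_Reals_iff by linarith
  have nz: "g z \<noteq> 0" for z using re[of z] by auto
  show ?thesis unfolding winds_def
    by (rule exI[of _ "\<lambda>z. Ln (g z)"])
       (auto intro!: continuous_on_Ln' c np simp: nz p)
qed

text \<open>Laplace's method: away from \<open>a\<close> the integrand is at most C r^n, while a
  small box around \<open>a\<close>, where \<open>h\<close> is negative and \<open>W\<close> is at
  least some s > r, contributes at most - \<epsilon> s^n times its volume. The quotient (r/s)^n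
  tends to 0.\<close>

lemma peak_integral_negative:
  fixes W h :: "'a::euclidean_space \<Rightarrow> real"
  assumes cW: "continuous_on (cbox p q) W" and ch: "continuous_on (cbox p q) h"
    and a: "a \<in> box p q"
    and W0: "\<And>z. z \<in> cbox p q \<Longrightarrow> 0 \<le> W z"
    and pk: "\<And>z. z \<in> cbox p q \<Longrightarrow> z \<noteq> a \<Longrightarrow> W z < W a"
    and ha: "h a < 0"
  shows "\<exists>n. integral (cbox p q) (\<lambda>z. W z ^ n * h z) < 0"
proof -
  have aC: "a \<in> cbox p q" using a box_subset_cbox by blast
  have ev_at: "\<exists>d>0. \<forall>z. dist z a < d \<longrightarrow> z \<in> box p q"
    using open_box[of p q] a unfolding open_dist by blast
  then obtain d0 where d0: "d0 > 0" "\<And>z. dist z a < d0 \<Longrightarrow> z \<in> box p q" by blast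
  define \<epsilon> where "\<epsilon> = - h a / 2"
  have eps: "\<epsilon> > 0" using ha by (simp add: \<epsilon>_def)
  obtain d1 where d1: "d1 > 0" "\<And>z. z \<in> cbox p q \<Longrightarrow> dist z a < d1 \<Longrightarrow> dist (h z) (h a) < \<epsilon>"
    using ch aC eps unfolding continuous_on_iff by blast
  define d where "d = min d0 d1"
  have d: "d > 0" using d0 d1 by (simp add: d_def)
  have hneg: "h z \<le> - \<epsilon>" if "dist z a < d" for z
  proof -
    have "z \<in> box p q" using d0(2) that by (simp add: d_def)
    then have "z \<in> cbox p q" using box_subset_cbox by blast
    then have "dist (h z) (h a) < \<epsilon>" using d1(2) that by (simp add: d_def)
    then show ?thesis unfolding dist_real_def \<epsilon>_def by (simp add: field_simps abs_less_iff)
  qed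
  define Out where "Out = cbox p q - ball a d"
  have cO: "compact Out" unfolding Out_def by (intro compact_diff compact_cbox open_ball)
  obtain r where r: "0 \<le> r" "r < W a" "\<And>z. z \<in> Out \<Longrightarrow> W z \<le> r"
  proof (cases "Out = {}")
    case True
    \<comment> \<open>Even when nothing lies outside the ball, taking r = 0 requires
      \<open>W a > 0\<close>, which any second point of the box provides.\<close>
    have "\<exists>b\<in>cbox p q. b \<noteq> a"
    proof -
      obtain u :: 'a where u: "u \<in> Basis" using nonempty_Basis by blast
      have "dist (a + (d0/2) *\<^sub>R u) a < d0" using u d0(1) by (simp add: dist_norm)
      then have "a + (d0/2) *\<^sub>R u \<in> box p q" by (rule d0(2))
      moreover have "a + (d0/2) *\<^sub>R u \<noteq> a" using u d0(1) by (auto simp: nonzero_Basis)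
      ultimately show ?thesis using box_subset_cbox by blast
    qed
    then have "W a > 0" using W0 pk by fastforce
    with True show ?thesis using that[of 0] by auto
  next
    case False
    have "continuous_on Out W" using cW by (rule continuous_on_subset) (auto simp: Out_def)
    then obtain m where m: "m \<in> Out" "\<And>z. z \<in> Out \<Longrightarrow> W z \<le> W m"
      using continuous_attains_sup[OF cO False] by blast
    have "m \<noteq> a" "m \<in> cbox p q" using m(1) d by (auto simp: Out_def)
    then show ?thesis using that[of "W m"] W0 pk m by blast
  qed
  \<comment> \<open>Strictly between the bound outside the ball and the peak value: near
    \<open>a\<close> the weight still exceeds \<open>s\<close> by continuity.\<close>
  define s where "s = (r + W a) / 2"
  have s: "r < s" "s < W a" "0 < s" using r by (auto simp: s_def)
  obtain d2 where d2: "d2 > 0" "\<And>z. z \<in> cbox p q \<Longrightarrow> dist z a < d2 \<Longrightarrow> dist (W z) (W a) < W a - s"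
    using cW aC s unfolding continuous_on_iff by (metis diff_gt_0_iff_gt)
  define d' where "d' = min d d2"
  have d': "d' > 0" using d d2 by (simp add: d'_def)
  obtain p' q' where pq: "cbox p' q' \<subseteq> ball a d'" "\<forall>i\<in>Basis. p' \<bullet> i < q' \<bullet> i"
    using open_contains_cbox[of "ball a d'" a] d' by (metis centre_in_ball open_ball)
  define B where "B = cbox p' q'"
  have Bsub: "B \<subseteq> cbox p q"
  proof
    fix z assume "z \<in> B"
    then have "dist z a < d'" using pq unfolding B_def by (metis dist_commute mem_ball subsetD)
    then show "z \<in> cbox p q" using d0(2)[of z] box_subset_cbox[of p q] by (auto simp: d'_def d_def)
  qed
  have vB: "measure lborel B > 0"
    using content_pos_lt[OF pq(2)] by (simp add: B_def)
  obtain C where C: "C \<ge> 0" "\<And>z. z \<in> cbox p q \<Longrightarrow> \<bar>h z\<bar> \<le> C"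
  proof -
    have "bounded (h ` cbox p q)" using ch compact_cbox compact_continuous_image compact_imp_bounded by blast
    then obtain C where "\<And>z. z \<in> cbox p q \<Longrightarrow> \<bar>h z\<bar> \<le> C" unfolding bounded_iff by auto
    moreover then have "C \<ge> 0" using aC by (metis abs_ge_zero order_trans)
    ultimately show ?thesis using that by blast
  qed
  have bound: "W z ^ n * h z \<le> C * r ^ n - (if z \<in> B then \<epsilon> * s ^ n else 0)" if z: "z \<in> cbox p q" for z n
  proof (cases "z \<in> B")
    case True
    then have dz: "dist z a < d'" using pq unfolding B_def by (metis dist_commute mem_ball subsetD)
    then have "h z \<le> - \<epsilon>" by (intro hneg) (simp add: d'_def)
    moreover have "s \<le> W z" using d2(2)[OF z] dz by (simp add: d'_def dist_real_def abs_less_iff)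
    then have "s ^ n \<le> W z ^ n" using s by (intro power_mono) auto
    ultimately have "\<epsilon> * s ^ n \<le> (- h z) * W z ^ n"
      using eps s by (intro mult_mono) auto
    moreover have "C * r ^ n \<ge> 0" using C r by simp
    ultimately show ?thesis using True by (simp add: mult.commute)
  next
    case False
    show ?thesis
    proof (cases "dist z a < d")
      case True
      then have "h z \<le> - \<epsilon>" by (rule hneg)
      then have "W z ^ n * h z \<le> 0" using eps W0[OF z] by (simp add: mult_nonneg_nonpos)
      moreover have "C * r ^ n \<ge> 0" using C r by simp
      ultimately show ?thesis using False by simp
    next
      case F: False
      then have "z \<in> Out" using z by (simp add: Out_def dist_commute)
      then have "W z ^ n \<le> r ^ n" using r(3) W0[OF z] by (intro power_mono) auto
      moreover have "h z \<le> C" using C(2)[OF z] by simp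
      ultimately have "W z ^ n * h z \<le> r ^ n * C"
        using C(1) W0[OF z] r(1) by (meson mult_left_mono mult_right_mono order_trans zero_le_power)
      then show ?thesis using False by (simp add: mult.commute)
    qed
  qed
  have int_ub: "integral (cbox p q) (\<lambda>z. W z ^ n * h z) \<le> C * r ^ n * measure lborel (cbox p q) - \<epsilon> * s ^ n * measure lborel B" for n
  proof -
    have i1: "((\<lambda>z. C * r ^ n) has_integral measure lborel (cbox p q) *\<^sub>R (C * r ^ n)) (cbox p q)"
      by (rule has_integral_const)
    have "((\<lambda>z. \<epsilon> * s ^ n) has_integral measure lborel B *\<^sub>R (\<epsilon> * s ^ n)) B"
      unfolding B_def by (rule has_integral_const)
    then have "((\<lambda>z. if z \<in> B then \<epsilon> * s ^ n else 0) has_integral measure lborel B *\<^sub>R (\<epsilon> * s ^ n)) (cbox p q)"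
      by (simp only: has_integral_restrict[OF Bsub])
    from has_integral_diff[OF i1 this]
    have i2: "((\<lambda>z. C * r ^ n - (if z \<in> B then \<epsilon> * s ^ n else 0)) has_integral
       (measure lborel (cbox p q) *\<^sub>R (C * r ^ n) - measure lborel B *\<^sub>R (\<epsilon> * s ^ n))) (cbox p q)" .
    have "(\<lambda>z. W z ^ n * h z) integrable_on cbox p q"
      by (intro integrable_continuous continuous_intros cW ch)
    then have "integral (cbox p q) (\<lambda>z. W z ^ n * h z) \<le> 
       measure lborel (cbox p q) *\<^sub>R (C * r ^ n) - measure lborel B *\<^sub>R (\<epsilon> * s ^ n)"
      by (rule has_integral_le[OF integrable_integral i2]) (rule bound)
    then show ?thesis by (simp add: mult_ac)
  qed
  have rs: "0 \<le> r / s" "r / s < 1" using r(1) s(1,3) by simp_all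
  have "(\<lambda>n. (r / s) ^ n) \<longlonglongrightarrow> 0" using rs by (rule LIMSEQ_realpow_zero)
  then have "(\<lambda>n. C * measure lborel (cbox p q) * (r / s) ^ n) \<longlonglongrightarrow> C * measure lborel (cbox p q) * 0"
    by (intro tendsto_mult tendsto_const)
  then have "eventually (\<lambda>n. C * measure lborel (cbox p q) * (r / s) ^ n < \<epsilon> * measure lborel B) sequentially"
    using eps vB by (intro order_tendstoD(2)) auto
  then obtain n where n: "C * measure lborel (cbox p q) * (r / s) ^ n < \<epsilon> * measure lborel B"
    using eventually_happens by fastforce
  then have "C * measure lborel (cbox p q) * (r / s) ^ n * s ^ n < \<epsilon> * measure lborel B * s ^ n"
    using s by simp
  then have "C * r ^ n * measure lborel (cbox p q) - \<epsilon> * s ^ n * measure lborel B < 0"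
    using s by (simp add: power_divide mult_ac)
  with int_ub[of n] show ?thesis by (intro exI[of _ n]) linarith
qed

section \<open>Positive kernels and their fibres\<close>

text \<open>Formal linear combinations as lists: repeated points are allowed, so that sums are
  concatenations and actions on points are maps, with no merging of coefficients.\<close>

type_synonym 'a comb = "(complex \<times> 'a) list"

definition form :: "('a \<Rightarrow> 'a \<Rightarrow> complex) \<Rightarrow> 'a comb \<Rightarrow> 'a comb \<Rightarrow> complex" where
  "form K f g = (\<Sum>(c, x)\<leftarrow>f. \<Sum>(d, y)\<leftarrow>g. c * cnj d * K x y)"

definition ev :: "('a \<Rightarrow> complex) \<Rightarrow> 'a comb \<Rightarrow> complex" where
  "ev u f = (\<Sum>(c, x)\<leftarrow>f. c * u x)"

definition smul :: "complex \<Rightarrow> 'a comb \<Rightarrow> 'a comb" where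
  "smul c f = map (\<lambda>(d, x). (c * d, x)) f"

lemma ev_Nil [simp]: "ev u [] = 0" by (simp add: ev_def)
lemma ev_Cons [simp]: "ev u ((c, x) # f) = c * u x + ev u f" by (simp add: ev_def)
lemma ev_append [simp]: "ev u (f @ g) = ev u f + ev u g" by (simp add: ev_def)
lemma ev_smul [simp]: "ev u (smul c f) = c * ev u f"
  by (induction f) (auto simp: smul_def ev_def distrib_left)
lemma ev_add: "ev (\<lambda>x. u x + v x) f = ev u f + ev v f"
  by (induction f) (auto simp: algebra_simps)
lemma ev_cmult: "ev (\<lambda>x. c * u x) f = c * ev u f"
  by (induction f) (auto simp: algebra_simps)
lemma ev_zero [simp]: "ev (\<lambda>x. 0) f = 0"
  by (induction f) auto
lemma ev_map: "ev u (map (\<lambda>t. (c t, p t)) [0..<n]) = (\<Sum>t<n. c t * u (p t))"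
  by (induction n) auto
lemma ev_sum: "ev (\<lambda>x. \<Sum>t\<in>T. u t x) f = (\<Sum>t\<in>T. ev (u t) f)"
  by (induction f) (auto simp: sum_distrib_left sum.distrib)
lemma ev_cong: "(\<And>c x. (c, x) \<in> set f \<Longrightarrow> u x = v x) \<Longrightarrow> ev u f = ev v f"
  unfolding ev_def by (intro arg_cong[of _ _ sum_list] map_cong) auto

text \<open>Conjugating twice turns the antilinear second argument into the linear
  \<open>ev\<close>; linearity, continuity and integration of \<open>form\<close> then all reduce to
  statements about \<open>ev\<close>.\<close>

lemma form_ev: "form K f g = ev (\<lambda>x. cnj (ev (\<lambda>y. cnj (K x y)) g)) f"
proof -
  have "(\<Sum>(d, y)\<leftarrow>g. c * cnj d * K x y) = c * cnj (ev (\<lambda>y. cnj (K x y)) g)" for c x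
    by (induction g) (auto simp: distrib_left ring_distribs ac_simps)
  then show ?thesis by (simp add: form_def ev_def[of _ f])
qed

lemma form_append1 [simp]: "form K (f @ g) h = form K f h + form K g h"
  by (simp add: form_ev)
lemma form_append2 [simp]: "form K h (f @ g) = form K h f + form K h g"
  by (simp add: form_ev ev_add)
lemma form_Nil [simp]: "form K [] h = 0" "form K h [] = 0"
  by (simp_all add: form_ev)
lemma form_smul1 [simp]: "form K (smul c f) g = c * form K f g"
  by (simp add: form_ev)
lemma form_smul2 [simp]: "form K f (smul c g) = cnj c * form K f g"
  by (simp add: form_ev ev_cmult)
lemma form_single [simp]: "form K [(c, x)] [(d, y)] = c * cnj d * K x y"
  by (simp add: form_ev)

lemma form_cong:
  assumes "\<And>c x d y. (c, x) \<in> set f \<Longrightarrow> (d, y) \<in> set g \<Longrightarrow> K x y = K' x y"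
  shows "form K f g = form K' f g"
  unfolding form_ev by (intro ev_cong arg_cong[of _ _ cnj]) (auto intro!: arg_cong[of _ _ cnj] assms)

lemma form_herm:
  assumes "\<And>x y. (\<exists>c. (c, x) \<in> set f \<union> set g) \<Longrightarrow> (\<exists>c. (c, y) \<in> set f \<union> set g) \<Longrightarrow> K y x = cnj (K x y)"
  shows "form K g f = cnj (form K f g)"
  using assms
proof (induction f)
  case Nil then show ?case by simp
next
  case (Cons a f)
  obtain c x where a: "a = (c, x)" by force
  have "form K g [(c, x)] = cnj (form K [(c, x)] g)"
  proof -
    have "form K g [(c, x)] = form (\<lambda>y x. cnj (K x y)) g [(c, x)]"
      using Cons.prems unfolding a by (intro form_cong) auto
    also have "\<dots> = cnj (form K [(c, x)] g)" by (induction g) (auto simp: form_ev distrib_left ac_simps)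
    finally show ?thesis .
  qed
  moreover have "form K g f = cnj (form K f g)" using Cons by auto
  ultimately show ?case
    using form_append1[of K "[(c, x)]" f g] form_append2[of K g "[(c, x)]" f] by (simp add: a)
qed

lemma form_diff: "form (\<lambda>x y. K x y - c * L x y) f g = form K f g - c * form L f g"
proof -
  have 1: "ev (\<lambda>x. u x - c * v x) f = ev u f - c * ev v f" for u v :: "_ \<Rightarrow> complex" and c and f :: "'a comb"
    by (induction f) (auto simp: algebra_simps)
  show ?thesis unfolding form_ev by (simp add: 1)
qed

definition act :: "('a \<Rightarrow> complex) \<Rightarrow> ('a \<Rightarrow> 'a) \<Rightarrow> 'a comb \<Rightarrow> 'a comb" where
  "act c \<tau> f = map (\<lambda>(d, x). (d * c x, \<tau> x)) f"

lemma ev_act: "ev u (act c \<tau> f) = ev (\<lambda>x. c x * u (\<tau> x)) f"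
  by (induction f) (auto simp: act_def ev_def)

lemma continuous_on_ev:
  assumes "\<And>c x. (c, x) \<in> set f \<Longrightarrow> continuous_on S (\<lambda>z. u z x)"
  shows "continuous_on S (\<lambda>z. ev (u z) f)"
  using assms
proof (induction f)
  case (Cons a f)
  obtain c x where "a = (c, x)" by force
  with Cons show ?case by (auto intro!: continuous_intros)
qed auto

lemma continuous_on_form:
  assumes "\<And>c x d y. (c, x) \<in> set f \<Longrightarrow> (d, y) \<in> set g \<Longrightarrow> continuous_on S (\<lambda>z. K z x y)"
  shows "continuous_on S (\<lambda>z. form (K z) f g)"
  unfolding form_ev by (intro continuous_on_ev continuous_intros) (auto intro: assms)

section \<open>Positive kernels and localisation to a fibre\<close>

definition psd :: "('a \<Rightarrow> 'a \<Rightarrow> complex) \<Rightarrow> bool" where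
  "psd K \<longleftrightarrow> (\<forall>x y. K y x = cnj (K x y)) \<and> (\<forall>f. 0 \<le> Re (form K f f))"

text \<open>With \<open>a = form K f g\<close>, the form along g - t cnj(a) f is affine in the real
  parameter t with slope -2 |a|^2, because the quadratic term vanishes. An affine function bounded
  below is constant.\<close>

lemma psd_null:
  assumes "psd K" "Re (form K f f) = 0"
  shows "form K f g = 0"
proof -
  have hK: "K y x = cnj (K x y)" for x y using assms(1) unfolding psd_def by blast
  have h: "form K g f = cnj (form K f g)" by (intro form_herm hK)
  have hf: "form K f f = 0"
  proof -
    have "form K f f = cnj (form K f f)" by (intro form_herm hK)
    then have "Im (form K f f) = 0" by (metis cnj.simps(2) neg_equal_zero)
    with assms(2) show ?thesis by (simp add: complex_eq_iff)
  qed
  define a where "a = form K f g"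
  have ineq: "0 \<le> - 2 * t * (norm a)\<^sup>2 + Re (form K g g)" for t :: real
  proof -
    let ?h = "smul (- of_real t * cnj a) f @ g"
    have "0 \<le> Re (form K ?h ?h)" using assms(1) unfolding psd_def by blast
    also have "form K ?h ?h = - of_real t * cnj a * a - of_real t * a * cnj a + form K g g"
      by (simp add: hf h a_def)
    also have "\<dots> = of_real (- 2 * t * (norm a)\<^sup>2) + form K g g"
      by (simp add: complex_norm_square algebra_simps del: of_real_power)
    finally show ?thesis by simp
  qed
  show ?thesis
  proof (rule ccontr)
    assume "form K f g \<noteq> 0"
    then have "(norm a)\<^sup>2 > 0" by (simp add: a_def)
    with ineq[of "(\<bar>Re (form K g g)\<bar> + 1) / (norm a)\<^sup>2"] show False by simp
  qed
qed

lemma norm_1_ee_le: "(norm (1 + ee t))\<^sup>2 \<le> 4"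
proof -
  have "norm (1 + ee t) \<le> 2" using norm_triangle_ineq[of 1 "ee t"] by simp
  then have "norm (1 + ee t) ^ 2 \<le> 2 ^ 2" by (intro power_mono) auto
  then show ?thesis by simp
qed

lemma norm_1_ee_eq: "(norm (1 + ee t))\<^sup>2 = 4 \<longleftrightarrow> ee t = 1"
proof
  have c: "(cos x)\<^sup>2 + (sin x)\<^sup>2 = 1" for x :: real by simp
  assume "(norm (1 + ee t))\<^sup>2 = 4"
  then have "(1 + cos (2 * pi * t))\<^sup>2 + (sin (2 * pi * t))\<^sup>2 = 4"
    by (simp add: ee_def cmod_power2)
  then have "cos (2 * pi * t) = 1" by (simp add: power2_sum sin_squared_eq)
  then show "ee t = 1" using c[of "2 * pi * t"] by (simp add: ee_def complex_eq_iff)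
qed simp

lemma periodic_of_int:
  fixes h :: "'a::real_vector \<Rightarrow> 'b"
  assumes "\<And>z. h (z + T) = h z"
  shows "h (z + of_int n *\<^sub>R T) = h z"
proof -
  have nat: "h (z + of_nat m *\<^sub>R T) = h z" for m z
  proof (induction m)
    case (Suc m)
    have "z + of_nat (Suc m) *\<^sub>R T = (z + of_nat m *\<^sub>R T) + T" by (simp add: scaleR_left_distrib)
    then show ?case using Suc assms by metis
  qed simp
  show ?thesis
  proof (cases "n \<ge> 0")
    case True then show ?thesis using nat[of z "nat n"] by simp
  next
    case False
    then have "z = (z + of_int n *\<^sub>R T) + of_nat (nat (- n)) *\<^sub>R T" by (simp add: scaleR_left_distrib[symmetric])
    then show ?thesis using nat[of "z + of_int n *\<^sub>R T" "nat (- n)"] by metis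
  qed
qed

text \<open>The weights \<open>|1 + e(z - a)|\<^sup>2\<^sup>n\<close> are squared moduli of trigonometric polynomials and concentrate at \<open>a\<close>.\<close>
lemma fibre_form_nonneg:
  fixes K :: "real \<times> real \<Rightarrow> 'a \<Rightarrow> 'a \<Rightarrow> complex"
  assumes herm: "\<And>z x y. x \<in> X \<Longrightarrow> y \<in> X \<Longrightarrow> K z y x = cnj (K z x y)"
    and cont: "\<And>x y. x \<in> X \<Longrightarrow> y \<in> X \<Longrightarrow> continuous_on UNIV (\<lambda>z. K z x y)"
    and per1: "\<And>z x y. x \<in> X \<Longrightarrow> y \<in> X \<Longrightarrow> K (z + (1, 0)) x y = K z x y"
    and per2: "\<And>z x y. x \<in> X \<Longrightarrow> y \<in> X \<Longrightarrow> K (z + (0, 1)) x y = K z x y"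
    and U1: "\<And>z x y. x \<in> X \<Longrightarrow> y \<in> X \<Longrightarrow> c1 x * K z (\<tau>1 x) y = ee (fst z) * K z x y"
    and U2: "\<And>z x y. x \<in> X \<Longrightarrow> y \<in> X \<Longrightarrow> c2 x * K z (\<tau>2 x) y = ee (snd z) * K z x y"
    and X: "\<And>x. x \<in> X \<Longrightarrow> \<tau>1 x \<in> X" "\<And>x. x \<in> X \<Longrightarrow> \<tau>2 x \<in> X"
    and int: "\<And>x y. x \<in> X \<Longrightarrow> y \<in> X \<Longrightarrow> integral (cbox (0, 0) (1, 1)) (\<lambda>z. K z x y) = I x y"
    and pos: "\<And>f. set f \<subseteq> UNIV \<times> X \<Longrightarrow> 0 \<le> Re (form I f f)"
    and f: "set f \<subseteq> UNIV \<times> X"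
  shows "0 \<le> Re (form (K z) f f)"
proof -
  define h where "h z = Re (form (K z) f f)" for z
  have ch: "continuous_on UNIV h"
    unfolding h_def using f by (intro continuous_intros continuous_on_form cont) auto
  have intform: "integral (cbox (0, 0) (1, 1)) (\<lambda>z. Re (form (K z) g g)) = Re (form I g g)"
    if g: "set g \<subseteq> UNIV \<times> X" for g
  proof -
    have hi1: "((\<lambda>z. K z x y) has_integral I x y) (cbox (0, 0) (1, 1))" if "x \<in> X" "y \<in> X" for x y
      using integrable_integral[OF integrable_continuous[OF continuous_on_subset[OF cont[OF that] subset_UNIV]]]
        int[OF that] by metis
    have hcnj: "((\<lambda>z. cnj (u z)) has_integral cnj v) S" if "(u has_integral v) S" for u :: "real \<times> real \<Rightarrow> complex" and v S
      using has_integral_cnj[of u v S] that by (simp add: comp_def)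
    have hi2: "((\<lambda>z. ev (u z) k) has_integral ev v k) (cbox (0, 0) (1, 1))"
      if "\<And>x. x \<in> X \<Longrightarrow> ((\<lambda>z. u z x) has_integral v x) (cbox (0, 0) (1, 1))" "set k \<subseteq> UNIV \<times> X" 
      for u :: "real \<times> real \<Rightarrow> 'a \<Rightarrow> complex" and v k
      using that(2)
    proof (induction k)
      case (Cons a k)
      obtain c x where a: "a = (c, x)" by force
      show ?case using Cons unfolding a ev_Cons
        by (intro has_integral_add has_integral_mult_right that) auto
    qed auto
    have "((\<lambda>z. form (K z) g g) has_integral form I g g) (cbox (0, 0) (1, 1))"
      unfolding form_ev using g by (intro hi2 hcnj hi1) auto
    then have "((\<lambda>z. Re (form (K z) g g)) has_integral Re (form I g g)) (cbox (0, 0) (1, 1))"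
      by (rule has_integral_Re)
    then show ?thesis by (rule integral_unique)
  qed
  \<comment> \<open>On the fibre at z the move (\<open>c\<close>, \<open>\<tau>\<close>) is
    multiplication by \<open>ee (s z)\<close>. Adding its multiple by \<open>ee (- a)\<close> to
    \<open>g\<close> therefore multiplies the form by the squared modulus of
    \<open>1 + ee (s z - a)\<close>, whatever \<open>g\<close> is.\<close>
  have step: "form (K z) (g @ smul (ee (- a)) (act c \<tau> g)) (g @ smul (ee (- a)) (act c \<tau> g)) = 
      of_real ((norm (1 + ee (s z - a)))\<^sup>2) * form (K z) g g"
    if U: "\<And>z x y. x \<in> X \<Longrightarrow> y \<in> X \<Longrightarrow> c x * K z (\<tau> x) y = ee (s z) * K z x y"
     and \<tau>: "\<And>x. x \<in> X \<Longrightarrow> \<tau> x \<in> X"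
     and g: "set g \<subseteq> UNIV \<times> X" for c \<tau> s g z a
  proof -
    have l: "form (K z) (act c \<tau> g) k = ee (s z) * form (K z) g k" if k: "set k \<subseteq> UNIV \<times> X" for k
    proof -
      have "form (K z) (act c \<tau> g) k = ev (\<lambda>x. ee (s z) * cnj (ev (\<lambda>y. cnj (K z x y)) k)) g"
        unfolding form_ev ev_act
      proof (rule ev_cong)
        fix d x assume "(d, x) \<in> set g"
        then have x: "x \<in> X" using g by auto
        have "c x * cnj (ev (\<lambda>y. cnj (K z (\<tau> x) y)) k) = cnj (ev (\<lambda>y. cnj (c x * K z (\<tau> x) y)) k)"
          by (simp add: ev_cmult)
        also have "ev (\<lambda>y. cnj (c x * K z (\<tau> x) y)) k = ev (\<lambda>y. cnj (ee (s z) * K z x y)) k"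
        proof (rule ev_cong)
          fix e y assume "(e, y) \<in> set k"
          then have "y \<in> X" using k by auto
          then show "cnj (c x * K z (\<tau> x) y) = cnj (ee (s z) * K z x y)" by (simp only: U[OF x])
        qed
        also have "\<dots> = cnj (ee (s z)) * ev (\<lambda>y. cnj (K z x y)) k"
          by (simp only: complex_cnj_mult ev_cmult)
        finally show "c x * cnj (ev (\<lambda>y. cnj (K z (\<tau> x) y)) k) = ee (s z) * cnj (ev (\<lambda>y. cnj (K z x y)) k)"
          by (simp only: complex_cnj_mult complex_cnj_cnj)
      qed
      then show ?thesis by (simp add: ev_cmult form_ev)
    qed
    let ?k = "smul (ee (- a)) (act c \<tau> g)"
    have kX: "set (g @ ?k) \<subseteq> UNIV \<times> X" using g \<tau> by (auto simp: smul_def act_def)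
    have H: "form (K z) u v = cnj (form (K z) v u)" if "set u \<subseteq> UNIV \<times> X" "set v \<subseteq> UNIV \<times> X" for u v
      using that by (intro form_herm herm) auto
    have A: "form (K z) (g @ ?k) k = (1 + ee (s z - a)) * form (K z) g k" if k: "set k \<subseteq> UNIV \<times> X" for k
      using l[OF k] by (simp add: ee_diff algebra_simps)
    have "form (K z) (g @ ?k) (g @ ?k) = (1 + ee (s z - a)) * form (K z) g (g @ ?k)"
      by (rule A[OF kX])
    also have "form (K z) g (g @ ?k) = cnj (form (K z) (g @ ?k) g)" by (rule H[OF g kX])
    also have "\<dots> = cnj (1 + ee (s z - a)) * form (K z) g g"
      unfolding A[OF g] complex_cnj_mult H[OF g g, symmetric] ..
    finally show ?thesis by (simp add: complex_norm_square mult_ac del: of_real_power)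
  qed
  \<comment> \<open>Interior points first: for \<open>a\<close> on the boundary of the square the
    weight has further maxima at the opposite sides. The closure and then the periods take care of
    the rest.\<close>
  have nn: "h a \<ge> 0" if a: "a \<in> box (0, 0) (1, 1)" for a
  proof (rule ccontr)
    assume neg: "\<not> h a \<ge> 0"
    obtain a1 a2 where aa: "a = (a1, a2)" by force
    have ab: "0 < a1" "a1 < 1" "0 < a2" "a2 < 1"
      using a by (auto simp: aa box_prod)
    define W where "W z = (norm (1 + ee (fst z - a1)))\<^sup>2 * (norm (1 + ee (snd z - a2)))\<^sup>2" for z :: "real \<times> real"
    define st where "st g = (let g' = g @ smul (ee (- a1)) (act c1 \<tau>1 g) in g' @ smul (ee (- a2)) (act c2 \<tau>2 g'))" for g
    have st: "set (st g) \<subseteq> UNIV \<times> X \<and> form (K z) (st g) (st g) = of_real (W z) * form (K z) g g"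
      if g: "set g \<subseteq> UNIV \<times> X" for g z
    proof -
      define g' where "g' = g @ smul (ee (- a1)) (act c1 \<tau>1 g)"
      have g': "set g' \<subseteq> UNIV \<times> X" using g X by (auto simp: g'_def smul_def act_def)
      have 1: "form (K z) g' g' = of_real ((norm (1 + ee (fst z - a1)))\<^sup>2) * form (K z) g g"
        unfolding g'_def by (rule step[where s = fst, OF U1 X(1) g])
      have 2: "form (K z) (st g) (st g) = of_real ((norm (1 + ee (snd z - a2)))\<^sup>2) * form (K z) g' g'"
        unfolding st_def Let_def g'_def[symmetric] by (rule step[where s = snd, OF U2 X(2) g'])
      have 3: "set (st g) \<subseteq> UNIV \<times> X" using g' X
        unfolding st_def Let_def g'_def[symmetric] by (auto simp: smul_def act_def)
      show ?thesis using 1 2 3 by (simp add: W_def)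
    qed
    have iter: "set ((st ^^ n) f) \<subseteq> UNIV \<times> X \<and> form (K z) ((st ^^ n) f) ((st ^^ n) f) = of_real (W z ^ n) * form (K z) f f" for n z
    proof (induction n)
      case (Suc n)
      then show ?case using st[of "(st ^^ n) f" z] by (simp add: mult_ac)
    qed (use f in simp)
    \<comment> \<open>The weighted integral is the value of \<open>I\<close> at an honest
      combination, the n-th iterate of \<open>st\<close>, and so it cannot be negative; the peak
      lemma says otherwise for large n.\<close>
    have "integral (cbox (0, 0) (1, 1)) (\<lambda>z. W z ^ n * h z) \<ge> 0" for n
    proof -
      have "integral (cbox (0, 0) (1, 1)) (\<lambda>z. W z ^ n * h z) = 
        integral (cbox (0, 0) (1, 1)) (\<lambda>z. Re (form (K z) ((st ^^ n) f) ((st ^^ n) f)))"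
        using iter by (simp add: h_def del: of_real_power)
      also have "\<dots> = Re (form I ((st ^^ n) f) ((st ^^ n) f))"
        using iter by (intro intform) blast
      also have "\<dots> \<ge> 0" using iter by (intro pos) blast
      finally show ?thesis .
    qed
    moreover have "\<exists>n. integral (cbox (0, 0) (1, 1)) (\<lambda>z. W z ^ n * h z) < 0"
    proof (rule peak_integral_negative)
      show "continuous_on (cbox (0, 0) (1, 1)) W"
        unfolding W_def by (intro continuous_intros)
      show "continuous_on (cbox (0, 0) (1, 1)) h" using ch continuous_on_subset by blast
      show "a \<in> box (0, 0) (1, 1)" by fact
      show "h a < 0" using neg by simp
      show "0 \<le> W z" for z by (simp add: W_def)
      fix z :: "real \<times> real" assume z: "z \<in> cbox (0, 0) (1, 1)" "z \<noteq> a"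
      have zb: "0 \<le> fst z" "fst z \<le> 1" "0 \<le> snd z" "snd z \<le> 1"
        using z(1) by (auto simp: cbox_prod)
      have key: "s = t" if "ee (s - t) = 1" "0 < t" "t < 1" "0 \<le> s" "s \<le> 1" for s t
      proof -
        obtain n where n: "s - t = of_int n" using \<open>ee (s - t) = 1\<close> by (auto simp: ee_eq_1_iff elim: Ints_cases)
        have "- 1 < real_of_int n" "real_of_int n < 1" using n that by linarith+
        then have "n = 0" by linarith
        then show ?thesis using n by simp
      qed
      have "(norm (1 + ee (fst z - a1)))\<^sup>2 < 4 \<or> (norm (1 + ee (snd z - a2)))\<^sup>2 < 4"
      proof (rule ccontr)
        assume "\<not> ?thesis"
        then have "(norm (1 + ee (fst z - a1)))\<^sup>2 = 4" "(norm (1 + ee (snd z - a2)))\<^sup>2 = 4"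
          using norm_1_ee_le[of "fst z - a1"] norm_1_ee_le[of "snd z - a2"] by linarith+
        then have "fst z = a1" "snd z = a2"
          using key ab zb by (auto simp: norm_1_ee_eq)
        then show False using z(2) aa by (metis prod.collapse)
      qed
      then have "W z < 4 * 4"
      proof
        assume "(norm (1 + ee (fst z - a1)))\<^sup>2 < 4"
        then have "W z \<le> (norm (1 + ee (fst z - a1)))\<^sup>2 * 4" unfolding W_def
          using norm_1_ee_le by (intro mult_left_mono) auto
        then show ?thesis using \<open>(norm (1 + ee (fst z - a1)))\<^sup>2 < 4\<close> by linarith
      next
        assume "(norm (1 + ee (snd z - a2)))\<^sup>2 < 4"
        moreover have "W z \<le> 4 * (norm (1 + ee (snd z - a2)))\<^sup>2" unfolding W_def
          using norm_1_ee_le by (intro mult_right_mono) auto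
        ultimately show ?thesis by linarith
      qed
      also have "4 * 4 = W a" by (simp add: W_def aa)
      finally show "W z < W a" .
    qed
    ultimately show False by (meson not_le)
  qed
  have nn2: "h a \<ge> 0" if "a \<in> cbox (0, 0) (1, 1)" for a
  proof -
    have "((1/2, 1/2) :: real \<times> real) \<in> box (0, 0) (1, 1)" by (simp add: box_prod)
    then have cl: "closure (box (0, 0) (1, 1)) = cbox (0 :: real, 0 :: real) (1, 1)"
      by (intro closure_box) blast
    show ?thesis
      by (rule continuous_ge_on_closure[of "box (0, 0) (1, 1)" h a 0])
         (use cl that nn continuous_on_subset[OF ch subset_UNIV] in auto)
  qed
  have "h (z + (1, 0)) = h z" for z
    unfolding h_def using f by (intro arg_cong[of _ _ Re] form_cong per1) auto
  then have hp1: "h (z + of_int n *\<^sub>R (1, 0)) = h z" for n z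
    by (rule periodic_of_int)
  have "h (z + (0, 1)) = h z" for z
    unfolding h_def using f by (intro arg_cong[of _ _ Re] form_cong per2) auto
  then have hp2: "h (z + of_int n *\<^sub>R (0, 1)) = h z" for n z
    by (rule periodic_of_int)
  define w where "w = (frac (fst z), frac (snd z))"
  have "z = (w + of_int \<lfloor>fst z\<rfloor> *\<^sub>R (1, 0)) + of_int \<lfloor>snd z\<rfloor> *\<^sub>R (0, 1)"
    by (simp add: w_def prod_eq_iff frac_def)
  then have "h z = h w" using hp1 hp2 by metis
  moreover have "w \<in> cbox (0, 0) (1, 1)"
    by (auto simp: w_def less_imp_le[OF frac_lt_1])
  ultimately show ?thesis using nn2[of w] by (simp add: h_def)
qed

section \<open>The Gram matrix of the fibres\<close>

definition wedge :: "real \<times> real \<Rightarrow> real \<times> real \<Rightarrow> real" where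
  "wedge x y = fst x * snd y - snd x * fst y"

definition latt :: "(real \<times> real) set" where
  "latt = {x. fst x \<in> \<int> \<and> snd x \<in> \<int>}"

text \<open>For t < Q these represent the cosets of the sublattice generated by (1, 0) and (0, Q);
  \<open>bv Q\<close> is its second generator.\<close>

definition bv :: "nat \<Rightarrow> real \<times> real" where "bv t = (0, of_nat t)"

lemma bv_simps [simp]: "fst (bv t) = 0" "snd (bv t) = of_nat t" by (simp_all add: bv_def)
lemma bv_0 [simp]: "bv 0 = 0" by (simp add: bv_def zero_prod_def)
lemma bv_add: "bv t + bv s = bv (t + s)" by (simp add: bv_def)
lemma bv_latt: "bv t \<in> latt" by (simp add: latt_def)
lemma zero_latt: "0 \<in> latt" by (simp add: latt_def)

section \<open>Characters on the unit square\<close>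

lemma ee_recurrence_int:
  assumes "\<And>n::int. f (n + 1) = ee c * (f n :: complex)"
  shows "f n = ee (of_int n * c) * f 0"
proof (induction n rule: int_induct[where k = 0])
  case base then show ?case by simp
next
  case (step1 i) then show ?case using assms[of i] by (simp add: distrib_right ee_add)
next
  case (step2 i)
  have "f i = ee c * f (i - 1)" using assms[of "i - 1"] by simp
  then have "f (i - 1) = ee (- c) * f i" by (simp add: ee_minus)
  then show ?case using step2 by (simp add: left_diff_distrib ee_diff ee_minus)
qed

lemma integral_ee_unit_interval:
  "integral {0..1} (\<lambda>t. ee (of_int m * t)) = (if m = 0 then 1 else 0)"
proof (cases "m = 0")
  case False
  let ?c = "of_real (2 * pi * of_int m) * \<i>"
  have c: "?c \<noteq> 0" using False by simp
  have "((\<lambda>t. ee (of_int m * t)) has_integral (ee (of_int m * 1) / ?c - ee (of_int m * 0) / ?c)) {0..1}"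
  proof (rule fundamental_theorem_of_calculus)
    fix x :: real
    have "((\<lambda>t. exp (of_real t * ?c) / ?c) has_vector_derivative exp (of_real x * ?c)) (at x within {0..1})"
    proof -
      have "((\<lambda>z. exp (z * ?c) / ?c) has_field_derivative exp (of_real x * ?c)) (at (of_real x))"
        by (rule derivative_eq_intros refl | use c in simp)+
      then show ?thesis by (rule has_vector_derivative_real_field)
    qed
    moreover have "exp (of_real t * ?c) = ee (of_int m * t)" for t
      by (simp add: ee_def cis_conv_exp mult_ac)
    ultimately show "((\<lambda>t. ee (of_int m * t) / ?c) has_vector_derivative ee (of_int m * x)) (at x within {0..1})"
      by simp
  qed simp
  then have "((\<lambda>t. ee (of_int m * t)) has_integral 0) {0..1}" by simp
  then show ?thesis using False by (simp add: integral_unique)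
qed simp

lemma integral_ee_unit_square:
  "integral (cbox (0, 0) (1, 1)) (\<lambda>z. ee (of_int m * fst z + of_int n * snd z)) = (if m = 0 \<and> n = 0 then 1 else 0)"
proof -
  have "integral (cbox (0, 0) (1, 1)) (\<lambda>z. ee (of_int m * fst z + of_int n * snd z)) = 
    integral (cbox 0 1) (\<lambda>x. integral (cbox 0 1) (\<lambda>y. ee (of_int m * x + of_int n * y)))"
    by (subst integral_prod_continuous) (auto intro!: continuous_intros)
  also have "\<dots> = integral {0..1} (\<lambda>x. ee (of_int m * x) * (if n = 0 then 1 else 0))"
    by (simp add: ee_add integral_ee_unit_interval)
  also have "\<dots> = (if m = 0 \<and> n = 0 then 1 else 0)"
    by (simp add: integral_ee_unit_interval)
  finally show ?thesis .
qed

lemma ev_cmult2: "ev (\<lambda>x. u x * c) f = ev u f * c"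
  using ev_cmult[of c u f] by (simp add: mult.commute)

text \<open>Merges repeated points of a list; the Riesz inequality speaks of finite sets of distinct
  points.\<close>

lemma ev_collapse:
  "ev u f = (\<Sum>x\<in>snd ` set f. ev (\<lambda>y. if y = x then 1 else 0) f * u x)"
proof -
  have "ev u f = ev (\<lambda>y. \<Sum>x\<in>snd ` set f. u x * (if y = x then 1 else 0)) f"
    by (rule ev_cong) (force simp: sum.delta' if_distrib cong: if_cong)
  then show ?thesis by (simp add: ev_sum ev_cmult mult.commute)
qed

lemma form_ev': "form K f g = cnj (ev (\<lambda>y. cnj (ev (\<lambda>x. K x y) f)) g)"
proof (induction f)
  case (Cons a f)
  obtain c x where a: "a = (c, x)" by force
  have "form K (a # f) g = c * cnj (ev (\<lambda>y. cnj (K x y)) g) + form K f g"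
    by (simp add: form_ev a)
  then show ?case using Cons by (simp add: a ev_add ev_cmult)
qed (simp add: form_ev)

text \<open>All analytic input is confined to these axioms, which both constructions of the bracket
  satisfy. \<open>K_U1\<close> and \<open>K_U2\<close> say that the generators of the sublattice act
  on the fibre at z as characters of z, \<open>K_shift\<close> that an arbitrary real shift moves
  the fibre parameter. The phases with \<open>\<theta> / 2\<close> and \<open>of_int P / 2\<close>
  are the cocycle of the symmetrised time-frequency shifts.\<close>

locale gram_field =
  fixes P :: int and Q :: nat and A :: real
    and K :: "real \<times> real \<Rightarrow> real \<times> real \<Rightarrow> real \<times> real \<Rightarrow> complex"
    and I :: "real \<times> real \<Rightarrow> real \<times> real \<Rightarrow> complex"
    and \<theta> :: real
  defines "\<theta> \<equiv> of_int P / of_nat Q"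
  assumes Q: "Q > 0" and PQ: "coprime P (int Q)" and A: "A > 0"
    and K_herm: "K z y x = cnj (K z x y)"
    and K_cont: "continuous_on UNIV (\<lambda>p. K (snd p) (fst p) y)"
    and K_per1: "K (z + (1, 0)) x y = K z x y"
    and K_per2: "K (z + (0, 1)) x y = K z x y"
    and K_U1: "K z (x + (1, 0)) y = ee (fst z - \<theta> / 2 * snd x) * K z x y"
    and K_U2: "K z (x + bv Q) y = ee (snd z + of_int P / 2 * fst x) * K z x y"
    and K_shift: "K z (w + x) (w + y) = ee (\<theta> / 2 * (wedge w y - wedge w x)) *
                    K (z + (- \<theta> * snd w, of_int P * fst w)) x y"
    and K_int: "integral (cbox (0, 0) (1, 1)) (\<lambda>z. K z x y) = I x y"
    and I_pos: "0 \<le> Re (form I f f)"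
    and I_riesz: "finite F \<Longrightarrow> F \<subseteq> latt \<Longrightarrow>
                    A * (\<Sum>x\<in>F. (norm (c x))\<^sup>2) \<le> Re (\<Sum>x\<in>F. \<Sum>y\<in>F. c x * cnj (c y) * I x y)"
begin

text \<open>The coefficient of the fibre of a lattice point \<open>x\<close> at the generator
  \<open>bv t\<close>: the second coordinate modulo Q selects the generator, and the phase is what
  accumulates when \<open>K_U1\<close> is applied \<open>fst x\<close> times and \<open>K_U2\<close>
  as often as the integer quotient says.\<close>

definition E :: "nat \<Rightarrow> real \<times> real \<Rightarrow> real \<times> real \<Rightarrow> complex" where
  "E t z x = (if nat (\<lfloor>snd x\<rfloor> mod int Q) = t
     then ee (- \<theta> / 2 * fst x * snd x + fst x * fst z + of_int (\<lfloor>snd x\<rfloor> div int Q) * snd z) else 0)"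

lemma thQ: "\<theta> * of_nat Q = of_int P" using Q by (simp add: \<theta>_def)

lemma latt_coords:
  assumes "x \<in> latt"
  obtains k l :: int and t where "x = (of_int k, of_nat t + of_nat Q * of_int l)" "t < Q"
    "nat (\<lfloor>snd x\<rfloor> mod int Q) = t" "\<lfloor>snd x\<rfloor> div int Q = l"
proof -
  obtain k m where km: "fst x = of_int k" "snd x = of_int m"
    using assms by (auto simp: latt_def elim!: Ints_cases)
  have m: "m = int (nat (m mod int Q)) + int Q * (m div int Q)" using Q by simp
  show ?thesis
  proof (rule that)
    show "x = (of_int k, of_nat (nat (m mod int Q)) + of_nat Q * of_int (m div int Q))"
      using km arg_cong[OF m, of real_of_int] by (simp add: prod_eq_iff)
    show "nat (m mod int Q) < Q" using Q by (simp add: nat_less_iff)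
  qed (simp_all add: km)
qed

lemma K_lattice:
  assumes "x \<in> latt"
  shows "K z x y = (\<Sum>t<Q. E t z x * K z (bv t) y)"
proof -
  obtain k l :: int and t where x: "x = (of_int k, of_nat t + of_nat Q * of_int l)" and t: "t < Q"
    "nat (\<lfloor>snd x\<rfloor> mod int Q) = t" "\<lfloor>snd x\<rfloor> div int Q = l"
    by (rule latt_coords[OF assms])
  define m where "m = real t + of_nat Q * of_int l"
  have 1: "K z (of_int n, m) y = ee (of_int n * (fst z - \<theta> / 2 * m)) * K z (0, m) y" for n
    using ee_recurrence_int[of "\<lambda>n. K z (of_int n, m) y" "fst z - \<theta> / 2 * m" n] K_U1[of z "(_, m)" y] by simp
  \<comment> \<open>The first coordinate is already 0 here, so the phase in \<open>K_U2\<close> that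
    depends on it disappears.\<close>
  have 2: "K z (0, of_nat t + of_nat Q * of_int n) y = ee (of_int n * snd z) * K z (bv t) y" for n
    using ee_recurrence_int[of "\<lambda>n. K z (0, of_nat t + of_nat Q * of_int n) y" "snd z" n] 
      K_U2[of z "(0, of_nat t + of_nat Q * of_int _)" y]
    by (simp add: bv_def algebra_simps)
  have "(\<Sum>t<Q. E t z x * K z (bv t) y) = (\<Sum>s<Q. if s = t then E t z x * K z (bv t) y else 0)"
    by (intro sum.cong refl) (auto simp: E_def t)
  also have "\<dots> = E t z x * K z (bv t) y" using t by simp
  also have "E t z x = ee (of_int k * (fst z - \<theta> / 2 * m)) * ee (of_int l * snd z)"
    unfolding ee_add[symmetric] E_def t using t(2,3) by (simp add: x m_def algebra_simps add_divide_distrib)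
  also have "\<dots> * K z (bv t) y = K z x y"
    unfolding x by (simp only: m_def[symmetric] 1) (simp only: m_def 2 mult.assoc)
  finally show ?thesis by simp
qed

lemma E_bv: "s < Q \<Longrightarrow> E t z (bv s) = (if s = t then 1 else 0)"
  by (simp add: E_def)

lemma K_cont': 
  fixes X :: "'c::topological_space \<Rightarrow> real \<times> real"
  assumes "continuous_on S X" "continuous_on S Z"
  shows "continuous_on S (\<lambda>p. K (Z p) (X p) y)"
proof -
  have "continuous_on S (\<lambda>p. (X p, Z p))" using assms by (rule continuous_on_Pair)
  from continuous_on_compose2[OF K_cont this, of y] show ?thesis by simp
qed

lemma psd_K: "psd (K z)"
  unfolding psd_def
proof (intro conjI allI)
  show "K z y x = cnj (K z x y)" for x y by (rule K_herm)
  fix f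
  show "0 \<le> Re (form (K z) f f)"
  proof (rule fibre_form_nonneg[where X = UNIV and I = I and K = K])
    show "continuous_on UNIV (\<lambda>z. K z x y)" for x y
      by (intro K_cont' continuous_intros)
    show "ee (\<theta> / 2 * snd x) * K z (x + (1, 0)) y = ee (fst z) * K z x y" for x y z
      by (simp add: K_U1 ee_diff ee_minus)
    show "ee (- (of_int P / 2 * fst x)) * K z (x + bv Q) y = ee (snd z) * K z x y" for x y z
      by (simp add: K_U2 ee_add ee_minus)
  qed (simp_all add: K_herm[symmetric] K_per1 K_per2 K_int I_pos)
qed

text \<open>The bracket that an orthonormal system indexed by the lattice would have. It obeys the
  transformation rules of \<open>K\<close> on lattice points, so subtracting A times it turns the
  lower Riesz bound into positivity of a kernel that can be tested fibre by fibre.\<close>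

definition K0 :: "real \<times> real \<Rightarrow> real \<times> real \<Rightarrow> real \<times> real \<Rightarrow> complex" where
  "K0 z x y = (\<Sum>t<Q. E t z x * cnj (E t z y))"

lemma E_U1: "E t z (x + (1, 0)) = ee (fst z - \<theta> / 2 * snd x) * E t z x"
  unfolding E_def by (simp add: ee_add[symmetric] algebra_simps add_divide_distrib diff_divide_distrib)

lemma E_U2:
  assumes "x \<in> latt"
  shows "E t z (x + bv Q) = ee (snd z + of_int P / 2 * fst x) * E t z x"
proof -
  obtain k where k: "fst x = of_int k" using assms by (auto simp: latt_def elim!: Ints_cases)
  have fl: "\<lfloor>snd x + real Q\<rfloor> = \<lfloor>snd x\<rfloor> + int Q" by linarith
  have "(\<lfloor>snd x\<rfloor> + int Q) div int Q = \<lfloor>snd x\<rfloor> div int Q + 1" using Q by simp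
  moreover have "ee (- \<theta> / 2 * fst x * (snd x + real Q) + fst x * fst z + of_int (\<lfloor>snd x\<rfloor> div int Q + 1) * snd z)
     = ee (snd z + of_int P / 2 * fst x + (- \<theta> / 2 * fst x * snd x + fst x * fst z + of_int (\<lfloor>snd x\<rfloor> div int Q) * snd z))"
  \<comment> \<open>The two phases differ by P times the first coordinate, an integer only because
    \<open>x\<close> is a lattice point.\<close>
  proof (rule ee_cong[of _ _ "- P * k"])
    have e: "real_of_int P = \<theta> * real Q" by (simp add: thQ)
    show "- \<theta> / 2 * fst x * (snd x + real Q) + fst x * fst z + of_int (\<lfloor>snd x\<rfloor> div int Q + 1) * snd z -
      (snd z + of_int P / 2 * fst x + (- \<theta> / 2 * fst x * snd x + fst x * fst z + of_int (\<lfloor>snd x\<rfloor> div int Q) * snd z))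
      = real_of_int (- P * k)"
      by (simp add: k[symmetric] e algebra_simps)
  qed
  ultimately show ?thesis unfolding E_def by (simp add: fl ee_add[symmetric])
qed

lemma K0_int:
  assumes "x \<in> latt" "y \<in> latt"
  shows "integral (cbox (0, 0) (1, 1)) (\<lambda>z. K0 z x y) = (if x = y then 1 else 0)"
proof -
  obtain k l :: int and t where x: "x = (of_int k, of_nat t + of_nat Q * of_int l)" "t < Q"
    "nat (\<lfloor>snd x\<rfloor> mod int Q) = t" "\<lfloor>snd x\<rfloor> div int Q = l"
    by (rule latt_coords[OF assms(1)])
  obtain k' l' :: int and t' where y: "y = (of_int k', of_nat t' + of_nat Q * of_int l')" "t' < Q"
    "nat (\<lfloor>snd y\<rfloor> mod int Q) = t'" "\<lfloor>snd y\<rfloor> div int Q = l'"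
    by (rule latt_coords[OF assms(2)])
  show ?thesis
  proof (cases "t = t'")
    case False
    then have "K0 z x y = 0" for z unfolding K0_def E_def x(3) y(3) by (intro sum.neutral) auto
    moreover have "x \<noteq> y" using False x(3) y(3) by auto
    ultimately show ?thesis by simp
  next
    case True
    let ?c = "- \<theta> / 2 * fst x * snd x + \<theta> / 2 * fst y * snd y"
    have "K0 z x y = ee ?c * ee (of_int (k - k') * fst z + of_int (l - l') * snd z)" for z
    proof -
      have "K0 z x y = (\<Sum>s<Q. if s = t then E t z x * cnj (E t z y) else 0)"
        unfolding K0_def by (intro sum.cong refl) (auto simp: E_def x(3) y(3) True)
      also have "\<dots> = E t z x * cnj (E t z y)" using x(2) by simp
      also have "\<dots> = ee ?c * ee (of_int (k - k') * fst z + of_int (l - l') * snd z)"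
        unfolding E_def x(3,4) y(3,4) True[symmetric]
        by (simp add: ee_add[symmetric] cnj_ee) (simp add: x(1) y(1) algebra_simps)
      finally show ?thesis .
    qed
    then have "integral (cbox (0, 0) (1, 1)) (\<lambda>z. K0 z x y) = ee ?c * (if k - k' = 0 \<and> l - l' = 0 then 1 else 0)"
      by (simp only: integral_mult_right integral_ee_unit_square)
    also have "k - k' = 0 \<and> l - l' = 0 \<longleftrightarrow> x = y"
      using Q by (auto simp: x(1) y(1) True)
    finally show ?thesis by auto
  qed
qed

lemma form_K0: "form (K0 z) f f = of_real (\<Sum>t<Q. (norm (ev (E t z) f))\<^sup>2)"
proof -
  have "form (K0 z) f f = (\<Sum>t<Q. ev (E t z) f * cnj (ev (E t z) f))"
    unfolding form_ev K0_def 
    by (simp add: ev_sum ev_cmult ev_cmult2)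
  then show ?thesis by (simp add: complex_norm_square mult.commute del: of_real_power)
qed

lemma I_lattice_lower:
  assumes "set f \<subseteq> UNIV \<times> latt"
  shows "0 \<le> Re (form (\<lambda>x y. I x y - of_real A * (if x = y then 1 else 0)) f f)"
proof -
  define F where "F = snd ` set f"
  define c where "c x = ev (\<lambda>y. if y = x then 1 else 0) f" for x
  have F: "finite F" "F \<subseteq> latt" using assms by (auto simp: F_def)
  have 1: "form M f f = (\<Sum>x\<in>F. \<Sum>y\<in>F. c x * cnj (c y) * M x y)" for M
    unfolding form_ev
    by (subst ev_collapse, subst (2) ev_collapse)
       (simp add: F_def[symmetric] c_def[symmetric] sum_distrib_left mult_ac)
  have "form (\<lambda>x y. if x = y then 1 else 0) f f = (\<Sum>x\<in>F. c x * cnj (c x))"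
    unfolding 1 using F(1) by (simp add: if_distrib[of "\<lambda>u. _ * u"] cong: if_cong)
  also have "\<dots> = of_real (\<Sum>x\<in>F. (norm (c x))\<^sup>2)"
    by (simp add: complex_norm_square del: of_real_power)
  finally show ?thesis
    using I_riesz[OF F, of c] unfolding form_diff by (simp add: 1[of I])
qed

text \<open>The Riesz bound survives in every fibre with the same constant: \<open>K - A K0\<close>
  satisfies the hypotheses of \<open>fibre_form_nonneg\<close> on the lattice, and on combinations
  of the \<open>bv t\<close> the form of \<open>K0\<close> is the plain sum of squares.\<close>

lemma gram_lower:
  "A * (\<Sum>t<Q. (norm (v t))\<^sup>2) \<le> Re (\<Sum>t<Q. \<Sum>s<Q. v t * cnj (v s) * K z (bv t) (bv s))"
proof -
  define f where "f = map (\<lambda>t. (v t, bv t)) [0..<Q]"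
  have f: "set f \<subseteq> UNIV \<times> latt" using bv_latt by (auto simp: f_def)
  have EX: "ev (E t z) f = v t" if "t < Q" for t
  proof -
    have "ev (E t z) f = (\<Sum>s<Q. v s * E t z (bv s))" by (simp add: f_def ev_map)
    also have "\<dots> = (\<Sum>s<Q. if s = t then v t else 0)" by (intro sum.cong refl) (auto simp: E_bv)
    finally show ?thesis using that by simp
  qed
  have "0 \<le> Re (form (\<lambda>x y. K z x y - of_real A * K0 z x y) f f)"
  proof (rule fibre_form_nonneg[where X = latt and I = "\<lambda>x y. I x y - of_real A * (if x = y then 1 else 0)"
          and K = "\<lambda>z x y. K z x y - of_real A * K0 z x y"])
    fix x y :: "real \<times> real" and z
    assume xy: "x \<in> latt" "y \<in> latt"
    have cK: "continuous_on UNIV (\<lambda>z. K z x y)"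
      by (intro K_cont' continuous_intros)
    have cE: "continuous_on UNIV (\<lambda>z. E t z x)" for t x
      unfolding E_def by (cases "nat (\<lfloor>snd x\<rfloor> mod int Q) = t") (auto intro!: continuous_intros)
    have cK0: "continuous_on UNIV (\<lambda>z. K0 z x y)"
      unfolding K0_def by (intro continuous_intros cE)
    show "continuous_on UNIV (\<lambda>z. K z x y - of_real A * K0 z x y)"
      by (intro continuous_intros cK cK0)
    show "K z y x - of_real A * K0 z y x = cnj (K z x y - of_real A * K0 z x y)"
      unfolding K0_def by (simp add: K_herm[symmetric] mult.commute)
    have e1: "E t (z + (1, 0)) x = E t z x" if "x \<in> latt" for t x
    proof -
      obtain k where k: "fst x = of_int k" using \<open>x \<in> latt\<close> by (auto simp: latt_def elim!: Ints_cases)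
      show ?thesis unfolding E_def by (auto intro!: ee_cong[of _ _ k] simp: k algebra_simps)
    qed
    show "K (z + (1, 0)) x y - of_real A * K0 (z + (1, 0)) x y = K z x y - of_real A * K0 z x y"
      unfolding K0_def by (simp add: K_per1 e1 xy)
    have e2: "E t (z + (0, 1)) x = E t z x" for t x
      unfolding E_def by (auto intro!: ee_cong[of _ _ "\<lfloor>snd x\<rfloor> div int Q"] simp: algebra_simps)
    show "K (z + (0, 1)) x y - of_real A * K0 (z + (0, 1)) x y = K z x y - of_real A * K0 z x y"
      unfolding K0_def by (simp add: K_per2 e2)
    have "K0 z (x + (1, 0)) y = ee (fst z - \<theta> / 2 * snd x) * K0 z x y"
      unfolding K0_def E_U1 by (simp add: sum_distrib_left mult.assoc)
    then show "ee (\<theta> / 2 * snd x) * (K z (x + (1, 0)) y - of_real A * K0 z (x + (1, 0)) y) = 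
        ee (fst z) * (K z x y - of_real A * K0 z x y)"
      by (simp add: K_U1 ee_diff ee_minus algebra_simps)
    have "K0 z (x + bv Q) y = ee (snd z + of_int P / 2 * fst x) * K0 z x y"
      unfolding K0_def E_U2[OF xy(1)] by (simp add: sum_distrib_left mult.assoc)
    then show "ee (- (of_int P / 2 * fst x)) * (K z (x + bv Q) y - of_real A * K0 z (x + bv Q) y) = 
        ee (snd z) * (K z x y - of_real A * K0 z x y)"
      by (simp add: K_U2 ee_add ee_minus algebra_simps)
    have "integral (cbox (0, 0) (1, 1)) (\<lambda>z. K z x y - of_real A * K0 z x y) = 
      integral (cbox (0, 0) (1, 1)) (\<lambda>z. K z x y) - integral (cbox (0, 0) (1, 1)) (\<lambda>z. of_real A * K0 z x y)"
      by (intro Henstock_Kurzweil_Integration.integral_diff integrable_continuous continuous_intros 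
           continuous_on_subset[OF cK] continuous_on_subset[OF cK0]) auto
    then show "integral (cbox (0, 0) (1, 1)) (\<lambda>z. K z x y - of_real A * K0 z x y) = 
       I x y - of_real A * (if x = y then 1 else 0)"
      by (simp add: K_int K0_int xy)
  next
    show "0 \<le> Re (form (\<lambda>x y. I x y - of_real A * (if x = y then 1 else 0)) f f)"
      if "set f \<subseteq> UNIV \<times> latt" for f using that by (rule I_lattice_lower)
  qed (use f in \<open>auto simp: latt_def bv_def\<close>)
  then have "A * (\<Sum>t<Q. (norm (ev (E t z) f))\<^sup>2) \<le> Re (form (K z) f f)"
    unfolding form_diff form_K0 by simp
  also have "form (K z) f f = (\<Sum>t<Q. \<Sum>s<Q. v t * cnj (v s) * K z (bv t) (bv s))"
    by (simp add: form_ev f_def ev_map sum_distrib_left mult_ac)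
  finally show ?thesis by (simp add: EX)
qed

lemma gram_inj:
  assumes "\<And>s. s < Q \<Longrightarrow> (\<Sum>t<Q. v t * K z (bv t) (bv s)) = 0" "t < Q"
  shows "v t = 0"
proof -
  have "(\<Sum>t<Q. \<Sum>s<Q. v t * cnj (v s) * K z (bv t) (bv s)) = (\<Sum>s<Q. cnj (v s) * (\<Sum>t<Q. v t * K z (bv t) (bv s)))"
    unfolding sum_distrib_left by (subst sum.swap) (simp add: mult_ac)
  also have "\<dots> = 0" using assms(1) by (intro sum.neutral) auto
  finally have "A * (\<Sum>t<Q. (norm (v t))\<^sup>2) \<le> 0" using gram_lower[of v z] by simp
  then have "(\<Sum>t<Q. (norm (v t))\<^sup>2) \<le> 0" using A by (simp add: mult_le_0_iff)
  then have "(\<Sum>t<Q. (norm (v t))\<^sup>2) = 0" by (intro antisym sum_nonneg) auto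
  then have "(norm (v t))\<^sup>2 = 0" using assms(2) by (subst (asm) sum_nonneg_eq_0_iff) auto
  then show ?thesis by simp
qed

end

section \<open>Winding numbers of the Gram determinants\<close>

context gram_field
begin

definition spanned :: "real \<times> real \<Rightarrow> (real \<times> real \<Rightarrow> complex) \<Rightarrow> bool" where
  "spanned z u \<longleftrightarrow> (\<exists>C. \<forall>y. u y = (\<Sum>t<Q. C t * K z (bv t) y))"

lemma spanned_cmult: 
  assumes "spanned z u"
  shows "spanned z (\<lambda>y. c * u y)"
proof -
  obtain C where "\<And>y. u y = (\<Sum>t<Q. C t * K z (bv t) y)"
    using assms unfolding spanned_def by blast
  then have "c * u y = (\<Sum>t<Q. (c * C t) * K z (bv t) y)" for y
    by (simp add: sum_distrib_left mult.assoc)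
  then show ?thesis unfolding spanned_def by (intro exI[of _ "\<lambda>t. c * C t"]) blast
qed

lemma spanned_add: 
  assumes "spanned z u" "spanned z v"
  shows "spanned z (\<lambda>y. u y + v y)"
proof -
  obtain C D where "\<And>y. u y = (\<Sum>t<Q. C t * K z (bv t) y)" "\<And>y. v y = (\<Sum>t<Q. D t * K z (bv t) y)"
    using assms unfolding spanned_def by blast
  then have "u y + v y = (\<Sum>t<Q. (C t + D t) * K z (bv t) y)" for y
    by (simp add: sum.distrib distrib_right)
  then show ?thesis unfolding spanned_def by (intro exI[of _ "\<lambda>t. C t + D t"]) blast
qed

lemma spanned_sum:
  "finite S \<Longrightarrow> (\<And>i. i \<in> S \<Longrightarrow> spanned z (u i)) \<Longrightarrow> spanned z (\<lambda>y. \<Sum>i\<in>S. c i * u i y)"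
proof (induction S rule: finite_induct)
  case empty
  show ?case unfolding spanned_def by (intro exI[of _ "\<lambda>_. 0"]) simp
next
  case (insert a S)
  then show ?case by (simp add: spanned_add spanned_cmult)
qed

definition shift :: "real \<times> real \<Rightarrow> real \<times> real" where
  "shift w = (- \<theta> * snd w, of_int P * fst w)"

definition Gam :: "(real \<times> real) set" where
  "Gam = {x. \<forall>z. spanned z (K z x)}"

lemma latt_Gam: "x \<in> latt \<Longrightarrow> x \<in> Gam"
  unfolding Gam_def spanned_def
  by (intro CollectI allI exI[of _ "\<lambda>t. E t _ x"]) (rule K_lattice)

lemma K_shift': "K z (w + x) (w + y) = ee (\<theta> / 2 * (wedge w y - wedge w x)) * K (z + shift w) x y"
  unfolding shift_def by (rule K_shift)

text \<open>Covariance transports a linear relation from the fibre at \<open>z + shift w\<close> to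
  the fibre at z, between the points translated by \<open>w\<close>. Testing against
  \<open>y - w\<close> leaves phases whose dependence on \<open>y\<close> is common to all
  terms.\<close>

lemma shift_span:
  assumes "\<And>y. K (z + shift w) x y = (\<Sum>t<Q. C t * K (z + shift w) (bv t) y)"
  shows "K z (w + x) y = (\<Sum>t<Q. C t * ee (\<theta> / 2 * (wedge w (bv t) - wedge w x)) * K z (w + bv t) y)"
proof -
  have "K z (w + x) y = ee (\<theta> / 2 * (wedge w (y - w) - wedge w x)) * K (z + shift w) x (y - w)"
    using K_shift'[of z w x "y - w"] by simp
  also have "\<dots> = (\<Sum>t<Q. ee (\<theta> / 2 * (wedge w (y - w) - wedge w x)) * (C t * K (z + shift w) (bv t) (y - w)))"
    by (simp add: assms sum_distrib_left)
  also have "\<dots> = (\<Sum>t<Q. C t * ee (\<theta> / 2 * (wedge w (bv t) - wedge w x)) * K z (w + bv t) y)"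
  proof (intro sum.cong refl)
    fix t
    have "K z (w + bv t) y = ee (\<theta> / 2 * (wedge w (y - w) - wedge w (bv t))) * K (z + shift w) (bv t) (y - w)"
      using K_shift'[of z w "bv t" "y - w"] by simp
    moreover have "ee (\<theta> / 2 * (wedge w (bv t) - wedge w x)) * ee (\<theta> / 2 * (wedge w (y - w) - wedge w (bv t)))
       = ee (\<theta> / 2 * (wedge w (y - w) - wedge w x))"
      unfolding ee_add[symmetric] by (rule arg_cong[of _ _ ee]) (simp add: algebra_simps)
    ultimately show "ee (\<theta> / 2 * (wedge w (y - w) - wedge w x)) * (C t * K (z + shift w) (bv t) (y - w)) =
        C t * ee (\<theta> / 2 * (wedge w (bv t) - wedge w x)) * K z (w + bv t) y"
      by (simp add: mult_ac)
  qed
  finally show ?thesis .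
qed

text \<open>Transporting by \<open>w\<close> the relation for \<open>x\<close> leaves the points w +
  \<open>bv t\<close>. Each of these is read as \<open>bv t\<close> + w, so that now the relation
  for \<open>w\<close> is transported by \<open>bv t\<close>; what remains are lattice points
  \<open>bv t\<close> + \<open>bv s\<close>.\<close>

lemma Gam_add:
  assumes w: "w \<in> Gam" and x: "x \<in> Gam"
  shows "w + x \<in> Gam"
  unfolding Gam_def
proof (intro CollectI allI)
  fix z
  obtain C where C: "\<And>y. K (z + shift w) x y = (\<Sum>t<Q. C t * K (z + shift w) (bv t) y)"
    using x unfolding Gam_def spanned_def by blast
  have "spanned z (K z (w + bv t))" for t
  proof -
    obtain C' where C': "\<And>y. K (z + shift (bv t)) w y = (\<Sum>s<Q. C' s * K (z + shift (bv t)) (bv s) y)"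
      using w unfolding Gam_def spanned_def by blast
    have eq: "K z (bv t + w) = (\<lambda>y. \<Sum>s<Q. (C' s * ee (\<theta> / 2 * (wedge (bv t) (bv s) - wedge (bv t) w))) * K z (bv t + bv s) y)"
      using shift_span[OF C'] by blast
    have "spanned z (K z (bv t + bv s))" for s
      using latt_Gam[OF bv_latt[of "t + s"]] unfolding bv_add Gam_def by blast
    then have "spanned z (K z (bv t + w))" unfolding eq by (intro spanned_sum) auto
    then show ?thesis by (simp add: add.commute)
  qed
  then have "spanned z (\<lambda>y. \<Sum>t<Q. (C t * ee (\<theta> / 2 * (wedge w (bv t) - wedge w x))) * K z (w + bv t) y)"
    by (intro spanned_sum) auto
  then show "spanned z (K z (w + x))"
    using shift_span[OF C] by presburger
qed

text \<open>The phase is chosen so that stepping past the last index, in the row or in the column,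
  costs only \<open>ee (snd z)\<close> or its conjugate, with no phase depending on
  \<open>x\<close>; this makes the cyclic renumbering exact.\<close>

definition N :: "real \<times> real \<Rightarrow> real \<times> real \<Rightarrow> nat \<Rightarrow> nat \<Rightarrow> complex" where
  "N x z r s = ee (- \<theta> / 2 * of_nat r * fst x) * K z (x + bv r) (bv s)"

definition D :: "real \<times> real \<Rightarrow> real \<times> real \<Rightarrow> complex" where
  "D x z = dt Q (N x z)"

lemma spanned_zero:
  assumes "spanned z u" "\<And>s. s < Q \<Longrightarrow> u (bv s) = 0"
  shows "u y = 0"
proof -
  obtain C where C: "\<And>y. u y = (\<Sum>t<Q. C t * K z (bv t) y)"
    using assms(1) unfolding spanned_def by blast
  have "C t = 0" if "t < Q" for t
    using assms(2) by (intro gram_inj[of C z t] that) (simp add: C)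
  then show ?thesis by (simp add: C)
qed

text \<open>A relation between the rows gives a combination of the points \<open>x + bv r\<close>
  that vanishes at all generators. Being spanned by them it vanishes everywhere, in particular at
  the points \<open>x + bv s\<close>; shifting back by \<open>x\<close> produces a relation in the
  Gram matrix of another fibre, which is excluded.\<close>

lemma D_nz:
  assumes x: "x \<in> Gam"
  shows "D x z \<noteq> 0"
proof
  assume "D x z = 0"
  then have "\<exists>v. (\<exists>r<Q. v r \<noteq> 0) \<and> (\<forall>s<Q. (\<Sum>r<Q. v r * N x z r s) = 0)"
    unfolding D_def by (rule dt_eq_0D) (rule exI, rule conjI, assumption, blast)
  then obtain v where v: "\<exists>r<Q. v r \<noteq> 0" "\<And>s. s < Q \<Longrightarrow> (\<Sum>r<Q. v r * N x z r s) = 0"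
    by blast
  define c where "c r = v r * ee (- \<theta> / 2 * of_nat r * fst x)" for r
  define u where "u y = (\<Sum>r<Q. c r * K z (x + bv r) y)" for y
  have "spanned z (K z (x + bv r))" for r
    using Gam_add[OF x latt_Gam[OF bv_latt]] unfolding Gam_def by blast
  then have "spanned z u" unfolding u_def by (intro spanned_sum) auto
  moreover have "u (bv s) = 0" if "s < Q" for s
    using v(2)[OF that] by (simp add: u_def c_def N_def mult_ac)
  ultimately have u0: "u y = 0" for y by (rule spanned_zero)
  have "c r * ee (- \<theta> / 2 * wedge x (bv r)) = 0" if r: "r < Q" for r
  proof (rule gram_inj[of "\<lambda>r. c r * ee (- \<theta> / 2 * wedge x (bv r))" "z + shift x" r, OF _ r])
    fix s assume "s < Q"
    have "0 = ee (- \<theta> / 2 * wedge x (bv s)) * u (x + bv s)" using u0 by simp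
    also have "\<dots> = (\<Sum>r<Q. c r * ee (- \<theta> / 2 * wedge x (bv r)) * K (z + shift x) (bv r) (bv s))"
      unfolding u_def sum_distrib_left
    proof (intro sum.cong refl)
      fix r
      have "ee (- \<theta> / 2 * wedge x (bv s)) * ee (\<theta> / 2 * (wedge x (bv s) - wedge x (bv r))) = ee (- \<theta> / 2 * wedge x (bv r))"
        unfolding ee_add[symmetric] by (rule arg_cong[of _ _ ee]) (simp add: algebra_simps)
      then show "ee (- \<theta> / 2 * wedge x (bv s)) * (c r * K z (x + bv r) (x + bv s)) =
         c r * ee (- \<theta> / 2 * wedge x (bv r)) * K (z + shift x) (bv r) (bv s)"
        unfolding K_shift' by (simp add: mult_ac)
    qed
    finally show "(\<Sum>r<Q. c r * ee (- \<theta> / 2 * wedge x (bv r)) * K (z + shift x) (bv r) (bv s)) = 0" ..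
  qed
  with v(1) show False by (auto simp: c_def)
qed

text \<open>The matrix expressing the points \<open>x + bv r\<close> through the generators has
  determinant D x / D 0 in the fibre at \<open>z + shift w\<close>. Transport by \<open>w\<close>
  multiplies it with the matrix of \<open>w\<close>, up to diagonal phases independent of z.\<close>

lemma D_mult:
  assumes w: "w \<in> Gam" and x: "x \<in> Gam"
  obtains c where "c \<noteq> 0" "\<And>z. D (w + x) z * D 0 (z + shift w) = c * D x (z + shift w) * D w z"
proof -
  define d where "d r = ee (- \<theta> / 2 * (of_nat r * fst w + wedge w (x + bv r)))" for r
  define d' where "d' t = ee (\<theta> / 2 * (wedge w (bv t) + of_nat t * fst w))" for t
  have "D (w + x) z * D 0 (z + shift w) = ((\<Prod>r<Q. d r) * (\<Prod>t<Q. d' t)) * D x (z + shift w) * D w z" for z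
  proof -
    have "\<exists>C. \<forall>y. K (z + shift w) (x + bv r) y = (\<Sum>t<Q. C t * K (z + shift w) (bv t) y)" for r
      using Gam_add[OF x latt_Gam[OF bv_latt]] unfolding Gam_def spanned_def by blast
    then obtain C where C: "\<And>r y. K (z + shift w) (x + bv r) y = (\<Sum>t<Q. C r t * K (z + shift w) (bv t) y)"
      by metis
    define C1 where "C1 r t = ee (- \<theta> / 2 * of_nat r * fst x) * C r t" for r t
    have "D x (z + shift w) = dt Q (\<lambda>r s. \<Sum>t<Q. C1 r t * N 0 (z + shift w) t s)"
      unfolding D_def by (rule dt_cong) (simp add: N_def C C1_def sum_distrib_left mult.assoc)
    then have 1: "D x (z + shift w) = dt Q C1 * D 0 (z + shift w)" by (simp add: dt_mult D_def)
    have "D (w + x) z = dt Q (\<lambda>r s. d r * (\<Sum>t<Q. C1 r t * (d' t * N w z t s)))"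
      unfolding D_def
    proof (rule dt_cong)
      fix r s
      have "N (w + x) z r s = (\<Sum>t<Q. ee (- \<theta> / 2 * of_nat r * fst (w + x)) *
         (C r t * ee (\<theta> / 2 * (wedge w (bv t) - wedge w (x + bv r))) * K z (w + bv t) (bv s)))"
        unfolding N_def add.assoc using shift_span[OF C, of r "bv s"] by (simp add: sum_distrib_left)
      also have "\<dots> = (\<Sum>t<Q. d r * (C1 r t * (d' t * N w z t s)))"
      proof (intro sum.cong refl)
        fix t
        have "ee (- \<theta> / 2 * of_nat r * fst (w + x)) * ee (\<theta> / 2 * (wedge w (bv t) - wedge w (x + bv r)))
          = d r * ee (- \<theta> / 2 * of_nat r * fst x) * d' t * ee (- \<theta> / 2 * of_nat t * fst w)"
          unfolding d_def d'_def ee_add[symmetric]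
          by (rule arg_cong[of _ _ ee]) (simp add: algebra_simps add_divide_distrib diff_divide_distrib)
        then show "ee (- \<theta> / 2 * of_nat r * fst (w + x)) *
         (C r t * ee (\<theta> / 2 * (wedge w (bv t) - wedge w (x + bv r))) * K z (w + bv t) (bv s)) =
          d r * (C1 r t * (d' t * N w z t s))"
          unfolding C1_def N_def by (simp add: mult_ac)
      qed
      finally show "N (w + x) z r s = d r * (\<Sum>t<Q. C1 r t * (d' t * N w z t s))"
        by (simp add: sum_distrib_left)
    qed
    then have "D (w + x) z = (\<Prod>r<Q. d r) * (dt Q C1 * ((\<Prod>t<Q. d' t) * D w z))"
      by (simp only: dt_scale_rows dt_mult D_def)
    then show ?thesis using 1 by simp
  qed
  moreover have "(\<Prod>r<Q. d r) * (\<Prod>t<Q. d' t) \<noteq> 0" by (simp add: d_def d'_def)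
  ultimately show ?thesis using that by blast
qed

section \<open>Periods of the determinants and their values at the lattice generators\<close>

lemma D_per1: "D x (z + (1, 0)) = D x z"
  and D_per2: "D x (z + (0, 1)) = D x z"
  unfolding D_def by (rule dt_cong, simp add: N_def K_per1 K_per2)+

text \<open>Multiplication by \<open>\<rho>(v\<^sub>2)\<close> permutes the generators cyclically.\<close>
definition W :: "real \<times> real \<Rightarrow> nat \<Rightarrow> nat \<Rightarrow> complex" where
  "W z r k = (if Suc r < Q then (if k = Suc r then 1 else 0) else (if k = 0 then ee (snd z) else 0))"

lemma W_unitary: "dt Q (W z) * dt Q (\<lambda>l s. cnj (W z s l)) = 1"
proof -
  have "dt Q (\<lambda>r s. \<Sum>l<Q. W z r l * cnj (W z s l)) = dt Q (\<lambda>i j. if i = j then 1 else 0)"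
  proof (rule dt_cong)
    fix r s assume rs: "r < Q" "s < Q"
    show "(\<Sum>l<Q. W z r l * cnj (W z s l)) = (if r = s then 1 else 0)"
    proof (cases "Suc r < Q")
      case True
      have "(\<Sum>l<Q. W z r l * cnj (W z s l)) = (\<Sum>l<Q. if l = Suc r then cnj (W z s l) else 0)"
        using True by (intro sum.cong refl) (auto simp: W_def)
      also have "\<dots> = cnj (W z s (Suc r))" using True by simp
      finally show ?thesis using True by (auto simp: W_def)
    next
      case False
      then have r: "r = Q - 1" using rs by simp
      have "(\<Sum>l<Q. W z r l * cnj (W z s l)) = (\<Sum>l<Q. if l = 0 then ee (snd z) * cnj (W z s l) else 0)"
        using False by (intro sum.cong refl) (auto simp: W_def)
      also have "\<dots> = ee (snd z) * cnj (W z s 0)" using Q by simp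
      finally show ?thesis using False rs r by (auto simp: W_def cnj_ee ee_minus)
    qed
  qed
  also have "\<dots> = 1" using dt_diag[of Q "\<lambda>_. 1"] by simp
  finally show ?thesis by (simp only: dt_mult)
qed

lemma sum_W:
  assumes "r < Q"
  shows "(\<Sum>k<Q. W z r k * f k) = (if Suc r < Q then f (Suc r) else ee (snd z) * f 0)"
proof (cases "Suc r < Q")
  case True
  have "(\<Sum>k<Q. W z r k * f k) = (\<Sum>k<Q. if k = Suc r then f k else 0)"
    using True by (intro sum.cong refl) (auto simp: W_def)
  then show ?thesis using True by simp
next
  case False
  have "(\<Sum>k<Q. W z r k * f k) = (\<Sum>k<Q. if k = 0 then ee (snd z) * f k else 0)"
    using False by (intro sum.cong refl) (auto simp: W_def)
  then show ?thesis using False Q by simp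
qed

lemma N_wrap1: "N x z Q s = ee (snd z) * N x z 0 s"
proof -
  have "- \<theta> / 2 * of_nat Q * fst x + (snd z + of_int P / 2 * fst x) = snd z"
    unfolding thQ[symmetric] by (simp add: algebra_simps)
  then have "ee (- \<theta> / 2 * of_nat Q * fst x) * ee (snd z + of_int P / 2 * fst x) = ee (snd z)"
    by (simp only: ee_add[symmetric])
  then show ?thesis
    by (simp only: N_def K_U2 mult.assoc[symmetric]) simp
qed

lemma N_wrap2: "N x z r Q = cnj (ee (snd z)) * N x z r 0"
proof -
  have "K z y (bv Q) = cnj (ee (snd z)) * K z y 0" for y
    using K_U2[of z 0 y] K_herm[of z y "bv Q"] K_herm[of z y 0]
    by (metis (no_types, lifting) add_0 complex_cnj_mult add.right_neutral fst_zero mult_zero_right)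
  then show ?thesis by (simp add: N_def mult_ac)
qed

lemma N_W: "r < Q \<Longrightarrow> N x z (Suc r) s = (\<Sum>k<Q. W z r k * N x z k s)"
  by (cases "Suc r = Q") (auto simp: sum_W N_wrap1)

text \<open>Shifting both arguments by \<open>bv 1\<close> raises both indices by one and moves z by
  (-\<theta>, 0). The raised indices are restored by \<open>W\<close> on the left and its adjoint on
  the right, whose determinants cancel.\<close>

lemma D_theta: "D x (z + (- \<theta>, 0)) = D x z"
proof -
  have *: "N x (z + (- \<theta>, 0)) r s = N x z (Suc r) (Suc s)" for r s
  proof -
    have "K z (bv 1 + (x + bv r)) (bv 1 + bv s) = ee (\<theta> / 2 * fst x) * K (z + (- \<theta>, 0)) (x + bv r) (bv s)"
      using K_shift[of z "bv 1" "x + bv r" "bv s"] by (simp add: wedge_def)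
    moreover have "bv 1 + (x + bv r) = x + bv (Suc r)" "bv 1 + bv s = bv (Suc s)"
      by (simp_all add: bv_def prod_eq_iff)
    moreover have "- \<theta> / 2 * of_nat (Suc r) * fst x + \<theta> / 2 * fst x = - \<theta> / 2 * of_nat r * fst x"
      by (simp add: algebra_simps add_divide_distrib)
    ultimately have "N x z (Suc r) (Suc s) = ee (- \<theta> / 2 * of_nat (Suc r) * fst x) * (ee (\<theta> / 2 * fst x) * K (z + (- \<theta>, 0)) (x + bv r) (bv s))"
      and "ee (- \<theta> / 2 * of_nat (Suc r) * fst x) * ee (\<theta> / 2 * fst x) = ee (- \<theta> / 2 * of_nat r * fst x)"
      by (simp_all only: N_def ee_add[symmetric])
    then show ?thesis by (simp only: N_def mult.assoc[symmetric])
  qed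
  have "D x (z + (- \<theta>, 0)) = dt Q (\<lambda>r s. \<Sum>k<Q. W z r k * (\<Sum>l<Q. N x z k l * cnj (W z s l)))"
    unfolding D_def
  proof (rule dt_cong)
    fix r s assume rs: "r < Q" "s < Q"
    have "N x z k (Suc s) = (\<Sum>l<Q. N x z k l * cnj (W z s l))" for k
    proof -
      have "(\<Sum>l<Q. N x z k l * cnj (W z s l)) = cnj (\<Sum>l<Q. W z s l * cnj (N x z k l))"
        by (simp add: mult.commute)
      also have "\<dots> = N x z k (Suc s)"
        unfolding sum_W[OF rs(2)] using rs by (cases "Suc s = Q") (auto simp: N_wrap2)
      finally show ?thesis by simp
    qed
    then show "N x (z + (- \<theta>, 0)) r s = (\<Sum>k<Q. W z r k * (\<Sum>l<Q. N x z k l * cnj (W z s l)))"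
      by (simp add: * N_W[OF rs(1)])
  qed
  also have "\<dots> = dt Q (W z) * (D x z * dt Q (\<lambda>l s. cnj (W z s l)))"
    by (simp only: dt_mult D_def)
  also have "\<dots> = D x z" using W_unitary[of z] by (simp add: mult_ac)
  finally show ?thesis .
qed

lemma D_per_Q: "D x (z + (1 / of_nat Q, 0)) = D x z"
proof -
  obtain u v where uv: "u * P + v * int Q = 1"
    using bezout_int[of P "int Q"] PQ by (auto simp: coprime_iff_gcd_eq_1)
  have "real_of_int (u * P + v * int Q) = 1" using uv by simp
  then have "real_of_int u * of_int P + of_int v * of_nat Q = 1" by simp
  then have e: "1 / of_nat Q = of_int u * \<theta> + of_int v" using Q by (simp add: \<theta>_def field_simps)
  have "z + (1 / of_nat Q, 0) = (z + of_int (- u) *\<^sub>R (- \<theta>, 0)) + of_int v *\<^sub>R (1, 0)"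
    by (simp add: prod_eq_iff e)
  then show ?thesis
    using periodic_of_int[of "D x" "(- \<theta>, 0)", OF D_theta] periodic_of_int[of "D x" "(1, 0)", OF D_per1]
    by metis
qed

text \<open>Each of the Q rows contributes one factor \<open>ee (fst z)\<close>; the exponent Q
  amounts to winding once along the period (1/Q, 0).\<close>

lemma D_U1: 
  obtains c where "c \<noteq> 0" "\<And>z. D (1, 0) z = c * (ee (of_nat Q * fst z) * D 0 z)"
proof -
  have "D (1, 0) z = (\<Prod>r<Q. ee (- \<theta> * of_nat r)) * (ee (of_nat Q * fst z) * D 0 z)" for z
  proof -
    have "D (1, 0) z = dt Q (\<lambda>r s. ee (- \<theta> * of_nat r) * (ee (fst z) * N 0 z r s))"
      unfolding D_def
    proof (rule dt_cong)
      fix r s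
      have "K z ((1, 0) + bv r) (bv s) = ee (fst z - \<theta> / 2 * of_nat r) * K z (bv r) (bv s)"
        using K_U1[of z "bv r" "bv s"] by (simp add: add.commute)
      moreover have "- \<theta> / 2 * of_nat r * fst (1 :: real, 0 :: real) + (fst z - \<theta> / 2 * of_nat r) = - \<theta> * of_nat r + fst z"
        by (simp add: field_simps)
      ultimately show "N (1, 0) z r s = ee (- \<theta> * of_nat r) * (ee (fst z) * N 0 z r s)"
        unfolding N_def by (simp add: ee_add[symmetric] mult.assoc[symmetric])
    qed
    then show ?thesis by (simp only: dt_scale_rows D_def) (simp add: ee_power mult_ac)
  qed
  moreover have "(\<Prod>r<Q. ee (- \<theta> * of_nat r)) \<noteq> 0" by simp
  ultimately show ?thesis using that by blast
qed

text \<open>The rows are permuted cyclically and only the one that wraps around carries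
  \<open>ee (snd z)\<close>, so here the exponent is 1, matching the period (0, 1).\<close>

lemma D_U2:
  obtains c where "c \<noteq> 0" "\<And>z. D (0, 1) z = c * (ee (snd z) * D 0 z)"
proof -
  have "D (0, 1) z = dt Q (W 0) * (ee (snd z) * D 0 z)" for z
  proof -
    have "D (0, 1) z = dt Q (\<lambda>r s. \<Sum>k<Q. W z r k * N 0 z k s)"
      unfolding D_def
    proof (rule dt_cong)
      fix r s assume r: "r < Q"
      have "(0, 1) + bv r = 0 + bv (Suc r)" by (simp add: bv_def prod_eq_iff)
      then have "N (0, 1) z r s = N 0 z (Suc r) s" by (simp add: N_def)
      then show "N (0, 1) z r s = (\<Sum>k<Q. W z r k * N 0 z k s)" by (simp add: N_W[OF r])
    qed
    then have 1: "D (0, 1) z = dt Q (W z) * D 0 z" by (simp only: dt_mult D_def)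
    have "dt Q (W z) = dt Q (\<lambda>r k. (if Suc r < Q then 1 else ee (snd z)) * W 0 r k)"
      by (rule dt_cong) (auto simp: W_def)
    also have "\<dots> = (\<Prod>r<Q. if Suc r < Q then 1 else ee (snd z)) * dt Q (W 0)"
      by (rule dt_scale_rows)
    also have "(\<Prod>r<Q. if Suc r < Q then 1 else ee (snd z)) = ee (snd z)"
    proof -
      obtain n where n: "Q = Suc n" using Q by (cases Q) auto
      have "(\<Prod>r<n. if Suc r < Suc n then 1 else ee (snd z)) = 1" by (intro prod.neutral) auto
      then show ?thesis by (simp add: n)
    qed
    finally show ?thesis using 1 by simp
  qed
  moreover have "dt Q (W 0) \<noteq> 0" using W_unitary[of 0] by auto
  ultimately show ?thesis using that by blast
qed

lemma D_cont2: "continuous_on UNIV (\<lambda>p. D (fst p) (snd p))"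
  unfolding D_def N_def by (intro continuous_on_dt continuous_intros K_cont')

lemma D_cont: "continuous_on UNIV (D x)"
  unfolding D_def N_def by (intro continuous_on_dt continuous_intros K_cont')

lemma D_0_nz: "D 0 z \<noteq> 0" by (intro D_nz latt_Gam zero_latt)

text \<open>The periods reduce z to the unit square, and the quotient is uniformly continuous for x
  in the unit ball and z in that square; this gives one radius for all z.\<close>

lemma D_near_0:
  obtains \<epsilon> where "\<epsilon> > 0" "\<And>x z. norm x < \<epsilon> \<Longrightarrow> norm (D x z / D 0 z - 1) < 1"
proof -
  define q where "q p = D (fst p) (snd p) / D 0 (snd p)" for p
  define S where "S = cball (0 :: real \<times> real) 1 \<times> cbox (0 :: real \<times> real) (1, 1)"
  have cq: "continuous_on S q" unfolding q_def
    by (intro continuous_intros continuous_on_subset[OF D_cont2] continuous_on_compose2[OF D_cont]) (auto simp: D_0_nz)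
  have "compact S" unfolding S_def by (intro compact_Times compact_cball compact_cbox)
  then have "uniformly_continuous_on S q" using cq by (rule compact_uniformly_continuous[rotated])
  from this[unfolded uniformly_continuous_on_def, rule_format, of 1]
  obtain d where d: "d > 0" "\<And>p p'. p \<in> S \<Longrightarrow> p' \<in> S \<Longrightarrow> dist p' p < d \<Longrightarrow> dist (q p') (q p) < 1"
    by auto
  show ?thesis
  proof (rule that)
    show "min d 1 > 0" using d by simp
    fix x z :: "real \<times> real" assume x: "norm x < min d 1"
    define w where "w = (frac (fst z), frac (snd z))"
    have z: "z = (w + of_int \<lfloor>fst z\<rfloor> *\<^sub>R (1, 0)) + of_int \<lfloor>snd z\<rfloor> *\<^sub>R (0, 1)"
      by (simp add: w_def prod_eq_iff frac_def)
    have per: "D y z = D y w" for y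
      using periodic_of_int[of "D y" "(1, 0)", OF D_per1] periodic_of_int[of "D y" "(0, 1)", OF D_per2] z by metis
    have "w \<in> cbox (0, 0) (1, 1)"
      unfolding w_def by (simp add: less_imp_le[OF frac_lt_1])
    then have w: "w \<in> cbox 0 (1, 1)" by (simp add: zero_prod_def)
    have "dist (x, w) (0, w) < d" using x by (simp add: dist_Pair_Pair)
    then have "dist (q (x, w)) (q (0, w)) < 1" using x w by (intro d(2)) (auto simp: S_def)
    then show "norm (D x z / D 0 z - 1) < 1"
      by (simp add: q_def per D_0_nz dist_norm)
  qed
qed

section \<open>Winding numbers as homomorphisms on \<open>Gam\<close>\<close>

definition wnd :: "real \<times> real \<Rightarrow> real \<times> real \<Rightarrow> int" where
  "wnd T x = (THE n. winds (D x) T n)"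

context
  fixes T :: "real \<times> real"
  assumes T: "\<And>x z. D x (z + T) = D x z"
begin

lemma wnd_eqI: "winds (D x) T n \<Longrightarrow> wnd T x = n"
  unfolding wnd_def using winds_unique by (intro the_equality) auto

lemma winds_wnd:
  assumes "x \<in> Gam"
  shows "winds (D x) T (wnd T x)"
proof -
  obtain n where "winds (D x) T n"
    using winds_exists[OF D_cont D_nz[OF assms] T] by blast
  then show ?thesis using wnd_eqI by simp
qed

text \<open>The translation of z in the product rule leaves winding numbers unchanged, so the
  failure of additivity is only the constant \<open>wnd T 0\<close>.\<close>

lemma wnd_add:
  assumes "w \<in> Gam" "x \<in> Gam"
  shows "wnd T (w + x) + wnd T 0 = wnd T w + wnd T x"
proof -
  obtain c where c: "c \<noteq> 0" "\<And>z. D (w + x) z * D 0 (z + shift w) = c * D x (z + shift w) * D w z"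
    using D_mult[OF assms] by blast
  have "winds (\<lambda>z. D (w + x) z * D 0 (z + shift w)) T (wnd T (w + x) + wnd T 0)"
    by (intro winds_mult winds_shift winds_wnd Gam_add assms latt_Gam zero_latt)
  then have "winds (\<lambda>z. c * D x (z + shift w) * D w z) T (wnd T (w + x) + wnd T 0)"
    unfolding c(2) .
  moreover have "winds (\<lambda>z. c * D x (z + shift w) * D w z) T (wnd T x + wnd T w)"
    by (intro winds_mult winds_shift winds_wnd winds_cmult assms c)
  ultimately have "wnd T (w + x) + wnd T 0 = wnd T x + wnd T w" by (rule winds_unique)
  then show ?thesis by simp
qed

lemma wnd_ee:
  assumes "x \<in> Gam" "c \<noteq> 0" "\<And>z. D x z = c * (ee (l z) * D 0 z)"
    "continuous_on UNIV l" "\<And>z. l (z + T) = l z + of_int n"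
  shows "wnd T x = wnd T 0 + n"
proof (rule wnd_eqI)
  have "winds (\<lambda>z. c * (ee (l z) * D 0 z)) T (n + wnd T 0)"
    by (intro winds_cmult winds_mult winds_ee winds_wnd assms latt_Gam zero_latt)
  moreover have "D x = (\<lambda>z. c * (ee (l z) * D 0 z))" by (rule ext) (rule assms(3))
  ultimately show "winds (D x) T (wnd T 0 + n)" by (simp add: add.commute)
qed

lemma wnd_near_0:
  obtains \<epsilon> where "\<epsilon> > 0" "\<And>x. x \<in> Gam \<Longrightarrow> norm x < \<epsilon> \<Longrightarrow> wnd T x = wnd T 0"
proof -
  obtain \<epsilon> where e: "\<epsilon> > 0" "\<And>x z. norm x < \<epsilon> \<Longrightarrow> norm (D x z / D 0 z - 1) < 1"
    using D_near_0 by blast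
  show ?thesis
  proof (rule that[OF e(1)])
    fix x assume x: "x \<in> Gam" "norm x < \<epsilon>"
    have "winds (\<lambda>z. D x z / D 0 z) T 0"
      by (intro winds_near_1 e(2) x continuous_intros D_cont) (simp_all add: D_0_nz T)
    then have "winds (\<lambda>z. (D x z / D 0 z) * D 0 z) T (0 + wnd T 0)"
      by (intro winds_mult winds_wnd latt_Gam zero_latt)
    then show "wnd T x = wnd T 0" by (intro wnd_eqI) (simp add: D_0_nz)
  qed
qed

text \<open>The normalised winding number is additive, locally zero and equals \<open>\<xi>\<close> on the lattice; by
  Dirichlet approximation it equals \<open>\<xi>\<close> on all of \<open>Gam\<close>.\<close>
lemma coordinate_Ints:
  assumes xi: "\<And>k m. of_int (wnd T (of_int k, of_int m) - wnd T 0) = \<xi> (of_int k, of_int m)"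
    and lin: "linear \<xi>" and bd: "\<And>x. \<bar>\<xi> x\<bar> \<le> norm x"
    and x: "x \<in> Gam"
  shows "\<xi> x \<in> \<int>"
proof -
  obtain \<epsilon> where e: "\<epsilon> > 0" "\<And>x. x \<in> Gam \<Longrightarrow> norm x < \<epsilon> \<Longrightarrow> wnd T x = wnd T 0"
    using wnd_near_0 by blast
  define w where "w x = wnd T x - wnd T 0" for x
  have wadd: "w (y + y') = w y + w y'" if "y \<in> Gam" "y' \<in> Gam" for y y'
    using wnd_add[OF that] by (simp add: w_def)
  have mult: "of_nat n *\<^sub>R x \<in> Gam \<and> w (of_nat n *\<^sub>R x) = int n * w x" for n
  proof (induction n)
    case 0
    then show ?case using latt_Gam[OF zero_latt] by (simp add: w_def)
  next
    case (Suc n)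
    have "of_nat (Suc n) *\<^sub>R x = of_nat n *\<^sub>R x + x" by (simp add: scaleR_left_distrib)
    then show ?case using Suc wadd[of "of_nat n *\<^sub>R x" x] Gam_add[of "of_nat n *\<^sub>R x" x] x by (simp add: algebra_simps)
  qed
  \<comment> \<open>Some multiple n x lies within 2/m of a lattice point l. The difference y is in
    \<open>Gam\<close> and small, so \<open>w y = 0\<close> and n \<open>w x\<close> equals \<xi> at
    l; hence n (\<xi> x - \<open>w x\<close>) = \<xi> y is at most 2/m in modulus, and n is at least
    1.\<close>
  have bound: "\<bar>\<xi> x - of_int (w x)\<bar> \<le> 2 / of_nat m" if m: "m > 0" "2 / of_nat m < \<epsilon>" for m :: nat
  proof -
    define \<theta>s where "\<theta>s i = (if i = 0 then fst x else snd x)" for i :: nat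
    obtain q p where qp: "0 < q" "\<And>i. i < 2 \<Longrightarrow> \<bar>of_int q * \<theta>s i - of_int (p i)\<bar> < 1 / of_nat m"
      using Dirichlet_approx_simult[OF m(1), of 2 \<theta>s] by metis
    define n where "n = nat q"
    have n: "n > 0" "real_of_int q = of_nat n" using qp(1) by (simp_all add: n_def)
    define l where "l = (real_of_int (p 0), real_of_int (p 1))"
    define y where "y = of_nat n *\<^sub>R x + (- l)"
    have "norm y \<le> \<bar>fst y\<bar> + \<bar>snd y\<bar>" using norm_Pair_le[of "fst y" "snd y"] by simp
    also have "\<dots> \<le> 1 / of_nat m + 1 / of_nat m"
      using qp(2)[of 0] qp(2)[of 1] by (simp add: y_def l_def \<theta>s_def n)
    finally have y: "norm y \<le> 2 / of_nat m" by simp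
    have lG: "l \<in> Gam" "- l \<in> Gam" by (auto intro!: latt_Gam simp: latt_def l_def)
    have "y \<in> Gam" unfolding y_def using mult lG by (intro Gam_add) auto
    then have "w y = 0" using e(2)[of y] y m(2) by (simp add: w_def)
    moreover have "w y = int n * w x + w (- l)" unfolding y_def using mult lG wadd by metis
    moreover have "real_of_int (w (- l)) = - \<xi> l"
      using xi[of "- p 0" "- p 1"] linear_neg[OF lin, of l] by (simp add: w_def l_def)
    ultimately have "real_of_int (int n * w x) = \<xi> l"
      by (metis add_eq_0_iff of_int_minus neg_equal_iff_equal)
    then have "of_nat n * \<xi> x - of_nat n * of_int (w x) = \<xi> y"
      by (simp add: y_def linear_diff[OF lin] linear_scale[OF lin])
    then have "\<bar>of_nat n * (\<xi> x - of_int (w x))\<bar> \<le> 2 / of_nat m"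
      using bd[of y] y by (simp add: right_diff_distrib)
    then have "of_nat n * \<bar>\<xi> x - of_int (w x)\<bar> \<le> 2 / of_nat m" by (simp add: abs_mult)
    moreover have "1 * \<bar>\<xi> x - of_int (w x)\<bar> \<le> of_nat n * \<bar>\<xi> x - of_int (w x)\<bar>"
      using n by (intro mult_right_mono) auto
    ultimately show ?thesis by simp
  qed
  have l0: "(\<lambda>m. 2 / of_nat m :: real) \<longlonglongrightarrow> 0" by (rule lim_const_over_n)
  have "eventually (\<lambda>m. 2 / of_nat m < \<epsilon>) sequentially"
    using order_tendstoD(2)[OF l0 e(1)] by simp
  then have "eventually (\<lambda>m. \<bar>\<xi> x - of_int (w x)\<bar> \<le> 2 / of_nat m) sequentially"
    using eventually_gt_at_top[of 0] by eventually_elim (rule bound)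
  then have "\<bar>\<xi> x - of_int (w x)\<bar> \<le> 0"
    by (rule tendsto_lowerbound[OF l0]) simp
  then show ?thesis by simp
qed

lemma wnd_lattice:
  "wnd T (of_int k, of_int m) - wnd T 0 = k * (wnd T (1, 0) - wnd T 0) + m * (wnd T (0, 1) - wnd T 0)"
proof -
  have G: "(of_int a, of_int b) \<in> Gam" for a b by (intro latt_Gam) (simp add: latt_def)
  have add: "wnd T (of_int (a + a'), of_int (b + b')) - wnd T 0 = 
     (wnd T (of_int a, of_int b) - wnd T 0) + (wnd T (of_int a', of_int b') - wnd T 0)" for a a' b b'
    using wnd_add[OF G[of a b] G[of a' b']] by simp
  have lin: "f n = n * f 1" if "\<And>a b. f (a + b) = f a + f b" for f :: "int \<Rightarrow> int" and n
  proof (induction n rule: int_induct[where k = 0])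
    case base show ?case using that[of 0 0] by simp
  next
    case (step1 i) then show ?case using that[of i 1] by (simp add: distrib_right)
  next
    case (step2 i) then show ?case using that[of "i - 1" 1] by (simp add: left_diff_distrib)
  qed
  have "wnd T (of_int (a + b), 0) - wnd T 0 = (wnd T (of_int a, 0) - wnd T 0) + (wnd T (of_int b, 0) - wnd T 0)" for a b
    using add[where a = a and a' = b and b = 0 and b' = 0] by simp
  from lin[of "\<lambda>k. wnd T (of_int k, 0) - wnd T 0" k, OF this]
  have 1: "wnd T (of_int k, 0) - wnd T 0 = k * (wnd T (1, 0) - wnd T 0)" by simp
  have "wnd T (0, of_int (a + b)) - wnd T 0 = (wnd T (0, of_int a) - wnd T 0) + (wnd T (0, of_int b) - wnd T 0)" for a b
    using add[where a = 0 and a' = 0 and b = a and b' = b] by simp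
  from lin[of "\<lambda>k. wnd T (0, of_int k) - wnd T 0" m, OF this]
  have 2: "wnd T (0, of_int m) - wnd T 0 = m * (wnd T (0, 1) - wnd T 0)" by simp
  have "wnd T (of_int k, of_int m) - wnd T 0 = (wnd T (of_int k, 0) - wnd T 0) + (wnd T (0, of_int m) - wnd T 0)"
    using add[where a = k and a' = 0 and b = 0 and b' = m] by simp
  then show ?thesis using 1 2 by linarith
qed

end

text \<open>The two periods separate the coordinates: along (1/Q, 0) the first generator winds once
  and the second not at all, along (0, 1) the roles are exchanged.\<close>

theorem Gam_eq_latt: "x \<in> Gam \<Longrightarrow> x \<in> latt"
proof -
  assume x: "x \<in> Gam"
  have G: "(1, 0) \<in> Gam" "(0, 1) \<in> Gam" by (rule latt_Gam, simp add: latt_def)+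
  obtain c1 where c1: "c1 \<noteq> 0" "\<And>z. D (1, 0) z = c1 * (ee (of_nat Q * fst z) * D 0 z)" using D_U1 by blast
  obtain c2 where c2: "c2 \<noteq> 0" "\<And>z. D (0, 1) z = c2 * (ee (snd z) * D 0 z)" using D_U2 by blast
  let ?T1 = "(1 / of_nat Q, 0) :: real \<times> real" and ?T2 = "(0, 1) :: real \<times> real"
  have 11: "wnd ?T1 (1, 0) = wnd ?T1 0 + 1"
    by (rule wnd_ee[OF D_per_Q G(1) c1]) (use Q in \<open>auto intro!: continuous_intros simp: algebra_simps\<close>)
  have 12: "wnd ?T1 (0, 1) = wnd ?T1 0 + 0"
    by (rule wnd_ee[OF D_per_Q G(2) c2]) (auto intro!: continuous_intros)
  have 21: "wnd ?T2 (1, 0) = wnd ?T2 0 + 0"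
    by (rule wnd_ee[OF D_per2 G(1) c1]) (auto intro!: continuous_intros)
  have 22: "wnd ?T2 (0, 1) = wnd ?T2 0 + 1"
    by (rule wnd_ee[OF D_per2 G(2) c2]) (auto intro!: continuous_intros)
  have f: "\<bar>fst y\<bar> \<le> norm y" and g: "\<bar>snd y\<bar> \<le> norm y" for y :: "real \<times> real"
    using norm_fst_le[of "fst y" "snd y"] norm_snd_le[of "snd y" "fst y"] by simp_all
  have "fst x \<in> \<int>"
    by (rule coordinate_Ints[OF D_per_Q _ _ f x]) (simp_all add: wnd_lattice[OF D_per_Q] 11 12 linear_fst)
  moreover have "snd x \<in> \<int>"
    by (rule coordinate_Ints[OF D_per2 _ _ g x]) (simp_all add: wnd_lattice[OF D_per2] 21 22 linear_snd)
  ultimately show ?thesis by (simp add: latt_def)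
qed

text \<open>The squared distance of the fibre of \<open>\<psi> x\<close> from the span of the generators is continuous, and its
  integral is at most the squared \<open>L\<^sup>2\<close> distance of \<open>\<psi> x\<close> from the span.\<close>
theorem Gam_closure:
  assumes appr: "\<And>\<epsilon>. \<epsilon> > 0 \<Longrightarrow> \<exists>h. set h \<subseteq> UNIV \<times> latt \<and> Re (form I ((1, x) # h) ((1, x) # h)) < \<epsilon>"
  shows "x \<in> Gam"
proof -
  define G where "G z i j = K z (bv i) (bv j)" for z i j
  have Gnz: "dt Q (G z) \<noteq> 0" for z
    using D_0_nz[of z] unfolding D_def by (subst dt_cong[of Q _ "N 0 z"]) (auto simp: G_def N_def)
  \<comment> \<open>Coefficients of the projection of the fibre of \<open>x\<close> onto the span of
    the generators, by Cramer's rule so that they are continuous in z.\<close>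
  define C where "C t z = dt Q (\<lambda>i j. if i = t then K z x (bv j) else G z i j) / dt Q (G z)" for t z
  have cC: "continuous_on UNIV (C t)" for t
    unfolding C_def
  proof (intro continuous_intros continuous_on_dt ballI Gnz)
    show "continuous_on UNIV (\<lambda>z. if i = t then K z x (bv j) else G z i j)" for i j
      unfolding G_def by (cases "i = t") (auto intro!: K_cont' continuous_intros)
    show "continuous_on UNIV (\<lambda>z. G z i j)" for i j
      unfolding G_def by (intro K_cont' continuous_intros)
  qed
  have C: "(\<Sum>t<Q. C t z * K z (bv t) (bv j)) = K z x (bv j)" if "j < Q" for z j
    using dt_cramer[OF Gnz that, of "\<lambda>j. K z x (bv j)" z] by (simp add: C_def G_def)
  define res where "res z = (1, x) # map (\<lambda>t. (- C t z, bv t)) [0..<Q]" for z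
  have ev_res: "ev u (res z) = u x - (\<Sum>t<Q. C t z * u (bv t))" for u z
    by (simp add: res_def ev_map sum_negf)
  have orth: "form (K z) (res z) (map (\<lambda>t. (c t, bv t)) [0..<Q]) = 0" for z c
    unfolding form_ev' by (simp add: ev_res ev_map C)
  define \<rho> where "\<rho> z = Re (K z x x - (\<Sum>t<Q. C t z * K z (bv t) x))" for z
  have c\<rho>: "continuous_on UNIV \<rho>" unfolding \<rho>_def
    by (intro continuous_intros K_cont' cC)
  have rho_form: "\<rho> z = Re (form (K z) (res z) (res z))" for z
  proof -
    have "res z = [(1, x)] @ map (\<lambda>t. (- C t z, bv t)) [0..<Q]" by (simp add: res_def)
    from arg_cong[OF this, of "form (K z) (res z)"]
    have "form (K z) (res z) (res z) = form (K z) (res z) [(1, x)]"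
      unfolding form_append2 orth by simp
    then show ?thesis by (simp only: \<rho>_def) (simp add: form_ev' ev_res)
  qed
  have rho_nonneg: "\<rho> z \<ge> 0" for z using psd_K[of z] unfolding rho_form psd_def by blast
  have rho_le: "\<rho> z \<le> Re (form (K z) ((1, x) # h) ((1, x) # h))" if h: "set h \<subseteq> UNIV \<times> latt" for z h
  proof -
    \<comment> \<open>Within a fibre \<open>h\<close> is itself a combination of generators. So the
      combination with head (1, x) equals the residual plus the generator part \<open>B\<close>,
      which are orthogonal, and Pythagoras applies.\<close>
    define B where "B = map (\<lambda>t. (C t z + ev (E t z) h, bv t)) [0..<Q]"
    define L where "L = res z @ B"
    have evh: "ev (\<lambda>x. K z x y) h = (\<Sum>t<Q. ev (E t z) h * K z (bv t) y)" for y
    proof -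
      have "ev (\<lambda>x. K z x y) h = ev (\<lambda>x. \<Sum>t<Q. K z (bv t) y * E t z x) h"
        using h by (intro ev_cong) (auto simp: K_lattice mult.commute)
      then show ?thesis by (simp add: ev_sum ev_cmult mult.commute)
    qed
    have same: "ev (\<lambda>x. K z x y) ((1, x) # h) = ev (\<lambda>x. K z x y) L" for y
      by (simp add: L_def B_def ev_res ev_map evh distrib_right sum.distrib)
    have f1: "form (K z) ((1, x) # h) g = form (K z) L g" for g
      unfolding form_ev' same ..
    have H: "form (K z) f g = cnj (form (K z) g f)" for f g by (rule form_herm, rule K_herm)
    have "form (K z) ((1, x) # h) ((1, x) # h) = cnj (form (K z) ((1, x) # h) L)"
      by (subst f1, subst H) simp
    also have "\<dots> = cnj (form (K z) L L)" by (simp only: f1)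
    finally have "Re (form (K z) ((1, x) # h) ((1, x) # h)) = Re (form (K z) L L)" by simp
    also have "form (K z) L L = form (K z) (res z) (res z) + form (K z) B B"
    proof -
      have o: "form (K z) (res z) B = 0" unfolding B_def by (rule orth)
      then have "form (K z) B (res z) = 0" using H[of B "res z"] by simp
      with o show ?thesis by (simp add: L_def)
    qed
    finally have "Re (form (K z) ((1, x) # h) ((1, x) # h)) = \<rho> z + Re (form (K z) B B)"
      by (simp add: rho_form)
    moreover have "Re (form (K z) B B) \<ge> 0" using psd_K[of z] unfolding psd_def by blast
    ultimately show ?thesis by simp
  qed
  have int_le: "integral (cbox (0, 0) (1, 1)) \<rho> \<le> Re (form I ((1, x) # h) ((1, x) # h))" if h: "set h \<subseteq> UNIV \<times> latt" for h
  proof -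
    have cK: "continuous_on UNIV (\<lambda>z. K z u v)" for u v by (intro K_cont' continuous_intros)
    have hi: "((\<lambda>z. K z u v) has_integral I u v) (cbox (0, 0) (1, 1))" for u v
      using integrable_integral[OF integrable_continuous[OF continuous_on_subset[OF cK subset_UNIV]]] K_int by metis
    have hcnj: "((\<lambda>z. cnj (u z)) has_integral cnj v) S" if "(u has_integral v) S" for u :: "real \<times> real \<Rightarrow> complex" and v S
      using has_integral_cnj[of u v S] that by (simp add: comp_def)
    have hi2: "((\<lambda>z. ev (u z) k) has_integral ev v k) (cbox (0, 0) (1, 1))"
      if "\<And>x. ((\<lambda>z. u z x) has_integral v x) (cbox (0, 0) (1, 1))"
      for u :: "real \<times> real \<Rightarrow> real \<times> real \<Rightarrow> complex" and v k
    proof (induction k)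
      case (Cons a k)
      obtain c y where a: "a = (c, y)" by (cases a)
      show ?case using Cons unfolding a ev_Cons
        by (intro has_integral_add has_integral_mult_right that) auto
    qed auto
    have "((\<lambda>z. form (K z) ((1, x) # h) ((1, x) # h)) has_integral form I ((1, x) # h) ((1, x) # h)) (cbox (0, 0) (1, 1))"
      unfolding form_ev by (intro hi2 hcnj hi)
    then have "((\<lambda>z. Re (form (K z) ((1, x) # h) ((1, x) # h))) has_integral Re (form I ((1, x) # h) ((1, x) # h))) (cbox (0, 0) (1, 1))"
      by (rule has_integral_Re)
    then show ?thesis
      by (rule has_integral_le[OF integrable_integral[OF integrable_continuous[OF continuous_on_subset[OF c\<rho> subset_UNIV]]]])
         (rule rho_le[OF h])
  qed
  have "integral (cbox (0, 0) (1, 1)) \<rho> \<le> 0"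
  proof (rule field_le_epsilon)
    fix e :: real assume "e > 0"
    then obtain h where "set h \<subseteq> UNIV \<times> latt" "Re (form I ((1, x) # h) ((1, x) # h)) < e" using appr by blast
    then show "integral (cbox (0, 0) (1, 1)) \<rho> \<le> 0 + e" using int_le[of h] by simp
  qed
  moreover have "integral (cbox (0, 0) (1, 1)) \<rho> \<ge> 0"
    by (intro Henstock_Kurzweil_Integration.integral_nonneg integrable_continuous continuous_on_subset[OF c\<rho>] rho_nonneg) auto
  ultimately have i0: "integral (cbox (0, 0) (1, 1)) \<rho> = 0" by simp
  have ne: "box (0, 0) (1, 1 :: real) \<noteq> ({} :: (real \<times> real) set)"
  proof -
    have "((1/2, 1/2) :: real \<times> real) \<in> box (0, 0) (1, 1)" by (simp add: box_prod)
    then show ?thesis by blast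
  qed
  have rho0: "\<rho> z = 0" if "z \<in> cbox (0, 0) (1, 1)" for z
    using integral_cbox_eq_0_iff[OF continuous_on_subset[OF c\<rho> subset_UNIV] ne rho_nonneg] i0 that by blast
  have sp: "spanned z (K z x)" if "z \<in> cbox (0, 0) (1, 1)" for z
  proof -
    \<comment> \<open>A residual of length 0 is orthogonal to all points, and orthogonality to the
      point y is exactly the spanning relation at y.\<close>
    have "form (K z) (res z) g = 0" for g
      using psd_null[OF psd_K[of z], of "res z" g] rho0[OF that] rho_form[of z] by simp
    then have "form (K z) (res z) [(1, y)] = 0" for y .
    then have "K z x y = (\<Sum>t<Q. C t z * K z (bv t) y)" for y
      by (simp add: form_ev' ev_res)
    then show ?thesis unfolding spanned_def by (intro exI[of _ "\<lambda>t. C t z"]) blast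
  qed
  have "spanned z (K z x)" for z
  proof -
    define w where "w = (frac (fst z), frac (snd z))"
    have z: "z = (w + of_int \<lfloor>fst z\<rfloor> *\<^sub>R (1, 0)) + of_int \<lfloor>snd z\<rfloor> *\<^sub>R (0, 1)"
      by (simp add: w_def prod_eq_iff frac_def)
    have "K (z + (1, 0)) = K z" "K (z + (0, 1)) = K z" for z
      by (intro ext K_per1 K_per2)+
    then have "K z = K w"
      using periodic_of_int[of K "(1, 0)"] periodic_of_int[of K "(0, 1)"] z by metis
    moreover have "w \<in> cbox (0, 0) (1, 1)"
      unfolding w_def by (simp add: less_imp_le[OF frac_lt_1])
    ultimately show ?thesis using sp[of w] unfolding spanned_def by simp
  qed
  then show ?thesis unfolding Gam_def by blast
qed

end

section \<open>Time-frequency shifts\<close>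

lemma L2_measurable [measurable_dest]: "f \<in> L2 \<Longrightarrow> f \<in> borel_measurable lborel"
  by (simp add: L2_def)

lemma L2_integrable_sq: "f \<in> L2 \<Longrightarrow> integrable lborel (\<lambda>x. (norm (f x))\<^sup>2)"
  by (simp add: L2_def)

lemma L2_cmult: "f \<in> L2 \<Longrightarrow> (\<lambda>x. c * f x) \<in> L2"
  by (auto simp: L2_def norm_mult power_mult_distrib)

lemma sq_norm_add_le: "(norm (a + b))\<^sup>2 \<le> 2 * (norm a)\<^sup>2 + 2 * (norm (b :: complex))\<^sup>2"
proof -
  have "(norm (a + b))\<^sup>2 \<le> (norm a + norm b)\<^sup>2" by (intro power_mono norm_triangle_ineq) auto
  also have "\<dots> \<le> 2 * (norm a)\<^sup>2 + 2 * (norm b)\<^sup>2"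
    using sum_squares_bound[of "norm a" "norm b"] by (simp add: power2_sum)
  finally show ?thesis .
qed

lemma L2_add:
  assumes "f \<in> L2" "g \<in> L2"
  shows "(\<lambda>x. f x + g x) \<in> L2"
proof -
  have [measurable]: "f \<in> borel_measurable lborel" "g \<in> borel_measurable lborel"
    using assms by (auto simp: L2_def)
  have "integrable lborel (\<lambda>x. (norm (f x + g x))\<^sup>2)"
  proof (rule Bochner_Integration.integrable_bound)
    show "integrable lborel (\<lambda>x. 2 * (norm (f x))\<^sup>2 + 2 * (norm (g x))\<^sup>2)"
      using assms by (auto simp: L2_def)
    show "AE x in lborel. norm ((norm (f x + g x))\<^sup>2) \<le> norm (2 * (norm (f x))\<^sup>2 + 2 * (norm (g x))\<^sup>2)"
      using sq_norm_add_le by (auto intro!: AE_I2)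
  qed measurable
  then show ?thesis by (simp add: L2_def)
qed

lemma L2_diff: "f \<in> L2 \<Longrightarrow> g \<in> L2 \<Longrightarrow> (\<lambda>x. f x - g x) \<in> L2"
  using L2_add[OF _ L2_cmult[of g "-1"]] by simp

lemma L2_zero: "(\<lambda>x. 0) \<in> L2" by (simp add: L2_def)

lemma L2_sum: "finite S \<Longrightarrow> (\<And>i. i \<in> S \<Longrightarrow> f i \<in> L2) \<Longrightarrow> (\<lambda>x. \<Sum>i\<in>S. f i x) \<in> L2"
  by (induction S rule: finite_induct) (auto simp: L2_zero L2_add)

lemma borel_measurable_cnj [measurable]: "cnj \<in> borel_measurable borel"
  by (intro borel_measurable_continuous_onI continuous_intros)

lemma ee_cnj: "ee a * u * cnj (ee a * v) = u * cnj v"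
proof -
  have "ee a * u * cnj (ee a * v) = (ee a * ee (- a)) * (u * cnj v)"
    by (simp only: complex_cnj_mult cnj_ee mult_ac)
  then show ?thesis by (simp add: ee_minus)
qed

lemma L2_integrable_prod:
  assumes "f \<in> L2" "g \<in> L2"
  shows "integrable lborel (\<lambda>x. f x * cnj (g x))"
proof (rule Bochner_Integration.integrable_bound)
  have [measurable]: "f \<in> borel_measurable lborel" "g \<in> borel_measurable lborel"
    using assms by (auto simp: L2_def)
  show "(\<lambda>x. f x * cnj (g x)) \<in> borel_measurable lborel" by measurable
  show "integrable lborel (\<lambda>x. (norm (f x))\<^sup>2 + (norm (g x))\<^sup>2)"
    using assms by (auto simp: L2_def)
  have "norm (f x * cnj (g x)) \<le> (norm (f x))\<^sup>2 + (norm (g x))\<^sup>2" for x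
    using sum_squares_bound[of "norm (f x)" "norm (g x)"] zero_le_power2[of "norm (f x)"] zero_le_power2[of "norm (g x)"]
    unfolding norm_mult complex_mod_cnj by linarith
  then show "AE x in lborel. norm (f x * cnj (g x)) \<le> norm ((norm (f x))\<^sup>2 + (norm (g x))\<^sup>2)"
    by (auto intro!: AE_I2)
qed

definition ip :: "(real \<Rightarrow> complex) \<Rightarrow> (real \<Rightarrow> complex) \<Rightarrow> complex" where
  "ip f g = (\<integral>x. f x * cnj (g x) \<partial>lborel)"

lemma ip_add1: "f \<in> L2 \<Longrightarrow> g \<in> L2 \<Longrightarrow> h \<in> L2 \<Longrightarrow> ip (\<lambda>x. f x + g x) h = ip f h + ip g h"
  unfolding ip_def distrib_right by (intro Bochner_Integration.integral_add L2_integrable_prod)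

lemma ip_diff1: "f \<in> L2 \<Longrightarrow> g \<in> L2 \<Longrightarrow> h \<in> L2 \<Longrightarrow> ip (\<lambda>x. f x - g x) h = ip f h - ip g h"
  unfolding ip_def left_diff_distrib by (intro Bochner_Integration.integral_diff L2_integrable_prod)

lemma ip_cnj: "cnj (ip f g) = ip g f"
  unfolding ip_def by (simp add: Bochner_Integration.integral_cnj[symmetric] mult.commute del: Bochner_Integration.integral_cnj)

lemma ip_cmult1: "ip (\<lambda>x. c * f x) g = c * ip f g"
  unfolding ip_def by (simp add: mult.assoc)

lemma ip_diff2: "f \<in> L2 \<Longrightarrow> g \<in> L2 \<Longrightarrow> h \<in> L2 \<Longrightarrow> ip h (\<lambda>x. f x - g x) = ip h f - ip h g"
  using ip_diff1[of f g h] by (metis complex_cnj_diff ip_cnj)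

lemma L2_norm_nonneg: "0 \<le> L2_norm f"
  by (simp add: L2_norm_def)

lemma L2_norm_sq: "(L2_norm f)\<^sup>2 = (\<integral>x. (norm (f x))\<^sup>2 \<partial>lborel)"
  by (simp add: L2_norm_def)

lemma ip_self: "ip f f = of_real ((L2_norm f)\<^sup>2)"
  unfolding L2_norm_sq ip_def integral_complex_of_real[symmetric]
  by (simp only: complex_norm_square)

lemma ip_cauchy_schwarz:
  assumes "f \<in> L2" "g \<in> L2"
  shows "norm (ip f g) \<le> L2_norm f * L2_norm g"
    and "(\<integral>x. norm (f x) * norm (g x) \<partial>lborel) \<le> L2_norm f * L2_norm g"
proof -
  have [measurable]: "f \<in> borel_measurable lborel" "g \<in> borel_measurable lborel"
    using assms by (auto simp: L2_def)
  let ?J = "\<integral>x. norm (f x) * norm (g x) \<partial>lborel"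
  have int: "integrable lborel (\<lambda>x. norm (f x) * norm (g x))"
    using integrable_norm[OF L2_integrable_prod[OF assms]] by (simp add: norm_mult)
  have J0: "0 \<le> ?J" by (intro Bochner_Integration.integral_nonneg) auto
  have "(ennreal ?J)\<^sup>2 \<le> ennreal ((L2_norm f)\<^sup>2) * ennreal ((L2_norm g)\<^sup>2)"
  proof -
    have "ennreal ?J = (\<integral>\<^sup>+x. ennreal (norm (f x)) * ennreal (norm (g x)) \<partial>lborel)"
      by (subst nn_integral_eq_integral[OF int, symmetric]) (auto simp: ennreal_mult)
    moreover have "ennreal ((L2_norm u)\<^sup>2) = (\<integral>\<^sup>+x. ennreal (norm (u x)) ^ 2 \<partial>lborel)" if "u \<in> L2" for u
      unfolding L2_norm_sq
      by (subst nn_integral_eq_integral[symmetric]) (use that in \<open>auto simp: L2_def ennreal_power\<close>)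
    ultimately show ?thesis using assms
      by (simp add: Cauchy_Schwarz_nn_integral)
  qed
  then have "?J\<^sup>2 \<le> (L2_norm f * L2_norm g)\<^sup>2"
    using J0 by (simp add: ennreal_power ennreal_mult[symmetric] power_mult_distrib del: ennreal_le_iff2)
  then show 1: "?J \<le> L2_norm f * L2_norm g"
    by (rule power2_le_imp_le) (simp add: L2_norm_nonneg)
  have "norm (ip f g) \<le> (\<integral>x. norm (f x * cnj (g x)) \<partial>lborel)"
    unfolding ip_def by (rule integral_norm_bound)
  with 1 show "norm (ip f g) \<le> L2_norm f * L2_norm g" by (simp add: norm_mult)
qed

text \<open>The half phase makes the cocycle of composition the antisymmetric
  \<open>sigma p q / 2\<close>, so that \<open>rho (- p)\<close> is the inverse and the adjoint of
  \<open>rho p\<close>.\<close>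

definition rho :: "real \<times> real \<Rightarrow> (real \<Rightarrow> complex) \<Rightarrow> real \<Rightarrow> complex" where
  "rho p f = (\<lambda>x. ee (snd p * x - fst p * snd p / 2) * f (x - fst p))"

definition sigma :: "real \<times> real \<Rightarrow> real \<times> real \<Rightarrow> real" where
  "sigma p q = fst q * snd p - fst p * snd q"

lemma tf_shift_rho: "tf_shift p f = (\<lambda>x. ee (fst p * snd p / 2) * rho p f x)"
  by (auto simp: tf_shift_def modulation_def translation_def rho_def ee_add[symmetric] mult.assoc[symmetric])
     (simp add: ee_def mult_ac)

lemma rho_tf_shift: "rho p f = (\<lambda>x. ee (- (fst p * snd p / 2)) * tf_shift p f x)"
  by (simp add: tf_shift_rho mult.assoc[symmetric] ee_add[symmetric])

lemma rho_rho: "rho p (rho q f) = (\<lambda>x. ee (sigma p q / 2) * rho (p + q) f x)"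
proof
  fix x
  have "ee (snd p * x - fst p * snd p / 2) * ee (snd q * (x - fst p) - fst q * snd q / 2) = 
     ee (sigma p q / 2) * ee (snd (p + q) * x - fst (p + q) * snd (p + q) / 2)"
    unfolding ee_add[symmetric] sigma_def
    by (rule arg_cong[of _ _ ee]) (simp add: field_simps)
  then show "rho p (rho q f) x = ee (sigma p q / 2) * rho (p + q) f x"
    by (simp add: rho_def mult.assoc[symmetric] diff_diff_eq)
qed

lemma rho_0 [simp]: "rho 0 f = f" by (simp add: rho_def)

lemma integral_shift: "(\<integral>x. h (x - u) \<partial>lborel) = (\<integral>x. h x \<partial>lborel :: complex)" for h :: "real \<Rightarrow> complex"
  using lborel_integral_real_affine[of 1 h "- u"] by simp

lemma rho_L2:
  assumes "f \<in> L2"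
  shows "rho p f \<in> L2"
proof -
  have [measurable]: "f \<in> borel_measurable borel" using assms by (auto simp: L2_def)
  have "(\<lambda>x. ee (snd p * x - fst p * snd p / 2) * f (x - fst p)) \<in> borel_measurable lborel"
    by measurable
  moreover have "integrable lborel (\<lambda>x. (norm (f (x - fst p)))\<^sup>2)"
    using lborel_integrable_real_affine[OF L2_integrable_sq[OF assms], of 1 "- fst p"] by simp
  ultimately show ?thesis by (simp add: L2_def rho_def norm_mult)
qed

lemma ip_rho: "ip (rho p f) (rho p g) = ip f g"
proof -
  have "ip (rho p f) (rho p g) = (\<integral>x. f (x - fst p) * cnj (g (x - fst p)) \<partial>lborel)"
    unfolding ip_def rho_def by (simp only: ee_cnj)
  also have "\<dots> = ip f g" unfolding ip_def by (rule integral_shift)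
  finally show ?thesis .
qed

lemma L2_norm_rho: "L2_norm (rho p f) = L2_norm f"
proof -
  have "complex_of_real ((L2_norm (rho p f))\<^sup>2) = of_real ((L2_norm f)\<^sup>2)"
    using ip_rho[of p f f] by (simp only: ip_self)
  then have "(L2_norm (rho p f))\<^sup>2 = (L2_norm f)\<^sup>2" by (simp only: of_real_eq_iff)
  then show ?thesis by (simp add: L2_norm_nonneg)
qed

lemma L2_norm_cmult: "L2_norm (\<lambda>x. c * f x) = norm c * L2_norm f"
  by (simp add: L2_norm_def norm_mult power_mult_distrib real_sqrt_mult)

lemma ip_rho_adjoint: "ip (rho p f) g = ip f (rho (- p) g)"
proof -
  have "rho p (rho (- p) g) = g" by (simp add: rho_rho sigma_def)
  then show ?thesis using ip_rho[of p f "rho (- p) g"] by simp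
qed

section \<open>Coordinates with respect to a lattice basis\<close>

lemma sigma_bilinear:
  "sigma (a *\<^sub>R p + b *\<^sub>R q) (c *\<^sub>R p + d *\<^sub>R q) = sigma p q * (a * d - b * c)"
  by (simp add: sigma_def algebra_simps)

lemma sigma_simps: "sigma (- p) q = - sigma p q" "sigma p (- q) = - sigma p q" "sigma p p = 0"
  "sigma q p = - sigma p q"
  by (simp_all add: sigma_def)

definition pt :: "real \<times> real \<Rightarrow> real \<times> real \<Rightarrow> real \<times> real \<Rightarrow> real \<times> real" where
  "pt v1 v2 x = fst x *\<^sub>R v1 + snd x *\<^sub>R v2"

lemma pt_diff: "pt v1 v2 (x - y) = pt v1 v2 x - pt v1 v2 y"
  by (simp add: pt_def algebra_simps)
lemma pt_0 [simp]: "pt v1 v2 0 = 0" by (simp add: pt_def)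

lemma sigma_pt: "sigma (pt v1 v2 x) (pt v1 v2 y) = sigma v1 v2 * wedge x y"
  unfolding pt_def sigma_bilinear wedge_def by simp

lemma pt_inj: 
  assumes "sigma v1 v2 \<noteq> 0" 
  shows "inj (pt v1 v2)"
proof (rule injI)
  fix x y assume e: "pt v1 v2 x = pt v1 v2 y"
  have "sigma v1 v2 * wedge (x - y) w = 0" for w
    unfolding sigma_pt[symmetric] pt_diff e by (simp add: sigma_def)
  then have "wedge (x - y) (1, 0) = 0" "wedge (x - y) (0, 1) = 0" using assms by auto
  then show "x = y" by (simp add: wedge_def prod_eq_iff)
qed

lemma pt_surj:
  assumes "sigma v1 v2 \<noteq> 0" 
  obtains x where "p = pt v1 v2 x"
proof -
  let ?x = "(sigma p v2 / sigma v1 v2, sigma v1 p / sigma v1 v2)"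
  have "sigma v1 v2 *\<^sub>R p = sigma p v2 *\<^sub>R v1 + sigma v1 p *\<^sub>R v2"
    by (simp add: sigma_def prod_eq_iff algebra_simps)
  then have "p = (1 / sigma v1 v2) *\<^sub>R (sigma p v2 *\<^sub>R v1 + sigma v1 p *\<^sub>R v2)"
    using assms by (metis divide_inverse_commute mult.commute right_inverse scaleR_one scaleR_scaleR mult.right_neutral inverse_eq_divide)
  then have "p = pt v1 v2 ?x" by (simp add: pt_def scaleR_add_right)
  then show ?thesis by (rule that)
qed

definition psi :: "(real \<Rightarrow> complex) \<Rightarrow> real \<times> real \<Rightarrow> real \<times> real \<Rightarrow> real \<times> real \<Rightarrow> real \<Rightarrow> complex" where
  "psi \<phi> v1 v2 x = rho (pt v1 v2 x) \<phi>"

lemma psi_L2: "\<phi> \<in> L2 \<Longrightarrow> psi \<phi> v1 v2 x \<in> L2" by (simp add: psi_def rho_L2)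

lemma ev_psi_L2: "\<phi> \<in> L2 \<Longrightarrow> (\<lambda>t. ev (\<lambda>x. psi \<phi> v1 v2 x t) f) \<in> L2"
  by (induction f) (auto simp: L2_zero L2_add L2_cmult psi_L2)

lemma form_psi:
  assumes "\<phi> \<in> L2"
  shows "form (\<lambda>x y. ip (psi \<phi> v1 v2 x) (psi \<phi> v1 v2 y)) f g =
     ip (\<lambda>t. ev (\<lambda>x. psi \<phi> v1 v2 x t) f) (\<lambda>t. ev (\<lambda>x. psi \<phi> v1 v2 x t) g)"
proof -
  have 1: "ev (\<lambda>x. ip (psi \<phi> v1 v2 x) h) f = ip (\<lambda>t. ev (\<lambda>x. psi \<phi> v1 v2 x t) f) h" if "h \<in> L2" for f h
  proof (induction f)
    case Nil then show ?case by (simp add: ip_def)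
  next
    case (Cons a f)
    then show ?case using that assms
      by (cases a) (simp add: ip_add1 ip_cmult1 ev_psi_L2 L2_cmult psi_L2)
  qed
  show ?thesis
    unfolding form_ev ip_cnj by (simp add: 1 assms psi_L2 ev_psi_L2 ip_cnj)
qed

lemma form_psi_self:
  assumes "\<phi> \<in> L2"
  shows "form (\<lambda>x y. ip (psi \<phi> v1 v2 x) (psi \<phi> v1 v2 y)) f f = of_real ((L2_norm (\<lambda>t. ev (\<lambda>x. psi \<phi> v1 v2 x t) f))\<^sup>2)"
  unfolding form_psi[OF assms] by (rule ip_self)

text \<open>Stated for \<open>rho\<close>; the unimodular phases between \<open>rho\<close> and
  \<open>tf_shift\<close> are absorbed by the coefficients.\<close>

definition lower_riesz :: "real \<Rightarrow> (real \<Rightarrow> complex) \<Rightarrow> (real \<times> real) set \<Rightarrow> bool" where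
  "lower_riesz A \<phi> \<Lambda> \<longleftrightarrow> (\<forall>F c. finite F \<longrightarrow> F \<subseteq> \<Lambda> \<longrightarrow>
     A * (\<Sum>p\<in>F. (norm (c p))\<^sup>2) \<le> (L2_norm (\<lambda>x. \<Sum>p\<in>F. c p * rho p \<phi> x))\<^sup>2)"

lemma riesz_basis_lower:
  assumes "riesz_basis \<Lambda> (\<lambda>p. tf_shift p \<phi>) H"
  obtains A where "A > 0" "lower_riesz A \<phi> \<Lambda>"
proof -
  obtain A where A: "A > 0" "\<And>F c. finite F \<Longrightarrow> F \<subseteq> \<Lambda> \<Longrightarrow>
        A * (\<Sum>i\<in>F. (norm (c i))\<^sup>2) \<le> (L2_norm (\<lambda>x. \<Sum>i\<in>F. c i * tf_shift i \<phi> x))\<^sup>2"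
    using assms unfolding riesz_basis_def by meson
  have "lower_riesz A \<phi> \<Lambda>" unfolding lower_riesz_def
  proof (intro allI impI)
    fix F :: "(real \<times> real) set" and c :: "real \<times> real \<Rightarrow> complex"
    assume "finite F" "F \<subseteq> \<Lambda>"
    from A(2)[OF this, of "\<lambda>p. c p * ee (- (fst p * snd p / 2))"]
    show "A * (\<Sum>p\<in>F. (norm (c p))\<^sup>2) \<le> (L2_norm (\<lambda>x. \<Sum>p\<in>F. c p * rho p \<phi> x))\<^sup>2"
      by (simp add: rho_tf_shift norm_mult mult.assoc)
  qed
  with A(1) show ?thesis using that by blast
qed

lemma gabor_space_approx:
  assumes "tf_shift p \<phi> \<in> gabor_space \<phi> \<Lambda>" "\<epsilon> > 0"
  obtains F c where "finite F" "F \<subseteq> \<Lambda>" "L2_norm (\<lambda>x. rho p \<phi> x - (\<Sum>q\<in>F. c q * rho q \<phi> x)) < \<epsilon>"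
proof -
  obtain h where h: "h \<in> lin_span \<Lambda> (\<lambda>q. tf_shift q \<phi>)" "L2_norm (\<lambda>x. tf_shift p \<phi> x - h x) < \<epsilon>"
    using assms unfolding gabor_space_def L2_closure_def by blast
  then obtain F c where F: "finite F" "F \<subseteq> \<Lambda>" "h = (\<lambda>x. \<Sum>q\<in>F. c q * tf_shift q \<phi> x)"
    unfolding lin_span_def by blast
  let ?e = "ee (- (fst p * snd p / 2))"
  let ?c = "\<lambda>q. ?e * c q * ee (fst q * snd q / 2)"
  have "(\<lambda>x. rho p \<phi> x - (\<Sum>q\<in>F. ?c q * rho q \<phi> x)) = (\<lambda>x. ?e * (tf_shift p \<phi> x - h x))"
    unfolding F(3) rho_tf_shift[of p] right_diff_distrib sum_distrib_left
    by (simp add: tf_shift_rho mult_ac)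
  then have "L2_norm (\<lambda>x. rho p \<phi> x - (\<Sum>q\<in>F. ?c q * rho q \<phi> x)) < \<epsilon>"
    using h(2) by (simp add: L2_norm_cmult)
  then show ?thesis by (rule that[OF F(1,2)])
qed

text \<open>The interface between the fibre argument and analysis: it suffices to exhibit a bracket
  with these covariance rules whose integral over the torus is the inner product.\<close>

lemma not_in_gabor_space_off_lattice:
  fixes P :: int and Q :: nat
  assumes phi: "\<phi> \<in> L2" and lower: "lower_riesz A \<phi> (pt v1 v2 ` latt)" and A: "A > 0"
    and Q: "Q > 0" and PQ: "coprime P (int Q)" and sig: "sigma v1 v2 = of_int P / of_nat Q" and P: "P \<noteq> 0"
    and K_herm: "\<And>z x y. K z y x = cnj (K z x y)"
    and K_cont: "\<And>y. continuous_on UNIV (\<lambda>p. K (snd p) (fst p) y)"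
    and K_per1: "\<And>z x y. K (z + (1, 0)) x y = K z x y"
    and K_per2: "\<And>z x y. K (z + (0, 1)) x y = K z x y"
    and K_U1: "\<And>z x y. K z (x + (1, 0)) y = ee (fst z - sigma v1 v2 / 2 * snd x) * K z x y"
    and K_U2: "\<And>z x y. K z (x + bv Q) y = ee (snd z + of_int P / 2 * fst x) * K z x y"
    and K_shift: "\<And>z w x y. K z (w + x) (w + y) = ee (sigma v1 v2 / 2 * (wedge w y - wedge w x)) *
                    K (z + (- sigma v1 v2 * snd w, of_int P * fst w)) x y"
    and K_int: "\<And>x y. integral (cbox (0, 0) (1, 1)) (\<lambda>z. K z x y) = ip (psi \<phi> v1 v2 x) (psi \<phi> v1 v2 y)"
    and mem: "tf_shift p \<phi> \<in> gabor_space \<phi> (pt v1 v2 ` latt)"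
  shows "p \<in> pt v1 v2 ` latt"
proof -
  let ?I = "\<lambda>x y. ip (psi \<phi> v1 v2 x) (psi \<phi> v1 v2 y)"
  have nz: "sigma v1 v2 \<noteq> 0" using sig P Q by simp
  have inj: "inj_on (pt v1 v2) F" for F using pt_inj[OF nz] by (rule inj_on_subset) simp
  have riesz: "A * (\<Sum>x\<in>F. (norm (c x))\<^sup>2) \<le> Re (\<Sum>x\<in>F. \<Sum>y\<in>F. c x * cnj (c y) * ?I x y)"
    if F: "finite F" "F \<subseteq> latt" for F c
  proof -
    define c' where "c' = c \<circ> inv_into UNIV (pt v1 v2)"
    have c': "c' (pt v1 v2 x) = c x" for x using pt_inj[OF nz] by (simp add: c'_def)
    obtain xs where xs: "set xs = F" "distinct xs" using finite_distinct_list[OF F(1)] by blast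
    define f where "f = map (\<lambda>x. (c x, x)) xs"
    have evf: "ev u f = (\<Sum>x\<in>F. c x * u x)" for u
      unfolding f_def ev_def xs(1)[symmetric] by (simp add: comp_def sum_list_distinct_conv_sum_set xs(2))
    have "A * (\<Sum>p\<in>pt v1 v2 ` F. (norm (c' p))\<^sup>2) \<le> (L2_norm (\<lambda>x. \<Sum>p\<in>pt v1 v2 ` F. c' p * rho p \<phi> x))\<^sup>2"
      using lower F unfolding lower_riesz_def by blast
    then have "A * (\<Sum>x\<in>F. (norm (c x))\<^sup>2) \<le> (L2_norm (\<lambda>t. ev (\<lambda>x. psi \<phi> v1 v2 x t) f))\<^sup>2"
      by (simp add: sum.reindex[OF inj] c' evf psi_def)
    also have "\<dots> = Re (form ?I f f)" unfolding form_psi_self[OF phi] by simp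
    also have "form ?I f f = (\<Sum>x\<in>F. \<Sum>y\<in>F. c x * cnj (c y) * ?I x y)"
      by (simp add: form_ev evf sum_distrib_left mult_ac)
    finally show ?thesis .
  qed
  interpret gram_field P Q A K ?I "of_int P / of_nat Q"
    by (unfold_locales;
       (fact Q PQ A K_herm K_cont K_per1 K_per2 K_U1[unfolded sig] K_U2 K_shift[unfolded sig] K_int riesz |
        simp add: form_psi_self[OF phi]))
  obtain x where x: "p = pt v1 v2 x" using pt_surj[OF nz] by blast
  have "x \<in> Gam"
  proof (rule Gam_closure)
    fix \<epsilon> :: real assume eps: "\<epsilon> > 0"
    obtain F c where F: "finite F" "F \<subseteq> pt v1 v2 ` latt" 
      "L2_norm (\<lambda>t. rho p \<phi> t - (\<Sum>q\<in>F. c q * rho q \<phi> t)) < sqrt \<epsilon>"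
      by (rule gabor_space_approx[OF mem, of "sqrt \<epsilon>"]) (use eps in simp)
    obtain xs where xs: "set xs = F" "distinct xs" using finite_distinct_list[OF F(1)] by blast
    define i where "i = inv_into latt (pt v1 v2)"
    have i: "pt v1 v2 (i q) = q" "i q \<in> latt" if "q \<in> F" for q
      using F(2) that unfolding i_def by (auto intro: f_inv_into_f inv_into_into)
    define h where "h = map (\<lambda>q. (- c q, i q)) xs"
    have "ev (\<lambda>x. psi \<phi> v1 v2 x t) h = - (\<Sum>q\<in>F. c q * rho q \<phi> t)" for t
    proof -
      have "ev (\<lambda>x. psi \<phi> v1 v2 x t) h = (\<Sum>q\<in>F. - c q * psi \<phi> v1 v2 (i q) t)"
        unfolding h_def ev_def xs(1)[symmetric] by (simp add: comp_def sum_list_distinct_conv_sum_set xs(2))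
      also have "\<dots> = (\<Sum>q\<in>F. - c q * rho q \<phi> t)"
        by (intro sum.cong refl) (simp add: psi_def i)
      finally show ?thesis by (simp add: sum_negf)
    qed
    then have "(\<lambda>t. ev (\<lambda>x. psi \<phi> v1 v2 x t) ((1, x) # h)) = (\<lambda>t. rho p \<phi> t - (\<Sum>q\<in>F. c q * rho q \<phi> t))"
      by (simp add: psi_def x)
    then have "Re (form ?I ((1, x) # h) ((1, x) # h)) = (L2_norm (\<lambda>t. rho p \<phi> t - (\<Sum>q\<in>F. c q * rho q \<phi> t)))\<^sup>2"
      unfolding form_psi_self[OF phi] by simp
    also have "\<dots> < (sqrt \<epsilon>)\<^sup>2"
      using F(3) by (intro power_strict_mono) (auto simp: L2_norm_nonneg)
    also have "\<dots> = \<epsilon>" using eps by simp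
    finally have "Re (form ?I ((1, x) # h) ((1, x) # h)) < \<epsilon>" .
    moreover have "set h \<subseteq> UNIV \<times> latt" using i(2) xs(1) by (auto simp: h_def)
    ultimately show "\<exists>h. set h \<subseteq> UNIV \<times> latt \<and> Re (form ?I ((1, x) # h) ((1, x) # h)) < \<epsilon>" by blast
  qed
  then have "x \<in> latt" by (rule Gam_eq_latt)
  then show ?thesis using x by blast
qed

section \<open>The Zak transform\<close>

abbreviation sq :: "(real \<times> real) set" where "sq \<equiv> cbox (0, 0) (1, 1)"

text \<open>The coordinates are exchanged because in the Zak model the first torus variable
  parametrises frequency and the second one time.\<close>

lemma nn_integral_pair_affine:
  fixes h :: "real \<times> real \<Rightarrow> ennreal"
  assumes h [measurable]: "h \<in> borel_measurable borel" and ab: "a \<noteq> 0" "b \<noteq> 0"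
  shows "(\<integral>\<^sup>+p. h p \<partial>lborel) = ennreal (\<bar>a\<bar> * \<bar>b\<bar>) * (\<integral>\<^sup>+z. h (c + a * snd z, d + b * fst z) \<partial>lborel)"
proof -
  have [measurable]: "h \<in> borel_measurable (lborel \<Otimes>\<^sub>M lborel)" by (simp add: lborel_prod)
  have [measurable]: "(\<lambda>z. h (c + a * snd z, d + b * fst z)) \<in> borel_measurable (lborel \<Otimes>\<^sub>M lborel)"
    by measurable
  have "(\<integral>\<^sup>+p. h p \<partial>lborel) = (\<integral>\<^sup>+x. \<integral>\<^sup>+y. h (x, y) \<partial>lborel \<partial>lborel)"
    unfolding lborel_prod[symmetric] by (rule lborel.nn_integral_fst[symmetric]) simp
  also have "\<dots> = (\<integral>\<^sup>+x. ennreal \<bar>b\<bar> * (\<integral>\<^sup>+y. h (x, d + b * y) \<partial>lborel) \<partial>lborel)"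
    by (intro nn_integral_cong nn_integral_real_affine ab) measurable
  also have "\<dots> = ennreal \<bar>b\<bar> * (\<integral>\<^sup>+x. \<integral>\<^sup>+y. h (x, d + b * y) \<partial>lborel \<partial>lborel)"
    by (rule nn_integral_cmult) measurable
  also have "(\<integral>\<^sup>+x. \<integral>\<^sup>+y. h (x, d + b * y) \<partial>lborel \<partial>lborel) = (\<integral>\<^sup>+y. \<integral>\<^sup>+x. h (x, d + b * y) \<partial>lborel \<partial>lborel)"
    by (rule lborel_pair.Fubini'[symmetric]) measurable
  also have "\<dots> = (\<integral>\<^sup>+y. ennreal \<bar>a\<bar> * (\<integral>\<^sup>+x. h (c + a * x, d + b * y) \<partial>lborel) \<partial>lborel)"
    by (intro nn_integral_cong nn_integral_real_affine ab) measurable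
  also have "\<dots> = ennreal \<bar>a\<bar> * (\<integral>\<^sup>+y. \<integral>\<^sup>+x. h (c + a * x, d + b * y) \<partial>lborel \<partial>lborel)"
    by (rule nn_integral_cmult) measurable
  also have "(\<integral>\<^sup>+y. \<integral>\<^sup>+x. h (c + a * x, d + b * y) \<partial>lborel \<partial>lborel) = (\<integral>\<^sup>+z. h (c + a * snd z, d + b * fst z) \<partial>(lborel \<Otimes>\<^sub>M lborel))"
    by (subst lborel.nn_integral_fst[symmetric]) auto
  finally show ?thesis by (simp add: lborel_prod ennreal_mult mult_ac)
qed

lemma nn_integral_sq_affine_le:
  fixes h :: "real \<times> real \<Rightarrow> ennreal"
  assumes h [measurable]: "h \<in> borel_measurable borel" and ab: "a \<noteq> 0" "b \<noteq> 0"
  shows "(\<integral>\<^sup>+z\<in>sq. h (c + a * snd z, d + b * fst z) \<partial>lborel) \<le>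
    ennreal (1 / (\<bar>a\<bar> * \<bar>b\<bar>)) * (\<integral>\<^sup>+p\<in>cbox (c - \<bar>a\<bar>, d - \<bar>b\<bar>) (c + \<bar>a\<bar>, d + \<bar>b\<bar>). h p \<partial>lborel)"
proof -
  let ?K = "cbox (c - \<bar>a\<bar>, d - \<bar>b\<bar>) (c + \<bar>a\<bar>, d + \<bar>b\<bar>)"
  let ?h = "\<lambda>p. h p * indicator ?K p"
  have bd: "\<bar>a * t\<bar> \<le> \<bar>a\<bar>" if "0 \<le> t" "t \<le> 1" for a t :: real
    using that mult_left_mono[of "\<bar>t\<bar>" 1 "\<bar>a\<bar>"] by (simp add: abs_mult)
  have "(\<integral>\<^sup>+z\<in>sq. h (c + a * snd z, d + b * fst z) \<partial>lborel) \<le> (\<integral>\<^sup>+z. ?h (c + a * snd z, d + b * fst z) \<partial>lborel)"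
  proof (rule nn_integral_mono)
    fix z :: "real \<times> real"
    have "(c + a * snd z, d + b * fst z) \<in> ?K" if "z \<in> sq"
    proof -
      have "0 \<le> fst z" "fst z \<le> 1" "0 \<le> snd z" "snd z \<le> 1" using that by (auto simp: cbox_prod)
      then have "\<bar>a * snd z\<bar> \<le> \<bar>a\<bar>" "\<bar>b * fst z\<bar> \<le> \<bar>b\<bar>" using bd by auto
      then show ?thesis by simp linarith
    qed
    then show "h (c + a * snd z, d + b * fst z) * indicator sq z \<le> ?h (c + a * snd z, d + b * fst z)"
      by (auto simp: indicator_def)
  qed
  also have "\<dots> = ennreal (1 / (\<bar>a\<bar> * \<bar>b\<bar>)) * (ennreal (\<bar>a\<bar> * \<bar>b\<bar>) * (\<integral>\<^sup>+z. ?h (c + a * snd z, d + b * fst z) \<partial>lborel))"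
    using ab by (simp add: mult.assoc[symmetric] ennreal_mult[symmetric])
  also have "ennreal (\<bar>a\<bar> * \<bar>b\<bar>) * (\<integral>\<^sup>+z. ?h (c + a * snd z, d + b * fst z) \<partial>lborel) = (\<integral>\<^sup>+p. ?h p \<partial>lborel)"
    by (rule nn_integral_pair_affine[OF _ ab, symmetric]) measurable
  finally show ?thesis .
qed

lemma continuous_zero_on_sq:
  fixes D :: "real \<times> real \<Rightarrow> complex"
  assumes c: "continuous_on UNIV D" and 0: "(\<integral>\<^sup>+z\<in>sq. ennreal ((norm (D z))\<^sup>2) \<partial>lborel) = 0" and z: "z \<in> sq"
  shows "D z = 0"
proof -
  let ?f = "\<lambda>z. (norm (D z))\<^sup>2"
  have cf: "continuous_on sq ?f" using c by (intro continuous_intros continuous_on_subset[OF c]) auto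
  have i: "integrable lborel (\<lambda>z. indicator sq z *\<^sub>R ?f z)"
    by (rule borel_integrable_compact[OF compact_cbox cf])
  have "integral sq ?f = (LINT z : sq | lborel. ?f z)"
    by (rule set_borel_integral_eq_integral(2)[symmetric]) (use i in \<open>simp add: set_integrable_def\<close>)
  also have "ennreal \<dots> = (\<integral>\<^sup>+z. ennreal (indicator sq z *\<^sub>R ?f z) \<partial>lborel)"
    unfolding set_lebesgue_integral_def by (rule nn_integral_eq_integral[OF i, symmetric]) auto
  also have "\<dots> = 0" using 0 by (simp add: ennreal_mult' mult.commute ennreal_indicator)
  finally have "integral sq ?f \<le> 0" by (simp add: ennreal_eq_0_iff)
  moreover have "integral sq ?f \<ge> 0" using cf by (intro Henstock_Kurzweil_Integration.integral_nonneg integrable_continuous) auto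
  ultimately have "integral sq ?f = 0" by simp
  moreover have "box (0, 0) (1, 1 :: real) \<noteq> ({} :: (real \<times> real) set)"
  proof -
    have "((1/2, 1/2) :: real \<times> real) \<in> box (0, 0) (1, 1)" by (simp add: box_prod)
    then show ?thesis by blast
  qed
  ultimately have "\<forall>z\<in>sq. ?f z = 0" using integral_cbox_eq_0_iff[OF cf] by auto
  then show ?thesis using z by simp
qed

text \<open>Since \<open>|a| \<le> t + |a|\<^sup>2/t\<close>, square-integrable convergence on a finite measure space controls the
  cross terms with a bounded function.\<close>
lemma (in finite_measure) integral_prod_tendsto:
  fixes G H :: "'a \<Rightarrow> complex"
  assumes [measurable]: "G \<in> borel_measurable M" "H \<in> borel_measurable M"
    "\<And>n. Gn n \<in> borel_measurable M" "\<And>n. Hn n \<in> borel_measurable M"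
    and C: "\<And>x. x \<in> space M \<Longrightarrow> norm (G x) \<le> C" "\<And>x. x \<in> space M \<Longrightarrow> norm (H x) \<le> C" and C0: "C \<ge> 0"
    and lG: "(\<lambda>n. \<integral>\<^sup>+x. ennreal ((norm (Gn n x - G x))\<^sup>2) \<partial>M) \<longlonglongrightarrow> 0"
    and lH: "(\<lambda>n. \<integral>\<^sup>+x. ennreal ((norm (Hn n x - H x))\<^sup>2) \<partial>M) \<longlonglongrightarrow> 0"
  shows "(\<lambda>n. \<integral>x. Gn n x * cnj (Hn n x) \<partial>M) \<longlonglongrightarrow> (\<integral>x. G x * cnj (H x) \<partial>M)"
proof -
  have [measurable]: "cnj \<in> borel_measurable borel" by (rule borel_measurable_cnj)
  define e where "e n = (\<integral>\<^sup>+x. ennreal ((norm (Gn n x - G x))\<^sup>2) \<partial>M)" for n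
  define f where "f n = (\<integral>\<^sup>+x. ennreal ((norm (Hn n x - H x))\<^sup>2) \<partial>M)" for n
  have le: "e \<longlonglongrightarrow> 0" "f \<longlonglongrightarrow> 0" using lG lH by (simp_all add: e_def[abs_def] f_def[abs_def])
  have intGH: "integrable M (\<lambda>x. G x * cnj (H x))"
    by (rule integrable_const_bound[of _ "C * C"])
       (use C C0 in \<open>auto simp: norm_mult intro!: AE_I2 mult_mono\<close>)
  have young: "r \<le> t + r\<^sup>2 / t" if "t > 0" "r \<ge> 0" for r t :: real
  proof (cases "r \<le> t")
    case True
    have "0 \<le> r\<^sup>2 / t" using that by simp
    then show ?thesis using True by linarith
  next
    case False
    then have "r * t \<le> r * r" using that by (intro mult_left_mono) auto
    then have "r \<le> r\<^sup>2 / t" using that by (simp add: pos_le_divide_eq power2_eq_square)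
    then show ?thesis using that by linarith
  qed
  have pw: "norm (Gn n x * cnj (Hn n x) - G x * cnj (H x)) \<le>
     (1 + C / t) * ((norm (Gn n x - G x))\<^sup>2 + (norm (Hn n x - H x))\<^sup>2) + 2 * C * t" if t: "t > 0" and x: "x \<in> space M" for n x t
  proof -
    define a b where "a = Gn n x - G x" and "b = Hn n x - H x"
    have "Gn n x * cnj (Hn n x) - G x * cnj (H x) = a * cnj b + a * cnj (H x) + G x * cnj b"
      by (simp add: a_def b_def algebra_simps)
    also have "norm \<dots> \<le> norm a * norm b + norm a * norm (H x) + norm (G x) * norm b"
      by (rule order_trans[OF norm_triangle_ineq] add_mono order_trans[OF norm_triangle_ineq] | simp add: norm_mult)+
    also have "\<dots> \<le> ((norm a)\<^sup>2 + (norm b)\<^sup>2) + (t + (norm a)\<^sup>2 / t) * C + C * (t + (norm b)\<^sup>2 / t)"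
    proof (intro add_mono mult_mono)
      have "2 * norm a * norm b \<le> (norm a)\<^sup>2 + (norm b)\<^sup>2" by (rule sum_squares_bound)
      moreover have "0 \<le> norm a * norm b" by simp
      ultimately show "norm a * norm b \<le> (norm a)\<^sup>2 + (norm b)\<^sup>2" by linarith
    qed (use young t C x C0 in auto)
    also have "\<dots> = (1 + C / t) * ((norm a)\<^sup>2 + (norm b)\<^sup>2) + 2 * C * t"
      using t by (simp add: field_simps)
    finally show ?thesis by (simp add: a_def b_def)
  qed
  have nnb: "(\<integral>\<^sup>+x. ennreal (norm (Gn n x * cnj (Hn n x) - G x * cnj (H x))) \<partial>M) \<le>
     ennreal (1 + C / t) * (e n + f n) + ennreal (2 * C * t * measure M (space M))" if t: "t > 0" for t n
  proof -
    have "(\<integral>\<^sup>+x. ennreal (norm (Gn n x * cnj (Hn n x) - G x * cnj (H x))) \<partial>M) \<le>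
      (\<integral>\<^sup>+x. ennreal (1 + C / t) * (ennreal ((norm (Gn n x - G x))\<^sup>2) + ennreal ((norm (Hn n x - H x))\<^sup>2)) + ennreal (2 * C * t) \<partial>M)"
    proof (rule nn_integral_mono)
      fix x assume "x \<in> space M"
      from ennreal_leI[OF pw[OF t this, of n]]
      show "ennreal (norm (Gn n x * cnj (Hn n x) - G x * cnj (H x))) \<le> 
         ennreal (1 + C / t) * (ennreal ((norm (Gn n x - G x))\<^sup>2) + ennreal ((norm (Hn n x - H x))\<^sup>2)) + ennreal (2 * C * t)"
        using t C0 by (simp add: ennreal_plus[symmetric] ennreal_mult[symmetric] del: ennreal_plus)
    qed
    also have "\<dots> = ennreal (1 + C / t) * (e n + f n) + ennreal (2 * C * t) * emeasure M (space M)"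
      by (simp add: nn_integral_add nn_integral_cmult e_def f_def)
    also have "ennreal (2 * C * t) * emeasure M (space M) = ennreal (2 * C * t * measure M (space M))"
      using t C0 by (simp add: emeasure_eq_measure ennreal_mult)
    finally show ?thesis .
  qed
  show ?thesis
  proof (rule LIMSEQ_I)
    fix \<epsilon> :: real assume eps: "\<epsilon> > 0"
    define m where "m = measure M (space M)"
    \<comment> \<open>Makes the error \<open>2 * C * t * m\<close> at most \<epsilon> / 2; the added
      ones guard against \<open>C = 0\<close> and \<open>m = 0\<close>.\<close>
    define t where "t = \<epsilon> / (4 * (C + 1) * (m + 1))"
    have m0: "m \<ge> 0" by (simp add: m_def)
    have t: "t > 0" using eps C0 m0 by (simp add: t_def)
    have tb: "2 * C * t * m \<le> \<epsilon> / 2"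
    proof -
      have "C * m \<le> (C + 1) * (m + 1)" using C0 m0 by (intro mult_mono) auto
      then have "2 * (C * m) * t \<le> 2 * ((C + 1) * (m + 1)) * t" using t by simp
      also have "\<dots> = \<epsilon> / 2"
      proof -
        define c where "c = (C + 1) * (m + 1)"
        have "c > 0" using C0 m0 by (simp add: c_def)
        moreover have "t = \<epsilon> / (4 * c)" by (simp add: t_def c_def mult.assoc)
        ultimately show ?thesis unfolding c_def[symmetric] by simp
      qed
      finally show ?thesis by (simp add: mult_ac)
    qed
    have "(\<lambda>n. ennreal (1 + C / t) * (e n + f n)) \<longlonglongrightarrow> ennreal (1 + C / t) * (0 + 0)"
      by (intro ennreal_tendsto_cmult tendsto_add le) auto
    then have "(\<lambda>n. ennreal (1 + C / t) * (e n + f n)) \<longlonglongrightarrow> 0" by simp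
    then have "eventually (\<lambda>n. ennreal (1 + C / t) * (e n + f n) < ennreal (\<epsilon> / 2)) sequentially"
      using eps by (intro order_tendstoD(2)) auto
    then obtain n0 where n0: "\<And>n. n \<ge> n0 \<Longrightarrow> ennreal (1 + C / t) * (e n + f n) < ennreal (\<epsilon> / 2)"
      unfolding eventually_sequentially by blast
    show "\<exists>n0. \<forall>n\<ge>n0. norm ((\<integral>x. Gn n x * cnj (Hn n x) \<partial>M) - (\<integral>x. G x * cnj (H x) \<partial>M)) < \<epsilon>"
    proof (intro exI[of _ n0] allI impI)
      fix n assume n: "n \<ge> n0"
      let ?d = "\<lambda>x. Gn n x * cnj (Hn n x) - G x * cnj (H x)"
      have "(\<integral>\<^sup>+x. ennreal (norm (?d x)) \<partial>M) \<le> ennreal (1 + C / t) * (e n + f n) + ennreal (\<epsilon> / 2)"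
        using nnb[OF t, of n] ennreal_leI[OF tb] unfolding m_def
        by (meson add_left_mono order_trans)
      also have "\<dots> < ennreal (\<epsilon> / 2) + ennreal (\<epsilon> / 2)"
      proof -
        have "ennreal (\<epsilon> / 2) + ennreal (1 + C / t) * (e n + f n) < ennreal (\<epsilon> / 2) + ennreal (\<epsilon> / 2)"
          unfolding ennreal_add_left_cancel_less using n0[OF n] by simp
        then show ?thesis by (simp only: add.commute)
      qed
      also have "\<dots> = ennreal \<epsilon>" using eps by (simp add: ennreal_plus[symmetric] del: ennreal_plus)
      finally have nn: "(\<integral>\<^sup>+x. ennreal (norm (?d x)) \<partial>M) < ennreal \<epsilon>" .
      have id: "integrable M ?d"
        by (rule integrableI_bounded) (use nn in \<open>auto intro: order_less_trans[OF _ ennreal_less_top]\<close>)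
      have "integrable M (\<lambda>x. ?d x + G x * cnj (H x))" by (rule Bochner_Integration.integrable_add[OF id intGH])
      then have "integrable M (\<lambda>x. Gn n x * cnj (Hn n x))" by simp
      then have "(\<integral>x. Gn n x * cnj (Hn n x) \<partial>M) - (\<integral>x. G x * cnj (H x) \<partial>M) = integral\<^sup>L M ?d"
        using intGH by (simp add: Bochner_Integration.integral_diff)
      moreover have "ennreal (norm (integral\<^sup>L M ?d)) < ennreal \<epsilon>"
        using integral_norm_bound_ennreal[OF id] nn by (rule order.strict_trans1)
      ultimately show "norm ((\<integral>x. Gn n x * cnj (Hn n x) \<partial>M) - (\<integral>x. G x * cnj (H x) \<partial>M)) < \<epsilon>"
        using eps by (simp add: ennreal_less_iff)
    qed
  qed
qed

lemma integral_pair_mult: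
  fixes v w :: "real \<Rightarrow> complex"
  assumes v: "integrable lborel v" and w: "integrable lborel w"
  shows "integrable lborel (\<lambda>z. v (fst z) * w (snd z))"
    and "(\<integral>z. v (fst z) * w (snd z) \<partial>lborel) = integral\<^sup>L lborel v * integral\<^sup>L lborel w"
proof -
  have [measurable]: "v \<in> borel_measurable borel" "w \<in> borel_measurable borel"
    using v w by auto
  have i: "integrable (lborel \<Otimes>\<^sub>M lborel) (\<lambda>z. v (fst z) * w (snd z))"
  proof (rule lborel_pair.Fubini_integrable)
    show "integrable lborel (\<lambda>x. \<integral>y. norm (v (fst (x, y)) * w (snd (x, y))) \<partial>lborel)"
      using v by (simp add: norm_mult)
    show "AE x in lborel. integrable lborel (\<lambda>y. v (fst (x, y)) * w (snd (x, y)))"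
      using w by simp
  qed measurable
  then show "integrable lborel (\<lambda>z. v (fst z) * w (snd z))" by (simp add: lborel_prod)
  show "(\<integral>z. v (fst z) * w (snd z) \<partial>lborel) = integral\<^sup>L lborel v * integral\<^sup>L lborel w"
    using lborel_pair.integral_fst'[OF i] by (simp add: lborel_prod)
qed

section \<open>The Zak series of functions with bounded support\<close>

lemma zak_series_ee:
  "zak_series \<alpha> f (x, \<omega>) = (\<Sum>\<^sub>\<infinity>k::int. f (x + \<alpha> * of_int k) * ee (- (\<alpha> * of_int k * \<omega>)))"
  by (simp add: zak_series_def ee_def mult.assoc)

lemma infsum_int_shift: "(\<Sum>\<^sub>\<infinity>k::int. g (k + 1)) = (\<Sum>\<^sub>\<infinity>k. g k :: complex)"
proof (rule infsum_reindex_bij_betw)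
  show "bij_betw (\<lambda>k::int. k + 1) UNIV UNIV"
    by (rule bij_betw_byWitness[where f' = "\<lambda>k. k - 1"]) auto
qed

lemma zak_series_quasiperiodic:
  "zak_series \<alpha> f (x + \<alpha>, \<omega>) = ee (\<alpha> * \<omega>) * zak_series \<alpha> f (x, \<omega>)"
proof -
  let ?g = "\<lambda>k::int. f (x + \<alpha> * of_int k) * ee (- (\<alpha> * of_int k * \<omega>))"
  have "f (x + \<alpha> + \<alpha> * of_int k) * ee (- (\<alpha> * of_int k * \<omega>)) = ee (\<alpha> * \<omega>) * ?g (k + 1)" for k
  proof -
    have "ee (\<alpha> * \<omega>) * ee (- (\<alpha> * of_int (k + 1) * \<omega>)) = ee (- (\<alpha> * of_int k * \<omega>))"
      unfolding ee_add[symmetric] by (rule arg_cong[of _ _ ee]) (simp add: algebra_simps)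
    then show ?thesis by (simp add: algebra_simps)
  qed
  then have "zak_series \<alpha> f (x + \<alpha>, \<omega>) = (\<Sum>\<^sub>\<infinity>k. ee (\<alpha> * \<omega>) * ?g (k + 1))"
    by (simp only: zak_series_ee)
  also have "\<dots> = ee (\<alpha> * \<omega>) * (\<Sum>\<^sub>\<infinity>k. ?g (k + 1))" by (rule infsum_cmult_right')
  also have "(\<Sum>\<^sub>\<infinity>k. ?g (k + 1)) = (\<Sum>\<^sub>\<infinity>k. ?g k)" by (rule infsum_int_shift)
  finally show ?thesis by (simp only: zak_series_ee)
qed

lemma zak_series_periodic:
  assumes "\<alpha> \<noteq> 0"
  shows "zak_series \<alpha> f (x, \<omega> + 1 / \<alpha>) = zak_series \<alpha> f (x, \<omega>)"
proof -
  have "ee (- (\<alpha> * of_int k * (\<omega> + 1 / \<alpha>))) = ee (- (\<alpha> * of_int k * \<omega>))" for k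
    by (rule ee_cong[of _ _ "- k"]) (use assms in \<open>simp add: field_simps\<close>)
  then show ?thesis by (simp only: zak_series_ee)
qed

lemma zak_series_rho:
  "zak_series \<alpha> (rho q f) (x, \<omega>) = ee (snd q * x - fst q * snd q / 2) * zak_series \<alpha> f (x - fst q, \<omega> - snd q)"
proof -
  have "rho q f (x + \<alpha> * of_int k) * ee (- (\<alpha> * of_int k * \<omega>)) =
    ee (snd q * x - fst q * snd q / 2) * (f (x - fst q + \<alpha> * of_int k) * ee (- (\<alpha> * of_int k * (\<omega> - snd q))))" for k :: int
  proof -
    have "ee (snd q * (x + \<alpha> * of_int k) - fst q * snd q / 2) * ee (- (\<alpha> * of_int k * \<omega>)) =
       ee (snd q * x - fst q * snd q / 2) * ee (- (\<alpha> * of_int k * (\<omega> - snd q)))"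
      unfolding ee_add[symmetric] by (rule arg_cong[of _ _ ee]) (simp add: algebra_simps)
    moreover have "x + \<alpha> * of_int k - fst q = x - fst q + \<alpha> * of_int k" by simp
    moreover have "u * v * w = c * (v * d)" if "u * w = c * d" for u v w c d :: complex
      using that by (simp add: mult_ac)
    ultimately show ?thesis unfolding rho_def by presburger
  qed
  then show ?thesis by (simp only: zak_series_ee infsum_cmult_right')
qed

lemma zak_series_finite:
  assumes a: "\<alpha> > 0" and supp: "\<And>y. \<bar>y\<bar> > r \<Longrightarrow> f y = 0" and x: "\<bar>x\<bar> \<le> X" and N: "X + r \<le> \<alpha> * of_int N"
  shows "zak_series \<alpha> f (x, \<omega>) = (\<Sum>k\<in>{- N..N}. f (x + \<alpha> * of_int k) * ee (- (\<alpha> * of_int k * \<omega>)))"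
proof -
  have z: "f (x + \<alpha> * of_int k) = 0" if "k \<notin> {- N..N}" for k :: int
  proof (rule supp)
    have "\<bar>of_int k\<bar> > (of_int N :: real)" using that by (auto simp: abs_if)
    then have "\<alpha> * of_int N < \<alpha> * \<bar>of_int k\<bar>" using a by simp
    also have "\<dots> = \<bar>\<alpha> * of_int k\<bar>" using a by (simp add: abs_mult)
    finally show "r < \<bar>x + \<alpha> * of_int k\<bar>" using x N by linarith
  qed
  have "zak_series \<alpha> f (x, \<omega>) = infsum (\<lambda>k. f (x + \<alpha> * of_int k) * ee (- (\<alpha> * of_int k * \<omega>))) {- N..N}"
    unfolding zak_series_ee by (rule infsum_cong_neutral) (auto simp: z)
  then show ?thesis by simp
qed

lemma bounded_supportE:
  assumes "bounded {x::real. f x \<noteq> (0::complex)}"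
  obtains r where "r \<ge> 0" "\<And>y. \<bar>y\<bar> > r \<Longrightarrow> f y = 0"
proof -
  obtain r where r: "\<And>x. f x \<noteq> 0 \<Longrightarrow> \<bar>x\<bar> \<le> r" using assms unfolding bounded_iff by auto
  then show ?thesis using that[of "max r 0"] by (metis abs_ge_zero max.cobounded2 max.strict_boundedE not_le)
qed

lemma zak_series_measurable:
  assumes a: "\<alpha> > 0" and f: "f \<in> L2" and b: "bounded {x. f x \<noteq> 0}"
  shows "zak_series \<alpha> f \<in> borel_measurable borel"
proof -
  have [measurable]: "f \<in> borel_measurable borel" using f by (auto simp: L2_def)
  obtain r where r: "r \<ge> 0" "\<And>y. \<bar>y\<bar> > r \<Longrightarrow> f y = 0" using bounded_supportE[OF b] by blast
  show ?thesis
  proof (rule borel_measurable_LIMSEQ_metric)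
    show "(\<lambda>p. \<Sum>k\<in>{- int i..int i}. f (fst p + \<alpha> * of_int k) * ee (- (\<alpha> * of_int k * snd p))) \<in> borel_measurable borel" for i
      unfolding borel_prod[symmetric] by measurable
    fix p :: "real \<times> real"
    obtain n0 :: nat where n0: "(\<bar>fst p\<bar> + r) / \<alpha> \<le> real n0" using real_arch_simple by blast
    have "eventually (\<lambda>i. (\<Sum>k\<in>{- int i..int i}. f (fst p + \<alpha> * of_int k) * ee (- (\<alpha> * of_int k * snd p))) = zak_series \<alpha> f p) sequentially"
      using eventually_ge_at_top[of n0]
    proof eventually_elim
      case (elim i)
      have "\<bar>fst p\<bar> + r \<le> \<alpha> * real n0" using n0 a by (simp add: field_simps)
      also have "\<dots> \<le> \<alpha> * real i" using elim a by simp
      finally have "\<bar>fst p\<bar> + r \<le> \<alpha> * of_int (int i)" by simp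
      from zak_series_finite[OF a r(2) order_refl this, where \<omega> = "snd p"] show ?case by simp
    qed
    then show "(\<lambda>i. \<Sum>k\<in>{- int i..int i}. f (fst p + \<alpha> * of_int k) * ee (- (\<alpha> * of_int k * snd p))) \<longlonglongrightarrow> zak_series \<alpha> f p"
      by (rule tendsto_eventually)
  qed
qed

abbreviation sqM :: "(real \<times> real) measure" where "sqM \<equiv> restrict_space lborel sq"

lemma L2_affine:
  assumes "f \<in> L2" "a \<noteq> 0"
  shows "(\<lambda>t. f (c + a * t)) \<in> L2"
proof -
  have [measurable]: "f \<in> borel_measurable borel" using assms by (auto simp: L2_def)
  have "(\<lambda>t. f (c + a * t)) \<in> borel_measurable lborel" by measurable
  moreover have "integrable lborel (\<lambda>t. (norm (f (c + a * t)))\<^sup>2)"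
    using lborel_integrable_real_affine[OF L2_integrable_sq[OF assms(1)] assms(2)] .
  ultimately show ?thesis by (simp add: L2_def)
qed

lemma integral_ee_indicator:
  "integrable lborel (\<lambda>t. indicator {0..1} t *\<^sub>R ee (of_int m * t))"
  "(\<integral>t. indicator {0..1} t *\<^sub>R ee (of_int m * t) \<partial>lborel) = (if m = 0 then 1 else 0)"
proof -
  show 1: "integrable lborel (\<lambda>t. indicator {0..1} t *\<^sub>R ee (of_int m * t))"
    by (rule borel_integrable_compact) (auto intro!: continuous_intros)
  have "(LINT t : {0..1} | lborel. ee (of_int m * t)) = integral {0..1} (\<lambda>t. ee (of_int m * t))"
    by (rule set_borel_integral_eq_integral(2)) (use 1 in \<open>simp add: set_integrable_def\<close>)
  then show "(\<integral>t. indicator {0..1} t *\<^sub>R ee (of_int m * t) \<partial>lborel) = (if m = 0 then 1 else 0)"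
    by (simp add: set_lebesgue_integral_def integral_ee_unit_interval)
qed

text \<open>The line is cut into cells of length \<open>a\<close>. The closed cells overlap only in
  the countable set of multiples of \<open>a\<close>, which is null.\<close>

lemma integral_cells:
  assumes a: "a > 0" and h: "integrable lborel (h :: real \<Rightarrow> complex)" and S: "finite S"
    and supp: "\<And>y. \<lfloor>y / a\<rfloor> \<notin> S \<Longrightarrow> h y = 0"
  shows "(\<Sum>m\<in>S. of_real a * (\<integral>t. indicator {0..1} t *\<^sub>R h (a * (t + of_int m)) \<partial>lborel)) = integral\<^sup>L lborel h"
proof -
  have [measurable]: "h \<in> borel_measurable borel" using h by auto
  define J where "J m = {a * of_int m .. a * (of_int m + 1)}" for m
  have i: "integrable lborel (\<lambda>y. indicator (J m) y *\<^sub>R h y)" for m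
    using h by (intro integrable_mult_indicator) (auto simp: J_def)
  have 1: "of_real a * (\<integral>t. indicator {0..1} t *\<^sub>R h (a * (t + of_int m)) \<partial>lborel) = (\<integral>y. indicator (J m) y *\<^sub>R h y \<partial>lborel)" for m
  proof -
    have "(\<integral>y. indicator (J m) y *\<^sub>R h y \<partial>lborel) = \<bar>a\<bar> *\<^sub>R (\<integral>t. indicator (J m) (a * of_int m + a * t) *\<^sub>R h (a * of_int m + a * t) \<partial>lborel)"
      using a by (intro lborel_integral_real_affine) auto
    also have "\<dots> = \<bar>a\<bar> *\<^sub>R (\<integral>t. indicator {0..1} t *\<^sub>R h (a * (t + of_int m)) \<partial>lborel)"
    proof -
      have "indicator (J m) (a * of_int m + a * t) = (indicator {0..1} t :: real)" for t
      proof -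
        have "0 \<le> a * t \<longleftrightarrow> 0 \<le> t" "a * t \<le> a \<longleftrightarrow> t \<le> 1" using a by (simp_all add: zero_le_mult_iff)
        then show ?thesis by (simp add: J_def indicator_def distrib_left)
      qed
      moreover have "a * of_int m + a * t = a * (t + of_int m)" for t by (simp add: distrib_left)
      ultimately show ?thesis by (simp only:)
    qed
    finally show ?thesis using a by (simp add: scaleR_conv_of_real)
  qed
  have "(\<Sum>m\<in>S. of_real a * (\<integral>t. indicator {0..1} t *\<^sub>R h (a * (t + of_int m)) \<partial>lborel)) = 
     (\<integral>y. (\<Sum>m\<in>S. indicator (J m) y *\<^sub>R h y) \<partial>lborel)"
    unfolding 1 by (rule Bochner_Integration.integral_sum[symmetric]) (rule i)
  also have "\<dots> = integral\<^sup>L lborel h"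
  proof (rule integral_cong_AE)
    have "countable (range (\<lambda>m::int. a * of_int m))" by simp
    then have "range (\<lambda>m::int. a * of_int m) \<in> null_sets lborel" by (rule countable_imp_null_set_lborel)
    then have "AE y in lborel. y \<notin> range (\<lambda>m::int. a * of_int m)" by (rule AE_not_in)
    then show "AE y in lborel. (\<Sum>m\<in>S. indicator (J m) y *\<^sub>R h y) = h y"
    proof eventually_elim
      case (elim y)
      have J: "y \<in> J m \<longleftrightarrow> m = \<lfloor>y / a\<rfloor>" for m
      proof -
        have "y \<in> J m \<longleftrightarrow> of_int m \<le> y / a \<and> y / a \<le> of_int m + 1"
          using a by (simp add: J_def pos_le_divide_eq pos_divide_le_eq mult.commute)
        also have "y / a \<noteq> of_int (m + 1)"
        proof
          assume "y / a = of_int (m + 1)"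
          then have "y = a * of_int (m + 1)" using a by (simp add: field_simps)
          with elim show False by blast
        qed
        then have "of_int m \<le> y / a \<and> y / a \<le> of_int m + 1 \<longleftrightarrow> of_int m \<le> y / a \<and> y / a < of_int m + 1"
          by auto
        also have "\<dots> \<longleftrightarrow> m = \<lfloor>y / a\<rfloor>" unfolding floor_eq_iff[symmetric] by (rule eq_commute)
        finally show ?thesis .
      qed
      have "(\<Sum>m\<in>S. indicator (J m) y *\<^sub>R h y) = (\<Sum>m\<in>S. if m = \<lfloor>y / a\<rfloor> then h y else 0)"
        by (intro sum.cong refl) (auto simp: J indicator_def)
      also have "\<dots> = h y" using S supp[of y] by auto
      finally show ?case .
    qed
  qed (auto simp: J_def)
  finally show ?thesis .
qed

text \<open>Orthogonality of characters in frequency, tiling of the line in time. The time interval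
  of length \<alpha> is cut into \<open>p\<close> pieces because the second torus variable will
  sweep only \<alpha> / p, and the bracket sums over the pieces.\<close>

lemma zak_series_unitary:
  fixes p :: nat
  assumes a: "\<alpha> > 0" and p: "p > 0" and f: "f \<in> L2" "bounded {x. f x \<noteq> 0}" and g: "g \<in> L2" "bounded {x. g x \<noteq> 0}"
  shows "(\<Sum>j<p. of_real (\<alpha> / p) * (\<integral>z. zak_series \<alpha> f (\<alpha> / p * (snd z + j), - (fst z / \<alpha>)) *
     cnj (zak_series \<alpha> g (\<alpha> / p * (snd z + j), - (fst z / \<alpha>))) \<partial>sqM)) = ip f g"
proof -
  define b where "b = \<alpha> / p"
  have b: "b > 0" "b * p = \<alpha>" using a p by (simp_all add: b_def)
  have [measurable]: "f \<in> borel_measurable borel" "g \<in> borel_measurable borel" using f g by (auto simp: L2_def)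
  obtain r1 where r1: "r1 \<ge> 0" "\<And>y. \<bar>y\<bar> > r1 \<Longrightarrow> f y = 0" using bounded_supportE[OF f(2)] by blast
  obtain r2 where r2: "r2 \<ge> 0" "\<And>y. \<bar>y\<bar> > r2 \<Longrightarrow> g y = 0" using bounded_supportE[OF g(2)] by blast
  define r where "r = max r1 r2"
  have r: "r \<ge> 0" "\<And>y. \<bar>y\<bar> > r \<Longrightarrow> f y = 0" "\<And>y. \<bar>y\<bar> > r \<Longrightarrow> g y = 0"
    using r1 r2 by (auto simp: r_def)
  \<comment> \<open>One period more than the radius of the support, as the time argument itself
    ranges over [0, \<alpha>].\<close>
  obtain n0 :: nat where n0: "(\<alpha> + r) / \<alpha> \<le> real n0" using real_arch_simple by blast
  define N where "N = int n0"
  have N: "\<alpha> + r \<le> \<alpha> * of_int N" using n0 a by (simp add: N_def field_simps)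
  define h where "h y = f y * cnj (g y)" for y
  have h: "integrable lborel h" unfolding h_def by (rule L2_integrable_prod[OF f(1) g(1)])
  let ?X = "\<lambda>j z. b * (snd z + real j)"
  define w where "w j k l t = indicator {0..1} t *\<^sub>R (f (b * (t + real j) + \<alpha> * of_int k) * cnj (g (b * (t + real j) + \<alpha> * of_int l)))"
    for j k l t
  have wi: "integrable lborel (w j k l)" for j k l
  proof -
    have e: "b * (t + real j) + \<alpha> * of_int k = (b * real j + \<alpha> * of_int k) + b * t" for t k
      by (simp add: algebra_simps)
    show ?thesis unfolding w_def e using b(1)
      by (intro integrable_mult_indicator L2_integrable_prod L2_affine f g) auto
  qed
  have zak: "zak_series \<alpha> u (?X j z, - (fst z / \<alpha>)) = (\<Sum>k\<in>{- N..N}. u (?X j z + \<alpha> * of_int k) * ee (of_int k * fst z))"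
    if u: "\<And>y. \<bar>y\<bar> > r \<Longrightarrow> u y = 0" and z: "z \<in> sq" and j: "j < p" for u j z
  proof -
    have zz: "0 \<le> snd z" "snd z \<le> 1" using z by (auto simp: cbox_prod)
    have "snd z + real j \<le> p" using zz j by linarith
    then have "?X j z \<le> b * p" using b by (intro mult_left_mono) auto
    moreover have "0 \<le> ?X j z" using zz b by simp
    ultimately have "\<bar>?X j z\<bar> \<le> \<alpha>" using b by simp
    from zak_series_finite[where f = u, OF a u this N]
    have "zak_series \<alpha> u (?X j z, - (fst z / \<alpha>)) = (\<Sum>k\<in>{- N..N}. u (?X j z + \<alpha> * of_int k) * ee (- (\<alpha> * of_int k * (- (fst z / \<alpha>)))))" .
    also have "\<dots> = (\<Sum>k\<in>{- N..N}. u (?X j z + \<alpha> * of_int k) * ee (of_int k * fst z))"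
      using a by simp
    finally show ?thesis .
  qed
  have inner: "(\<integral>z. zak_series \<alpha> f (?X j z, - (fst z / \<alpha>)) * cnj (zak_series \<alpha> g (?X j z, - (fst z / \<alpha>))) \<partial>sqM)
     = (\<Sum>k\<in>{- N..N}. \<integral>t. indicator {0..1} t *\<^sub>R h (b * (t + of_int (int j + int p * k))) \<partial>lborel)" if j: "j < p" for j
  proof -
    define v where "v m t = indicator {0..1::real} t *\<^sub>R ee (of_int m * t)" for m :: int and t
    have "(\<integral>z. zak_series \<alpha> f (?X j z, - (fst z / \<alpha>)) * cnj (zak_series \<alpha> g (?X j z, - (fst z / \<alpha>))) \<partial>sqM) =
      (\<integral>z. indicator sq z *\<^sub>R (zak_series \<alpha> f (?X j z, - (fst z / \<alpha>)) * cnj (zak_series \<alpha> g (?X j z, - (fst z / \<alpha>)))) \<partial>lborel)"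
      by (rule integral_restrict_space) simp
    also have "\<dots> = (\<integral>z. (\<Sum>k\<in>{- N..N}. \<Sum>l\<in>{- N..N}. v (k - l) (fst z) * w j k l (snd z)) \<partial>lborel)"
    proof (intro Bochner_Integration.integral_cong refl)
      fix z :: "real \<times> real"
      show "indicator sq z *\<^sub>R (zak_series \<alpha> f (?X j z, - (fst z / \<alpha>)) * cnj (zak_series \<alpha> g (?X j z, - (fst z / \<alpha>)))) =
        (\<Sum>k\<in>{- N..N}. \<Sum>l\<in>{- N..N}. v (k - l) (fst z) * w j k l (snd z))"
      proof (cases "z \<in> sq")
        case True
        have E: "ee (of_int k * t) * cnj (ee (of_int l * t)) = ee (of_int (k - l) * t)" for k l :: int and t
          by (simp add: cnj_ee ee_add[symmetric] algebra_simps)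
        have eq: "F * ee (of_int k * t) * cnj (G * ee (of_int l * t)) = ee (of_int (k - l) * t) * (F * cnj G)" for F G k l t
          unfolding E[symmetric] by (simp only: complex_cnj_mult mult_ac)
        have "fst z \<in> {0..1}" "snd z \<in> {0..1}" using True by (auto simp: cbox_prod)
        then show ?thesis using True
          by (simp add: zak[OF r(2) True j] zak[OF r(3) True j] v_def w_def sum_product eq del: complex_cnj_mult)
      next
        case False
        then have "fst z \<notin> {0..1} \<or> snd z \<notin> {0..1}" by (auto simp: cbox_prod mem_Times_iff)
        then have "v (k - l) (fst z) * w j k l (snd z) = 0" for k l by (auto simp: v_def w_def)
        then have "(\<Sum>k\<in>{- N..N}. \<Sum>l\<in>{- N..N}. v (k - l) (fst z) * w j k l (snd z)) = 0"
          by (simp only: sum.neutral_const)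
        then show ?thesis using False by simp
      qed
    qed
    also have "\<dots> = (\<Sum>k\<in>{- N..N}. \<Sum>l\<in>{- N..N}. (\<integral>z. v (k - l) (fst z) * w j k l (snd z) \<partial>lborel))"
      unfolding v_def
      by (subst Bochner_Integration.integral_sum, intro Bochner_Integration.integrable_sum integral_pair_mult integral_ee_indicator wi)
         (intro sum.cong refl Bochner_Integration.integral_sum integral_pair_mult integral_ee_indicator wi)
    also have "\<dots> = (\<Sum>k\<in>{- N..N}. \<Sum>l\<in>{- N..N}. if k = l then integral\<^sup>L lborel (w j k l) else 0)"
      unfolding v_def integral_pair_mult(2)[OF integral_ee_indicator(1) wi] integral_ee_indicator(2)
      by (intro sum.cong refl) auto
    also have "\<dots> = (\<Sum>k\<in>{- N..N}. integral\<^sup>L lborel (w j k k))" by simp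
    also have "\<dots> = (\<Sum>k\<in>{- N..N}. \<integral>t. indicator {0..1} t *\<^sub>R h (b * (t + of_int (int j + int p * k))) \<partial>lborel)"
    proof -
      have "b * (t + real j) + \<alpha> * of_int k = b * (t + of_int (int j + int p * k))" for t k
        using b(2)[symmetric] by (simp add: algebra_simps)
      then show ?thesis unfolding w_def h_def by simp
    qed
    finally show ?thesis .
  qed
  \<comment> \<open>Division with remainder: the cell j + p k is the j-th piece of the k-th
    translate, so distinct pairs give distinct cells.\<close>
  define S where "S = (\<lambda>(j, k). int j + int p * k) ` ({..<p} \<times> {- N..N})"
  have inj: "inj_on (\<lambda>(j, k). int j + int p * k) ({..<p} \<times> {- N..N})"
  proof (rule inj_onI, clarsimp)
    fix j k j' k' assume jj: "j < p" "j' < p" and e: "int j + int p * k = int j' + int p * k'"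
    have m: "(int i + int p * l) mod int p = int i" "(int i + int p * l) div int p = l" if "i < p" for i l
      using that by simp_all
    show "j = j' \<and> k = k'" using m[OF jj(1), of k] m[OF jj(2), of k'] e by simp
  qed
  have "(\<Sum>j<p. of_real b * (\<Sum>k\<in>{- N..N}. \<integral>t. indicator {0..1} t *\<^sub>R h (b * (t + of_int (int j + int p * k))) \<partial>lborel))
     = (\<Sum>m\<in>S. of_real b * (\<integral>t. indicator {0..1} t *\<^sub>R h (b * (t + of_int m)) \<partial>lborel))"
    unfolding S_def sum.reindex[OF inj] sum_distrib_left
    by (subst sum.cartesian_product) (simp add: case_prod_beta comp_def)
  also have "\<dots> = integral\<^sup>L lborel h"
  proof (rule integral_cells[OF b(1) h])
    show "finite S" by (simp add: S_def)
    fix y assume y: "\<lfloor>y / b\<rfloor> \<notin> S"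
    define m where "m = \<lfloor>y / b\<rfloor>"
    have m: "m = int (nat (m mod int p)) + int p * (m div int p)" using p by simp
    have "nat (m mod int p) < p" using p by (simp add: nat_less_iff)
    then have nk: "m div int p \<notin> {- N..N}" using y m unfolding S_def m_def[symmetric] by force
    have dv: "m div int p = \<lfloor>y / \<alpha>\<rfloor>"
    proof -
      have "\<lfloor>y / b / real_of_int (int p)\<rfloor> = \<lfloor>y / b\<rfloor> div int p" by (rule floor_divide_real_eq_div) simp
      then show ?thesis using b(2) by (simp add: m_def)
    qed
    have "\<bar>y\<bar> > r"
    proof (rule ccontr)
      assume "\<not> \<bar>y\<bar> > r"
      then have "\<bar>y\<bar> \<le> \<alpha> * (of_int N - 1)" using N by (simp add: algebra_simps)
      then have "y / \<alpha> \<le> of_int N - 1" "- (of_int N - 1) \<le> y / \<alpha>" using a by (auto simp: field_simps abs_le_iff)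
      then have "\<lfloor>y / \<alpha>\<rfloor> \<le> N" "- N \<le> \<lfloor>y / \<alpha>\<rfloor>" by linarith+
      then show False using nk dv by simp
    qed
    then show "h y = 0" using r by (simp add: h_def)
  qed
  also have "\<dots> = ip f g" by (simp add: h_def[abs_def] ip_def)
  finally show ?thesis using inner by (simp add: b_def[symmetric])
qed

text \<open>\<open>F\<close> is the continuous representative and \<open>s\<close> the approximating
  sequence. Identities are proved for the finite series of \<open>s n\<close>, pass to
  \<open>F\<close> in the mean on compact sets, and hold at every point by continuity.\<close>

locale zak_rep =
  fixes \<alpha> :: real and \<phi> :: "real \<Rightarrow> complex" and F :: "real \<times> real \<Rightarrow> complex" and s :: "nat \<Rightarrow> real \<Rightarrow> complex"
  assumes a: "\<alpha> > 0" and phi: "\<phi> \<in> L2" and cF: "continuous_on UNIV F"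
    and s: "\<And>n. s n \<in> L2" "\<And>n. bounded {x. s n x \<noteq> 0}"
    and ls: "(\<lambda>n. L2_norm (\<lambda>x. s n x - \<phi> x)) \<longlonglongrightarrow> 0"
    and lK: "\<And>K. compact K \<Longrightarrow>
       (\<lambda>n. \<integral>\<^sup>+p\<in>K. ennreal ((norm (zak_series \<alpha> (s n) p - F p))\<^sup>2) \<partial>lborel) \<longlonglongrightarrow> 0"
begin

abbreviation Z :: "nat \<Rightarrow> real \<times> real \<Rightarrow> complex" where "Z n \<equiv> zak_series \<alpha> (s n)"

lemma F_measurable [measurable]: "F \<in> borel_measurable borel"
  using cF by (rule borel_measurable_continuous_onI)

lemma Z_measurable [measurable]: "Z n \<in> borel_measurable borel"
  by (rule zak_series_measurable[OF a s])

lemma conv: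
  assumes "a' \<noteq> 0" "b' \<noteq> 0"
  shows "(\<lambda>n. \<integral>\<^sup>+z\<in>sq. ennreal ((norm (Z n (c + a' * snd z, d + b' * fst z) - F (c + a' * snd z, d + b' * fst z)))\<^sup>2) \<partial>lborel) \<longlonglongrightarrow> 0"
proof (rule tendsto_sandwich[of "\<lambda>_. 0"])
  let ?K = "cbox (c - \<bar>a'\<bar>, d - \<bar>b'\<bar>) (c + \<bar>a'\<bar>, d + \<bar>b'\<bar>)"
  let ?u = "\<lambda>n. ennreal (1 / (\<bar>a'\<bar> * \<bar>b'\<bar>)) * (\<integral>\<^sup>+p\<in>?K. ennreal ((norm (Z n p - F p))\<^sup>2) \<partial>lborel)"
  have "(\<lambda>n. ?u n) \<longlonglongrightarrow> ennreal (1 / (\<bar>a'\<bar> * \<bar>b'\<bar>)) * 0"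
    by (intro ennreal_tendsto_cmult lK compact_cbox) auto
  then show "?u \<longlonglongrightarrow> 0" by simp
  show "eventually (\<lambda>n. (\<integral>\<^sup>+z\<in>sq. ennreal ((norm (Z n (c + a' * snd z, d + b' * fst z) - F (c + a' * snd z, d + b' * fst z)))\<^sup>2) \<partial>lborel) \<le> ?u n) sequentially"
    by (intro always_eventually allI nn_integral_sq_affine_le[where h = "\<lambda>p. ennreal ((norm (Z _ p - F p))\<^sup>2)"] assms) measurable
qed auto

lemma conv1:
  "(\<lambda>n. \<integral>\<^sup>+z\<in>sq. ennreal ((norm (Z n (c + snd z, d + fst z) - F (c + snd z, d + fst z)))\<^sup>2) \<partial>lborel) \<longlonglongrightarrow> 0"
  using conv[of 1 1 c d] by simp

text \<open>The defect \<open>D\<close> of the identity, based so that the given point sits at the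
  corner of the unit square, is the difference of two approximation errors that tend to 0 in the
  mean; being continuous it vanishes at the corner.\<close>

lemma F_transform:
  assumes Zt: "\<And>n x \<omega>. Z n (x + u, \<omega> + v) = ee (l x \<omega>) * Z n (x, \<omega>)" and cl: "continuous_on UNIV (\<lambda>p. l (fst p) (snd p))"
  shows "F (x + u, \<omega> + v) = ee (l x \<omega>) * F (x, \<omega>)"
proof -
  define D where "D z = F (x + u + snd z, \<omega> + v + fst z) - ee (l (x + snd z) (\<omega> + fst z)) * F (x + snd z, \<omega> + fst z)" for z
  have cl': "continuous_on UNIV (\<lambda>z. l (x + snd z) (\<omega> + fst z))"
  proof -
    have "continuous_on UNIV (\<lambda>z :: real \<times> real. (x + snd z, \<omega> + fst z))" by (intro continuous_intros)
    from continuous_on_compose2[OF cl this] show ?thesis by simp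
  qed
  have cD: "continuous_on UNIV D" unfolding D_def
    by (intro continuous_intros cl' continuous_on_compose2[OF cF]) auto
  have [measurable]: "(\<lambda>z. l (x + snd z) (\<omega> + fst z)) \<in> borel_measurable borel"
    by (rule borel_measurable_continuous_onI[OF cl'])
  let ?e = "\<lambda>c d n. \<integral>\<^sup>+z\<in>sq. ennreal ((norm (Z n (c + snd z, d + fst z) - F (c + snd z, d + fst z)))\<^sup>2) \<partial>lborel"
  have [measurable]: "(\<lambda>z. G (c + snd z, d + fst z)) \<in> borel_measurable borel"
    if "G \<in> borel_measurable borel" for G :: "real \<times> real \<Rightarrow> complex" and c d
  proof -
    have "(\<lambda>z :: real \<times> real. (c + snd z, d + fst z)) \<in> borel_measurable borel"
      by (intro borel_measurable_continuous_onI continuous_intros)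
    from measurable_compose[OF this that] show ?thesis .
  qed
  have le: "(\<integral>\<^sup>+z\<in>sq. ennreal ((norm (D z))\<^sup>2) \<partial>lborel) \<le> 2 * ?e (x + u) (\<omega> + v) n + 2 * ?e x \<omega> n" for n
  proof -
    have "(\<integral>\<^sup>+z\<in>sq. ennreal ((norm (D z))\<^sup>2) \<partial>lborel) \<le> (\<integral>\<^sup>+z. 2 * (ennreal ((norm (Z n (x + u + snd z, \<omega> + v + fst z) - F (x + u + snd z, \<omega> + v + fst z)))\<^sup>2) * indicator sq z)
      + 2 * (ennreal ((norm (Z n (x + snd z, \<omega> + fst z) - F (x + snd z, \<omega> + fst z)))\<^sup>2) * indicator sq z) \<partial>lborel)"
    proof (rule nn_integral_mono)
      fix z :: "real \<times> real"
      let ?A = "Z n (x + u + snd z, \<omega> + v + fst z) - F (x + u + snd z, \<omega> + v + fst z)"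
      let ?B = "Z n (x + snd z, \<omega> + fst z) - F (x + snd z, \<omega> + fst z)"
      let ?c = "ee (l (x + snd z) (\<omega> + fst z))"
      have "Z n (x + u + snd z, \<omega> + v + fst z) = ?c * Z n (x + snd z, \<omega> + fst z)"
        using Zt[of n "x + snd z" "\<omega> + fst z"] by (simp add: ac_simps)
      then have "D z = - ?A + ?c * ?B" by (simp add: D_def algebra_simps)
      then have "(norm (D z))\<^sup>2 \<le> 2 * (norm ?A)\<^sup>2 + 2 * (norm ?B)\<^sup>2"
        using sq_norm_add_le[of "- ?A" "?c * ?B"] by (simp only: norm_minus_cancel norm_mult norm_ee mult_1)
      then have "ennreal ((norm (D z))\<^sup>2) \<le> ennreal (2 * (norm ?A)\<^sup>2 + 2 * (norm ?B)\<^sup>2)"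
        by (rule ennreal_leI)
      also have "\<dots> = 2 * ennreal ((norm ?A)\<^sup>2) + 2 * ennreal ((norm ?B)\<^sup>2)"
        by (simp add: ennreal_mult)
      finally have "ennreal ((norm (D z))\<^sup>2) \<le> 2 * ennreal ((norm ?A)\<^sup>2) + 2 * ennreal ((norm ?B)\<^sup>2)" .
      then show "ennreal ((norm (D z))\<^sup>2) * indicator sq z \<le> 
        2 * (ennreal ((norm ?A)\<^sup>2) * indicator sq z) + 2 * (ennreal ((norm ?B)\<^sup>2) * indicator sq z)"
        by (auto simp: indicator_def)
    qed
    also have "\<dots> = 2 * ?e (x + u) (\<omega> + v) n + 2 * ?e x \<omega> n"
      by (subst nn_integral_add) (auto simp: nn_integral_cmult)
    finally show ?thesis .
  qed
  have "(\<lambda>n. 2 * ?e (x + u) (\<omega> + v) n + 2 * ?e x \<omega> n) \<longlonglongrightarrow> 2 * 0 + 2 * 0"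
    by (intro tendsto_add ennreal_tendsto_cmult conv1) auto
  then have "(\<integral>\<^sup>+z\<in>sq. ennreal ((norm (D z))\<^sup>2) \<partial>lborel) \<le> 2 * 0 + 2 * 0"
    by (rule tendsto_lowerbound) (use le in auto)
  then have "(\<integral>\<^sup>+z\<in>sq. ennreal ((norm (D z))\<^sup>2) \<partial>lborel) = 0" by simp
  then have "D (0, 0) = 0" by (intro continuous_zero_on_sq[OF cD]) auto
  then show ?thesis by (simp add: D_def)
qed

lemma F_quasiperiodic: "F (x + \<alpha>, \<omega>) = ee (\<alpha> * \<omega>) * F (x, \<omega>)"
  using F_transform[where u = \<alpha> and v = 0 and l = "\<lambda>x \<omega>. \<alpha> * \<omega>" and x = x and \<omega> = \<omega>]
  by (simp add: zak_series_quasiperiodic continuous_intros)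

lemma F_periodic: "F (x, \<omega> + 1 / \<alpha>) = F (x, \<omega>)"
  using F_transform[where u = 0 and v = "1 / \<alpha>" and l = "\<lambda>x \<omega>. 0" and x = x and \<omega> = \<omega>] a
  by (simp add: zak_series_periodic)

lemma F_periodic_nat: "F (x, \<omega> - real m / \<alpha>) = F (x, \<omega>)"
proof -
  have "F ((x, \<omega>) + of_int (- int m) *\<^sub>R (0, 1 / \<alpha>)) = F (x, \<omega>)"
    by (rule periodic_of_int) (metis F_periodic add.right_neutral add_Pair prod.collapse)
  then show ?thesis by simp
qed

text \<open>By \<open>zak_series_rho\<close> this represents the Zak transform of
  \<open>rho q \<phi>\<close>.\<close>

definition Psi :: "real \<times> real \<Rightarrow> real \<Rightarrow> real \<Rightarrow> complex" where
  "Psi q X \<Omega> = ee (snd q * X - fst q * snd q / 2) * F (X - fst q, \<Omega> - snd q)"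

lemma ip_tendsto: "(\<lambda>n. ip (rho q (s n)) (rho q' (s n))) \<longlonglongrightarrow> ip (rho q \<phi>) (rho q' \<phi>)"
proof -
  define d where "d n = L2_norm (\<lambda>x. s n x - \<phi> x)" for n
  have d: "d \<longlonglongrightarrow> 0" using ls by (simp add: d_def[abs_def])
  define N where "N = L2_norm \<phi>"
  have b: "norm (ip (rho q (s n)) (rho q' (s n)) - ip (rho q \<phi>) (rho q' \<phi>)) \<le> d n * d n + d n * N + N * d n" for n
  proof -
    define u where "u = (\<lambda>x. s n x - \<phi> x)"
    have u: "u \<in> L2" unfolding u_def by (rule L2_diff[OF s(1) phi])
    have r: "rho p (s n) = (\<lambda>x. rho p u x + rho p \<phi> x)" for p
      by (simp add: rho_def u_def algebra_simps)
    have L: "rho p u \<in> L2" "rho p \<phi> \<in> L2" for p using rho_L2 u phi by auto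
    have add2: "ip f (\<lambda>x. g x + h x) = ip f g + ip f h" if "f \<in> L2" "g \<in> L2" "h \<in> L2" for f g h
      using ip_add1[of g h f] that by (metis complex_cnj_add ip_cnj)
    have "ip (rho q (s n)) (rho q' (s n)) - ip (rho q \<phi>) (rho q' \<phi>) = 
       ip (rho q u) (rho q' u) + ip (rho q u) (rho q' \<phi>) + ip (rho q \<phi>) (rho q' u)"
      unfolding r by (simp add: ip_add1 add2 L L2_add)
    also have "norm \<dots> \<le> norm (ip (rho q u) (rho q' u)) + norm (ip (rho q u) (rho q' \<phi>)) + norm (ip (rho q \<phi>) (rho q' u))"
      by (intro order_trans[OF norm_triangle_ineq] add_mono norm_triangle_ineq order_refl)
    also have "\<dots> \<le> L2_norm (rho q u) * L2_norm (rho q' u) + L2_norm (rho q u) * L2_norm (rho q' \<phi>) + L2_norm (rho q \<phi>) * L2_norm (rho q' u)"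
      by (intro add_mono ip_cauchy_schwarz L)
    finally show ?thesis by (simp add: L2_norm_rho d_def N_def u_def)
  qed
  have "(\<lambda>n. d n * d n + d n * N + N * d n) \<longlonglongrightarrow> 0 * 0 + 0 * N + N * 0"
    by (intro tendsto_add tendsto_mult d tendsto_const)
  then have "(\<lambda>n. d n * d n + d n * N + N * d n) \<longlonglongrightarrow> 0" by simp
  from Lim_null_comparison[OF _ this, of "\<lambda>n. ip (rho q (s n)) (rho q' (s n)) - ip (rho q \<phi>) (rho q' \<phi>)"]
  have "(\<lambda>n. ip (rho q (s n)) (rho q' (s n)) - ip (rho q \<phi>) (rho q' \<phi>)) \<longlonglongrightarrow> 0"
    using b by auto
  then show ?thesis by (simp add: LIM_zero_iff)
qed

lemma finite_measure_sqM: "finite_measure sqM"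
proof
  have "emeasure lborel sq < \<infinity>" by (rule emeasure_compact_finite) simp
  then show "emeasure sqM (space sqM) \<noteq> \<infinity>"
    by (simp add: emeasure_restrict_space space_restrict_space less_top[symmetric])
qed

lemma Psi_comp_continuous:
  assumes "continuous_on S q" "continuous_on S X" "continuous_on S W"
  shows "continuous_on S (\<lambda>p. Psi (q p) (X p) (W p))"
  unfolding Psi_def by (intro continuous_intros continuous_on_compose2[OF cF] assms) auto

text \<open>Both sides of the unitarity for \<open>s n\<close> converge: the inner products because
  the shifts are isometric, the integrals over the square because the limit functions are continuous
  and hence bounded there.\<close>

lemma integral_Psi:
  fixes p :: nat
  assumes p: "p > 0"
  shows "integral sq (\<lambda>z. \<Sum>j<p. of_real (\<alpha> / p) * (Psi q (\<alpha> / p * (snd z + j)) (- (fst z / \<alpha>)) *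
     cnj (Psi q' (\<alpha> / p * (snd z + j)) (- (fst z / \<alpha>))))) = ip (rho q \<phi>) (rho q' \<phi>)"
proof -
  interpret finite_measure sqM by (rule finite_measure_sqM)
  let ?X = "\<lambda>j z. \<alpha> / p * (snd z + real j)" and ?W = "\<lambda>z. - (fst z / \<alpha>)"
  let ?G = "\<lambda>q j z. Psi q (?X j z) (?W z)"
  let ?Gn = "\<lambda>q j n z. zak_series \<alpha> (rho q (s n)) (?X j z, ?W z)"
  have cG: "continuous_on UNIV (?G q j)" for q j
    using a by (intro Psi_comp_continuous continuous_intros) auto
  have conv_n: "(\<lambda>n. \<integral>\<^sup>+z. ennreal ((norm (?Gn q j n z - ?G q j z))\<^sup>2) \<partial>sqM) \<longlonglongrightarrow> 0" for q j
  proof -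
    have "(\<integral>\<^sup>+z. ennreal ((norm (?Gn q j n z - ?G q j z))\<^sup>2) \<partial>sqM) = 
      (\<integral>\<^sup>+z\<in>sq. ennreal ((norm (Z n ((\<alpha> / p * j - fst q) + \<alpha> / p * snd z, (- snd q) + (- (1 / \<alpha>)) * fst z) - 
         F ((\<alpha> / p * j - fst q) + \<alpha> / p * snd z, (- snd q) + (- (1 / \<alpha>)) * fst z)))\<^sup>2) \<partial>lborel)" for n
    proof -
      have "norm (?Gn q j n z - ?G q j z) = norm (Z n ((\<alpha> / p * j - fst q) + \<alpha> / p * snd z, (- snd q) + (- (1 / \<alpha>)) * fst z) - 
         F ((\<alpha> / p * j - fst q) + \<alpha> / p * snd z, (- snd q) + (- (1 / \<alpha>)) * fst z))" for z
      proof -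
        have e: "?X j z - fst q = (\<alpha> / p * j - fst q) + \<alpha> / p * snd z" "?W z - snd q = (- snd q) + (- (1 / \<alpha>)) * fst z"
          by (simp_all add: algebra_simps)
        have "?Gn q j n z - ?G q j z = ee (snd q * ?X j z - fst q * snd q / 2) * (Z n (?X j z - fst q, ?W z - snd q) - F (?X j z - fst q, ?W z - snd q))"
          unfolding zak_series_rho Psi_def by (simp only: right_diff_distrib)
        then show ?thesis unfolding e by (simp only: norm_mult norm_ee mult_1)
      qed
      then show ?thesis by (simp only: nn_integral_restrict_space[of sq lborel] sets.Int_space_eq2 sets_lborel space_lborel Int_UNIV_right borel_closed closed_cbox)
    qed
    moreover have "\<alpha> / p \<noteq> 0" "- (1 / \<alpha>) \<noteq> 0" using a p by auto
    ultimately show ?thesis using conv by presburger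
  qed
  have mGn: "?Gn q j n \<in> borel_measurable sqM" for q j n
  proof (rule measurable_restrict_space1)
    have [measurable]: "zak_series \<alpha> (rho q (s n)) \<in> borel_measurable borel"
    proof (rule zak_series_measurable[OF a rho_L2[OF s(1)]])
      obtain r where r: "\<And>y. \<bar>y\<bar> > r \<Longrightarrow> s n y = 0" using bounded_supportE[OF s(2)] by blast
      have "{x. rho q (s n) x \<noteq> 0} \<subseteq> {fst q - r..fst q + r}"
        using r by (force simp: rho_def abs_if not_less split: if_splits)
      then show "bounded {x. rho q (s n) x \<noteq> 0}" using bounded_closed_interval bounded_subset by blast
    qed
    have "(\<lambda>z. (?X j z, ?W z)) \<in> borel_measurable borel"
      using a by (intro borel_measurable_continuous_onI continuous_intros) auto
    from measurable_compose[OF this, of "zak_series \<alpha> (rho q (s n))" borel]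
    show "?Gn q j n \<in> borel_measurable lborel" by simp
  qed
  have mG: "?G q j \<in> borel_measurable sqM" for q j
    by (rule measurable_restrict_space1) (use borel_measurable_continuous_onI[OF cG] in simp)
  have bound: "\<exists>C\<ge>0. \<forall>z\<in>sq. norm (?G q j z) \<le> C" for q j
  proof -
    have "bounded (?G q j ` sq)"
      by (intro compact_imp_bounded compact_continuous_image continuous_on_subset[OF cG]) auto
    then obtain C where "\<forall>z\<in>sq. norm (?G q j z) \<le> C" unfolding bounded_iff by blast
    then have "\<forall>z\<in>sq. norm (?G q j z) \<le> max C 0" by (meson max.cobounded1 order_trans)
    then show ?thesis using max.cobounded2 by blast
  qed
  have lim: "(\<lambda>n. \<integral>z. ?Gn q j n z * cnj (?Gn q' j n z) \<partial>sqM) \<longlonglongrightarrow> (\<integral>z. ?G q j z * cnj (?G q' j z) \<partial>sqM)" for j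
  proof -
    obtain C1 C2 where C: "C1 \<ge> 0" "\<forall>z\<in>sq. norm (?G q j z) \<le> C1" "C2 \<ge> 0" "\<forall>z\<in>sq. norm (?G q' j z) \<le> C2"
      using bound by metis
    show ?thesis
    proof (rule integral_prod_tendsto[where C = "max C1 C2"])
      show "norm (?G q j z) \<le> max C1 C2" "norm (?G q' j z) \<le> max C1 C2" if "z \<in> space sqM" for z
        using C that by (auto simp: space_restrict_space le_max_iff_disj)
    qed (use C mGn mG conv_n in auto)
  qed
  have supp: "bounded {x. rho q (s n) x \<noteq> 0}" for q n
  proof -
    obtain r where r: "\<And>y. \<bar>y\<bar> > r \<Longrightarrow> s n y = 0" using bounded_supportE[OF s(2)] by blast
    have "{x. rho q (s n) x \<noteq> 0} \<subseteq> {fst q - r..fst q + r}"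
      using r by (force simp: rho_def abs_if not_less split: if_splits)
    then show ?thesis using bounded_closed_interval bounded_subset by blast
  qed
  have "(\<lambda>n. \<Sum>j<p. of_real (\<alpha> / p) * (\<integral>z. ?Gn q j n z * cnj (?Gn q' j n z) \<partial>sqM)) \<longlonglongrightarrow>
     (\<Sum>j<p. of_real (\<alpha> / p) * (\<integral>z. ?G q j z * cnj (?G q' j z) \<partial>sqM))"
    by (intro tendsto_sum tendsto_mult tendsto_const lim)
  then have "(\<lambda>n. ip (rho q (s n)) (rho q' (s n))) \<longlonglongrightarrow> (\<Sum>j<p. of_real (\<alpha> / p) * (\<integral>z. ?G q j z * cnj (?G q' j z) \<partial>sqM))"
    by (simp only: zak_series_unitary[OF a p rho_L2[OF s(1)] supp rho_L2[OF s(1)] supp])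
  note l = LIMSEQ_unique[OF this ip_tendsto]
  have c: "continuous_on sq (\<lambda>z. ?G q j z * cnj (?G q' j z))" for j
    by (intro continuous_intros continuous_on_subset[OF cG]) auto
  from l
  have "(\<Sum>j<p. of_real (\<alpha> / p) * (\<integral>z. ?G q j z * cnj (?G q' j z) \<partial>sqM)) = ip (rho q \<phi>) (rho q' \<phi>)" .
  moreover have "(\<integral>z. ?G q j z * cnj (?G q' j z) \<partial>sqM) = integral sq (\<lambda>z. ?G q j z * cnj (?G q' j z))" for j
  proof -
    have "(\<integral>z. ?G q j z * cnj (?G q' j z) \<partial>sqM) = (LINT z : sq | lborel. ?G q j z * cnj (?G q' j z))"
      unfolding set_lebesgue_integral_def by (rule integral_restrict_space) simp
    also have "\<dots> = integral sq (\<lambda>z. ?G q j z * cnj (?G q' j z))"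
      by (rule set_borel_integral_eq_integral)
         (unfold set_integrable_def, rule borel_integrable_compact[OF compact_cbox c])
    finally show ?thesis .
  qed
  moreover have "integral sq (\<lambda>z. \<Sum>j<p. of_real (\<alpha> / p) * (?G q j z * cnj (?G q' j z))) = 
    (\<Sum>j<p. of_real (\<alpha> / p) * integral sq (\<lambda>z. ?G q j z * cnj (?G q' j z)))"
    by (subst Henstock_Kurzweil_Integration.integral_sum, simp)
       (intro integrable_continuous continuous_on_mult continuous_on_const c, simp)
  ultimately show ?thesis by simp
qed

end

theorem zak_case:
  fixes \<alpha> \<beta> :: real
  assumes phi: "\<phi> \<in> L2" and a: "\<alpha> > 0" and b: "\<beta> > 0" and rat: "\<alpha> * \<beta> \<in> \<rat>"
    and lower: "lower_riesz A \<phi> (pt (\<alpha>, 0) (0, \<beta>) ` latt)" and A: "A > 0"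
    and zak: "zak_transform_continuous \<alpha> \<phi>"
    and mem: "tf_shift q \<phi> \<in> gabor_space \<phi> (pt (\<alpha>, 0) (0, \<beta>) ` latt)"
  shows "q \<in> pt (\<alpha>, 0) (0, \<beta>) ` latt"
proof -
  obtain F where F: "has_zak_transform \<alpha> \<phi> F" "continuous_on UNIV F"
    using zak unfolding zak_transform_continuous_def by blast
  then obtain s where "zak_rep \<alpha> \<phi> F s"
    using a phi unfolding has_zak_transform_def zak_rep_def by blast
  then interpret zak_rep \<alpha> \<phi> F s .
  have ab: "\<alpha> * \<beta> > 0" using a b by simp
  obtain m n :: nat where mn: "n \<noteq> 0" "\<bar>\<alpha> * \<beta>\<bar> = real m / real n" "coprime m n"
    using Rats_abs_nat_div_natE[OF rat] by metis
  have n: "n > 0" using mn by simp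
  have e: "\<alpha> * \<beta> = real m / real n" using mn ab by simp
  have m: "m > 0" using e ab n by (auto simp: zero_less_divide_iff intro: Nat.gr0I)
  have bn: "\<beta> * real n = real m / \<alpha>" using e a n by (simp add: field_simps)
  let ?pt = "pt (\<alpha>, 0) (0, \<beta>)"
  have pt: "fst (?pt x) = fst x * \<alpha>" "snd (?pt x) = snd x * \<beta>" for x by (simp_all add: pt_def)
  have sg: "sigma (\<alpha>, 0) (0, \<beta>) = - (\<alpha> * \<beta>)" by (simp add: sigma_def)
  \<comment> \<open>With \<alpha> \<beta> = m / n the second sublattice generator
    \<open>bv n\<close> modulates by \<beta> n = m / \<alpha>. On the piece j this is the factor
    \<open>ee (snd z + j)\<close>, equal to \<open>ee (snd z)\<close>; hence the step \<alpha> / m.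
    The frequency is - fst z / \<alpha> because translation by \<alpha> multiplies a Zak transform
    by \<open>ee\<close> of minus \<alpha> times the frequency. The area has a negative sign, so P =
    -m.\<close>
  define X where "X z j = \<alpha> / real m * (snd z + real j)" for z :: "real \<times> real" and j :: nat
  define W where "W z = - (fst z / \<alpha>)" for z :: "real \<times> real"
  define K where "K z x y = (\<Sum>j<m. of_real (\<alpha> / real m) * (Psi (?pt x) (X z j) (W z) * cnj (Psi (?pt y) (X z j) (W z))))"
    for z x y
  have scale: "K z' x' y' = c * K z x y" 
    if "\<And>j. Psi (?pt x') (X z' j) (W z') * cnj (Psi (?pt y') (X z' j) (W z')) = c * (Psi (?pt x) (X z j) (W z) * cnj (Psi (?pt y) (X z j) (W z)))"
    for z z' x x' y y' c
    unfolding K_def sum_distrib_left by (intro sum.cong refl) (simp add: that)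
  show ?thesis
  proof (rule not_in_gabor_space_off_lattice[OF phi lower A n, of "- int m", where K = K])
    show "coprime (- int m) (int n)" using mn(3) by simp
    show "sigma (\<alpha>, 0) (0, \<beta>) = of_int (- int m) / of_nat n" using e by (simp add: sg)
    show "- int m \<noteq> 0" using m by simp
    show "K z y x = cnj (K z x y)" for z x y unfolding K_def by (simp add: mult.commute)
    show "continuous_on UNIV (\<lambda>p. K (snd p) (fst p) y)" for y
      unfolding K_def X_def W_def pt_def using a m
      by (intro continuous_intros Psi_comp_continuous) auto
    show "K (z + (1, 0)) x y = K z x y" for z x y
    proof -
      have "Psi p V (W (z + (1, 0))) = Psi p V (W z)" for p V
      proof -
        have "W (z + (1, 0)) - snd p = (W z - snd p) - real 1 / \<alpha>" by (simp add: W_def add_divide_distrib)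
        then show ?thesis unfolding Psi_def by (simp only: F_periodic_nat)
      qed
      then show ?thesis unfolding K_def X_def by simp
    qed
    show "K (z + (0, 1)) x y = K z x y" for z x y
    proof -
      define t where "t j = of_real (\<alpha> / real m) * (Psi (?pt x) (X z j) (W z) * cnj (Psi (?pt y) (X z j) (W z)))" for j
      have Xs: "X (z + (0, 1)) j = X z (Suc j)" for j by (simp add: X_def algebra_simps)
      have "K (z + (0, 1)) x y = (\<Sum>j<m. t (Suc j))"
        unfolding K_def t_def Xs by (simp add: W_def)
      also have "\<dots> = (\<Sum>j<m. t j) + t m - t 0" using sum.lessThan_Suc_shift[of t m] by simp
      \<comment> \<open>Adding (0, 1) to z moves every piece to the next one. The last lands one
        full \<alpha> beyond the first, and its quasi-periodic phase cancels between the two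
        factors.\<close>
      also have "t m = t 0"
      proof -
        have Xm: "X z m = X z 0 + \<alpha>" using m by (simp add: X_def algebra_simps)
        have "Psi p (X z 0 + \<alpha>) w = ee (\<alpha> * w) * Psi p (X z 0) w" for p w
        proof -
          have "F (X z 0 + \<alpha> - fst p, w - snd p) = ee (\<alpha> * (w - snd p)) * F (X z 0 - fst p, w - snd p)"
            using F_quasiperiodic[of "X z 0 - fst p" "w - snd p"] by (simp add: algebra_simps)
          moreover have "ee (snd p * (X z 0 + \<alpha>) - fst p * snd p / 2) * ee (\<alpha> * (w - snd p)) = ee (\<alpha> * w) * ee (snd p * X z 0 - fst p * snd p / 2)"
            unfolding ee_add[symmetric] by (rule arg_cong[of _ _ ee]) (simp add: algebra_simps)
          ultimately show ?thesis unfolding Psi_def by (simp add: mult.assoc[symmetric])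
        qed
        then show ?thesis unfolding t_def Xm by (simp only: ee_cnj)
      qed
      finally show ?thesis by (simp add: K_def t_def)
    qed
    show "K z (x + (1, 0)) y = ee (fst z - sigma (\<alpha>, 0) (0, \<beta>) / 2 * snd x) * K z x y" for z x y
    proof (rule scale)
      fix j
      let ?p = "?pt x"
      have p': "fst (?pt (x + (1, 0))) = fst ?p + \<alpha>" "snd (?pt (x + (1, 0))) = snd ?p"
        by (simp_all add: pt algebra_simps)
      have "F (X z j - fst ?p, W z - snd ?p) = ee (\<alpha> * (W z - snd ?p)) * F (X z j - (fst ?p + \<alpha>), W z - snd ?p)"
        using F_quasiperiodic[of "X z j - (fst ?p + \<alpha>)" "W z - snd ?p"] by (simp add: algebra_simps)
      moreover have "ee (fst z - sigma (\<alpha>, 0) (0, \<beta>) / 2 * snd x) * ee (snd ?p * X z j - fst ?p * snd ?p / 2) * ee (\<alpha> * (W z - snd ?p)) = 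
         ee (snd ?p * X z j - (fst ?p + \<alpha>) * snd ?p / 2)"
        unfolding ee_add[symmetric] sg pt W_def using a by (intro arg_cong[of _ _ ee]) (simp add: field_simps)
      ultimately have "Psi (?pt (x + (1, 0))) (X z j) (W z) = ee (fst z - sigma (\<alpha>, 0) (0, \<beta>) / 2 * snd x) * Psi ?p (X z j) (W z)"
        unfolding Psi_def p' by (simp only: mult.assoc[symmetric])
      then show "Psi (?pt (x + (1, 0))) (X z j) (W z) * cnj (Psi (?pt y) (X z j) (W z)) =
         ee (fst z - sigma (\<alpha>, 0) (0, \<beta>) / 2 * snd x) * (Psi ?p (X z j) (W z) * cnj (Psi (?pt y) (X z j) (W z)))"
        by (simp only: mult.assoc)
    qed
    show "K z (x + bv n) y = ee (snd z + of_int (- int m) / 2 * fst x) * K z x y" for z x y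
    proof (rule scale)
      fix j
      let ?p = "?pt x"
      have p': "fst (?pt (x + bv n)) = fst ?p" "snd (?pt (x + bv n)) = snd ?p + real m / \<alpha>"
        using bn by (simp_all add: pt algebra_simps)
      have "W z - (snd ?p + real m / \<alpha>) = (W z - snd ?p) - real m / \<alpha>" by simp
      then have 1: "F (X z j - fst ?p, W z - (snd ?p + real m / \<alpha>)) = F (X z j - fst ?p, W z - snd ?p)"
        by (simp only: F_periodic_nat)
      have "ee ((snd ?p + real m / \<alpha>) * X z j - fst ?p * (snd ?p + real m / \<alpha>) / 2) =
        ee (snd z + of_int (- int m) / 2 * fst x + (snd ?p * X z j - fst ?p * snd ?p / 2))"
      proof (rule ee_cong[of _ _ "int j"])
        have "real m / \<alpha> * X z j = snd z + real j" using a m by (simp add: X_def)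
        moreover have "fst ?p * (real m / \<alpha>) = real m * fst x" using a by (simp add: pt)
        ultimately show "(snd ?p + real m / \<alpha>) * X z j - fst ?p * (snd ?p + real m / \<alpha>) / 2 -
          (snd z + of_int (- int m) / 2 * fst x + (snd ?p * X z j - fst ?p * snd ?p / 2)) = real_of_int (int j)"
          by (simp add: distrib_left distrib_right add_divide_distrib)
      qed
      then have "Psi (?pt (x + bv n)) (X z j) (W z) = ee (snd z + of_int (- int m) / 2 * fst x) * Psi ?p (X z j) (W z)"
        unfolding Psi_def p' 1 by (simp only: ee_add mult.assoc)
      then show "Psi (?pt (x + bv n)) (X z j) (W z) * cnj (Psi (?pt y) (X z j) (W z)) =
         ee (snd z + of_int (- int m) / 2 * fst x) * (Psi ?p (X z j) (W z) * cnj (Psi (?pt y) (X z j) (W z)))"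
        by (simp only: mult.assoc)
    qed
    show "K z (w + x) (w + y) = ee (sigma (\<alpha>, 0) (0, \<beta>) / 2 * (wedge w y - wedge w x)) *
        K (z + (- sigma (\<alpha>, 0) (0, \<beta>) * snd w, of_int (- int m) * fst w)) x y" for z w x y
    proof (rule scale)
      fix j
      let ?z = "z + (- sigma (\<alpha>, 0) (0, \<beta>) * snd w, of_int (- int m) * fst w)"
      have Xs: "X ?z j = X z j - fst (?pt w)" using m by (simp add: X_def pt field_simps)
      have Ws: "W ?z = W z - snd (?pt w)" using a by (simp add: W_def pt sg field_simps)
      have P: "Psi (?pt (w + x)) (X z j) (W z) = ee (snd (?pt w) * X z j - fst (?pt w) * snd (?pt w) / 2) * 
        (ee (- sigma (\<alpha>, 0) (0, \<beta>) / 2 * wedge w x) * Psi (?pt x) (X ?z j) (W ?z))" for x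
      proof -
        have "ee (snd (?pt (w + x)) * X z j - fst (?pt (w + x)) * snd (?pt (w + x)) / 2) = 
          ee (snd (?pt w) * X z j - fst (?pt w) * snd (?pt w) / 2) * ee (- sigma (\<alpha>, 0) (0, \<beta>) / 2 * wedge w x) *
          ee (snd (?pt x) * (X z j - fst (?pt w)) - fst (?pt x) * snd (?pt x) / 2)"
          unfolding ee_add[symmetric] pt sg wedge_def
          by (rule arg_cong[of _ _ ee]) (simp add: field_simps)
        moreover have "X z j - fst (?pt (w + x)) = X z j - fst (?pt w) - fst (?pt x)" "W z - snd (?pt (w + x)) = W z - snd (?pt w) - snd (?pt x)"
          by (simp_all add: pt algebra_simps)
        ultimately show ?thesis unfolding Psi_def Xs Ws by (simp only: mult.assoc)
      qed
      have "ee (- sigma (\<alpha>, 0) (0, \<beta>) / 2 * wedge w x) * cnj (ee (- sigma (\<alpha>, 0) (0, \<beta>) / 2 * wedge w y)) = 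
        ee (sigma (\<alpha>, 0) (0, \<beta>) / 2 * (wedge w y - wedge w x))"
        unfolding cnj_ee ee_add[symmetric] by (rule arg_cong[of _ _ ee]) (simp add: algebra_simps)
      moreover have "(c * u) * cnj (d * v) = (c * cnj d) * (u * cnj v)" for c d u v :: complex
        by (simp only: complex_cnj_mult mult_ac)
      ultimately show "Psi (?pt (w + x)) (X z j) (W z) * cnj (Psi (?pt (w + y)) (X z j) (W z)) =
        ee (sigma (\<alpha>, 0) (0, \<beta>) / 2 * (wedge w y - wedge w x)) * (Psi (?pt x) (X ?z j) (W ?z) * cnj (Psi (?pt y) (X ?z j) (W ?z)))"
        unfolding P ee_cnj by (simp only:)
    qed
    show "integral sq (\<lambda>z. K z x y) = ip (psi \<phi> (\<alpha>, 0) (0, \<beta>) x) (psi \<phi> (\<alpha>, 0) (0, \<beta>) y)" for x y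
      unfolding K_def X_def W_def psi_def by (rule integral_Psi[OF m])
  qed (rule mem)
qed

section \<open>Moyal's formula for the Gaussian window\<close>

lemma L2_normI:
  assumes "f \<in> L2" "(\<integral>x. (norm (f x))\<^sup>2 \<partial>lborel) < \<epsilon>\<^sup>2" "\<epsilon> > 0"
  shows "L2_norm f < \<epsilon>"
  using assms unfolding L2_norm_def by (metis real_sqrt_less_iff real_sqrt_unique less_imp_le)

definition clip :: "real \<Rightarrow> complex \<Rightarrow> complex" where
  "clip M y = (M / max M (norm y)) *\<^sub>R y"

lemma clip_props:
  assumes M: "M > 0"
  shows "norm (clip M y) \<le> M" "norm (clip M y) \<le> norm y" "norm y \<le> M \<Longrightarrow> clip M y = y" "clip M 0 = 0"
proof -
  have m: "max M (norm y) > 0" using M by auto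
  have n: "norm (clip M y) = M * norm y / max M (norm y)" using M by (simp add: clip_def abs_of_pos m)
  have "M * norm y \<le> M * max M (norm y)" using M by (intro mult_left_mono) auto
  then show "norm (clip M y) \<le> M" unfolding n using m by (simp add: pos_divide_le_eq)
  have "M * norm y \<le> max M (norm y) * norm y" by (intro mult_right_mono) auto
  then show "norm (clip M y) \<le> norm y" unfolding n using m by (simp add: pos_divide_le_eq mult.commute)
  show "norm y \<le> M \<Longrightarrow> clip M y = y" using M by (simp add: clip_def max_def)
qed (simp add: clip_def)

lemma continuous_on_clip:
  assumes "M > 0"
  shows "continuous_on UNIV (clip M)"
proof -
  have "max M (norm y) \<noteq> 0" for y :: complex using assms by (auto simp: max_def)
  then show ?thesis unfolding clip_def
    by (intro continuous_on_scaleR continuous_on_divide continuous_on_max continuous_on_norm continuous_on_const continuous_on_id ballI)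
qed

definition cutoff :: "real \<Rightarrow> real \<Rightarrow> real" where
  "cutoff M x = max 0 (min 1 (M + 1 - \<bar>x\<bar>))"

lemma cutoff_props: "0 \<le> cutoff M x" "cutoff M x \<le> 1" "\<bar>x\<bar> \<le> M \<Longrightarrow> cutoff M x = 1" "\<bar>x\<bar> > M + 1 \<Longrightarrow> cutoff M x = 0"
  by (auto simp: cutoff_def max_def min_def)

lemma continuous_on_cutoff: "continuous_on UNIV (cutoff M)"
  unfolding cutoff_def by (intro continuous_intros)

text \<open>The truncation by \<open>clip\<close> and \<open>cutoff\<close> is continuous and is
  used twice: on \<open>v\<close>, giving a bounded function of bounded support near
  \<open>v\<close>, and on continuous functions converging to \<open>v\<close> almost everywhere,
  giving the common bound for dominated convergence.\<close>

lemma L2_dense_continuous: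
  assumes v: "v \<in> L2" and eps: "\<epsilon> > 0"
  obtains w where "continuous_on UNIV w" "bounded {x. w x \<noteq> 0}" "w \<in> L2" "L2_norm (\<lambda>x. v x - w x) < \<epsilon>"
proof -
  have vm [measurable]: "v \<in> borel_measurable borel" using v by (auto simp: L2_def)
  define vM where "vM M x = of_real (cutoff M x) * clip M (v x)" for M x
  have cm: "clip M \<in> borel_measurable borel" if "M > 0" for M
    by (rule borel_measurable_continuous_onI[OF continuous_on_clip[OF that]])
  have [measurable]: "cutoff M \<in> borel_measurable borel" for M
    by (rule borel_measurable_continuous_onI[OF continuous_on_cutoff])
  have vMm: "vM M \<in> borel_measurable borel" if "M > 0" for M
    unfolding vM_def using cm[OF that] by measurable
  have cc: "norm (of_real (cutoff M x) * clip M y) \<le> norm y" "norm (of_real (cutoff M x) * clip M y) \<le> M" if "M > 0" for M x y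
  proof -
    have "norm (of_real (cutoff M x) * clip M y) = cutoff M x * norm (clip M y)" by (simp add: norm_mult cutoff_props)
    also have "\<dots> \<le> 1 * norm (clip M y)" by (intro mult_right_mono cutoff_props) auto
    finally show "norm (of_real (cutoff M x) * clip M y) \<le> norm y" "norm (of_real (cutoff M x) * clip M y) \<le> M"
      using clip_props(1,2)[OF that, of y] by auto
  qed
  have vML2: "vM M \<in> L2" if "M > 0" for M
    unfolding L2_def
  proof (intro CollectI conjI)
    show "vM M \<in> borel_measurable lborel" using vMm[OF that] by simp
    show "integrable lborel (\<lambda>x. (norm (vM M x))\<^sup>2)"
    proof (rule Bochner_Integration.integrable_bound[OF L2_integrable_sq[OF v]])
      show "(\<lambda>x. (norm (vM M x))\<^sup>2) \<in> borel_measurable lborel" using vMm[OF that] by simp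
      show "AE x in lborel. norm ((norm (vM M x))\<^sup>2) \<le> norm ((norm (v x))\<^sup>2)"
        using cc(1)[OF that] by (auto simp: vM_def intro!: power_mono)
    qed
  qed
  have "(\<lambda>M. \<integral>x. (norm (v x - vM (real (Suc M)) x))\<^sup>2 \<partial>lborel) \<longlonglongrightarrow> (\<integral>x. 0 \<partial>(lborel :: real measure))"
  proof (rule integral_dominated_convergence[where w = "\<lambda>x. 4 * (norm (v x))\<^sup>2"])
    show "(\<lambda>x. (norm (v x - vM (real (Suc M)) x))\<^sup>2) \<in> borel_measurable lborel" for M
      using vMm[of "real (Suc M)"] by simp
    show "integrable lborel (\<lambda>x. 4 * (norm (v x))\<^sup>2)" using L2_integrable_sq[OF v] by simp
    show "AE x in lborel. (\<lambda>M. (norm (v x - vM (real (Suc M)) x))\<^sup>2) \<longlonglongrightarrow> 0"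
    proof (rule AE_I2)
      fix x
      obtain n0 where n0: "\<bar>x\<bar> + norm (v x) \<le> real n0" using real_arch_simple by blast
      have "eventually (\<lambda>M. (norm (v x - vM (real (Suc M)) x))\<^sup>2 = 0) sequentially"
        using eventually_ge_at_top[of n0]
      proof eventually_elim
        case (elim M)
        have "\<bar>x\<bar> \<le> real (Suc M)" "norm (v x) \<le> real (Suc M)" 
          using n0 of_nat_mono[OF elim, where 'a = real] norm_ge_zero[of "v x"] abs_ge_zero[of x]
          unfolding of_nat_Suc by linarith+
        then show ?case by (simp add: vM_def clip_props cutoff_props)
      qed
      then show "(\<lambda>M. (norm (v x - vM (real (Suc M)) x))\<^sup>2) \<longlonglongrightarrow> 0" by (rule tendsto_eventually)
    qed
    show "AE x in lborel. norm ((norm (v x - vM (real (Suc M)) x))\<^sup>2) \<le> 4 * (norm (v x))\<^sup>2" for M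
    proof (rule AE_I2)
      fix x
      have "norm (v x - vM (real (Suc M)) x) \<le> norm (v x) + norm (vM (real (Suc M)) x)" by (rule norm_triangle_ineq4)
      also have "\<dots> \<le> 2 * norm (v x)" using cc(1)[of "real (Suc M)" x "v x"] by (simp add: vM_def)
      finally have "(norm (v x - vM (real (Suc M)) x))\<^sup>2 \<le> (2 * norm (v x))\<^sup>2" by (intro power_mono) auto
      then show "norm ((norm (v x - vM (real (Suc M)) x))\<^sup>2) \<le> 4 * (norm (v x))\<^sup>2" by (simp add: power_mult_distrib)
    qed
  qed simp
  then have "(\<lambda>M. \<integral>x. (norm (v x - vM (real (Suc M)) x))\<^sup>2 \<partial>lborel) \<longlonglongrightarrow> 0" by simp
  \<comment> \<open>Each of the two squared errors is kept below \<epsilon>^2 / 4, since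
    \<open>sq_norm_add_le\<close> doubles both.\<close>
  from order_tendstoD(2)[OF this, of "\<epsilon>\<^sup>2 / 4"] eps
  obtain M0 where M0: "(\<integral>x. (norm (v x - vM (real (Suc M0)) x))\<^sup>2 \<partial>lborel) < \<epsilon>\<^sup>2 / 4"
    using eventually_happens by fastforce
  define M where "M = real (Suc M0)"
  have M: "M > 0" by (simp add: M_def)
  have "v \<in> borel_measurable (lebesgue_on UNIV)"
    unfolding lebesgue_on_UNIV_eq by (rule measurable_completion) (simp add: vm)
  then have "v measurable_on UNIV" by (subst measurable_on_iff_borel_measurable) auto
  then obtain N g where N: "negligible N" and g: "\<And>n::nat. continuous_on UNIV (g n)" "\<And>x. x \<notin> N \<Longrightarrow> (\<lambda>n. g n x) \<longlonglongrightarrow> v x"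
    unfolding measurable_on_def by auto
  have AE: "AE x in lborel. x \<notin> N"
  proof -
    have "N \<in> null_sets lebesgue" using N by (simp add: negligible_iff_null_sets)
    then have "AE x in lebesgue. x \<notin> N" by (rule AE_not_in)
    then show ?thesis by (simp add: AE_completion_iff)
  qed
  define wn where "wn n x = of_real (cutoff M x) * clip M (g n x)" for n x
  have cw: "continuous_on UNIV (wn n)" for n
    unfolding wn_def by (intro continuous_intros continuous_on_cutoff continuous_on_compose2[OF continuous_on_clip[OF M] g(1)]) auto
  have [measurable]: "wn n \<in> borel_measurable borel" for n by (rule borel_measurable_continuous_onI[OF cw])
  have [measurable]: "vM M \<in> borel_measurable borel" by (rule vMm[OF M])
  have supp: "wn n x = 0" "vM M x = 0" if "x \<notin> {- M - 1..M + 1}" for n x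
    using cutoff_props(4)[of M x] that by (auto simp: wn_def vM_def abs_if split: if_splits)
  have ii: "integrable lborel (\<lambda>x. C * indicator {- M - 1..M + 1} x :: real)" for C
    by (intro integrable_mult_right integrable_real_indicator) (auto simp: emeasure_lborel_Icc_eq)
  have wL2: "wn n \<in> L2" for n
    unfolding L2_def
  proof (intro CollectI conjI)
    show "integrable lborel (\<lambda>x. (norm (wn n x))\<^sup>2)"
    proof (rule Bochner_Integration.integrable_bound[OF ii[of "M\<^sup>2"]])
      have "(norm (wn n x))\<^sup>2 \<le> M\<^sup>2" for x using cc(2)[OF M] by (intro power_mono) (auto simp: wn_def)
      then show "AE x in lborel. norm ((norm (wn n x))\<^sup>2) \<le> norm (M\<^sup>2 * indicator {- M - 1..M + 1} x)"
        using supp(1) by (auto intro!: AE_I2 simp: indicator_def)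
    qed simp
  qed simp
  have "(\<lambda>n. \<integral>x. (norm (vM M x - wn n x))\<^sup>2 \<partial>lborel) \<longlonglongrightarrow> (\<integral>x. 0 \<partial>(lborel :: real measure))"
  proof (rule integral_dominated_convergence[where w = "\<lambda>x. 4 * M\<^sup>2 * indicator {- M - 1..M + 1} x"])
    show "integrable lborel (\<lambda>x. 4 * M\<^sup>2 * indicator {- M - 1..M + 1} x :: real)" by (rule ii)
    show "AE x in lborel. (\<lambda>n. (norm (vM M x - wn n x))\<^sup>2) \<longlonglongrightarrow> 0"
      using AE
    proof eventually_elim
      case (elim x)
      have "(\<lambda>n. clip M (g n x)) \<longlonglongrightarrow> clip M (v x)"
        using continuous_on_tendsto_compose[OF continuous_on_clip[OF M] g(2)[OF elim]] by simp
      then have "(\<lambda>n. (norm (vM M x - wn n x))\<^sup>2) \<longlonglongrightarrow> (norm (vM M x - of_real (cutoff M x) * clip M (v x)))\<^sup>2"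
        unfolding wn_def by (intro tendsto_power tendsto_norm tendsto_diff tendsto_mult tendsto_const)
      then show ?case by (simp add: vM_def)
    qed
    show "AE x in lborel. norm ((norm (vM M x - wn n x))\<^sup>2) \<le> 4 * M\<^sup>2 * indicator {- M - 1..M + 1} x" for n
    proof (rule AE_I2)
      fix x
      have "norm (vM M x - wn n x) \<le> norm (vM M x) + norm (wn n x)" by (rule norm_triangle_ineq4)
      also have "\<dots> \<le> 2 * M" using cc(2)[OF M, of x "v x"] cc(2)[OF M, of x "g n x"] unfolding vM_def wn_def by linarith
      finally have "(norm (vM M x - wn n x))\<^sup>2 \<le> (2 * M)\<^sup>2" by (intro power_mono) auto
      then show "norm ((norm (vM M x - wn n x))\<^sup>2) \<le> 4 * M\<^sup>2 * indicator {- M - 1..M + 1} x"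
        using supp[of x] by (auto simp: indicator_def power_mult_distrib)
    qed
  qed simp_all
  then have "(\<lambda>n. \<integral>x. (norm (vM M x - wn n x))\<^sup>2 \<partial>lborel) \<longlonglongrightarrow> 0" by simp
  from order_tendstoD(2)[OF this, of "\<epsilon>\<^sup>2 / 4"] eps
  obtain n where n: "(\<integral>x. (norm (vM M x - wn n x))\<^sup>2 \<partial>lborel) < \<epsilon>\<^sup>2 / 4"
    using eventually_happens by fastforce
  have d: "(\<lambda>x. v x - vM M x) \<in> L2" "(\<lambda>x. vM M x - wn n x) \<in> L2" "(\<lambda>x. v x - wn n x) \<in> L2"
    by (intro L2_diff v vML2 M wL2)+
  have "(\<integral>x. (norm (v x - wn n x))\<^sup>2 \<partial>lborel) \<le> (\<integral>x. 2 * (norm (v x - vM M x))\<^sup>2 + 2 * (norm (vM M x - wn n x))\<^sup>2 \<partial>lborel)"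
  proof (rule integral_mono)
    show "(norm (v x - wn n x))\<^sup>2 \<le> 2 * (norm (v x - vM M x))\<^sup>2 + 2 * (norm (vM M x - wn n x))\<^sup>2" for x
      using sq_norm_add_le[of "v x - vM M x" "vM M x - wn n x"] by simp
  qed (use d[THEN L2_integrable_sq] in auto)
  also have "\<dots> = 2 * (\<integral>x. (norm (v x - vM M x))\<^sup>2 \<partial>lborel) + 2 * (\<integral>x. (norm (vM M x - wn n x))\<^sup>2 \<partial>lborel)"
    using d[THEN L2_integrable_sq] by simp
  also have "\<dots> < \<epsilon>\<^sup>2" using M0 n by (simp add: M_def)
  finally have "L2_norm (\<lambda>x. v x - wn n x) < \<epsilon>" by (intro L2_normI d eps)
  moreover have "bounded {x. wn n x \<noteq> 0}"
  proof (rule bounded_subset[OF bounded_closed_interval[of "- M - 1" "M + 1"]], rule subsetI)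
    fix x assume "x \<in> {x. wn n x \<noteq> 0}"
    then show "x \<in> {- M - 1..M + 1}" using supp(1)[of x n] by blast
  qed
  ultimately show ?thesis using that cw wL2 by blast
qed

section \<open>Gaussian integrals and Parseval's identity\<close>

lemma Fubini_bounded_kernel:
  fixes a b :: "real \<Rightarrow> complex" and k :: "real \<Rightarrow> real \<Rightarrow> complex"
  assumes a: "integrable lborel a" and b: "integrable lborel b"
    and k: "(\<lambda>p. k (fst p) (snd p)) \<in> borel_measurable (lborel \<Otimes>\<^sub>M lborel)" "\<And>x y. norm (k x y) \<le> 1"
  shows "(\<integral>x. a x * (\<integral>y. b y * k x y \<partial>lborel) \<partial>lborel) = (\<integral>y. b y * (\<integral>x. a x * k x y \<partial>lborel) \<partial>lborel)"
proof -
  have [measurable]: "a \<in> borel_measurable borel" "b \<in> borel_measurable borel" using a b by auto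
  have ab: "integrable (lborel \<Otimes>\<^sub>M lborel) (\<lambda>p. a (fst p) * b (snd p))"
    using a b by (intro lborel_pair.Fubini_integrable) (auto simp: norm_mult)
  have i: "integrable (lborel \<Otimes>\<^sub>M lborel) (\<lambda>p. a (fst p) * b (snd p) * k (fst p) (snd p))"
  proof (rule Bochner_Integration.integrable_bound[OF ab])
    show "(\<lambda>p. a (fst p) * b (snd p) * k (fst p) (snd p)) \<in> borel_measurable (lborel \<Otimes>\<^sub>M lborel)"
      using k(1) by measurable
    have "norm (a (fst p) * b (snd p) * k (fst p) (snd p)) \<le> norm (a (fst p) * b (snd p)) * 1" for p
      unfolding norm_mult[of "a (fst p) * b (snd p)"] by (intro mult_left_mono k) auto
    then show "AE p in lborel \<Otimes>\<^sub>M lborel. norm (a (fst p) * b (snd p) * k (fst p) (snd p)) \<le> norm (a (fst p) * b (snd p))"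
      by (auto intro!: AE_I2)
  qed
  have "integrable (lborel \<Otimes>\<^sub>M lborel) (case_prod (\<lambda>x y. a x * b y * k x y))"
    using i by (simp add: case_prod_beta')
  from lborel_pair.Fubini_integral[OF this]
  have "(\<integral>y. \<integral>x. a x * b y * k x y \<partial>lborel \<partial>lborel) = (\<integral>x. \<integral>y. a x * b y * k x y \<partial>lborel \<partial>lborel)" .
  moreover have "(\<integral>x. a x * b y * k x y \<partial>lborel) = b y * (\<integral>x. a x * k x y \<partial>lborel)" for y
    unfolding integral_mult_right_zero[symmetric] by (simp add: mult_ac)
  moreover have "(\<integral>y. a x * b y * k x y \<partial>lborel) = a x * (\<integral>y. b y * k x y \<partial>lborel)" for x
    unfolding integral_mult_right_zero[symmetric] by (simp add: mult_ac)
  ultimately show ?thesis by simp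
qed

text \<open>The Fourier integral is the characteristic function of the standard normal law at the
  point 2 pi s.\<close>

lemma gaussian_integral_base:
  "integrable lborel (\<lambda>x. of_real (exp (- x\<^sup>2 / 2)) * ee (s * x))"
  "(\<integral>x. of_real (exp (- x\<^sup>2 / 2)) * ee (s * x) \<partial>lborel) = of_real (sqrt (2 * pi) * exp (- 2 * pi\<^sup>2 * s\<^sup>2))"
proof -
  have sd: "exp (- x\<^sup>2 / 2) = sqrt (2 * pi) * std_normal_density x" for x
    by (simp add: std_normal_density_def)
  have "integrable lborel std_normal_density" using integrable_normal_moment_nz_1[of 1 0] integrable_std_normal_moment[of 0] by simp
  then have i0: "integrable lborel (\<lambda>x. complex_of_real (exp (- x\<^sup>2 / 2)))" unfolding sd by simp
  show i: "integrable lborel (\<lambda>x. of_real (exp (- x\<^sup>2 / 2)) * ee (s * x))"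
    by (rule Bochner_Integration.integrable_bound[OF i0]) (auto simp: norm_mult)
  have "char std_normal_distribution (2 * pi * s) = (\<integral>x. std_normal_density x *\<^sub>R exp (\<i> * of_real (2 * pi * s * x)) \<partial>lborel)"
    unfolding char_def by (subst integral_density) (auto simp: normal_density_nonneg)
  then have "of_real (exp (- ((2 * pi * s)\<^sup>2) / 2)) = (\<integral>x. std_normal_density x *\<^sub>R exp (\<i> * of_real (2 * pi * s * x)) \<partial>lborel)"
    by (simp add: char_std_normal_distribution)
  then have "of_real (sqrt (2 * pi)) * of_real (exp (- ((2 * pi * s)\<^sup>2) / 2)) = 
     (\<integral>x. of_real (sqrt (2 * pi)) * (std_normal_density x *\<^sub>R exp (\<i> * of_real (2 * pi * s * x))) \<partial>lborel)"
    by (simp only: integral_mult_right_zero)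
  also have "\<dots> = (\<integral>x. of_real (exp (- x\<^sup>2 / 2)) * ee (s * x) \<partial>lborel)"
    unfolding sd by (intro Bochner_Integration.integral_cong refl) (simp add: scaleR_conv_of_real ee_def cis_conv_exp mult_ac)
  finally have e: "of_real (sqrt (2 * pi)) * of_real (exp (- ((2 * pi * s)\<^sup>2) / 2)) = (\<integral>x. of_real (exp (- x\<^sup>2 / 2)) * ee (s * x) \<partial>lborel)" .
  show "(\<integral>x. of_real (exp (- x\<^sup>2 / 2)) * ee (s * x) \<partial>lborel) = of_real (sqrt (2 * pi) * exp (- 2 * pi\<^sup>2 * s\<^sup>2))"
    unfolding e[symmetric] by (simp add: power_mult_distrib mult.assoc)
qed

lemma gaussian_integral:
  assumes r: "r > 0"
  shows "integrable lborel (\<lambda>x. of_real (exp (- (r * x)\<^sup>2 / 2)) * ee (s * x))"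
    and "(\<integral>x. of_real (exp (- (r * x)\<^sup>2 / 2)) * ee (s * x) \<partial>lborel) = of_real (sqrt (2 * pi) / r * exp (- 2 * pi\<^sup>2 * (s / r)\<^sup>2))"
proof -
  let ?f = "\<lambda>x. of_real (exp (- x\<^sup>2 / 2)) * ee (s / r * x)"
  have e: "of_real (exp (- (r * x)\<^sup>2 / 2)) * ee (s * x) = ?f (0 + r * x)" for x using r by simp
  show "integrable lborel (\<lambda>x. of_real (exp (- (r * x)\<^sup>2 / 2)) * ee (s * x))"
    unfolding e by (rule lborel_integrable_real_affine[OF gaussian_integral_base(1)]) (use r in simp)
  have "(\<integral>x. ?f x \<partial>lborel) = \<bar>r\<bar> *\<^sub>R (\<integral>x. ?f (0 + r * x) \<partial>lborel)"
    by (rule lborel_integral_real_affine) (use r in simp)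
  then have "of_real r * (\<integral>x. ?f (0 + r * x) \<partial>lborel) = of_real (sqrt (2 * pi) * exp (- 2 * pi\<^sup>2 * (s / r)\<^sup>2))"
    unfolding gaussian_integral_base(2) using r by (simp add: scaleR_conv_of_real)
  then have "(\<integral>x. ?f (0 + r * x) \<partial>lborel) = of_real (sqrt (2 * pi) * exp (- 2 * pi\<^sup>2 * (s / r)\<^sup>2)) / of_real r"
    using r by (simp add: field_simps)
  then show "(\<integral>x. of_real (exp (- (r * x)\<^sup>2 / 2)) * ee (s * x) \<partial>lborel) = of_real (sqrt (2 * pi) / r * exp (- 2 * pi\<^sup>2 * (s / r)\<^sup>2))"
    unfolding e by simp
qed

text \<open>Gaussian summability: a factor \<open>k n\<close> tending to 1 is inserted on the
  frequency side, which allows the integrals to be exchanged and replaces \<open>cnj v\<close> by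
  its mean against a narrow Gaussian. Integrability of \<open>uh\<close> controls one limit,
  boundedness of \<open>v\<close> the other.\<close>

lemma parseval_compact_support:
  fixes u v :: "real \<Rightarrow> complex"
  defines "uh \<equiv> \<lambda>\<nu>. \<integral>x. u x * ee (\<nu> * x) \<partial>lborel" and "vh \<equiv> \<lambda>\<nu>. \<integral>x. v x * ee (\<nu> * x) \<partial>lborel"
  assumes u: "integrable lborel u" and cv: "continuous_on UNIV v" and bv: "bounded {x. v x \<noteq> 0}"
    and uh: "integrable lborel uh"
  shows "(\<integral>\<nu>. uh \<nu> * cnj (vh \<nu>) \<partial>lborel) = (\<integral>x. u x * cnj (v x) \<partial>lborel)"
proof -
  have um [measurable]: "u \<in> borel_measurable borel" using u by auto
  have vm [measurable]: "v \<in> borel_measurable borel" by (rule borel_measurable_continuous_onI[OF cv])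
  have uhm [measurable]: "uh \<in> borel_measurable borel" using uh by auto
  obtain r where r: "r \<ge> 0" "\<And>y. \<bar>y\<bar> > r \<Longrightarrow> v y = 0" using bounded_supportE[OF bv] by blast
  have "bounded (v ` {- r..r})"
    by (intro compact_imp_bounded compact_continuous_image continuous_on_subset[OF cv]) auto
  then obtain B0 where B0: "\<forall>y\<in>{- r..r}. norm (v y) \<le> B0" unfolding bounded_iff by blast
  define B where "B = max B0 0"
  have B: "norm (v y) \<le> B" for y
  proof (cases "\<bar>y\<bar> > r")
    case True then show ?thesis using r by (simp add: B_def)
  next
    case False
    then have "y \<in> {- r..r}" by auto
    then show ?thesis using B0 by (auto simp: B_def le_max_iff_disj)
  qed
  have Bnn: "B \<ge> 0" by (simp add: B_def)
  have vi: "integrable lborel v"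
  proof (rule Bochner_Integration.integrable_bound)
    show "integrable lborel (\<lambda>x. B * indicator {- r..r} x :: real)"
      by (intro integrable_mult_right integrable_real_indicator) (auto simp: emeasure_lborel_Icc_eq)
    show "AE x in lborel. norm (v x) \<le> norm (B * indicator {- r..r} x)"
      using B r Bnn by (auto intro!: AE_I2 simp: indicator_def abs_if not_less split: if_splits)
  qed simp
  have vcn: "integrable lborel (\<lambda>y. cnj (v y))" using vi by simp
  have [measurable]: "(\<lambda>p. v (snd p) * ee (fst p * snd p)) \<in> borel_measurable (lborel \<Otimes>\<^sub>M lborel)" by measurable
  have vhm [measurable]: "vh \<in> borel_measurable borel"
    using lborel.borel_measurable_lebesgue_integral[of "\<lambda>\<nu> x. v x * ee (\<nu> * x)" lborel]
    by (simp add: vh_def case_prod_beta')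
  have vhb: "norm (vh \<nu>) \<le> (\<integral>x. norm (v x) \<partial>lborel)" for \<nu>
    unfolding vh_def by (rule order_trans[OF integral_norm_bound]) (simp add: norm_mult)
  define k where "k n \<nu> = exp (- ((1 / real (Suc n)) * \<nu>)\<^sup>2 / 2)" for n \<nu>
  have k01: "0 \<le> k n \<nu>" "k n \<nu> \<le> 1" for n \<nu> by (simp_all add: k_def)
  have [measurable]: "k n \<in> borel_measurable borel" for n unfolding k_def by measurable
  have ki: "integrable lborel (\<lambda>\<nu>. complex_of_real (k n \<nu>))" for n
    using gaussian_integral(1)[of "1 / real (Suc n)" 0] by (simp add: k_def)
  have lim1: "(\<lambda>n. \<integral>\<nu>. uh \<nu> * cnj (vh \<nu>) * of_real (k n \<nu>) \<partial>lborel) \<longlonglongrightarrow> (\<integral>\<nu>. uh \<nu> * cnj (vh \<nu>) \<partial>lborel)"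
  proof (rule integral_dominated_convergence[where w = "\<lambda>\<nu>. norm (uh \<nu>) * (\<integral>x. norm (v x) \<partial>lborel)"])
    show "integrable lborel (\<lambda>\<nu>. norm (uh \<nu>) * (\<integral>x. norm (v x) \<partial>lborel))" using uh by simp
    show "AE \<nu> in lborel. (\<lambda>n. uh \<nu> * cnj (vh \<nu>) * of_real (k n \<nu>)) \<longlonglongrightarrow> uh \<nu> * cnj (vh \<nu>)"
    proof (rule AE_I2)
      fix \<nu>
      have "(\<lambda>n. k n \<nu>) \<longlonglongrightarrow> exp (- (0 * \<nu>)\<^sup>2 / 2)"
        unfolding k_def
          by (intro tendsto_exp tendsto_divide tendsto_minus tendsto_power tendsto_mult tendsto_const LIMSEQ_Suc[OF lim_1_over_n]) auto
      then have "(\<lambda>n. uh \<nu> * cnj (vh \<nu>) * of_real (k n \<nu>)) \<longlonglongrightarrow> uh \<nu> * cnj (vh \<nu>) * of_real (exp (- (0 * \<nu>)\<^sup>2 / 2))"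
        by (intro tendsto_mult tendsto_const tendsto_of_real tendsto_cnj)
      then show "(\<lambda>n. uh \<nu> * cnj (vh \<nu>) * of_real (k n \<nu>)) \<longlonglongrightarrow> uh \<nu> * cnj (vh \<nu>)" by simp
    qed
    show "AE \<nu> in lborel. norm (uh \<nu> * cnj (vh \<nu>) * of_real (k n \<nu>)) \<le> norm (uh \<nu>) * (\<integral>x. norm (v x) \<partial>lborel)" for n
    proof (rule AE_I2)
      fix \<nu>
      have "norm (uh \<nu> * cnj (vh \<nu>) * of_real (k n \<nu>)) = norm (uh \<nu>) * norm (vh \<nu>) * k n \<nu>" using k01 by (simp add: norm_mult)
      also have "\<dots> \<le> norm (uh \<nu>) * norm (vh \<nu>) * 1" by (intro mult_left_mono k01) auto
      also have "\<dots> \<le> norm (uh \<nu>) * (\<integral>x. norm (v x) \<partial>lborel)" using vhb by (simp add: mult_left_mono)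
      finally show "norm (uh \<nu> * cnj (vh \<nu>) * of_real (k n \<nu>)) \<le> norm (uh \<nu>) * (\<integral>x. norm (v x) \<partial>lborel)" .
    qed
  qed measurable
  \<comment> \<open>The Gaussian mean of \<open>cnj v\<close> around \<open>x\<close> at scale
    1/(n+1), in the variable \<tau> = (n+1)(x - y); in this variable the weight has total mass 1 and
    no longer depends on n.\<close>
  define I where "I n x = (\<integral>\<tau>. cnj (v (x - \<tau> / real (Suc n))) * of_real (sqrt (2 * pi) * exp (- (2 * pi * \<tau>)\<^sup>2 / 2)) \<partial>lborel)" for n x
  have h: "integrable lborel (\<lambda>\<tau>. exp (- (2 * pi * \<tau>)\<^sup>2 / 2))"
    "(\<integral>\<tau>. exp (- (2 * pi * \<tau>)\<^sup>2 / 2) \<partial>lborel) = sqrt (2 * pi) / (2 * pi)"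
  proof -
    have "2 * pi > 0" by simp
    note g = gaussian_integral[OF this, of 0, unfolded mult_zero_left ee_0 mult_1_right div_0 power_zero_numeral mult_zero_right exp_zero]
    from g(1) show "integrable lborel (\<lambda>\<tau>. exp (- (2 * pi * \<tau>)\<^sup>2 / 2))"
      by (simp only: complex_of_real_integrable_eq)
    from g(2) show "(\<integral>\<tau>. exp (- (2 * pi * \<tau>)\<^sup>2 / 2) \<partial>lborel) = sqrt (2 * pi) / (2 * pi)"
      by (simp only: integral_complex_of_real of_real_eq_iff)
  qed
  have G1r: "integrable lborel (\<lambda>\<tau>. sqrt (2 * pi) * exp (- (2 * pi * \<tau>)\<^sup>2 / 2))"
    "(\<integral>\<tau>. sqrt (2 * pi) * exp (- (2 * pi * \<tau>)\<^sup>2 / 2) \<partial>lborel) = 1"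
  proof -
    show "integrable lborel (\<lambda>\<tau>. sqrt (2 * pi) * exp (- (2 * pi * \<tau>)\<^sup>2 / 2))"
      using h(1) by (rule integrable_mult_right)
    show "(\<integral>\<tau>. sqrt (2 * pi) * exp (- (2 * pi * \<tau>)\<^sup>2 / 2) \<partial>lborel) = 1"
      unfolding integral_mult_right_zero h(2) by simp
  qed
  have G1: "(\<integral>\<tau>. complex_of_real (sqrt (2 * pi) * exp (- (2 * pi * \<tau>)\<^sup>2 / 2)) \<partial>lborel) = 1"
    unfolding integral_complex_of_real G1r(2) by simp
  have kern: "(\<integral>\<nu>. uh \<nu> * cnj (vh \<nu>) * of_real (k n \<nu>) \<partial>lborel) = (\<integral>x. u x * I n x \<partial>lborel)" for n
  proof -
    have ai: "integrable lborel (\<lambda>\<nu>. cnj (vh \<nu>) * of_real (k n \<nu>))"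
    proof (rule Bochner_Integration.integrable_bound)
      show "integrable lborel (\<lambda>\<nu>. (\<integral>x. norm (v x) \<partial>lborel) * complex_of_real (k n \<nu>))" using ki by simp
      show "AE \<nu> in lborel. norm (cnj (vh \<nu>) * of_real (k n \<nu>)) \<le> norm ((\<integral>x. norm (v x) \<partial>lborel) * complex_of_real (k n \<nu>))"
        using vhb k01 by (auto intro!: AE_I2 mult_right_mono order_trans[OF vhb abs_ge_self] simp: norm_mult)
    qed measurable
    have inner: "(\<integral>\<nu>. (cnj (vh \<nu>) * of_real (k n \<nu>)) * ee (\<nu> * x) \<partial>lborel) = I n x" for x
    proof -
      have "(cnj (vh \<nu>) * of_real (k n \<nu>)) * ee (\<nu> * x) = of_real (k n \<nu>) * (\<integral>y. cnj (v y) * ee (\<nu> * (x - y)) \<partial>lborel)" for \<nu>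
      proof -
        have "cnj (vh \<nu>) = (\<integral>y. cnj (v y) * ee (- (\<nu> * y)) \<partial>lborel)"
          unfolding vh_def Bochner_Integration.integral_cnj[symmetric] by (simp add: cnj_ee)
        then have "cnj (vh \<nu>) * ee (\<nu> * x) = (\<integral>y. cnj (v y) * ee (- (\<nu> * y)) * ee (\<nu> * x) \<partial>lborel)" by simp
        also have "\<dots> = (\<integral>y. cnj (v y) * ee (\<nu> * (x - y)) \<partial>lborel)"
          by (simp add: mult.assoc ee_add[symmetric] right_diff_distrib)
        finally show ?thesis by (simp add: mult_ac)
      qed
      then have "(\<integral>\<nu>. (cnj (vh \<nu>) * of_real (k n \<nu>)) * ee (\<nu> * x) \<partial>lborel) = 
         (\<integral>\<nu>. of_real (k n \<nu>) * (\<integral>y. cnj (v y) * ee (\<nu> * (x - y)) \<partial>lborel) \<partial>lborel)" by (simp only:)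
      also have "\<dots> = (\<integral>y. cnj (v y) * (\<integral>\<nu>. of_real (k n \<nu>) * ee (\<nu> * (x - y)) \<partial>lborel) \<partial>lborel)"
        by (rule Fubini_bounded_kernel[OF ki vcn]) auto
      also have "\<dots> = (\<integral>y. cnj (v y) * of_real (sqrt (2 * pi) * real (Suc n) * exp (- 2 * pi\<^sup>2 * ((x - y) * real (Suc n))\<^sup>2)) \<partial>lborel)"
        using gaussian_integral(2)[of "1 / real (Suc n)"] by (simp add: k_def mult.commute[of _ "x - _"])
      also have "\<dots> = \<bar>- 1 / real (Suc n)\<bar> *\<^sub>R (\<integral>\<tau>. cnj (v (x + - 1 / real (Suc n) * \<tau>)) * 
           of_real (sqrt (2 * pi) * real (Suc n) * exp (- 2 * pi\<^sup>2 * ((x - (x + - 1 / real (Suc n) * \<tau>)) * real (Suc n))\<^sup>2)) \<partial>lborel)"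
        by (rule lborel_integral_real_affine) simp
      also have "\<dots> = I n x"
        unfolding I_def integral_scaleR_right[symmetric]
        by (intro Bochner_Integration.integral_cong refl)
           (simp add: scaleR_conv_of_real power_mult_distrib del: of_nat_Suc)
      finally show ?thesis .
    qed
    have "(\<integral>\<nu>. uh \<nu> * cnj (vh \<nu>) * of_real (k n \<nu>) \<partial>lborel) = (\<integral>\<nu>. (cnj (vh \<nu>) * of_real (k n \<nu>)) * (\<integral>x. u x * ee (\<nu> * x) \<partial>lborel) \<partial>lborel)"
      by (simp add: uh_def mult_ac)
    also have "\<dots> = (\<integral>x. u x * (\<integral>\<nu>. (cnj (vh \<nu>) * of_real (k n \<nu>)) * ee (\<nu> * x) \<partial>lborel) \<partial>lborel)"
      by (rule Fubini_bounded_kernel[OF ai u]) auto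
    also have "\<dots> = (\<integral>x. u x * I n x \<partial>lborel)" by (simp only: inner)
    finally show ?thesis .
  qed
  have Ib: "norm (I n x) \<le> B" for n x
  proof -
    have "norm (I n x) \<le> (\<integral>\<tau>. norm (cnj (v (x - \<tau> / real (Suc n))) * of_real (sqrt (2 * pi) * exp (- (2 * pi * \<tau>)\<^sup>2 / 2))) \<partial>lborel)"
      unfolding I_def by (rule integral_norm_bound)
    also have "\<dots> \<le> (\<integral>\<tau>. B * (sqrt (2 * pi) * exp (- (2 * pi * \<tau>)\<^sup>2 / 2)) \<partial>lborel)"
    proof (rule integral_mono')
      show "integrable lborel (\<lambda>\<tau>. B * (sqrt (2 * pi) * exp (- (2 * pi * \<tau>)\<^sup>2 / 2)))" using G1r(1) by (rule integrable_mult_right)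
      show "norm (cnj (v (x - \<tau> / real (Suc n))) * of_real (sqrt (2 * pi) * exp (- (2 * pi * \<tau>)\<^sup>2 / 2))) \<le> B * (sqrt (2 * pi) * exp (- (2 * pi * \<tau>)\<^sup>2 / 2))" for \<tau>
        unfolding norm_mult complex_mod_cnj norm_of_real by (intro mult_mono B Bnn) auto
    qed (use Bnn in auto)
    also have "\<dots> = B * (\<integral>\<tau>. sqrt (2 * pi) * exp (- (2 * pi * \<tau>)\<^sup>2 / 2) \<partial>lborel)" by (rule integral_mult_right_zero)
    also have "\<dots> = B" unfolding G1r(2) by simp
    finally show ?thesis .
  qed
  have Im: "I n \<in> borel_measurable borel" for n
    using lborel.borel_measurable_lebesgue_integral[of "\<lambda>x \<tau>. cnj (v (x - \<tau> / real (Suc n))) * of_real (sqrt (2 * pi) * exp (- (2 * pi * \<tau>)\<^sup>2 / 2))" lborel]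
    by (simp add: I_def[abs_def] case_prod_beta')
  have Il: "(\<lambda>n. I n x) \<longlonglongrightarrow> cnj (v x)" for x
  proof -
    have "(\<lambda>n. I n x) \<longlonglongrightarrow> (\<integral>\<tau>. cnj (v x) * of_real (sqrt (2 * pi) * exp (- (2 * pi * \<tau>)\<^sup>2 / 2)) \<partial>lborel)"
      unfolding I_def
    proof (rule integral_dominated_convergence[where w = "\<lambda>\<tau>. B * (sqrt (2 * pi) * exp (- (2 * pi * \<tau>)\<^sup>2 / 2))"])
      show "integrable lborel (\<lambda>\<tau>. B * (sqrt (2 * pi) * exp (- (2 * pi * \<tau>)\<^sup>2 / 2)))" using G1r(1) by (rule integrable_mult_right)
      show "AE \<tau> in lborel. (\<lambda>n. cnj (v (x - \<tau> / real (Suc n))) * of_real (sqrt (2 * pi) * exp (- (2 * pi * \<tau>)\<^sup>2 / 2))) \<longlonglongrightarrow>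
         cnj (v x) * of_real (sqrt (2 * pi) * exp (- (2 * pi * \<tau>)\<^sup>2 / 2))"
      proof (rule AE_I2)
        fix \<tau>
        have "(\<lambda>n. x - \<tau> / real (Suc n)) \<longlonglongrightarrow> x - 0"
          by (intro tendsto_diff tendsto_const LIMSEQ_Suc[OF lim_const_over_n])
        then have "(\<lambda>n. v (x - \<tau> / real (Suc n))) \<longlonglongrightarrow> v x"
          using continuous_on_tendsto_compose[OF cv] by simp
        then show "(\<lambda>n. cnj (v (x - \<tau> / real (Suc n))) * of_real (sqrt (2 * pi) * exp (- (2 * pi * \<tau>)\<^sup>2 / 2))) \<longlonglongrightarrow>
         cnj (v x) * of_real (sqrt (2 * pi) * exp (- (2 * pi * \<tau>)\<^sup>2 / 2))" by (intro tendsto_mult tendsto_const tendsto_of_real tendsto_cnj)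
      qed
      show "AE \<tau> in lborel. norm (cnj (v (x - \<tau> / real (Suc n))) * of_real (sqrt (2 * pi) * exp (- (2 * pi * \<tau>)\<^sup>2 / 2))) \<le> B * (sqrt (2 * pi) * exp (- (2 * pi * \<tau>)\<^sup>2 / 2))" for n
        unfolding norm_mult complex_mod_cnj norm_of_real by (intro AE_I2 mult_mono B Bnn) auto
    qed measurable
    then show ?thesis unfolding integral_mult_right_zero G1 by simp
  qed
  have "(\<lambda>n. \<integral>x. u x * I n x \<partial>lborel) \<longlonglongrightarrow> (\<integral>x. u x * cnj (v x) \<partial>lborel)"
  proof (rule integral_dominated_convergence[where w = "\<lambda>x. norm (u x) * B"])
    show "integrable lborel (\<lambda>x. norm (u x) * B)" using u by simp
    show "AE x in lborel. (\<lambda>n. u x * I n x) \<longlonglongrightarrow> u x * cnj (v x)" by (intro AE_I2 tendsto_mult tendsto_const Il)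
    show "AE x in lborel. norm (u x * I n x) \<le> norm (u x) * B" for n
      unfolding norm_mult by (intro AE_I2 mult_left_mono Ib) auto
    show "(\<lambda>x. u x * I n x) \<in> borel_measurable lborel" for n using Im by simp
  qed measurable
  with lim1 show ?thesis unfolding kern by (rule LIMSEQ_unique)
qed

section \<open>The Gaussian short-time Fourier transform\<close>

definition gauss :: "real \<Rightarrow> real \<Rightarrow> complex" where
  "gauss t x = of_real (exp (- (x - t)\<^sup>2))"

lemma gauss_stft_ee: "gauss_stft f p = (\<integral>x. (f x * gauss (fst p) x) * ee (snd p * x) \<partial>lborel)"
  by (simp add: gauss_stft_def case_prod_beta gauss_def ee_def mult_ac)

lemma gauss_measurable [measurable]: "gauss t \<in> borel_measurable borel"
  unfolding gauss_def by measurable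

lemma gauss_sq:
  "integrable lborel (\<lambda>x. (norm (gauss t x))\<^sup>2)" "(\<integral>x. (norm (gauss t x))\<^sup>2 \<partial>lborel) = sqrt (2 * pi) / 2"
  "(\<integral>t. (norm (gauss t x))\<^sup>2 \<partial>lborel) = sqrt (2 * pi) / 2" "integrable lborel (\<lambda>t. (norm (gauss t x))\<^sup>2)"
proof -
  let ?h = "\<lambda>x::real. exp (- (2 * x)\<^sup>2 / 2)"
  have "integrable lborel (\<lambda>x. complex_of_real (?h x))" using gaussian_integral(1)[of 2 0] by simp
  then have hi: "integrable lborel ?h" by (simp only: complex_of_real_integrable_eq)
  have "(\<integral>x. complex_of_real (?h x) \<partial>lborel) = of_real (sqrt (2 * pi) / 2)" using gaussian_integral(2)[of 2 0] by simp
  then have hv: "(\<integral>x. ?h x \<partial>lborel) = sqrt (2 * pi) / 2" unfolding integral_complex_of_real of_real_eq_iff .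
  have e: "(norm (gauss t x))\<^sup>2 = ?h (- t + 1 * x)" "(norm (gauss t x))\<^sup>2 = ?h (x + (- 1) * t)" for t x
    by (simp_all add: gauss_def power2_eq_square exp_add[symmetric] algebra_simps)
  show "integrable lborel (\<lambda>x. (norm (gauss t x))\<^sup>2)"
    unfolding e(1) by (rule lborel_integrable_real_affine[OF hi]) simp
  show "integrable lborel (\<lambda>t. (norm (gauss t x))\<^sup>2)"
    unfolding e(2) by (rule lborel_integrable_real_affine[OF hi]) simp
  show "(\<integral>x. (norm (gauss t x))\<^sup>2 \<partial>lborel) = sqrt (2 * pi) / 2"
    unfolding e(1) hv[symmetric] using lborel_integral_real_affine[of 1 ?h "- t"] by simp
  show "(\<integral>t. (norm (gauss t x))\<^sup>2 \<partial>lborel) = sqrt (2 * pi) / 2"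
    unfolding e(2) hv[symmetric] using lborel_integral_real_affine[of "- 1" ?h x] by simp
qed

lemma gauss_L2: "gauss t \<in> L2"
  using gauss_sq(1) by (simp add: L2_def)

definition gnorm :: real where "gnorm = sqrt (sqrt (2 * pi) / 2)"

lemma L2_norm_gauss: "L2_norm (gauss t) = gnorm"
  by (simp add: L2_norm_def gauss_sq(2) gnorm_def)

lemma gauss_cnj [simp]: "cnj (gauss t x) = gauss t x" by (simp add: gauss_def)

lemma gauss_mult_integrable: "f \<in> L2 \<Longrightarrow> integrable lborel (\<lambda>x. f x * gauss t x)"
  using L2_integrable_prod[OF _ gauss_L2[of t], of f] by simp

lemma gauss_stft_integrable:
  assumes "f \<in> L2"
  shows "integrable lborel (\<lambda>x. (f x * gauss t x) * ee (\<nu> * x))"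
proof (rule Bochner_Integration.integrable_bound)
  have [measurable]: "f \<in> borel_measurable borel" using assms by (auto simp: L2_def)
  show "integrable lborel (\<lambda>x. f x * gauss t x)" by (rule gauss_mult_integrable[OF assms])
  show "(\<lambda>x. (f x * gauss t x) * ee (\<nu> * x)) \<in> borel_measurable lborel" by measurable
qed (simp add: norm_mult)

lemma gauss_stft_diff:
  assumes "f \<in> L2" "g \<in> L2"
  shows "gauss_stft (\<lambda>x. f x - g x) p = gauss_stft f p - gauss_stft g p"
  unfolding gauss_stft_ee left_diff_distrib
  by (rule Bochner_Integration.integral_diff) (intro gauss_stft_integrable assms)+

lemma gauss_stft_bound:
  assumes "f \<in> L2"
  shows "norm (gauss_stft f p) \<le> L2_norm f * gnorm"
proof -
  have "norm (gauss_stft f p) \<le> (\<integral>x. norm (f x) * norm (gauss (fst p) x) \<partial>lborel)"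
    unfolding gauss_stft_ee by (rule order_trans[OF integral_norm_bound]) (simp add: norm_mult)
  also have "\<dots> \<le> L2_norm f * L2_norm (gauss (fst p))" by (rule ip_cauchy_schwarz[OF assms gauss_L2])
  finally show ?thesis by (simp add: L2_norm_gauss)
qed

lemma gauss_stft_continuous:
  assumes f: "f \<in> L2"
  shows "continuous_on UNIV (gauss_stft f)"
proof (rule continuous_on_sequentiallyI)
  fix p :: "nat \<Rightarrow> real \<times> real" and a assume p: "p \<longlonglongrightarrow> a"
  have [measurable]: "f \<in> borel_measurable borel" using f by (auto simp: L2_def)
  have p1: "(\<lambda>n. fst (p n)) \<longlonglongrightarrow> fst a" and p2: "(\<lambda>n. snd (p n)) \<longlonglongrightarrow> snd a"
    using p by (auto intro: tendsto_fst tendsto_snd)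
  have "bounded (range (\<lambda>n. fst (p n) - fst a))"
    by (rule convergent_imp_bounded[OF tendsto_diff[OF p1 tendsto_const]])
  then obtain B where B: "\<And>n. \<bar>fst (p n) - fst a\<bar> \<le> B" unfolding bounded_iff by auto
  \<comment> \<open>A Gaussian with a moving but bounded centre is dominated by a wider one at the
    limit centre, because (x - a)^2 is at most 2 (x - t)^2 + 2 (t - a)^2; this is the origin of the
    exponent halved.\<close>
  have dom: "exp (- (x - fst (p n))\<^sup>2) \<le> exp (B\<^sup>2) * exp (- (x - fst a)\<^sup>2 / 2)" for x n
  proof -
    have "(x - fst a)\<^sup>2 \<le> 2 * (x - fst (p n))\<^sup>2 + 2 * (fst (p n) - fst a)\<^sup>2"
      using sum_squares_bound[of "x - fst (p n)" "fst (p n) - fst a"] by (simp add: power2_eq_square algebra_simps)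
    moreover have "(fst (p n) - fst a)\<^sup>2 \<le> B\<^sup>2" using B[of n] by (metis abs_ge_zero power2_abs power_mono)
    ultimately have "- (x - fst (p n))\<^sup>2 \<le> B\<^sup>2 + - (x - fst a)\<^sup>2 / 2" by simp
    then show ?thesis unfolding exp_add[symmetric] by simp
  qed
  have g2: "(\<lambda>x. complex_of_real (exp (- (x - fst a)\<^sup>2 / 2))) \<in> L2"
  proof -
    have "integrable lborel (\<lambda>x. complex_of_real (exp (- (sqrt 2 * x)\<^sup>2 / 2)))" using gaussian_integral(1)[of "sqrt 2" 0] by simp
    then have "integrable lborel (\<lambda>x. exp (- (sqrt 2 * x)\<^sup>2 / 2))" by (simp only: complex_of_real_integrable_eq)
    then have "integrable lborel (\<lambda>x::real. exp (- x\<^sup>2))" by (simp add: power_mult_distrib)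
    from lborel_integrable_real_affine[OF this, of 1 "- fst a"] have "integrable lborel (\<lambda>x. exp (- (x - fst a)\<^sup>2))" by simp
    then show ?thesis by (simp add: L2_def power2_eq_square exp_add[symmetric])
  qed
  have "(\<lambda>n. \<integral>x. (f x * gauss (fst (p n)) x) * ee (snd (p n) * x) \<partial>lborel) \<longlonglongrightarrow> (\<integral>x. (f x * gauss (fst a) x) * ee (snd a * x) \<partial>lborel)"
  proof (rule integral_dominated_convergence[where w = "\<lambda>x. exp (B\<^sup>2) * (norm (f x * cnj (complex_of_real (exp (- (x - fst a)\<^sup>2 / 2)))))"])
    show "integrable lborel (\<lambda>x. exp (B\<^sup>2) * (norm (f x * cnj (complex_of_real (exp (- (x - fst a)\<^sup>2 / 2))))))"
      by (intro integrable_mult_right integrable_norm L2_integrable_prod[OF f g2])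
    show "AE x in lborel. (\<lambda>n. f x * gauss (fst (p n)) x * ee (snd (p n) * x)) \<longlonglongrightarrow> f x * gauss (fst a) x * ee (snd a * x)"
    proof (rule AE_I2)
      fix x
      have "(\<lambda>n. ee (snd (p n) * x)) \<longlonglongrightarrow> ee (snd a * x)"
        by (rule isCont_tendsto_compose[OF isCont_ee]) (intro tendsto_mult p2 tendsto_const)
      moreover have "(\<lambda>n. gauss (fst (p n)) x) \<longlonglongrightarrow> gauss (fst a) x"
        unfolding gauss_def by (intro tendsto_of_real tendsto_exp tendsto_minus tendsto_power tendsto_diff tendsto_const p1)
      ultimately show "(\<lambda>n. f x * gauss (fst (p n)) x * ee (snd (p n) * x)) \<longlonglongrightarrow> f x * gauss (fst a) x * ee (snd a * x)"
        by (intro tendsto_mult tendsto_const)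
    qed
    show "AE x in lborel. norm (f x * gauss (fst (p n)) x * ee (snd (p n) * x)) \<le> exp (B\<^sup>2) * (norm (f x * cnj (complex_of_real (exp (- (x - fst a)\<^sup>2 / 2)))))" for n
    proof (rule AE_I2)
      fix x
      have "norm (f x) * exp (- (x - fst (p n))\<^sup>2) \<le> norm (f x) * (exp (B\<^sup>2) * exp (- (x - fst a)\<^sup>2 / 2))"
        by (intro mult_left_mono dom) simp
      then show "norm (f x * gauss (fst (p n)) x * ee (snd (p n) * x)) \<le> exp (B\<^sup>2) * (norm (f x * cnj (complex_of_real (exp (- (x - fst a)\<^sup>2 / 2)))))"
        by (simp add: norm_mult gauss_def mult_ac)
    qed
  qed measurable
  then show "(\<lambda>n. gauss_stft f (p n)) \<longlonglongrightarrow> gauss_stft f a" by (simp only: gauss_stft_ee)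
qed

lemma gauss_stft_measurable: "f \<in> L2 \<Longrightarrow> gauss_stft f \<in> borel_measurable borel"
  by (intro borel_measurable_continuous_onI gauss_stft_continuous)

lemma integrable_stft_mult:
  assumes F: "integrable lborel (gauss_stft \<phi>)" and h: "h \<in> L2"
  shows "integrable lborel (\<lambda>p. gauss_stft \<phi> p * cnj (gauss_stft h p))"
proof (rule Bochner_Integration.integrable_bound)
  have [measurable]: "gauss_stft h \<in> borel_measurable borel" using h by (rule gauss_stft_measurable)
  have [measurable]: "gauss_stft \<phi> \<in> borel_measurable borel" using F by auto
  show "integrable lborel (\<lambda>p. norm (gauss_stft \<phi> p) * (L2_norm h * gnorm))" using F by simp
  show "(\<lambda>p. gauss_stft \<phi> p * cnj (gauss_stft h p)) \<in> borel_measurable lborel" by measurable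
  show "AE p in lborel. norm (gauss_stft \<phi> p * cnj (gauss_stft h p)) \<le> norm (norm (gauss_stft \<phi> p) * (L2_norm h * gnorm))"
  proof (rule AE_I2)
    fix p
    have "norm (gauss_stft \<phi> p * cnj (gauss_stft h p)) \<le> norm (gauss_stft \<phi> p) * (L2_norm h * gnorm)"
      unfolding norm_mult complex_mod_cnj by (intro mult_left_mono gauss_stft_bound h) auto
    then show "norm (gauss_stft \<phi> p * cnj (gauss_stft h p)) \<le> norm (norm (gauss_stft \<phi> p) * (L2_norm h * gnorm))" by simp
  qed
qed

text \<open>For almost every time \<open>t\<close> the slice of the transform of \<phi> is
  integrable, so Parseval applies to \<open>\<phi> x * gauss t x\<close> and
  \<open>h x * gauss t x\<close>. Integrating over \<open>t\<close> afterwards reduces the squared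
  window to the constant \<open>gnorm\<^sup>2\<close>.\<close>

lemma moyal_continuous:
  assumes phi: "\<phi> \<in> L2" and F: "integrable lborel (gauss_stft \<phi>)"
    and h: "h \<in> L2" "continuous_on UNIV h" "bounded {x. h x \<noteq> 0}"
  shows "of_real (gnorm\<^sup>2) * ip \<phi> h = (\<integral>p. gauss_stft \<phi> p * cnj (gauss_stft h p) \<partial>lborel)"
proof -
  have [measurable]: "\<phi> \<in> borel_measurable borel" "h \<in> borel_measurable borel" using phi h by (auto simp: L2_def)
  have i: "integrable (lborel \<Otimes>\<^sub>M lborel) (\<lambda>p. gauss_stft \<phi> p * cnj (gauss_stft h p))"
    using integrable_stft_mult[OF F h(1)] by (simp add: lborel_prod)
  have F': "integrable (lborel \<Otimes>\<^sub>M lborel) (gauss_stft \<phi>)" using F by (simp add: lborel_prod)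
  let ?a = "\<lambda>x. \<phi> x * cnj (h x)"
  let ?E = "\<lambda>t x. complex_of_real ((norm (gauss t x))\<^sup>2)"
  have ai: "integrable lborel ?a" by (rule L2_integrable_prod[OF phi h(1)])
  have inner: "AE t in lborel. (\<integral>\<nu>. gauss_stft \<phi> (t, \<nu>) * cnj (gauss_stft h (t, \<nu>)) \<partial>lborel) = (\<integral>x. ?a x * ?E t x \<partial>lborel)"
    using lborel_pair.AE_integrable_fst'[OF F']
  proof eventually_elim
    case (elim t)
    have cg: "continuous_on UNIV (\<lambda>x. h x * gauss t x)"
      unfolding gauss_def using h(2) by (intro continuous_intros)
    have bg: "bounded {x. h x * gauss t x \<noteq> 0}" by (rule bounded_subset[OF h(3)]) auto
    have e: "gauss_stft f (t, \<nu>) = (\<integral>x. (f x * gauss t x) * ee (\<nu> * x) \<partial>lborel)" for f \<nu>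
      unfolding gauss_stft_ee by simp
    have "(\<integral>\<nu>. gauss_stft \<phi> (t, \<nu>) * cnj (gauss_stft h (t, \<nu>)) \<partial>lborel) = (\<integral>x. (\<phi> x * gauss t x) * cnj (h x * gauss t x) \<partial>lborel)"
      unfolding e by (rule parseval_compact_support[OF gauss_mult_integrable[OF phi] cg bg]) (use elim in \<open>simp add: e\<close>)
    also have "\<dots> = (\<integral>x. ?a x * ?E t x \<partial>lborel)"
      by (intro Bochner_Integration.integral_cong refl) (simp add: complex_norm_square mult_ac del: of_real_power)
    finally show ?case .
  qed
  have [measurable]: "(\<lambda>p. gauss (fst p) (snd p)) \<in> borel_measurable (lborel \<Otimes>\<^sub>M lborel)"
    unfolding gauss_def by measurable
  have ii: "integrable (lborel \<Otimes>\<^sub>M lborel) (\<lambda>p. ?a (fst p) * ?E (snd p) (fst p))"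
  proof (rule lborel_pair.Fubini_integrable)
    have [measurable]: "(\<lambda>p. gauss (snd p) (fst p)) \<in> borel_measurable (lborel \<Otimes>\<^sub>M lborel)"
      unfolding gauss_def by measurable
    show "(\<lambda>p. ?a (fst p) * ?E (snd p) (fst p)) \<in> borel_measurable (lborel \<Otimes>\<^sub>M lborel)" by measurable
    have "(\<integral>t. norm (?a (fst (x, t)) * ?E (snd (x, t)) (fst (x, t))) \<partial>lborel) = norm (?a x) * (sqrt (2 * pi) / 2)" for x
      unfolding fst_conv snd_conv norm_mult[of "?a x"] by (simp add: gauss_sq(3) del: of_real_power)
    then show "integrable lborel (\<lambda>x. \<integral>t. norm (?a (fst (x, t)) * ?E (snd (x, t)) (fst (x, t))) \<partial>lborel)"
      using integrable_norm[OF ai] by (simp only: integrable_mult_left)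
    show "AE x in lborel. integrable lborel (\<lambda>t. ?a (fst (x, t)) * ?E (snd (x, t)) (fst (x, t)))"
    proof (intro AE_I2)
      fix x
      have "integrable lborel (\<lambda>t. ?E t x)" using gauss_sq(4)[of x] by (simp only: complex_of_real_integrable_eq)
      then show "integrable lborel (\<lambda>t. ?a (fst (x, t)) * ?E (snd (x, t)) (fst (x, t)))" by simp
    qed
  qed
  have "(\<integral>p. gauss_stft \<phi> p * cnj (gauss_stft h p) \<partial>lborel) = (\<integral>t. \<integral>\<nu>. gauss_stft \<phi> (t, \<nu>) * cnj (gauss_stft h (t, \<nu>)) \<partial>lborel \<partial>lborel)"
    using lborel_pair.integral_fst'[OF i] by (simp add: lborel_prod)
  also have "\<dots> = (\<integral>t. \<integral>x. ?a x * ?E t x \<partial>lborel \<partial>lborel)"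
  proof (rule integral_cong_AE)
    show "(\<lambda>t. \<integral>\<nu>. gauss_stft \<phi> (t, \<nu>) * cnj (gauss_stft h (t, \<nu>)) \<partial>lborel) \<in> borel_measurable lborel"
      using lborel_pair.integrable_fst'[OF i] by auto
    show "(\<lambda>t. \<integral>x. ?a x * ?E t x \<partial>lborel) \<in> borel_measurable lborel"
      using lborel.borel_measurable_lebesgue_integral[of "\<lambda>t x. ?a x * ?E t x" lborel] by (simp add: case_prod_beta')
  qed (rule inner)
  also have "\<dots> = (\<integral>x. \<integral>t. ?a x * ?E t x \<partial>lborel \<partial>lborel)"
    using lborel_pair.Fubini_integral[of "\<lambda>x t. ?a x * ?E t x"] ii by (simp add: case_prod_beta')
  also have "\<dots> = (\<integral>x. ?a x * of_real (gnorm\<^sup>2) \<partial>lborel)"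
  proof -
    have "(\<integral>t. ?E t x \<partial>lborel) = of_real (gnorm\<^sup>2)" for x
      unfolding integral_complex_of_real gauss_sq(3) by (simp add: gnorm_def)
    then show ?thesis unfolding integral_mult_right_zero by simp
  qed
  finally show ?thesis by (simp add: ip_def mult.commute)
qed

text \<open>Both sides are continuous in \<open>h\<close> for the L2 norm, with joint constant
  \<open>C\<close>: the left by Cauchy-Schwarz, the right because the transform of \<open>h\<close>
  is bounded by its norm and that of \<phi> is integrable. Density does the rest.\<close>

lemma moyal:
  assumes phi: "\<phi> \<in> L2" and F: "integrable lborel (gauss_stft \<phi>)" and h: "h \<in> L2"
  shows "of_real (gnorm\<^sup>2) * ip \<phi> h = (\<integral>p. gauss_stft \<phi> p * cnj (gauss_stft h p) \<partial>lborel)"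
proof -
  define C where "C = gnorm\<^sup>2 * L2_norm \<phi> + (\<integral>p. norm (gauss_stft \<phi> p) \<partial>lborel) * gnorm"
  have C: "C \<ge> 0" by (simp add: C_def L2_norm_nonneg gnorm_def)
  have "norm (of_real (gnorm\<^sup>2) * ip \<phi> h - (\<integral>p. gauss_stft \<phi> p * cnj (gauss_stft h p) \<partial>lborel)) \<le> 0 + \<epsilon>" if eps: "\<epsilon> > 0" for \<epsilon>
  proof -
    obtain w where w: "continuous_on UNIV w" "bounded {x. w x \<noteq> 0}" "w \<in> L2" "L2_norm (\<lambda>x. h x - w x) < \<epsilon> / (C + 1)"
      using L2_dense_continuous[OF h, of "\<epsilon> / (C + 1)"] C eps by auto
    define d where "d = (\<lambda>x. h x - w x)"
    have d: "d \<in> L2" unfolding d_def by (rule L2_diff[OF h w(3)])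
    have Vd: "gauss_stft h p - gauss_stft w p = gauss_stft d p" for p
      unfolding d_def by (rule gauss_stft_diff[OF h w(3), symmetric])
    have "of_real (gnorm\<^sup>2) * ip \<phi> h - (\<integral>p. gauss_stft \<phi> p * cnj (gauss_stft h p) \<partial>lborel) = 
       of_real (gnorm\<^sup>2) * (ip \<phi> h - ip \<phi> w) - ((\<integral>p. gauss_stft \<phi> p * cnj (gauss_stft h p) \<partial>lborel) - (\<integral>p. gauss_stft \<phi> p * cnj (gauss_stft w p) \<partial>lborel))"
      using moyal_continuous[OF phi F w(3,1,2)] by (simp add: algebra_simps)
    also have "ip \<phi> h - ip \<phi> w = ip \<phi> d" unfolding d_def by (rule ip_diff2[OF h w(3) phi, symmetric])
    also have "(\<integral>p. gauss_stft \<phi> p * cnj (gauss_stft h p) \<partial>lborel) - (\<integral>p. gauss_stft \<phi> p * cnj (gauss_stft w p) \<partial>lborel) = 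
       (\<integral>p. gauss_stft \<phi> p * cnj (gauss_stft d p) \<partial>lborel)"
      unfolding Vd[symmetric] complex_cnj_diff right_diff_distrib
      by (rule Bochner_Integration.integral_diff[symmetric]) (intro integrable_stft_mult F h w)+
    also have "norm (of_real (gnorm\<^sup>2) * ip \<phi> d - (\<integral>p. gauss_stft \<phi> p * cnj (gauss_stft d p) \<partial>lborel)) \<le>
       gnorm\<^sup>2 * (L2_norm \<phi> * L2_norm d) + (\<integral>p. norm (gauss_stft \<phi> p) \<partial>lborel) * (L2_norm d * gnorm)"
    proof (rule order_trans[OF norm_triangle_ineq4] , rule add_mono)
      show "norm (of_real (gnorm\<^sup>2) * ip \<phi> d) \<le> gnorm\<^sup>2 * (L2_norm \<phi> * L2_norm d)"
        unfolding norm_mult norm_of_real by (intro mult_mono ip_cauchy_schwarz phi d) auto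
      have "norm (\<integral>p. gauss_stft \<phi> p * cnj (gauss_stft d p) \<partial>lborel) \<le> (\<integral>p. norm (gauss_stft \<phi> p) * (L2_norm d * gnorm) \<partial>lborel)"
      proof (rule order_trans[OF integral_norm_bound], rule integral_mono')
        show "integrable lborel (\<lambda>p. norm (gauss_stft \<phi> p) * (L2_norm d * gnorm))" using F by simp
        show "norm (gauss_stft \<phi> p * cnj (gauss_stft d p)) \<le> norm (gauss_stft \<phi> p) * (L2_norm d * gnorm)" for p
          unfolding norm_mult complex_mod_cnj by (intro mult_left_mono gauss_stft_bound d) auto
      qed (simp add: L2_norm_nonneg gnorm_def)
      then show "norm (\<integral>p. gauss_stft \<phi> p * cnj (gauss_stft d p) \<partial>lborel) \<le> (\<integral>p. norm (gauss_stft \<phi> p) \<partial>lborel) * (L2_norm d * gnorm)"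
        by simp
    qed
    also have "\<dots> = C * L2_norm d" by (simp add: C_def algebra_simps)
    also have "\<dots> \<le> C * (\<epsilon> / (C + 1))" using w(4) C by (intro mult_left_mono) (auto simp: d_def)
    also have "\<dots> \<le> \<epsilon>"
    proof -
      have "C * \<epsilon> \<le> \<epsilon> * (C + 1)" using eps by (simp add: algebra_simps)
      then show ?thesis using C by (simp add: pos_divide_le_eq)
    qed
    finally show ?thesis by simp
  qed
  then have "norm (of_real (gnorm\<^sup>2) * ip \<phi> h - (\<integral>p. gauss_stft \<phi> p * cnj (gauss_stft h p) \<partial>lborel)) \<le> 0"
    by (rule field_le_epsilon)
  then show ?thesis by simp
qed

section \<open>Decay of the ambiguity function\<close>

lemma gnorm_pos: "gnorm > 0" by (simp add: gnorm_def)

lemma gnorm_sq: "gnorm\<^sup>2 = sqrt (2 * pi) / 2" by (simp add: gnorm_def)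

text \<open>The frequency moves by plus \<open>snd p\<close>, contrary to the time, because the
  transform carries the character with a positive sign.\<close>

lemma gauss_stft_rho:
  "gauss_stft (rho p f) q = ee (fst p * snd p / 2 + fst p * snd q) * gauss_stft f (fst q - fst p, snd q + snd p)"
proof -
  define g where "g y = (ee (snd p * (y + fst p) - fst p * snd p / 2) * f y * gauss (fst q) (y + fst p)) * ee (snd q * (y + fst p))" for y
  have e: "ee (snd p * (y + fst p) - fst p * snd p / 2) * ee (snd q * (y + fst p)) = ee (fst p * snd p / 2 + fst p * snd q) * ee ((snd q + snd p) * y)" for y
    unfolding ee_add[symmetric] by (rule arg_cong[where f = ee]) (simp add: field_simps)
  have gs: "gauss (fst q) (y + fst p) = gauss (fst q - fst p) y" for y
    by (simp add: gauss_def algebra_simps)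
  have g: "g y = ee (fst p * snd p / 2 + fst p * snd q) * ((f y * gauss (fst q - fst p) y) * ee ((snd q + snd p) * y))" for y
  proof -
    have "g y = (ee (snd p * (y + fst p) - fst p * snd p / 2) * ee (snd q * (y + fst p))) * (f y * gauss (fst q) (y + fst p))"
      unfolding g_def by (simp only: mult_ac)
    then show ?thesis unfolding e gs by (simp only: mult_ac)
  qed
  have "gauss_stft (rho p f) q = (\<integral>x. g (x - fst p) \<partial>lborel)"
    unfolding gauss_stft_ee rho_def g_def by simp
  also have "\<dots> = (\<integral>y. g y \<partial>lborel)" by (rule integral_shift)
  also have "\<dots> = ee (fst p * snd p / 2 + fst p * snd q) * gauss_stft f (fst q - fst p, snd q + snd p)"
    unfolding g gauss_stft_ee fst_conv snd_conv by (rule integral_mult_right_zero)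
  finally show ?thesis .
qed

text \<open>Moyal's formula is applied to \<open>h\<close>, a time-frequency shifted Gaussian whose
  inner product with \<phi> is the transform at \<open>q\<close>. The transform of \<open>h\<close>
  is again a Gaussian up to a phase, so a pointwise value is bounded by a local average.\<close>

lemma gauss_stft_reproducing:
  assumes phi: "\<phi> \<in> L2" and F: "integrable lborel (gauss_stft \<phi>)"
  shows "norm (gauss_stft \<phi> q) \<le> (\<integral>p. norm (gauss_stft \<phi> p) * exp (- ((fst p - fst q)\<^sup>2 + (snd p - snd q)\<^sup>2) / 2) \<partial>lborel)"
proof -
  define h where "h x = gauss (fst q) x * ee (- (snd q * x))" for x
  have [measurable]: "h \<in> borel_measurable borel" unfolding h_def by measurable
  have "norm (h x) = norm (gauss (fst q) x)" for x by (simp add: h_def norm_mult)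
  then have h: "h \<in> L2" using gauss_sq(1)[of "fst q"] by (simp add: L2_def)
  have ip: "ip \<phi> h = gauss_stft \<phi> q"
    unfolding ip_def gauss_stft_ee h_def by (simp add: cnj_ee mult.assoc)
  have V: "norm (gauss_stft h p) \<le> gnorm\<^sup>2 * exp (- ((fst p - fst q)\<^sup>2 + (snd p - snd q)\<^sup>2) / 2)" for p
  proof -
    define m s where "m = (fst p + fst q) / 2" and "s = snd p - snd q"
    define c where "c = exp (- (fst p - fst q)\<^sup>2 / 2)"
    define g where "g y = (of_real c * ee (s * m)) * (of_real (exp (- (2 * y)\<^sup>2 / 2)) * ee (s * y))" for y
    have gg: "gauss (fst q) x * gauss (fst p) x = of_real c * of_real (exp (- (2 * (x - m))\<^sup>2 / 2))" for x
    proof -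
      \<comment> \<open>Completing the square at the midpoint \<open>m\<close> of the two
        centres.\<close>
      have "- (x - fst q)\<^sup>2 + - (x - fst p)\<^sup>2 = - (fst p - fst q)\<^sup>2 / 2 + - (2 * (x - m))\<^sup>2 / 2"
        unfolding m_def power2_eq_square by (simp add: field_simps)
      then show ?thesis unfolding gauss_def c_def of_real_mult[symmetric] exp_add[symmetric] by simp
    qed
    have es: "ee (- (snd q * x)) * ee (snd p * x) = ee (s * m) * ee (s * (x - m))" for x
      unfolding ee_add[symmetric] by (rule arg_cong[where f = ee]) (simp add: s_def algebra_simps)
    have "h x * gauss (fst p) x * ee (snd p * x) = (gauss (fst q) x * gauss (fst p) x) * (ee (- (snd q * x)) * ee (snd p * x))" for x
      unfolding h_def by (simp only: mult_ac)
    then have "h x * gauss (fst p) x * ee (snd p * x) = g (x - m)" for x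
      unfolding gg es g_def by (simp only: mult_ac)
    then have "gauss_stft h p = (\<integral>x. g (x - m) \<partial>lborel)" unfolding gauss_stft_ee by simp
    also have "\<dots> = (\<integral>x. g x \<partial>lborel)" by (rule integral_shift)
    also have "\<dots> = (of_real c * ee (s * m)) * of_real (sqrt (2 * pi) / 2 * exp (- 2 * pi\<^sup>2 * (s / 2)\<^sup>2))"
      unfolding g_def integral_mult_right_zero[of lborel "of_real c * ee (s * m)"] using gaussian_integral(2)[of 2 s] by simp
    finally have Vh: "gauss_stft h p = (of_real c * ee (s * m)) * of_real (sqrt (2 * pi) / 2 * exp (- 2 * pi\<^sup>2 * (s / 2)\<^sup>2))" .
    have "norm (gauss_stft h p) = gnorm\<^sup>2 * (c * exp (- 2 * pi\<^sup>2 * (s / 2)\<^sup>2))"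
      unfolding Vh norm_mult norm_of_real norm_ee gnorm_sq by (simp add: c_def abs_mult)
    also have "\<dots> \<le> gnorm\<^sup>2 * (c * exp (- s\<^sup>2 / 2))"
    proof -
      \<comment> \<open>The true decay in frequency is faster; it is weakened to give a Gaussian of
        the same width in both variables.\<close>
      have "1 * s\<^sup>2 \<le> pi\<^sup>2 * s\<^sup>2" using pi_ge_two by (intro mult_right_mono one_le_power) auto
      then have "- 2 * pi\<^sup>2 * (s / 2)\<^sup>2 \<le> - s\<^sup>2 / 2" by (simp add: power_divide)
      then show ?thesis by (intro mult_left_mono) (auto simp: c_def)
    qed
    also have "c * exp (- s\<^sup>2 / 2) = exp (- ((fst p - fst q)\<^sup>2 + (snd p - snd q)\<^sup>2) / 2)"
      unfolding c_def exp_add[symmetric] s_def by (simp add: field_simps)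
    finally show ?thesis .
  qed
  let ?G = "\<lambda>p. exp (- ((fst p - fst q)\<^sup>2 + (snd p - snd q)\<^sup>2) / 2) :: real"
  have [measurable]: "gauss_stft \<phi> \<in> borel_measurable borel" by (rule gauss_stft_measurable[OF phi])
  have i: "integrable lborel (\<lambda>p. norm (gauss_stft \<phi> p) * (gnorm\<^sup>2 * ?G p))"
  proof (rule Bochner_Integration.integrable_bound)
    show "integrable lborel (\<lambda>p. norm (gauss_stft \<phi> p) * gnorm\<^sup>2)" using F by simp
    have [measurable]: "?G \<in> borel_measurable borel" by (intro borel_measurable_continuous_onI continuous_intros) auto
    show "(\<lambda>p. norm (gauss_stft \<phi> p) * (gnorm\<^sup>2 * ?G p)) \<in> borel_measurable lborel" by measurable
    have "?G p \<le> 1" for p by (simp add: divide_nonpos_pos)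
    then have "norm (gauss_stft \<phi> p) * (gnorm\<^sup>2 * ?G p) \<le> norm (gauss_stft \<phi> p) * (gnorm\<^sup>2 * 1)" for p
      by (intro mult_left_mono) auto
    then show "AE p in lborel. norm (norm (gauss_stft \<phi> p) * (gnorm\<^sup>2 * ?G p)) \<le> norm (norm (gauss_stft \<phi> p) * gnorm\<^sup>2)"
      by (intro AE_I2) (simp add: abs_mult)
  qed
  have "gnorm\<^sup>2 * norm (gauss_stft \<phi> q) = norm (\<integral>p. gauss_stft \<phi> p * cnj (gauss_stft h p) \<partial>lborel)"
    unfolding moyal[OF phi F h, symmetric] ip norm_mult norm_of_real by simp
  also have "\<dots> \<le> (\<integral>p. norm (gauss_stft \<phi> p) * (gnorm\<^sup>2 * ?G p) \<partial>lborel)"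
  proof (rule order_trans[OF integral_norm_bound], rule integral_mono')
    show "norm (gauss_stft \<phi> p * cnj (gauss_stft h p)) \<le> norm (gauss_stft \<phi> p) * (gnorm\<^sup>2 * ?G p)" for p
      unfolding norm_mult complex_mod_cnj by (intro mult_left_mono V) auto
  qed (rule i, simp)
  also have "\<dots> = gnorm\<^sup>2 * (\<integral>p. norm (gauss_stft \<phi> p) * ?G p \<partial>lborel)"
    unfolding integral_mult_right_zero[symmetric] by (simp only: mult_ac)
  finally show ?thesis using gnorm_pos by (simp add: mult_le_cancel_left_pos)
qed

definition amb :: "(real \<Rightarrow> complex) \<Rightarrow> real \<times> real \<Rightarrow> complex" where
  "amb \<phi> p = ip (rho p \<phi>) \<phi>"

lemma amb_minus: "amb \<phi> (- p) = cnj (amb \<phi> p)"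
  unfolding amb_def ip_cnj using ip_rho_adjoint[of "- p" \<phi> \<phi>] by (simp only: minus_minus)

lemma ip_rho_amb: "ip (rho p \<phi>) (rho q \<phi>) = ee (- sigma q p / 2) * amb \<phi> (p - q)"
proof -
  have "ip (rho p \<phi>) (rho q \<phi>) = ip (rho (- q) (rho p \<phi>)) (rho (- q) (rho q \<phi>))" by (simp only: ip_rho)
  also have "rho (- q) (rho q \<phi>) = \<phi>" by (simp add: rho_rho sigma_simps(1-3))
  also have "rho (- q) (rho p \<phi>) = (\<lambda>x. ee (- sigma q p / 2) * rho (p - q) \<phi> x)"
    by (simp add: rho_rho sigma_simps(1-3))
  finally show ?thesis by (simp add: ip_cmult1 amb_def)
qed

lemma amb_moyal:
  assumes phi: "\<phi> \<in> L2" and F: "integrable lborel (gauss_stft \<phi>)"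
  shows "of_real (gnorm\<^sup>2) * amb \<phi> p = (\<integral>q. gauss_stft \<phi> q * 
    cnj (ee (fst p * snd p / 2 - fst p * snd q) * gauss_stft \<phi> (fst q + fst p, snd q - snd p)) \<partial>lborel)"
proof -
  have "of_real (gnorm\<^sup>2) * amb \<phi> p = of_real (gnorm\<^sup>2) * ip \<phi> (rho (- p) \<phi>)" by (simp only: amb_def ip_rho_adjoint)
  also have "\<dots> = (\<integral>q. gauss_stft \<phi> q * cnj (gauss_stft (rho (- p) \<phi>) q) \<partial>lborel)" by (rule moyal[OF phi F rho_L2[OF phi]])
  finally show ?thesis unfolding gauss_stft_rho by simp
qed

text \<open>By Moyal's formula the point enters only one factor of the integrand, which is
  continuous and bounded; the other factor is integrable, so dominated convergence applies.\<close>

lemma amb_continuous: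
  assumes phi: "\<phi> \<in> L2" and F: "integrable lborel (gauss_stft \<phi>)"
  shows "continuous_on UNIV (amb \<phi>)"
proof (rule continuous_on_sequentiallyI)
  fix p :: "nat \<Rightarrow> real \<times> real" and a assume p: "p \<longlonglongrightarrow> a"
  have [measurable]: "gauss_stft \<phi> \<in> borel_measurable borel" by (rule gauss_stft_measurable[OF phi])
  let ?h = "\<lambda>p q. gauss_stft \<phi> q * cnj (ee (fst p * snd p / 2 - fst p * snd q) * gauss_stft \<phi> (fst q + fst p, snd q - snd p))"
  have "(\<lambda>n. \<integral>q. ?h (p n) q \<partial>lborel) \<longlonglongrightarrow> (\<integral>q. ?h a q \<partial>lborel)"
  proof (rule integral_dominated_convergence[where w = "\<lambda>q. norm (gauss_stft \<phi> q) * (L2_norm \<phi> * gnorm)"])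
    show "integrable lborel (\<lambda>q. norm (gauss_stft \<phi> q) * (L2_norm \<phi> * gnorm))" using F by simp
    show "AE q in lborel. (\<lambda>n. ?h (p n) q) \<longlonglongrightarrow> ?h a q"
    proof (rule AE_I2)
      fix q
      have c: "continuous_on UNIV (\<lambda>p. ?h p q)"
        by (intro continuous_intros continuous_on_compose2[OF gauss_stft_continuous[OF phi]]) auto
      show "(\<lambda>n. ?h (p n) q) \<longlonglongrightarrow> ?h a q" using continuous_on_tendsto_compose[OF c p] by simp
    qed
    show "AE q in lborel. norm (?h (p n) q) \<le> norm (gauss_stft \<phi> q) * (L2_norm \<phi> * gnorm)" for n
      unfolding norm_mult complex_mod_cnj norm_ee mult_1_left by (intro AE_I2 mult_left_mono gauss_stft_bound[OF phi]) auto
    have m: "?h b \<in> borel_measurable borel" for b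
      by (intro borel_measurable_continuous_onI continuous_intros gauss_stft_continuous[OF phi]
        continuous_on_compose2[OF gauss_stft_continuous[OF phi]]) auto
    show "?h a \<in> borel_measurable lborel" "?h (p n) \<in> borel_measurable lborel" for n
      using m[of a] m[of "p n"] by simp_all
  qed
  then have "(\<lambda>n. of_real (gnorm\<^sup>2) * amb \<phi> (p n)) \<longlonglongrightarrow> of_real (gnorm\<^sup>2) * amb \<phi> a"
    unfolding amb_moyal[OF phi F] .
  then have "(\<lambda>n. inverse (of_real (gnorm\<^sup>2)) * (of_real (gnorm\<^sup>2) * amb \<phi> (p n))) \<longlonglongrightarrow> inverse (of_real (gnorm\<^sup>2)) * (of_real (gnorm\<^sup>2) * amb \<phi> a)"
    by (rule tendsto_mult[OF tendsto_const])
  moreover have "inverse (complex_of_real (gnorm\<^sup>2)) * (of_real (gnorm\<^sup>2) * z) = z" for z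
    using gnorm_pos by (simp add: field_simps)
  ultimately show "(\<lambda>n. amb \<phi> (p n)) \<longlonglongrightarrow> amb \<phi> a" by (simp only:)
qed

text \<open>Used in place of a Gaussian because a bounded shift of the argument costs only a
  constant factor, uniformly in the argument, while the values at the integers remain
  summable.\<close>

definition lor :: "real \<Rightarrow> real \<Rightarrow> real" where "lor c t = 1 / (1 + c * t\<^sup>2)"

lemma lor_bounds: "c \<ge> 0 \<Longrightarrow> 0 < lor c t" "c \<ge> 0 \<Longrightarrow> lor c t \<le> 1"
  by (simp_all add: lor_def add_pos_nonneg)

lemma lor_shift:
  assumes c: "c \<ge> 0" and f: "\<bar>f\<bar> \<le> r"
  shows "lor c (a + f) \<le> (2 + 2 * c * r\<^sup>2) * lor c a"
proof -
  have "f\<^sup>2 \<le> r\<^sup>2" using f by (metis abs_ge_zero power2_abs power_mono)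
  then have cf: "c * f\<^sup>2 \<le> c * r\<^sup>2" using c by (rule mult_left_mono)
  have "a\<^sup>2 \<le> 2 * (a + f)\<^sup>2 + 2 * f\<^sup>2" using zero_le_power2[of "a + 2 * f"] by (simp add: power2_eq_square algebra_simps)
  then have "c * a\<^sup>2 \<le> c * (2 * (a + f)\<^sup>2 + 2 * f\<^sup>2)" using c by (rule mult_left_mono)
  also have "\<dots> = 2 * (c * (a + f)\<^sup>2) + 2 * (c * f\<^sup>2)" by (simp add: algebra_simps)
  finally have "1 + c * a\<^sup>2 \<le> 1 + (2 * (c * (a + f)\<^sup>2) + 2 * (c * r\<^sup>2))" using cf by simp
  also have "\<dots> \<le> (2 + 2 * (c * r\<^sup>2)) * (1 + c * (a + f)\<^sup>2)"
    using c by (simp add: distrib_left distrib_right)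
  finally show ?thesis
    using c by (simp add: lor_def divide_simps add_pos_nonneg mult.assoc zero_less_mult_iff add_nonneg_eq_0_iff split: if_splits)
qed

lemma lor_summable:
  assumes c: "c > 0"
  shows "(\<lambda>k::int. lor c (of_int k)) summable_on UNIV"
proof -
  have s: "summable (\<lambda>n. lor c (real n))"
  proof (rule summable_comparison_test_ev)
    show "summable (\<lambda>n. 1 / c * inverse ((real n)\<^sup>2))" by (intro summable_mult inverse_power_summable) simp
    show "eventually (\<lambda>n. norm (lor c (real n)) \<le> 1 / c * inverse ((real n)\<^sup>2)) sequentially"
      using eventually_gt_at_top[of 0]
    proof eventually_elim
      case (elim n)
      have "1 / (1 + c * (real n)\<^sup>2) \<le> 1 / (c * (real n)\<^sup>2)" using elim c by (intro divide_left_mono mult_pos_pos add_pos_pos) auto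
      then show ?case using lor_bounds[of c "real n"] c by (simp add: lor_def field_simps)
    qed
  qed
  then have n: "(\<lambda>n. lor c (real n)) summable_on UNIV"
    using lor_bounds c by (subst summable_on_UNIV_nonneg_real_iff) (auto intro: less_imp_le)
  have 1: "(\<lambda>k::int. lor c (of_int k)) summable_on range int"
    by (subst summable_on_reindex) (auto simp: comp_def n)
  have 2: "(\<lambda>k::int. lor c (of_int k)) summable_on range (\<lambda>n. - int n)"
    by (subst summable_on_reindex) (auto simp: comp_def inj_on_def lor_def n[unfolded lor_def])
  have "(\<lambda>k::int. lor c (of_int k)) summable_on (range int \<union> range (\<lambda>n. - int n))"
    by (rule summable_on_union[OF 1 2])
  also have "range int \<union> range (\<lambda>n. - int n) = UNIV"
    by (auto simp: image_iff) (metis int_cases2)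
  finally show ?thesis .
qed

text \<open>The bound is uniform in \<open>y\<close>: its integer part only renumbers the summands,
  and its fractional part costs the constant of \<open>lor_shift\<close>.\<close>

lemma lor_sum_bound:
  assumes c: "c > 0"
  obtains T where "T \<ge> 0" "\<And>y S. finite S \<Longrightarrow> (\<Sum>k\<in>S. lor c (y - of_int k)) \<le> T"
proof
  define T0 where "T0 = infsum (\<lambda>k::int. lor c (of_int k)) UNIV"
  have l0: "0 \<le> lor c t" for t using lor_bounds(1)[of c t] c by simp
  show "(2 + 2 * c * 1\<^sup>2) * T0 \<ge> 0" unfolding T0_def using c by (intro mult_nonneg_nonneg infsum_nonneg l0) auto
  fix y and S :: "int set" assume S: "finite S"
  have "(\<Sum>k\<in>S. lor c (y - of_int k)) \<le> (\<Sum>k\<in>S. (2 + 2 * c * 1\<^sup>2) * lor c (of_int (\<lfloor>y\<rfloor> - k)))"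
  proof (rule sum_mono)
    fix k
    have "\<bar>frac y\<bar> \<le> 1" using frac_lt_1[of y] by (simp add: abs_of_nonneg)
    from lor_shift[OF less_imp_le[OF c] this, of "of_int (\<lfloor>y\<rfloor> - k)"]
    show "lor c (y - of_int k) \<le> (2 + 2 * c * 1\<^sup>2) * lor c (of_int (\<lfloor>y\<rfloor> - k))" by (simp add: frac_def)
  qed
  also have "\<dots> = (2 + 2 * c * 1\<^sup>2) * (\<Sum>k\<in>(\<lambda>k. \<lfloor>y\<rfloor> - k) ` S. lor c (of_int k))"
    by (subst sum.reindex) (auto simp: inj_on_def sum_distrib_left comp_def)
  also have "\<dots> \<le> (2 + 2 * c * 1\<^sup>2) * T0"
    unfolding T0_def using c S by (intro mult_left_mono finite_sum_le_infsum lor_summable l0) auto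
  finally show "(\<Sum>k\<in>S. lor c (y - of_int k)) \<le> (2 + 2 * c * 1\<^sup>2) * T0" .
qed

lemma gaussian_lor:
  assumes sg: "sigma v1 v2 \<noteq> 0"
  obtains c where "c > 0" "\<And>x. exp (- ((fst (pt v1 v2 x))\<^sup>2 + (snd (pt v1 v2 x))\<^sup>2) / 2) \<le> lor c (fst x) * lor c (snd x)"
proof
  define n where "n = (fst v1)\<^sup>2 + (snd v1)\<^sup>2 + (fst v2)\<^sup>2 + (snd v2)\<^sup>2"
  have n: "n > 0"
  proof (rule ccontr)
    assume "\<not> n > 0"
    then have "(fst v1)\<^sup>2 = 0 \<and> (snd v1)\<^sup>2 = 0"
      unfolding n_def by (smt (verit) zero_le_power2)
    then show False using sg by (simp add: sigma_def)
  qed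
  \<comment> \<open>The squared coordinates times \<open>(sigma v1 v2)\<^sup>2\<close> add up to at
    most \<open>n\<close> times the squared length; the factor 2 comes from the exponent of the
    Gaussian.\<close>
  define c where "c = (sigma v1 v2)\<^sup>2 / (2 * n)"
  show c: "c > 0" using n sg by (simp add: c_def)
  fix x
  define a b where "a = fst (pt v1 v2 x)" and "b = snd (pt v1 v2 x)"
  have ab: "a = fst x * fst v1 + snd x * fst v2" "b = fst x * snd v1 + snd x * snd v2" by (simp_all add: a_def b_def pt_def)
  have x1: "fst x * sigma v1 v2 = fst v2 * b - snd v2 * a" unfolding ab sigma_def by (simp add: algebra_simps)
  have x2: "snd x * sigma v1 v2 = snd v1 * a - fst v1 * b" unfolding ab sigma_def by (simp add: algebra_simps)
  have "(fst x * sigma v1 v2)\<^sup>2 + (snd x * sigma v1 v2)\<^sup>2 \<le> n * (a\<^sup>2 + b\<^sup>2)"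
  proof -
    \<comment> \<open>Lagrange's identity for both basis vectors; two of the four squares are the
      scaled coordinates.\<close>
    have "n * (a\<^sup>2 + b\<^sup>2) = (fst v2 * b - snd v2 * a)\<^sup>2 + (snd v1 * a - fst v1 * b)\<^sup>2 + (fst v2 * a + snd v2 * b)\<^sup>2 + (fst v1 * a + snd v1 * b)\<^sup>2"
      unfolding n_def by (simp add: power2_eq_square algebra_simps)
    then show ?thesis unfolding x1 x2 by simp
  qed
  then have "((fst x)\<^sup>2 + (snd x)\<^sup>2) * (sigma v1 v2)\<^sup>2 \<le> n * (a\<^sup>2 + b\<^sup>2)" by (simp add: power_mult_distrib distrib_right)
  then have le: "c * (fst x)\<^sup>2 + c * (snd x)\<^sup>2 \<le> (a\<^sup>2 + b\<^sup>2) / 2" unfolding c_def using n by (simp add: field_simps)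
  have "(1 + c * (fst x)\<^sup>2) * (1 + c * (snd x)\<^sup>2) \<le> exp (c * (fst x)\<^sup>2) * exp (c * (snd x)\<^sup>2)"
    using c by (intro mult_mono exp_ge_add_one_self) auto
  also have "\<dots> \<le> exp ((a\<^sup>2 + b\<^sup>2) / 2)" unfolding exp_add[symmetric] using le by simp
  finally have l: "(1 + c * (fst x)\<^sup>2) * (1 + c * (snd x)\<^sup>2) \<le> exp ((a\<^sup>2 + b\<^sup>2) / 2)" .
  have "1 / exp ((a\<^sup>2 + b\<^sup>2) / 2) \<le> 1 / ((1 + c * (fst x)\<^sup>2) * (1 + c * (snd x)\<^sup>2))"
    using l c by (intro divide_left_mono) (auto intro!: mult_pos_pos add_pos_nonneg)
  moreover have "exp (- (a\<^sup>2 + b\<^sup>2) / 2) = 1 / exp ((a\<^sup>2 + b\<^sup>2) / 2)"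
    unfolding minus_divide_left[symmetric] exp_minus by (rule inverse_eq_divide)
  ultimately show "exp (- ((fst (pt v1 v2 x))\<^sup>2 + (snd (pt v1 v2 x))\<^sup>2) / 2) \<le> lor c (fst x) * lor c (snd x)"
    by (simp add: lor_def a_def[symmetric] b_def[symmetric])
qed

text \<open>Moyal's formula bounds the ambiguity function by a correlation of the transform of
  \<phi> with its own translate, and the reproducing estimate replaces the translate by a Gaussian
  average. Dominating the Gaussian by Lorentz factors removes the dependence on \<open>x\<close> in
  the box, and their sums over the integers are uniformly bounded; so the total is at most a
  constant times the square of the L1 norm of the transform.\<close>

theorem amb_majorant:
  assumes phi: "\<phi> \<in> L2" and F: "integrable lborel (gauss_stft \<phi>)" and sg: "sigma v1 v2 \<noteq> 0"
  obtains M where "M summable_on (UNIV :: (int \<times> int) set)"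
    "\<And>x k l. \<bar>fst x\<bar> \<le> r \<Longrightarrow> \<bar>snd x\<bar> \<le> r \<Longrightarrow> norm (amb \<phi> (pt v1 v2 (x + (of_int k, of_int l)))) \<le> M (k, l)"
proof -
  obtain c where c: "c > 0" "\<And>x. exp (- ((fst (pt v1 v2 x))\<^sup>2 + (snd (pt v1 v2 x))\<^sup>2) / 2) \<le> lor c (fst x) * lor c (snd x)"
    using gaussian_lor[OF sg] by blast
  obtain T where T: "T \<ge> 0" "\<And>y S. finite S \<Longrightarrow> (\<Sum>k\<in>S. lor c (y - of_int k)) \<le> T"
    using lor_sum_bound[OF c(1)] by blast
  define F1 where "F1 p = norm (gauss_stft \<phi> p)" for p
  have [measurable]: "gauss_stft \<phi> \<in> borel_measurable borel" by (rule gauss_stft_measurable[OF phi])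
  have F1m [measurable]: "F1 \<in> borel_measurable borel" unfolding F1_def by measurable
  have F1i: "integrable lborel F1" using F unfolding F1_def by simp
  have F1nn: "F1 p \<ge> 0" for p by (simp add: F1_def)
  have lnn: "0 \<le> lor c t" and l1: "lor c t \<le> 1" for t using lor_bounds[of c t] c by auto
  define b where "b = 2 + 2 * c * r\<^sup>2"
  have b: "b \<ge> 0" using c by (simp add: b_def)
  \<comment> \<open>Lattice coordinates of the point (fst p, - snd p); the frequency is reflected
    because \<open>amb_moyal\<close> adds in time but subtracts in frequency.\<close>
  define Y1 where "Y1 p = (fst v2 * (- snd p) - snd v2 * fst p) / sigma v1 v2" for p :: "real \<times> real"
  define Y2 where "Y2 p = (snd v1 * fst p - fst v1 * (- snd p)) / sigma v1 v2" for p :: "real \<times> real"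
  have Y: "pt v1 v2 (Y1 p, Y2 p) = (fst p, - snd p)" for p
    using sg unfolding pt_def Y1_def Y2_def by (simp add: prod_eq_iff field_simps) (simp add: sigma_def algebra_simps)
  define H where "H \<kappa> p = b\<^sup>2 * (lor c (Y1 p - of_int (fst \<kappa>)) * lor c (Y2 p - of_int (snd \<kappa>)))" for \<kappa> :: "int \<times> int" and p
  have lm: "lor c \<in> borel_measurable borel" unfolding lor_def by measurable
  have Ym: "Y1 \<in> borel_measurable borel" "Y2 \<in> borel_measurable borel"
    unfolding Y1_def Y2_def using sg by (auto intro!: borel_measurable_continuous_onI continuous_intros)
  have lY: "(\<lambda>p. lor c (Y1 p - a)) \<in> borel_measurable borel" "(\<lambda>p. lor c (Y2 p - a)) \<in> borel_measurable borel" for a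
    by (rule measurable_compose[OF borel_measurable_diff[OF Ym(1) borel_measurable_const] lm],
        rule measurable_compose[OF borel_measurable_diff[OF Ym(2) borel_measurable_const] lm])
  have Hm [measurable]: "H \<kappa> \<in> borel_measurable borel" for \<kappa>
    unfolding H_def by (intro borel_measurable_times borel_measurable_const lY)
  have H0: "0 \<le> H \<kappa> p" for \<kappa> p unfolding H_def by (intro mult_nonneg_nonneg lnn) auto
  have Hb: "H \<kappa> p \<le> b\<^sup>2" for \<kappa> p
  proof -
    have "H \<kappa> p \<le> b\<^sup>2 * (1 * 1)" unfolding H_def by (intro mult_left_mono mult_mono lnn l1) auto
    then show ?thesis by simp
  qed
  have HS: "(\<Sum>\<kappa>\<in>S. H \<kappa> p) \<le> b\<^sup>2 * (T * T)" if S: "finite S" for S p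
  proof -
    have "(\<Sum>\<kappa>\<in>S. H \<kappa> p) \<le> (\<Sum>\<kappa>\<in>fst ` S \<times> snd ` S. H \<kappa> p)"
    proof (rule sum_mono2)
      show "S \<subseteq> fst ` S \<times> snd ` S" by (auto intro: rev_image_eqI)
    qed (use S in \<open>auto intro: H0\<close>)
    also have "\<dots> = b\<^sup>2 * ((\<Sum>k\<in>fst ` S. lor c (Y1 p - of_int k)) * (\<Sum>l\<in>snd ` S. lor c (Y2 p - of_int l)))"
    proof -
      have "(\<Sum>k\<in>fst ` S. f k) * (\<Sum>l\<in>snd ` S. g l) = (\<Sum>\<kappa>\<in>fst ` S \<times> snd ` S. f (fst \<kappa>) * g (snd \<kappa>))" for f g :: "int \<Rightarrow> real"
        by (simp add: sum_product sum.cartesian_product case_prod_beta)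
      then show ?thesis unfolding H_def by (simp only: sum_distrib_left)
    qed
    also have "\<dots> \<le> b\<^sup>2 * (T * T)"
    proof (rule mult_left_mono[OF mult_mono])
      show "(\<Sum>k\<in>fst ` S. lor c (Y1 p - of_int k)) \<le> T" "(\<Sum>l\<in>snd ` S. lor c (Y2 p - of_int l)) \<le> T"
        using S by (simp_all add: T(2))
    qed (simp_all add: T(1) sum_nonneg lnn)
    finally show ?thesis .
  qed
  define h where "h \<kappa> q = (\<integral>p. F1 p * H \<kappa> (p - q) \<partial>lborel)" for \<kappa> q
  have hi: "integrable lborel (\<lambda>p. F1 p * H \<kappa> (p - q))" for \<kappa> q
  proof (rule Bochner_Integration.integrable_bound)
    show "integrable lborel (\<lambda>p. F1 p * b\<^sup>2)" using F1i by simp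
    show "(\<lambda>p. F1 p * H \<kappa> (p - q)) \<in> borel_measurable lborel" by measurable
    show "AE p in lborel. norm (F1 p * H \<kappa> (p - q)) \<le> norm (F1 p * b\<^sup>2)"
      by (intro AE_I2) (simp add: abs_mult H0 F1nn mult_left_mono Hb)
  qed
  have h0: "0 \<le> h \<kappa> q" for \<kappa> q unfolding h_def by (intro Bochner_Integration.integral_nonneg mult_nonneg_nonneg F1nn H0)
  have hS: "(\<Sum>\<kappa>\<in>S. h \<kappa> q) \<le> integral\<^sup>L lborel F1 * (b\<^sup>2 * (T * T))" if S: "finite S" for S q
  proof -
    have "(\<Sum>\<kappa>\<in>S. h \<kappa> q) = (\<integral>p. F1 p * (\<Sum>\<kappa>\<in>S. H \<kappa> (p - q)) \<partial>lborel)"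
      unfolding h_def sum_distrib_left by (rule Bochner_Integration.integral_sum[symmetric]) (rule hi)
    also have "\<dots> \<le> (\<integral>p. F1 p * (b\<^sup>2 * (T * T)) \<partial>lborel)"
    proof (rule integral_mono')
      show "integrable lborel (\<lambda>p. F1 p * (b\<^sup>2 * (T * T)))" using F1i by (rule integrable_mult_left)
    qed (use T in \<open>auto intro!: mult_left_mono HS S F1nn mult_nonneg_nonneg\<close>)
    also have "\<dots> = integral\<^sup>L lborel F1 * (b\<^sup>2 * (T * T))" by (rule integral_mult_left_zero)
    finally show ?thesis .
  qed
  have hb: "h \<kappa> q \<le> integral\<^sup>L lborel F1 * (b\<^sup>2 * (T * T))" for \<kappa> q using hS[of "{\<kappa>}" q] by simp
  have hm [measurable]: "h \<kappa> \<in> borel_measurable borel" for \<kappa>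
    using lborel.borel_measurable_lebesgue_integral[of "\<lambda>q p. F1 p * H \<kappa> (p - q)" lborel] by (simp add: h_def[abs_def] case_prod_beta')
  have ohi: "integrable lborel (\<lambda>q. F1 q * h \<kappa> q)" for \<kappa>
  proof (rule Bochner_Integration.integrable_bound)
    show "integrable lborel (\<lambda>p. F1 p * (integral\<^sup>L lborel F1 * (b\<^sup>2 * (T * T))))" using F1i by (rule integrable_mult_left)
    show "AE p in lborel. norm (F1 p * h \<kappa> p) \<le> norm (F1 p * (integral\<^sup>L lborel F1 * (b\<^sup>2 * (T * T))))"
      using hb h0 F1nn by (intro AE_I2) (smt (verit) abs_of_nonneg mult_left_mono mult_nonneg_nonneg real_norm_def)
    show "(\<lambda>q. F1 q * h \<kappa> q) \<in> borel_measurable lborel" by measurable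
  qed
  define M where "M \<kappa> = (\<integral>q. F1 q * h \<kappa> q \<partial>lborel) / gnorm\<^sup>2" for \<kappa>
  have M0: "0 \<le> M \<kappa>" for \<kappa> unfolding M_def by (intro divide_nonneg_nonneg Bochner_Integration.integral_nonneg mult_nonneg_nonneg F1nn h0) auto
  have "M summable_on UNIV"
  proof (rule nonneg_bdd_above_summable_on)
    show "bdd_above (sum M ` {S. S \<subseteq> UNIV \<and> finite S})"
    proof (rule bdd_aboveI2)
      fix S assume "S \<in> {S. S \<subseteq> UNIV \<and> finite (S :: (int \<times> int) set)}"
      then have S: "finite S" by simp
      have "sum M S = (\<integral>q. F1 q * (\<Sum>\<kappa>\<in>S. h \<kappa> q) \<partial>lborel) / gnorm\<^sup>2"
        unfolding M_def sum_divide_distrib[symmetric] sum_distrib_left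
        by (rule arg_cong[where f = "\<lambda>u. u / gnorm\<^sup>2"], rule Bochner_Integration.integral_sum[symmetric], rule ohi)
      also have "\<dots> \<le> (\<integral>q. F1 q * (integral\<^sup>L lborel F1 * (b\<^sup>2 * (T * T))) \<partial>lborel) / gnorm\<^sup>2"
      proof (rule divide_right_mono, rule integral_mono')
        show "integrable lborel (\<lambda>q. F1 q * (integral\<^sup>L lborel F1 * (b\<^sup>2 * (T * T))))" using F1i by (rule integrable_mult_left)
        show "F1 q * (\<Sum>\<kappa>\<in>S. h \<kappa> q) \<le> F1 q * (integral\<^sup>L lborel F1 * (b\<^sup>2 * (T * T)))" for q by (intro mult_left_mono hS S F1nn)
        show "0 \<le> F1 q * (integral\<^sup>L lborel F1 * (b\<^sup>2 * (T * T)))" for q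
          using T by (intro mult_nonneg_nonneg F1nn Bochner_Integration.integral_nonneg) auto
      qed simp
      finally show "sum M S \<le> (\<integral>q. F1 q * (integral\<^sup>L lborel F1 * (b\<^sup>2 * (T * T))) \<partial>lborel) / gnorm\<^sup>2" .
    qed
  qed (rule M0)
  moreover have "norm (amb \<phi> (pt v1 v2 (x + (of_int k, of_int l)))) \<le> M (k, l)" if x: "\<bar>fst x\<bar> \<le> r" "\<bar>snd x\<bar> \<le> r" for x k l
  proof -
    define w where "w = pt v1 v2 (x + (of_int k, of_int l))"
    have G: "exp (- ((fst p - (fst q + fst w))\<^sup>2 + (snd p - (snd q - snd w))\<^sup>2) / 2) \<le> H (k, l) (p - q)" for p q
    proof -
      let ?y = "(Y1 (p - q), Y2 (p - q)) - (x + (of_int k, of_int l))"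
      have e: "pt v1 v2 ?y = (fst p - fst q - fst w, - (snd p - snd q) - snd w)"
        unfolding pt_diff Y w_def by (simp add: prod_eq_iff)
      have "(fst p - (fst q + fst w))\<^sup>2 + (snd p - (snd q - snd w))\<^sup>2 = (fst (pt v1 v2 ?y))\<^sup>2 + (snd (pt v1 v2 ?y))\<^sup>2"
        unfolding e by (simp add: power2_eq_square algebra_simps)
      then have "exp (- ((fst p - (fst q + fst w))\<^sup>2 + (snd p - (snd q - snd w))\<^sup>2) / 2) \<le> lor c (fst ?y) * lor c (snd ?y)"
        using c(2)[of ?y] by simp
      also have "\<dots> \<le> (b * lor c (Y1 (p - q) - of_int k)) * (b * lor c (Y2 (p - q) - of_int l))"
      proof (intro mult_mono lnn mult_nonneg_nonneg b)
        have "\<bar>- fst x\<bar> \<le> r" "\<bar>- snd x\<bar> \<le> r" using x by auto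
        from lor_shift[OF less_imp_le[OF c(1)] this(1), of "Y1 (p - q) - of_int k"] lor_shift[OF less_imp_le[OF c(1)] this(2), of "Y2 (p - q) - of_int l"]
        show "lor c (fst ?y) \<le> b * lor c (Y1 (p - q) - of_int k)" "lor c (snd ?y) \<le> b * lor c (Y2 (p - q) - of_int l)"
          by (simp_all add: b_def algebra_simps)
      qed
      finally show ?thesis by (simp add: H_def power2_eq_square mult_ac)
    qed
    have Fh: "norm (gauss_stft \<phi> (fst q + fst w, snd q - snd w)) \<le> h (k, l) q" for q
    proof -
      have "norm (gauss_stft \<phi> (fst q + fst w, snd q - snd w)) \<le> 
         (\<integral>p. F1 p * exp (- ((fst p - (fst q + fst w))\<^sup>2 + (snd p - (snd q - snd w))\<^sup>2) / 2) \<partial>lborel)"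
        using gauss_stft_reproducing[OF phi F, of "(fst q + fst w, snd q - snd w)"] by (simp add: F1_def)
      also have "\<dots> \<le> h (k, l) q" unfolding h_def
        by (rule integral_mono'[OF hi]) (intro mult_left_mono G F1nn mult_nonneg_nonneg H0)+
      finally show ?thesis .
    qed
    have "gnorm\<^sup>2 * norm (amb \<phi> w) = norm (of_real (gnorm\<^sup>2) * amb \<phi> w)" by (simp add: norm_mult norm_power)
    also have "\<dots> \<le> (\<integral>q. F1 q * h (k, l) q \<partial>lborel)"
      unfolding amb_moyal[OF phi F]
    proof (rule order_trans[OF integral_norm_bound], rule integral_mono'[OF ohi])
      show "norm (gauss_stft \<phi> q * cnj (ee (fst w * snd w / 2 - fst w * snd q) * gauss_stft \<phi> (fst q + fst w, snd q - snd w))) \<le> F1 q * h (k, l) q" for q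
        unfolding norm_mult complex_mod_cnj norm_ee mult_1_left F1_def[symmetric] by (intro mult_left_mono Fh[folded F1_def] F1nn)
    qed (intro mult_nonneg_nonneg F1nn h0)
    finally show ?thesis unfolding M_def w_def[symmetric] using gnorm_pos by (simp add: field_simps)
  qed
  ultimately show thesis by (rule that)
qed

section \<open>The bracket series\<close>

locale series_kernel =
  fixes \<phi> :: "real \<Rightarrow> complex" and v1 v2 :: "real \<times> real" and P :: int and Q :: nat
  assumes phi: "\<phi> \<in> L2" and F: "integrable lborel (gauss_stft \<phi>)"
    and Q: "Q > 0" and sig: "sigma v1 v2 = of_int P / of_nat Q" and P: "P \<noteq> 0"
begin

abbreviation \<theta> :: real where "\<theta> \<equiv> sigma v1 v2"

lemma sg: "\<theta> \<noteq> 0" using sig P Q by simp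

lemma theta_Q: "\<theta> * of_nat Q = of_int P" using sig Q by simp

text \<open>With U1 = \<open>rho v1\<close> and U2 the shift by Q v2, the term with index \<kappa> =
  (k, l) is e(k z1 + l z2) times the inner product of \<open>psi\<close> at x with U1^k U2^l applied
  to \<open>psi\<close> at y. The cocycle phases are collected here; the one with k l arises since
  U1^k U2^l is e(P k l / 2) times a single symmetrised shift.\<close>

definition ph :: "real \<times> real \<Rightarrow> real \<times> real \<Rightarrow> real \<times> real \<Rightarrow> int \<times> int \<Rightarrow> real" where
  "ph z x y \<kappa> = \<theta> / 2 * wedge x y + of_int P / 2 * of_int (snd \<kappa>) * (fst x + fst y)
     - \<theta> / 2 * of_int (fst \<kappa>) * (snd x + snd y) - of_int P / 2 * of_int (fst \<kappa>) * of_int (snd \<kappa>)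
     + of_int (fst \<kappa>) * fst z + of_int (snd \<kappa>) * snd z"

definition emb :: "int \<times> int \<Rightarrow> real \<times> real" where
  "emb \<kappa> = (of_int (fst \<kappa>), of_nat Q * of_int (snd \<kappa>))"

definition trm :: "real \<times> real \<Rightarrow> real \<times> real \<Rightarrow> real \<times> real \<Rightarrow> int \<times> int \<Rightarrow> complex" where
  "trm z x y \<kappa> = ee (ph z x y \<kappa>) * amb \<phi> (pt v1 v2 (x - y - emb \<kappa>))"

definition K :: "real \<times> real \<Rightarrow> real \<times> real \<Rightarrow> real \<times> real \<Rightarrow> complex" where
  "K z x y = infsum (trm z x y) UNIV"

text \<open>After renumbering the index set each covariance rule is an identity between single
  terms, true up to an integer in the phase.\<close>

lemma K_transform:
  assumes b: "bij g" and e: "\<And>\<kappa>. trm z' x' y' (g \<kappa>) = c * trm z x y \<kappa>"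
  shows "K z' x' y' = c * K z x y"
proof -
  have "K z' x' y' = infsum (\<lambda>\<kappa>. trm z' x' y' (g \<kappa>)) UNIV"
    unfolding K_def by (rule infsum_reindex_bij_betw[OF b, symmetric])
  then show ?thesis unfolding e K_def by (simp only: infsum_cmult_right')
qed

lemma trm_eqI:
  assumes "ph z' x' y' \<kappa>' = s + ph z x y \<kappa> + of_int n" "x' - y' - emb \<kappa>' = x - y - emb \<kappa>"
  shows "trm z' x' y' \<kappa>' = ee s * trm z x y \<kappa>"
  unfolding trm_def assms by (simp add: ee_add)

lemma K_herm: "K z y x = cnj (K z x y)"
proof -
  have t: "trm z y x (- \<kappa>) = cnj (trm z x y \<kappa>)" for \<kappa>
  proof -
    have p: "ph z y x (- \<kappa>) = - ph z x y \<kappa> + of_int (- P * fst \<kappa> * snd \<kappa>)"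
      unfolding ph_def wedge_def by (simp add: field_simps)
    have e: "y - x - emb (- \<kappa>) = - (x - y - emb \<kappa>)" by (simp add: emb_def prod_eq_iff)
    have "pt v1 v2 (- w) = - pt v1 v2 w" for w by (simp add: pt_def)
    then have "pt v1 v2 (y - x - emb (- \<kappa>)) = - pt v1 v2 (x - y - emb \<kappa>)" unfolding e .
    then show ?thesis unfolding trm_def p by (simp only: amb_minus ee_add ee_of_int mult_1_right complex_cnj_mult cnj_ee)
  qed
  have "K z y x = infsum (\<lambda>\<kappa>. trm z y x (- \<kappa>)) UNIV"
    unfolding K_def by (rule infsum_reindex_bij_betw[symmetric]) (rule bij_uminus)
  then show ?thesis unfolding t K_def by (simp only: infsum_cnj)
qed

lemma bij_id': "bij (\<lambda>x. x)" by (simp add: bij_def)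

lemma K_per1: "K (z + (1, 0)) x y = K z x y"
proof -
  have "K (z + (1, 0)) x y = ee 0 * K z x y"
  proof (rule K_transform[OF bij_id'])
    show "trm (z + (1, 0)) x y \<kappa> = ee 0 * trm z x y \<kappa>" for \<kappa>
      by (rule trm_eqI[where n = "fst \<kappa>"]) (simp_all add: ph_def algebra_simps)
  qed
  then show ?thesis by simp
qed

lemma K_per2: "K (z + (0, 1)) x y = K z x y"
proof -
  have "K (z + (0, 1)) x y = ee 0 * K z x y"
  proof (rule K_transform[OF bij_id'])
    show "trm (z + (0, 1)) x y \<kappa> = ee 0 * trm z x y \<kappa>" for \<kappa>
      by (rule trm_eqI[where n = "snd \<kappa>"]) (simp_all add: ph_def algebra_simps)
  qed
  then show ?thesis by simp
qed

lemma bij_plus': "bij (\<lambda>\<kappa>. \<kappa> + a :: int \<times> int)" by (rule bij_plus_right)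

lemma K_U1: "K z (x + (1, 0)) y = ee (fst z - \<theta> / 2 * snd x) * K z x y"
proof (rule K_transform[OF bij_plus'[of "(1, 0)"]])
  show "trm z (x + (1, 0)) y (\<kappa> + (1, 0)) = ee (fst z - \<theta> / 2 * snd x) * trm z x y \<kappa>" for \<kappa>
    by (rule trm_eqI[where n = 0]) (simp_all add: ph_def wedge_def emb_def prod_eq_iff field_simps)
qed

lemma K_U2: "K z (x + bv Q) y = ee (snd z + of_int P / 2 * fst x) * K z x y"
proof (rule K_transform[OF bij_plus'[of "(0, 1)"]])
  show "trm z (x + bv Q) y (\<kappa> + (0, 1)) = ee (snd z + of_int P / 2 * fst x) * trm z x y \<kappa>" for \<kappa>
    by (rule trm_eqI[where n = "- P * fst \<kappa>"])
       (simp_all add: ph_def wedge_def emb_def prod_eq_iff theta_Q[symmetric] field_simps)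
qed

lemma K_shift: "K z (w + x) (w + y) = ee (\<theta> / 2 * (wedge w y - wedge w x)) * K (z + (- \<theta> * snd w, of_int P * fst w)) x y"
proof (rule K_transform[OF bij_id'])
  show "trm z (w + x) (w + y) \<kappa> = ee (\<theta> / 2 * (wedge w y - wedge w x)) * trm (z + (- \<theta> * snd w, of_int P * fst w)) x y \<kappa>" for \<kappa>
    by (rule trm_eqI[where n = 0]) (simp_all add: ph_def wedge_def field_simps)
qed

text \<open>The phases have modulus 1, so only the difference of x and y has to stay in a box, while
  z is arbitrary. The sublattice is the image of the full index set under the injective map
  \<open>g\<close>.\<close>

lemma trm_majorant:
  obtains M where "M summable_on UNIV"
    "\<And>z x y \<kappa>. \<bar>fst x - fst y\<bar> \<le> r \<Longrightarrow> \<bar>snd x - snd y\<bar> \<le> r \<Longrightarrow> norm (trm z x y \<kappa>) \<le> M \<kappa>"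
proof -
  obtain M where M: "M summable_on (UNIV :: (int \<times> int) set)"
    "\<And>x k l. \<bar>fst x\<bar> \<le> r \<Longrightarrow> \<bar>snd x\<bar> \<le> r \<Longrightarrow> norm (amb \<phi> (pt v1 v2 (x + (of_int k, of_int l)))) \<le> M (k, l)"
    using amb_majorant[OF phi F sg] by blast
  define g where "g \<kappa> = (- fst \<kappa>, - (int Q * snd \<kappa>))" for \<kappa> :: "int \<times> int"
  have "inj g" using Q by (auto simp: inj_def g_def prod_eq_iff)
  moreover have "M summable_on range g" by (rule summable_on_subset_banach[OF M(1)]) simp
  ultimately have "(M \<circ> g) summable_on UNIV" by (simp add: summable_on_reindex)
  moreover have "norm (trm z x y \<kappa>) \<le> (M \<circ> g) \<kappa>" if "\<bar>fst x - fst y\<bar> \<le> r" "\<bar>snd x - snd y\<bar> \<le> r" for z x y \<kappa>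
  proof -
    have e: "x - y - emb \<kappa> = (x - y) + (of_int (fst (g \<kappa>)), of_int (snd (g \<kappa>)))" by (simp add: emb_def g_def prod_eq_iff)
    show ?thesis using M(2)[of "x - y" "fst (g \<kappa>)" "snd (g \<kappa>)"] that unfolding trm_def norm_mult norm_ee e by simp
  qed
  ultimately show thesis by (rule that)
qed

lemma continuous_on_trm:
  assumes "continuous_on S f" "continuous_on S g"
  shows "continuous_on S (\<lambda>p. trm (f p) (g p) y \<kappa>)"
proof -
  have 1: "continuous_on S (\<lambda>p. pt v1 v2 (g p - y - emb \<kappa>))"
    unfolding pt_def by (intro continuous_intros assms)
  have 2: "continuous_on S (\<lambda>p. ph (f p) (g p) y \<kappa>)"
    unfolding ph_def wedge_def by (intro continuous_intros assms)
  show ?thesis unfolding trm_def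
    by (intro continuous_on_mult continuous_on_ee 2 continuous_on_compose2[OF amb_continuous[OF phi F] 1]) auto
qed

lemma K_uniform_limit:
  assumes "\<And>p. p \<in> S \<Longrightarrow> \<bar>fst (g p) - fst y\<bar> \<le> r" "\<And>p. p \<in> S \<Longrightarrow> \<bar>snd (g p) - snd y\<bar> \<le> r"
  shows "uniform_limit S (\<lambda>X p. \<Sum>\<kappa>\<in>X. trm (f p) (g p) y \<kappa>) (\<lambda>p. K (f p) (g p) y) (finite_subsets_at_top UNIV)"
proof -
  obtain M where M: "M summable_on UNIV"
    "\<And>z x y \<kappa>. \<bar>fst x - fst y\<bar> \<le> r \<Longrightarrow> \<bar>snd x - snd y\<bar> \<le> r \<Longrightarrow> norm (trm z x y \<kappa>) \<le> M \<kappa>"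
    using trm_majorant by blast
  show ?thesis unfolding K_def
    by (rule Weierstrass_m_test_general[OF _ M(1)]) (intro M(2) assms)
qed

text \<open>Near any point the x-coordinate stays in a strip on which the series converges uniformly
  by the majorant, and the partial sums are continuous because the ambiguity function is.\<close>

lemma K_cont: "continuous_on UNIV (\<lambda>p. K (snd p) (fst p) y)"
proof -
  have "continuous (at a) (\<lambda>p. K (snd p) (fst p) y)" for a
  proof -
    let ?S = "{p :: (real \<times> real) \<times> (real \<times> real). \<bar>fst (fst p) - fst (fst a)\<bar> < 1 \<and> \<bar>snd (fst p) - snd (fst a)\<bar> < 1}"
    define r where "r = \<bar>fst (fst a) - fst y\<bar> + \<bar>snd (fst a) - snd y\<bar> + 1"
    have o: "open ?S" by (intro open_Collect_conj open_Collect_less continuous_intros)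
    have "continuous_on ?S (\<lambda>p. K (snd p) (fst p) y)"
    proof (rule uniform_limit_theorem[OF _ K_uniform_limit[where r = r]])
      show "\<forall>\<^sub>F X in finite_subsets_at_top UNIV. continuous_on ?S (\<lambda>p. \<Sum>\<kappa>\<in>X. trm (snd p) (fst p) y \<kappa>)"
        by (intro always_eventually allI continuous_on_sum continuous_on_trm continuous_intros)
    qed (auto simp: r_def)
    moreover have "a \<in> ?S" by simp
    ultimately show ?thesis unfolding continuous_on_eq_continuous_at[OF o] by blast
  qed
  then show ?thesis by (simp add: continuous_at_imp_continuous_on)
qed

text \<open>Uniform convergence permits termwise integration, and orthogonality of characters leaves
  only the index 0, whose term is the inner product itself.\<close>

lemma K_int: "integral (cbox (0, 0) (1, 1)) (\<lambda>z. K z x y) = ip (psi \<phi> v1 v2 x) (psi \<phi> v1 v2 y)"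
proof -
  let ?B = "cbox (0, 0) (1, 1) :: (real \<times> real) set"
  have u: "uniform_limit ?B (\<lambda>X z. \<Sum>\<kappa>\<in>X. trm z x y \<kappa>) (\<lambda>z. K z x y) (finite_subsets_at_top UNIV)"
    by (rule K_uniform_limit[where f = "\<lambda>z. z" and g = "\<lambda>z. x" and r = "\<bar>fst x - fst y\<bar> + \<bar>snd x - snd y\<bar>"]) auto
  have c: "continuous_on ?B (\<lambda>z. trm z x y \<kappa>)" for \<kappa>
    by (rule continuous_on_trm) (intro continuous_intros)+
  obtain I J where I: "\<And>X. ((\<lambda>z. \<Sum>\<kappa>\<in>X. trm z x y \<kappa>) has_integral I X) ?B"
    and J: "((\<lambda>z. K z x y) has_integral J) ?B" and lim: "(I \<longlongrightarrow> J) (finite_subsets_at_top UNIV)"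
    by (rule uniform_limit_integral_cbox[OF u]) (auto intro!: continuous_on_sum c)
  define T where "T \<kappa> = ee (ph 0 x y \<kappa>) * amb \<phi> (pt v1 v2 (x - y - emb \<kappa>))" for \<kappa>
  have tT: "trm z x y \<kappa> = T \<kappa> * ee (of_int (fst \<kappa>) * fst z + of_int (snd \<kappa>) * snd z)" for z \<kappa>
  proof -
    have "ph z x y \<kappa> = ph 0 x y \<kappa> + (of_int (fst \<kappa>) * fst z + of_int (snd \<kappa>) * snd z)" by (simp add: ph_def)
    then show ?thesis unfolding trm_def T_def by (simp add: ee_add mult_ac)
  qed
  have It: "integral ?B (\<lambda>z. trm z x y \<kappa>) = (if \<kappa> = 0 then T 0 else 0)" for \<kappa>
  proof -
    have "integral ?B (\<lambda>z. trm z x y \<kappa>) = T \<kappa> * integral ?B (\<lambda>z. ee (of_int (fst \<kappa>) * fst z + of_int (snd \<kappa>) * snd z))"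
      unfolding tT by (rule integral_mult_right)
    then show ?thesis unfolding integral_ee_unit_square by (cases \<kappa>) (auto simp: zero_prod_def)
  qed
  have IX: "I X = T 0" if "finite X" "0 \<in> X" for X
  proof -
    have "I X = integral ?B (\<lambda>z. \<Sum>\<kappa>\<in>X. trm z x y \<kappa>)" by (rule integral_unique[OF I, symmetric])
    also have "\<dots> = (\<Sum>\<kappa>\<in>X. integral ?B (\<lambda>z. trm z x y \<kappa>))"
      by (rule integral_sum) (auto intro: that integrable_continuous c)
    also have "\<dots> = T 0" unfolding It using that by simp
    finally show ?thesis .
  qed
  have "eventually (\<lambda>X. I X = T 0) (finite_subsets_at_top UNIV)"
    unfolding eventually_finite_subsets_at_top by (rule exI[of _ "{0}"]) (auto intro: IX)
  then have "(I \<longlongrightarrow> T 0) (finite_subsets_at_top UNIV)" by (rule tendsto_eventually)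
  then have "J = T 0" using lim by (intro tendsto_unique[OF _ lim]) auto
  also have "T 0 = ip (psi \<phi> v1 v2 x) (psi \<phi> v1 v2 y)"
    unfolding psi_def ip_rho_amb T_def sigma_pt
    by (simp add: ph_def emb_def pt_diff wedge_def zero_prod_def[symmetric] field_simps)
  finally show ?thesis using J by (simp add: integral_unique)
qed

end

theorem feichtinger_case:
  assumes phi: "\<phi> \<in> feichtinger_algebra" and rat: "sigma v1 v2 \<in> \<rat>" and sg: "sigma v1 v2 \<noteq> 0"
    and lower: "lower_riesz A \<phi> (pt v1 v2 ` latt)" and A: "A > 0"
    and mem: "tf_shift p \<phi> \<in> gabor_space \<phi> (pt v1 v2 ` latt)"
  shows "p \<in> pt v1 v2 ` latt"
proof -
  have L2: "\<phi> \<in> L2" and F: "integrable lborel (gauss_stft \<phi>)" using phi by (auto simp: feichtinger_algebra_def)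
  obtain P Q where PQ: "Q > 0" "coprime P Q" "sigma v1 v2 = of_int P / of_int Q"
    using rat by (rule Rats_cases') 
  define n where "n = nat Q"
  have n: "n > 0" "coprime P (int n)" "sigma v1 v2 = of_int P / of_nat n" "int n = Q"
    using PQ by (auto simp: n_def)
  have P: "P \<noteq> 0" using sg n by auto
  interpret series_kernel \<phi> v1 v2 P n by unfold_locales (use L2 F n P in auto)
  show ?thesis
    by (rule not_in_gabor_space_off_lattice[OF L2 lower A n(1,2,3) P K_herm K_cont K_per1 K_per2 K_U1 K_U2 K_shift K_int mem])
qed

section \<open>Degenerate lattices\<close>

lemma gabor_space_mono: "\<Lambda> \<subseteq> \<Lambda>' \<Longrightarrow> gabor_space \<phi> \<Lambda> \<subseteq> gabor_space \<phi> \<Lambda>'"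
proof -
  assume "\<Lambda> \<subseteq> \<Lambda>'"
  then have "lin_span \<Lambda> (\<lambda>p. tf_shift p \<phi>) \<subseteq> lin_span \<Lambda>' (\<lambda>p. tf_shift p \<phi>)"
    unfolding lin_span_def by (intro Collect_mono) (metis order_trans)
  then show "gabor_space \<phi> \<Lambda> \<subseteq> gabor_space \<phi> \<Lambda>'"
    unfolding gabor_space_def L2_closure_def by (intro Collect_mono) (metis subsetD)
qed

section \<open>Stability of the lower Riesz bound under adding distant points\<close>

lemma ip_sum1:
  assumes "finite S" "\<And>i. i \<in> S \<Longrightarrow> f i \<in> L2" "h \<in> L2"
  shows "ip (\<lambda>x. \<Sum>i\<in>S. f i x) h = (\<Sum>i\<in>S. ip (f i) h)"
  using assms(1,2)
proof (induction S rule: finite_induct)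
  case empty then show ?case by (simp add: ip_def)
next
  case (insert i S)
  then have "ip (\<lambda>x. f i x + (\<Sum>i\<in>S. f i x)) h = ip (f i) h + ip (\<lambda>x. \<Sum>i\<in>S. f i x) h"
    by (intro ip_add1 L2_sum assms(3)) auto
  then show ?case using insert by simp
qed

lemma L2_norm_sum_rho:
  assumes phi: "\<phi> \<in> L2" and S: "finite S"
  shows "of_real ((L2_norm (\<lambda>x. \<Sum>p\<in>S. c p * rho p \<phi> x))\<^sup>2) = 
    (\<Sum>p\<in>S. \<Sum>q\<in>S. c p * cnj (c q) * ip (rho p \<phi>) (rho q \<phi>))"
proof -
  let ?f = "\<lambda>x. \<Sum>p\<in>S. c p * rho p \<phi> x"
  have r: "(\<lambda>x. c p * rho p \<phi> x) \<in> L2" for p by (intro L2_cmult rho_L2 phi)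
  have fL: "?f \<in> L2" by (intro L2_sum S r)
  have "of_real ((L2_norm ?f)\<^sup>2) = ip ?f ?f" by (rule ip_self[symmetric])
  also have "\<dots> = (\<Sum>p\<in>S. ip (\<lambda>x. c p * rho p \<phi> x) ?f)" by (rule ip_sum1[OF S r fL])
  also have "\<dots> = (\<Sum>p\<in>S. c p * cnj (ip ?f (rho p \<phi>)))" by (simp only: ip_cmult1 ip_cnj)
  also have "\<dots> = (\<Sum>p\<in>S. c p * cnj (\<Sum>q\<in>S. ip (\<lambda>x. c q * rho q \<phi> x) (rho p \<phi>)))"
    by (simp only: ip_sum1[OF S r rho_L2[OF phi]])
  also have "\<dots> = (\<Sum>p\<in>S. c p * (\<Sum>q\<in>S. cnj (c q) * ip (rho p \<phi>) (rho q \<phi>)))"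
    by (simp only: cnj_sum ip_cmult1 complex_cnj_mult ip_cnj)
  also have "\<dots> = (\<Sum>p\<in>S. \<Sum>q\<in>S. c p * cnj (c q) * ip (rho p \<phi>) (rho q \<phi>))"
    by (simp only: sum_distrib_left mult.assoc)
  finally show ?thesis .
qed

text \<open>The unitary \<open>rho p0\<close> carries the system over \<Lambda> to the one over a
  coset, up to unimodular phases that enter the coefficients.\<close>

lemma lower_riesz_translate:
  assumes low: "lower_riesz A \<phi> \<Lambda>" and S: "finite S" "\<And>p. p \<in> S \<Longrightarrow> p - p0 \<in> \<Lambda>"
  shows "A * (\<Sum>p\<in>S. (norm (c p))\<^sup>2) \<le> (L2_norm (\<lambda>x. \<Sum>p\<in>S. c p * rho p \<phi> x))\<^sup>2"
proof -
  define c' where "c' q = c (p0 + q) * ee (- sigma p0 q / 2)" for q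
  let ?t = "\<lambda>p. p - p0"
  have inj: "inj_on ?t S" by (simp add: inj_on_def)
  let ?h = "\<lambda>x. \<Sum>q\<in>?t ` S. c' q * rho q \<phi> x"
  have "rho p0 ?h x = (\<Sum>p\<in>S. c p * rho p \<phi> x)" for x
  proof -
    have t: "c' (p - p0) * rho p0 (rho (p - p0) \<phi>) x = c p * rho p \<phi> x" for p
    proof -
      have "ee (- sigma p0 (p - p0) / 2) * ee (sigma p0 (p - p0) / 2) = 1" by (simp add: ee_add[symmetric])
      then show ?thesis by (simp add: c'_def rho_rho)
    qed
    have "rho p0 ?h x = (\<Sum>p\<in>S. c' (p - p0) * rho p0 (rho (p - p0) \<phi>) x)"
      unfolding sum.reindex[OF inj] rho_def[of p0] comp_def sum_distrib_left by (simp only: mult_ac)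
    then show ?thesis by (simp only: t)
  qed
  then have h: "rho p0 ?h = (\<lambda>x. \<Sum>p\<in>S. c p * rho p \<phi> x)" by blast
  have "A * (\<Sum>q\<in>?t ` S. (norm (c' q))\<^sup>2) \<le> (L2_norm ?h)\<^sup>2"
    by (rule low[unfolded lower_riesz_def, rule_format]) (use S in auto)
  moreover have "(\<Sum>q\<in>?t ` S. (norm (c' q))\<^sup>2) = (\<Sum>p\<in>S. (norm (c p))\<^sup>2)"
    by (simp add: sum.reindex[OF inj] c'_def norm_mult)
  ultimately show ?thesis unfolding h[symmetric] L2_norm_rho by simp
qed

text \<open>Restricting the Gram matrix to pairs in the same coset of \<Lambda> makes it block
  diagonal. The induction splits off the coset of one point, where the bound holds by
  translation.\<close>

lemma lower_riesz_blocks: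
  assumes phi: "\<phi> \<in> L2" and low: "lower_riesz A \<phi> \<Lambda>" and z: "0 \<in> \<Lambda>"
    and diff: "\<And>p q. p \<in> \<Lambda> \<Longrightarrow> q \<in> \<Lambda> \<Longrightarrow> p - q \<in> \<Lambda>" and S: "finite S"
  shows "A * (\<Sum>p\<in>S. (norm (c p))\<^sup>2) \<le> 
     Re (\<Sum>p\<in>S. \<Sum>q\<in>S. if p - q \<in> \<Lambda> then c p * cnj (c q) * ip (rho p \<phi>) (rho q \<phi>) else 0)"
  using S
proof (induction S rule: finite_psubset_induct)
  case (psubset S)
  let ?h = "\<lambda>p q. c p * cnj (c q) * ip (rho p \<phi>) (rho q \<phi>)"
  let ?g = "\<lambda>p q. if p - q \<in> \<Lambda> then ?h p q else 0"
  show ?case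
  proof (cases "S = {}")
    case False
    then obtain p0 where p0: "p0 \<in> S" by blast
    define S1 where "S1 = {p \<in> S. p - p0 \<in> \<Lambda>}"
    define S2 where "S2 = S - S1"
    have S12: "S = S1 \<union> S2" "S1 \<inter> S2 = {}" "finite S1" "finite S2" using psubset.hyps by (auto simp: S1_def S2_def)
    have neg: "- q \<in> \<Lambda>" if "q \<in> \<Lambda>" for q using diff[OF z that] by simp
    have 11: "p - q \<in> \<Lambda>" if "p \<in> S1" "q \<in> S1" for p q
      using diff[of "p - p0" "q - p0"] that by (simp add: S1_def)
    have 12: "p - q \<notin> \<Lambda>" if "p \<in> S1" "q \<in> S2" for p q
      using diff[of "p - p0" "p - q"] that by (auto simp: S1_def S2_def)
    have 21: "q - p \<notin> \<Lambda>" if "p \<in> S1" "q \<in> S2" for p q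
      using 12[OF that] neg[of "q - p"] by auto
    have "p0 \<in> S1" using p0 z by (simp add: S1_def)
    then have "S2 \<subset> S" using p0 by (auto simp: S2_def)
    from psubset.IH[OF this] have IH: "A * (\<Sum>p\<in>S2. (norm (c p))\<^sup>2) \<le> Re (\<Sum>p\<in>S2. \<Sum>q\<in>S2. ?g p q)" .
    have "A * (\<Sum>p\<in>S1. (norm (c p))\<^sup>2) \<le> (L2_norm (\<lambda>x. \<Sum>p\<in>S1. c p * rho p \<phi> x))\<^sup>2"
      by (rule lower_riesz_translate[OF low S12(3), of p0]) (simp add: S1_def)
    also have "\<dots> = Re (\<Sum>p\<in>S1. \<Sum>q\<in>S1. ?h p q)"
      unfolding L2_norm_sum_rho[OF phi S12(3), symmetric] by (simp only: Re_complex_of_real)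
    also have "(\<Sum>p\<in>S1. \<Sum>q\<in>S1. ?h p q) = (\<Sum>p\<in>S1. \<Sum>q\<in>S1. ?g p q)"
      by (intro sum.cong refl) (simp add: 11)
    finally have "A * (\<Sum>p\<in>S1. (norm (c p))\<^sup>2) + A * (\<Sum>p\<in>S2. (norm (c p))\<^sup>2) \<le>
       Re ((\<Sum>p\<in>S1. \<Sum>q\<in>S1. ?g p q) + (\<Sum>p\<in>S2. \<Sum>q\<in>S2. ?g p q))" using IH by simp
    moreover have "(\<Sum>p\<in>S. (norm (c p))\<^sup>2) = (\<Sum>p\<in>S1. (norm (c p))\<^sup>2) + (\<Sum>p\<in>S2. (norm (c p))\<^sup>2)"
      unfolding S12(1) by (rule sum.union_disjoint[OF S12(3,4,2)])
    moreover have "(\<Sum>q\<in>S. ?g p q) = (\<Sum>q\<in>S1. ?g p q)" if "p \<in> S1" for p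
    proof (rule sum.mono_neutral_right)
      show "\<forall>q\<in>S - S1. ?g p q = 0" unfolding S2_def[symmetric] using 12[OF that] by simp
    qed (use S12(1) psubset.hyps in blast)+
    moreover have "(\<Sum>q\<in>S. ?g p q) = (\<Sum>q\<in>S2. ?g p q)" if "p \<in> S2" for p
    proof (rule sum.mono_neutral_right)
      have "S - S2 = S1" using S12(1,2) by blast
      then show "\<forall>q\<in>S - S2. ?g p q = 0" using 21[OF _ that] by simp
    qed (use S12(1) psubset.hyps in blast)+
    moreover have "(\<Sum>p\<in>S. \<Sum>q\<in>S. ?g p q) = (\<Sum>p\<in>S1. \<Sum>q\<in>S. ?g p q) + (\<Sum>p\<in>S2. \<Sum>q\<in>S. ?g p q)"
      using sum.union_disjoint[OF S12(3,4,2), of "\<lambda>p. \<Sum>q\<in>S. ?g p q"] S12(1) by simp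
    ultimately show ?thesis by (simp add: distrib_left)
  qed simp
qed

text \<open>Schur's test: inside the cosets of \<Lambda> the constant A persists, and the remaining
  part of the Gram matrix has absolute row sums at most A / 2, hence removes at most half of
  it.\<close>

lemma lower_riesz_extend:
  assumes phi: "\<phi> \<in> L2" and low: "lower_riesz A \<phi> \<Lambda>" and z: "0 \<in> \<Lambda>"
    and diff: "\<And>p q. p \<in> \<Lambda> \<Longrightarrow> q \<in> \<Lambda> \<Longrightarrow> p - q \<in> \<Lambda>"
    and diff': "\<And>p q. p \<in> \<Lambda>' \<Longrightarrow> q \<in> \<Lambda>' \<Longrightarrow> p - q \<in> \<Lambda>'"
    and off: "\<And>S. finite S \<Longrightarrow> S \<subseteq> \<Lambda>' - \<Lambda> \<Longrightarrow> (\<Sum>p\<in>S. norm (amb \<phi> p)) \<le> A / 2"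
  shows "lower_riesz (A / 2) \<phi> \<Lambda>'"
  unfolding lower_riesz_def
proof (intro allI impI)
  fix S and c :: "real \<times> real \<Rightarrow> complex" assume S: "finite S" "S \<subseteq> \<Lambda>'"
  let ?h = "\<lambda>p q. c p * cnj (c q) * ip (rho p \<phi>) (rho q \<phi>)"
  let ?u = "\<lambda>p q. if p - q \<in> \<Lambda> then ?h p q else 0"
  let ?v = "\<lambda>p q. if p - q \<in> \<Lambda> then 0 else ?h p q"
  let ?a = "\<lambda>p q. if p - q \<in> \<Lambda> then 0 else norm (amb \<phi> (p - q))"
  let ?n = "\<Sum>p\<in>S. (norm (c p))\<^sup>2"
  have neg: "p - q \<in> \<Lambda> \<longleftrightarrow> q - p \<in> \<Lambda>" for p q using diff[OF z, of "p - q"] diff[OF z, of "q - p"] by auto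
  have asym: "?a q p = ?a p q" for p q
    using amb_minus[of \<phi> "p - q"] neg[of p q] by simp
  have a0: "0 \<le> ?a p q" for p q by simp
  have row: "(\<Sum>q\<in>S. ?a p q) \<le> A / 2" if "p \<in> S" for p
  proof -
    let ?S = "{q \<in> S. p - q \<notin> \<Lambda>}"
    have "(\<Sum>q\<in>S. ?a p q) = (\<Sum>q\<in>?S. norm (amb \<phi> (p - q)))"
      using S by (intro sum.mono_neutral_cong_right) auto
    also have "\<dots> = (\<Sum>w\<in>(\<lambda>q. p - q) ` ?S. norm (amb \<phi> w))"
      by (subst sum.reindex) (auto simp: inj_on_def)
    also have "\<dots> \<le> A / 2" using S that by (intro off) (auto intro!: diff')
    finally show ?thesis .
  qed
  have v: "norm (?v p q) \<le> (norm (c p))\<^sup>2 / 2 * ?a p q + (norm (c q))\<^sup>2 / 2 * ?a q p" for p q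
  proof -
    have "norm (?v p q) = norm (c p) * norm (c q) * ?a p q"
      by (simp add: norm_mult ip_rho_amb)
    also have "\<dots> \<le> ((norm (c p))\<^sup>2 / 2 + (norm (c q))\<^sup>2 / 2) * ?a p q"
      using sum_squares_bound[of "norm (c p)" "norm (c q)"] by (intro mult_right_mono a0) auto
    finally show ?thesis unfolding asym[of q p] by (simp only: distrib_right)
  qed
  have "norm (\<Sum>p\<in>S. \<Sum>q\<in>S. ?v p q) \<le> (\<Sum>p\<in>S. \<Sum>q\<in>S. (norm (c p))\<^sup>2 / 2 * ?a p q + (norm (c q))\<^sup>2 / 2 * ?a q p)"
    by (intro sum_norm_le v)
  also have "\<dots> = (\<Sum>p\<in>S. \<Sum>q\<in>S. (norm (c p))\<^sup>2 / 2 * ?a p q) + (\<Sum>q\<in>S. \<Sum>p\<in>S. (norm (c q))\<^sup>2 / 2 * ?a q p)"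
    unfolding sum.distrib by (subst (2) sum.swap) (rule refl)
  also have "\<dots> = (\<Sum>p\<in>S. (norm (c p))\<^sup>2 * (\<Sum>q\<in>S. ?a p q))"
    unfolding sum_distrib_left[symmetric] sum.distrib[symmetric] by (simp add: field_simps)
  also have "\<dots> \<le> (\<Sum>p\<in>S. (norm (c p))\<^sup>2 * (A / 2))"
    by (intro sum_mono mult_left_mono row) auto
  also have "\<dots> = A / 2 * ?n" unfolding sum_distrib_right[symmetric] by (rule mult.commute)
  finally have off': "norm (\<Sum>p\<in>S. \<Sum>q\<in>S. ?v p q) \<le> A / 2 * ?n" .
  have "A * ?n \<le> Re (\<Sum>p\<in>S. \<Sum>q\<in>S. ?u p q)"
    by (rule lower_riesz_blocks[OF phi low z diff S(1)])
  moreover have "- Re (\<Sum>p\<in>S. \<Sum>q\<in>S. ?v p q) \<le> A / 2 * ?n"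
    using off' abs_Re_le_cmod[of "\<Sum>p\<in>S. \<Sum>q\<in>S. ?v p q"] by linarith
  ultimately have "A / 2 * ?n \<le> Re ((\<Sum>p\<in>S. \<Sum>q\<in>S. ?u p q) + (\<Sum>p\<in>S. \<Sum>q\<in>S. ?v p q))" by simp
  also have "(\<Sum>p\<in>S. \<Sum>q\<in>S. ?u p q) + (\<Sum>p\<in>S. \<Sum>q\<in>S. ?v p q) = (\<Sum>p\<in>S. \<Sum>q\<in>S. ?h p q)"
    unfolding sum.distrib[symmetric] by (intro sum.cong refl) simp
  also have "\<dots> = of_real ((L2_norm (\<lambda>x. \<Sum>p\<in>S. c p * rho p \<phi> x))\<^sup>2)" by (rule L2_norm_sum_rho[OF phi S(1), symmetric])
  finally show "A / 2 * ?n \<le> (L2_norm (\<lambda>x. \<Sum>p\<in>S. c p * rho p \<phi> x))\<^sup>2" by (simp only: Re_complex_of_real)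
qed

lemma summable_tail:
  fixes M :: "'a \<Rightarrow> real"
  assumes M: "M summable_on UNIV" "\<And>x. M x \<ge> 0" and e: "e > 0"
  obtains S0 where "finite S0" "\<And>S. finite S \<Longrightarrow> S \<inter> S0 = {} \<Longrightarrow> sum M S \<le> e"
proof -
  have "(sum M \<longlongrightarrow> infsum M UNIV) (finite_subsets_at_top UNIV)"
    using has_sum_infsum[OF M(1)] by (simp add: has_sum_def)
  then have "eventually (\<lambda>S. sum M S > infsum M UNIV - e) (finite_subsets_at_top UNIV)"
    by (rule order_tendstoD) (use e in simp)
  then obtain S0 where S0: "finite S0" "sum M S0 > infsum M UNIV - e"
    unfolding eventually_finite_subsets_at_top by blast
  have "sum M S \<le> e" if "finite S" "S \<inter> S0 = {}" for S
  proof -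
    have "sum M S + sum M S0 = sum M (S \<union> S0)" using that S0 by (intro sum.union_disjoint[symmetric]) auto
    also have "\<dots> \<le> infsum M UNIV" using that S0 by (intro finite_sum_le_infsum M) auto
    finally show ?thesis using S0 by simp
  qed
  with S0(1) show thesis by (rule that)
qed

lemma amb_tail:
  assumes phi: "\<phi> \<in> L2" and F: "integrable lborel (gauss_stft \<phi>)" and sg: "sigma v1 v2 \<noteq> 0" and e: "e > 0"
  obtains N :: nat where "\<And>S. finite S \<Longrightarrow> 
    S \<subseteq> {pt v1 v2 (of_int k, of_int l) |k l. \<bar>k\<bar> > int N \<or> \<bar>l\<bar> > int N} \<Longrightarrow> (\<Sum>p\<in>S. norm (amb \<phi> p)) \<le> e"
proof -
  obtain M where M: "M summable_on (UNIV :: (int \<times> int) set)"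
    "\<And>x k l. \<bar>fst x\<bar> \<le> 0 \<Longrightarrow> \<bar>snd x\<bar> \<le> 0 \<Longrightarrow> norm (amb \<phi> (pt v1 v2 (x + (of_int k, of_int l)))) \<le> M (k, l)"
    using amb_majorant[OF phi F sg, of 0] by blast
  let ?g = "\<lambda>\<kappa> :: int \<times> int. pt v1 v2 (of_int (fst \<kappa>), of_int (snd \<kappa>))"
  have Mg: "norm (amb \<phi> (?g \<kappa>)) \<le> M \<kappa>" for \<kappa> using M(2)[of 0 "fst \<kappa>" "snd \<kappa>"] by simp
  then have M0: "0 \<le> M \<kappa>" for \<kappa> using order_trans[OF norm_ge_zero] by blast
  obtain S0 where S0: "finite S0" "\<And>S. finite S \<Longrightarrow> S \<inter> S0 = {} \<Longrightarrow> sum M S \<le> e"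
    using summable_tail[OF M(1) M0 e] by blast
  define N where "N = Max (insert 0 ((\<lambda>\<kappa>. nat (max \<bar>fst \<kappa>\<bar> \<bar>snd \<kappa>\<bar>)) ` S0))"
  have N: "\<bar>fst \<kappa>\<bar> \<le> int N" "\<bar>snd \<kappa>\<bar> \<le> int N" if "\<kappa> \<in> S0" for \<kappa>
  proof -
    have "nat (max \<bar>fst \<kappa>\<bar> \<bar>snd \<kappa>\<bar>) \<le> N" unfolding N_def using S0(1) that by (intro Max_ge) auto
    then show "\<bar>fst \<kappa>\<bar> \<le> int N" "\<bar>snd \<kappa>\<bar> \<le> int N" by auto
  qed
  have inj: "inj ?g"
  proof (rule injI)
    fix a b assume "?g a = ?g b"
    then have "(real_of_int (fst a), real_of_int (snd a)) = (of_int (fst b), of_int (snd b))"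
      by (rule injD[OF pt_inj[OF sg]])
    then show "a = b" by (simp add: prod_eq_iff)
  qed
  have "(\<Sum>p\<in>S. norm (amb \<phi> p)) \<le> e"
    if S: "finite S" "S \<subseteq> {pt v1 v2 (of_int k, of_int l) |k l. \<bar>k\<bar> > int N \<or> \<bar>l\<bar> > int N}" for S
  proof -
    have sub: "S \<subseteq> ?g ` {\<kappa>. \<bar>fst \<kappa>\<bar> > int N \<or> \<bar>snd \<kappa>\<bar> > int N}"
    proof
      fix p assume "p \<in> S"
      then obtain k l where "p = pt v1 v2 (of_int k, of_int l)" "\<bar>k\<bar> > int N \<or> \<bar>l\<bar> > int N" using S(2) by blast
      then show "p \<in> ?g ` {\<kappa>. \<bar>fst \<kappa>\<bar> > int N \<or> \<bar>snd \<kappa>\<bar> > int N}" by (intro image_eqI[of _ _ "(k, l)"]) auto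
    qed
    then obtain C where C: "C \<subseteq> {\<kappa>. \<bar>fst \<kappa>\<bar> > int N \<or> \<bar>snd \<kappa>\<bar> > int N}" "finite C" "S = ?g ` C"
      using finite_subset_image[OF S(1) sub] by blast
    have "(\<Sum>p\<in>S. norm (amb \<phi> p)) = (\<Sum>\<kappa>\<in>C. norm (amb \<phi> (?g \<kappa>)))"
      unfolding C(3) by (simp add: sum.reindex[OF inj_on_subset[OF inj subset_UNIV]])
    also have "\<dots> \<le> sum M C" by (intro sum_mono Mg)
    also have "\<dots> \<le> e"
    proof (rule S0(2)[OF C(2)])
      have "\<kappa> \<notin> S0" if "\<kappa> \<in> C" for \<kappa>
        using subsetD[OF C(1) that] N[of \<kappa>] by force
      then show "C \<inter> S0 = {}" by blast
    qed
    finally show ?thesis .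
  qed
  then show thesis by (rule that)
qed

lemma latt_diff: "x \<in> latt \<Longrightarrow> y \<in> latt \<Longrightarrow> x - y \<in> latt"
  by (auto simp: latt_def)

text \<open>A second generator \<open>k w\<close> with integer k completes the line to a full
  lattice of area k, which is rational. For large k the lower bound is only halved, and membership
  of \<open>p\<close> in the large lattice already forces it onto the given one.\<close>

lemma feichtinger_rank_one_case:
  assumes phi: "\<phi> \<in> feichtinger_algebra" and v: "v \<noteq> 0"
    and lower: "lower_riesz A \<phi> (range (\<lambda>m::int. of_int m *\<^sub>R v))" and A: "A > 0"
    and mem: "tf_shift p \<phi> \<in> gabor_space \<phi> (range (\<lambda>m::int. of_int m *\<^sub>R v))"
  shows "p \<in> range (\<lambda>m::int. of_int m *\<^sub>R v)"
proof -
  let ?L = "range (\<lambda>m::int. of_int m *\<^sub>R v)"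
  have L2: "\<phi> \<in> L2" and F: "integrable lborel (gauss_stft \<phi>)" using phi by (auto simp: feichtinger_algebra_def)
  define n where "n = (fst v)\<^sup>2 + (snd v)\<^sup>2"
  have n: "n \<noteq> 0" using v by (simp add: n_def prod_eq_iff sum_power2_eq_zero_iff)
  \<comment> \<open>The vector v turned by a right angle and scaled so that the area
    \<open>sigma v w\<close> is 1.\<close>
  define w where "w = (snd v / n, - fst v / n)"
  have "sigma v w = ((fst v)\<^sup>2 + (snd v)\<^sup>2) / n" by (simp add: sigma_def w_def power2_eq_square add_divide_distrib)
  then have sg: "sigma v w = 1" using n by (simp add: n_def[symmetric])
  then have sg0: "sigma v w \<noteq> 0" by simp
  obtain N where N: "\<And>S. finite S \<Longrightarrow> S \<subseteq> {pt v w (of_int k, of_int l) |k l. \<bar>k\<bar> > int N \<or> \<bar>l\<bar> > int N} \<Longrightarrow> (\<Sum>p\<in>S. norm (amb \<phi> p)) \<le> A / 2"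
    using amb_tail[OF L2 F sg0, of "A / 2"] A by auto
  obtain x where x: "p = pt v w x" using pt_surj[OF sg0] by blast
  \<comment> \<open>\<open>k > N\<close> puts every added point into the small tail of the ambiguity
    function, and \<open>real k > \<bar>snd x\<bar>\<close> prevents \<open>p\<close> from being one
    of the added points.\<close>
  define k where "k = max (Suc N) (nat \<lceil>\<bar>snd x\<bar>\<rceil> + 1)"
  have k: "k > N" "k > 0" "real k > \<bar>snd x\<bar>" unfolding k_def by linarith+
  let ?L' = "pt v (real k *\<^sub>R w) ` latt"
  have pk: "pt v (real k *\<^sub>R w) y = pt v w (fst y, real k * snd y)" for y by (simp add: pt_def)
  have L'E: "\<exists>m l. q = pt v w (of_int m, of_int (int k * l))" if "q \<in> ?L'" for q
  proof -
    obtain y where y: "y \<in> latt" "q = pt v (real k *\<^sub>R w) y" using \<open>q \<in> ?L'\<close> by blast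
    then obtain m l :: int where "fst y = of_int m" "snd y = of_int l" by (auto simp: latt_def elim!: Ints_cases)
    then have "q = pt v w (of_int m, of_int (int k * l))" using y(2) pk[of y] by simp
    then show ?thesis by blast
  qed
  have sub: "?L \<subseteq> ?L'"
  proof
    fix q assume "q \<in> ?L"
    then obtain m :: int where "q = of_int m *\<^sub>R v" by blast
    then have "q = pt v (real k *\<^sub>R w) (of_int m, 0)" by (simp add: pt_def)
    then show "q \<in> ?L'" by (auto simp: latt_def)
  qed
  have low': "lower_riesz (A / 2) \<phi> ?L'"
  proof (rule lower_riesz_extend[OF L2 lower])
    show "0 \<in> ?L" by (simp add: range_eqI[of _ _ 0])
    show "p - q \<in> ?L" if pq: "p \<in> ?L" "q \<in> ?L" for p q
    proof -
      obtain a b :: int where "p = of_int a *\<^sub>R v" "q = of_int b *\<^sub>R v" using pq by blast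
      then have "p - q = of_int (a - b) *\<^sub>R v" by (simp add: algebra_simps)
      then show ?thesis by (rule range_eqI)
    qed
    show "p - q \<in> ?L'" if "p \<in> ?L'" "q \<in> ?L'" for p q
      using that latt_diff by (auto simp: pt_diff[symmetric])
    show "(\<Sum>p\<in>S. norm (amb \<phi> p)) \<le> A / 2" if S: "finite S" "S \<subseteq> ?L' - ?L" for S
    proof (rule N[OF S(1)], rule subsetI)
      fix q assume q: "q \<in> S"
      then obtain m l where ml: "q = pt v w (of_int m, of_int (int k * l))" using S(2) L'E by blast
      have "l \<noteq> 0"
      proof
        assume "l = 0"
        then have "q = of_int m *\<^sub>R v" using ml by (simp add: pt_def)
        then show False using q S(2) by blast
      qed
      then have "1 \<le> \<bar>l\<bar>" by simp
      then have "int k * 1 \<le> int k * \<bar>l\<bar>" by (rule mult_left_mono) simp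
      then have "\<bar>int k * l\<bar> \<ge> int k" by (simp only: abs_mult abs_of_nat mult_1_right)
      then have "\<bar>int k * l\<bar> > int N" using k(1) by linarith
      then show "q \<in> {pt v w (of_int k, of_int l) |k l. \<bar>k\<bar> > int N \<or> \<bar>l\<bar> > int N}" using ml by blast
    qed
  qed
  have sgk: "sigma v (real k *\<^sub>R w) = of_nat k" using sg by (simp add: sigma_def algebra_simps)
  have "p \<in> ?L'"
  proof (rule feichtinger_case[OF phi _ _ low'])
    show "tf_shift p \<phi> \<in> gabor_space \<phi> ?L'" using mem gabor_space_mono[OF sub] by blast
  qed (use A k sgk in auto)
  then obtain m l where ml: "p = pt v w (of_int m, of_int (int k * l))" using L'E by blast
  then have "pt v w x = pt v w (of_int m, of_int (int k * l))" using x by simp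
  then have xe: "x = (of_int m, of_int (int k * l))" by (rule injD[OF pt_inj[OF sg0]])
  then have "real k * \<bar>of_int l\<bar> < real k * 1" using k by (simp add: abs_mult)
  then have "l = 0" using k by (simp only: mult_less_cancel_left_pos of_nat_0_less_iff)
  then have "p = of_int m *\<^sub>R v" using ml by (simp add: pt_def)
  then show ?thesis by (rule range_eqI)
qed

text \<open>The same device one rank lower: a long horizontal vector is added, longer than the first
  coordinate of \<open>p\<close>, and the rank one case applies.\<close>

lemma feichtinger_rank_zero_case:
  assumes phi: "\<phi> \<in> feichtinger_algebra"
    and lower: "lower_riesz A \<phi> {0}" and A: "A > 0" and mem: "tf_shift p \<phi> \<in> gabor_space \<phi> {0}"
  shows "p = 0"
proof -
  have L2: "\<phi> \<in> L2" and F: "integrable lborel (gauss_stft \<phi>)" using phi by (auto simp: feichtinger_algebra_def)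
  have sg0: "sigma (1, 0) (0, 1) \<noteq> 0" by (simp add: sigma_def)
  obtain N where N: "\<And>S. finite S \<Longrightarrow> S \<subseteq> {pt (1, 0) (0, 1) (of_int k, of_int l) |k l. \<bar>k\<bar> > int N \<or> \<bar>l\<bar> > int N} \<Longrightarrow> (\<Sum>p\<in>S. norm (amb \<phi> p)) \<le> A / 2"
    using amb_tail[OF L2 F sg0, of "A / 2"] A by auto
  define k where "k = max (Suc N) (nat \<lceil>\<bar>fst p\<bar>\<rceil> + 1)"
  have k: "k > N" "k > 0" "real k > \<bar>fst p\<bar>" unfolding k_def by linarith+
  define v where "v = (real k, 0 :: real)"
  have v: "v \<noteq> 0" using k by (simp add: v_def zero_prod_def)
  let ?L = "range (\<lambda>m::int. of_int m *\<^sub>R v)"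
  have low': "lower_riesz (A / 2) \<phi> ?L"
  proof (rule lower_riesz_extend[OF L2 lower])
    show "p - q \<in> ?L" if pq: "p \<in> ?L" "q \<in> ?L" for p q
    proof -
      obtain a b :: int where "p = of_int a *\<^sub>R v" "q = of_int b *\<^sub>R v" using pq by blast
      then have "p - q = of_int (a - b) *\<^sub>R v" by (simp add: algebra_simps)
      then show ?thesis by (rule range_eqI)
    qed
    show "(\<Sum>p\<in>S. norm (amb \<phi> p)) \<le> A / 2" if S: "finite S" "S \<subseteq> ?L - {0}" for S
    proof (rule N[OF S(1)], rule subsetI)
      fix q assume q: "q \<in> S"
      then obtain m :: int where m: "q = of_int m *\<^sub>R v" "q \<noteq> 0" using S(2) by blast
      then have "m \<noteq> 0" by auto
      then have "1 \<le> \<bar>m\<bar>" by simp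
      then have "int k * 1 \<le> int k * \<bar>m\<bar>" by (rule mult_left_mono) simp
      then have "\<bar>int k * m\<bar> \<ge> int k" by (simp only: abs_mult abs_of_nat mult_1_right)
      then have "\<bar>int k * m\<bar> > int N" using k(1) by linarith
      moreover have "q = pt (1, 0) (0, 1) (of_int (int k * m), of_int 0)" using m by (simp add: pt_def v_def)
      ultimately show "q \<in> {pt (1, 0) (0, 1) (of_int k, of_int l) |k l. \<bar>k\<bar> > int N \<or> \<bar>l\<bar> > int N}" by blast
    qed
  qed auto
  have sub: "{0} \<subseteq> ?L" by (simp add: range_eqI[of _ _ 0])
  have "p \<in> ?L"
    by (rule feichtinger_rank_one_case[OF phi v low']) (use A mem gabor_space_mono[OF sub] in auto)
  then obtain m :: int where m: "p = of_int m *\<^sub>R v" by blast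
  then have "real k * \<bar>of_int m\<bar> < real k * 1" using k by (simp add: v_def abs_mult)
  then have "m = 0" using k by (simp only: mult_less_cancel_left_pos of_nat_0_less_iff)
  then show ?thesis using m by simp
qed

text \<open>A smallest positive element exists by discreteness, and division with remainder shows
  that it generates.\<close>

lemma discrete_real_subgroup:
  fixes G :: "real set"
  assumes z: "0 \<in> G" and diff: "\<And>x y. x \<in> G \<Longrightarrow> y \<in> G \<Longrightarrow> x - y \<in> G"
    and d: "\<delta> > 0" "\<And>x. x \<in> G \<Longrightarrow> x \<noteq> 0 \<Longrightarrow> \<bar>x\<bar> \<ge> \<delta>"
  obtains g where "G = range (\<lambda>m::int. of_int m * g)"
proof (cases "G = {0}")
  case True
  then show thesis using that[of 0] by auto
next
  case False
  have neg: "- x \<in> G" if "x \<in> G" for x using diff[OF z that] by simp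
  obtain y where "y \<in> G" "y \<noteq> 0" using False z by blast
  then have "\<exists>y. y \<in> G \<and> y > 0" using neg[of y] by (metis linorder_neqE_linordered_idom neg_0_less_iff_less)
  \<comment> \<open>Minimality is sought for the natural number floor(y / \<delta>), whose values
    are well-ordered. Two elements with the same value differ by less than \<delta> and so
    coincide.\<close>
  then obtain g where g: "g \<in> G" "g > 0" and min: "\<And>y. y \<in> G \<Longrightarrow> y > 0 \<Longrightarrow> nat \<lfloor>g / \<delta>\<rfloor> \<le> nat \<lfloor>y / \<delta>\<rfloor>"
    using ex_has_least_nat[of "\<lambda>y. y \<in> G \<and> y > 0" _ "\<lambda>y. nat \<lfloor>y / \<delta>\<rfloor>"] by blast
  have least: "g \<le> y" if y: "y \<in> G" "y > 0" for y
  proof (rule ccontr)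
    assume "\<not> g \<le> y"
    then have "\<lfloor>y / \<delta>\<rfloor> \<le> \<lfloor>g / \<delta>\<rfloor>" "y < g" using d by (auto intro!: floor_mono divide_right_mono)
    moreover have "\<lfloor>g / \<delta>\<rfloor> \<le> \<lfloor>y / \<delta>\<rfloor>" using min[OF y] y(2) d(1) by (simp add: nat_le_eq_zle)
    ultimately have "\<lfloor>g / \<delta>\<rfloor> = \<lfloor>y / \<delta>\<rfloor>" by simp
    then have "g / \<delta> - y / \<delta> < 1" by linarith
    then have "g - y < \<delta>" using d by (simp add: diff_divide_distrib[symmetric])
    then show False using d(2)[OF diff[OF g(1) y(1)]] \<open>y < g\<close> by simp
  qed
  have mult: "of_int m * g \<in> G" for m
  proof -
    have n: "of_nat n * g \<in> G" for n
    proof (induction n)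
      case (Suc n)
      from diff[OF this neg[OF g(1)]] show ?case by (simp add: algebra_simps)
    qed (simp add: z)
    show ?thesis using n neg by (cases m rule: int_cases2) auto
  qed
  have "y \<in> range (\<lambda>m::int. of_int m * g)" if y: "y \<in> G" for y
  proof -
    let ?r = "y - of_int \<lfloor>y / g\<rfloor> * g"
    have "?r \<in> G" by (rule diff[OF y mult])
    moreover have "0 \<le> ?r" "?r < g"
    proof -
      have "of_int \<lfloor>y / g\<rfloor> \<le> y / g" "y / g < of_int \<lfloor>y / g\<rfloor> + 1" by linarith+
      then have "of_int \<lfloor>y / g\<rfloor> * g \<le> y" "y < (of_int \<lfloor>y / g\<rfloor> + 1) * g"
        by (simp_all only: pos_le_divide_eq[OF g(2)] pos_divide_less_eq[OF g(2)])
      then show "0 \<le> ?r" "?r < g" by (simp_all add: distrib_right)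
    qed
    ultimately have "?r = 0" using least[of ?r] by force
    then have "y = of_int \<lfloor>y / g\<rfloor> * g" by simp
    then show ?thesis by (rule range_eqI)
  qed
  then have "G = range (\<lambda>m::int. of_int m * g)" using mult by auto
  then show thesis by (rule that)
qed

text \<open>The squared norm of \<phi> - \<open>rho p \<phi>\<close> is 2 Re
  (\<open>amb \<phi> 0\<close> - \<open>amb \<phi> p\<close>), which is small for p near 0, whereas
  the coefficients 1 and -1 force it to be at least 2 A.\<close>

lemma lower_riesz_discrete:
  assumes phi: "\<phi> \<in> L2" and F: "integrable lborel (gauss_stft \<phi>)" and low: "lower_riesz A \<phi> \<Lambda>"
    and A: "A > 0" and z: "0 \<in> \<Lambda>"
  obtains \<delta> where "\<delta> > 0" "\<And>p. p \<in> \<Lambda> \<Longrightarrow> p \<noteq> 0 \<Longrightarrow> norm p \<ge> \<delta>"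
proof -
  have "isCont (amb \<phi>) 0" using amb_continuous[OF phi F] unfolding continuous_on_eq_continuous_at[OF open_UNIV] by blast
  then obtain \<delta> where d: "\<delta> > 0" "\<And>p. dist p 0 < \<delta> \<Longrightarrow> dist (amb \<phi> p) (amb \<phi> 0) < A"
    unfolding continuous_at_eps_delta using A by blast
  have "norm p \<ge> \<delta>" if p: "p \<in> \<Lambda>" "p \<noteq> 0" for p
  proof (rule ccontr)
    assume "\<not> norm p \<ge> \<delta>"
    then have near: "norm (amb \<phi> p - amb \<phi> 0) < A" using d(2)[of p] by (simp add: dist_norm)
    define c :: "real \<times> real \<Rightarrow> complex" where "c q = (if q = 0 then 1 else - 1)" for q
    have "A * (\<Sum>p\<in>{0, p}. (norm (c p))\<^sup>2) \<le> (L2_norm (\<lambda>x. \<Sum>p\<in>{0, p}. c p * rho p \<phi> x))\<^sup>2"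
      by (rule low[unfolded lower_riesz_def, rule_format]) (use p z in auto)
    then have "A * 2 \<le> Re (of_real ((L2_norm (\<lambda>x. \<Sum>p\<in>{0, p}. c p * rho p \<phi> x))\<^sup>2))"
      using p by (simp add: c_def)
    also have "\<dots> = Re (2 * amb \<phi> 0 - amb \<phi> p - cnj (amb \<phi> p))"
      unfolding L2_norm_sum_rho[OF phi finite.insertI[OF finite.insertI[OF finite.emptyI]]]
      using p by (simp add: c_def ip_rho_amb sigma_def amb_minus)
    also have "\<dots> = 2 * Re (amb \<phi> 0 - amb \<phi> p)" by simp
    also have "\<dots> \<le> 2 * norm (amb \<phi> p - amb \<phi> 0)" using complex_Re_le_cmod[of "amb \<phi> 0 - amb \<phi> p"] by (simp add: norm_minus_commute)
    finally show False using near by simp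
  qed
  with d(1) show thesis by (rule that)
qed

text \<open>The two generators are collinear but may be incommensurable, and then their integer span
  would be dense in a line. The lower Riesz bound rules this out by making the span discrete, so a
  single vector generates it.\<close>

theorem feichtinger_degenerate_case:
  assumes phi: "\<phi> \<in> feichtinger_algebra" and sg: "sigma v1 v2 = 0"
    and lower: "lower_riesz A \<phi> (pt v1 v2 ` latt)" and A: "A > 0"
    and mem: "tf_shift p \<phi> \<in> gabor_space \<phi> (pt v1 v2 ` latt)"
  shows "p \<in> pt v1 v2 ` latt"
proof -
  let ?L = "pt v1 v2 ` latt"
  have L2: "\<phi> \<in> L2" and F: "integrable lborel (gauss_stft \<phi>)" using phi by (auto simp: feichtinger_algebra_def)
  obtain w s t where w: "w \<noteq> 0" "v1 = s *\<^sub>R w" "v2 = t *\<^sub>R w"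
  proof (cases "v1 = 0")
    case True
    show thesis
    proof (cases "v2 = 0")
      case True
      then show thesis using that[of "(1, 0)" 0 0] \<open>v1 = 0\<close> by (simp add: zero_prod_def)
    next
      case False
      then show thesis using that[of v2 0 1] \<open>v1 = 0\<close> by simp
    qed
  next
    case False
    define n where "n = (fst v1)\<^sup>2 + (snd v1)\<^sup>2"
    have n: "n \<noteq> 0" using False by (simp add: n_def prod_eq_iff sum_power2_eq_zero_iff)
    \<comment> \<open>The coefficient of the orthogonal projection of \<open>v2\<close> onto
      \<open>v1\<close>, which recovers \<open>v2\<close> itself because the area vanishes.\<close>
    define t where "t = (fst v1 * fst v2 + snd v1 * snd v2) / n"
    have s: "fst v2 * snd v1 = fst v1 * snd v2" using sg by (simp add: sigma_def)
    have "n * fst v2 = n * (t * fst v1)"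
    proof -
      have "n * fst v2 = fst v1 * (fst v1 * fst v2) + snd v1 * (fst v2 * snd v1)" by (simp add: n_def power2_eq_square algebra_simps)
      also have "\<dots> = (fst v1 * fst v2 + snd v1 * snd v2) * fst v1" unfolding s by (simp add: algebra_simps)
      finally show ?thesis using n by (simp add: t_def)
    qed
    moreover have "n * snd v2 = n * (t * snd v1)"
    proof -
      have "n * snd v2 = fst v1 * (fst v1 * snd v2) + snd v1 * (snd v1 * snd v2)" by (simp add: n_def power2_eq_square algebra_simps)
      also have "\<dots> = (fst v1 * fst v2 + snd v1 * snd v2) * snd v1" unfolding s[symmetric] by (simp add: algebra_simps)
      finally show ?thesis using n by (simp add: t_def)
    qed
    ultimately have "v2 = t *\<^sub>R v1" using n by (simp add: prod_eq_iff)
    then show thesis using that[of v1 1 t] False by simp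
  qed
  define G where "G = {of_int m * s + of_int n * t |m n :: int. True}"
  have L: "?L = (\<lambda>x. x *\<^sub>R w) ` G"
  proof -
    have e: "pt v1 v2 y = (fst y * s + snd y * t) *\<^sub>R w" for y by (simp add: pt_def w algebra_simps)
    have G: "G = (\<lambda>y. fst y * s + snd y * t) ` latt"
    proof (intro equalityI subsetI)
      fix x assume "x \<in> G"
      then obtain m n :: int where "x = of_int m * s + of_int n * t" by (auto simp: G_def)
      then show "x \<in> (\<lambda>y. fst y * s + snd y * t) ` latt"
        by (intro image_eqI[of _ _ "(of_int m, of_int n)"]) (simp_all add: latt_def)
    next
      fix x assume "x \<in> (\<lambda>y. fst y * s + snd y * t) ` latt"
      then obtain y where y: "y \<in> latt" "x = fst y * s + snd y * t" by blast
      then obtain m l :: int where "fst y = of_int m" "snd y = of_int l" by (auto simp: latt_def elim!: Ints_cases)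
      then show "x \<in> G" using y(2) unfolding G_def by auto
    qed
    show ?thesis unfolding G image_image by (intro image_cong refl e)
  qed
  have G0: "0 \<in> G" unfolding G_def by (auto intro!: exI[of _ 0])
  have Gd: "x - y \<in> G" if xy: "x \<in> G" "y \<in> G" for x y
  proof -
    obtain a b c d :: int where "x = of_int a * s + of_int b * t" "y = of_int c * s + of_int d * t" using xy unfolding G_def by blast
    then have "x - y = of_int (a - c) * s + of_int (b - d) * t" by (simp add: algebra_simps)
    then show ?thesis unfolding G_def by blast
  qed
  have L0: "0 \<in> ?L" unfolding L using G0 by (auto intro: rev_image_eqI)
  obtain \<delta> where d: "\<delta> > 0" "\<And>p. p \<in> ?L \<Longrightarrow> p \<noteq> 0 \<Longrightarrow> norm p \<ge> \<delta>"
    using lower_riesz_discrete[OF L2 F lower A L0] by blast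
  have "\<bar>x\<bar> \<ge> \<delta> / norm w" if "x \<in> G" "x \<noteq> 0" for x
    using d(2)[of "x *\<^sub>R w"] that w(1) unfolding L by (simp add: pos_divide_le_eq)
  moreover have "\<delta> / norm w > 0" using d w by simp
  ultimately obtain g where g: "G = range (\<lambda>m::int. of_int m * g)"
    using discrete_real_subgroup[OF G0 Gd] by blast
  have Lg: "?L = range (\<lambda>m::int. of_int m *\<^sub>R (g *\<^sub>R w))" unfolding L g by (simp add: image_image)
  show ?thesis
  proof (cases "g = 0")
    case True
    then have "?L = {0}" using Lg by simp
    then show ?thesis using feichtinger_rank_zero_case[OF phi _ A] lower mem by simp
  next
    case False
    then have "g *\<^sub>R w \<noteq> 0" using w by simp
    from feichtinger_rank_one_case[OF phi this _ A] show ?thesis using lower mem unfolding Lg by blast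
  qed
qed

section \<open>Bases of the lattice\<close>

hide_const (open) Lattice.lattice Determinant.det

lemma lattice_eq_pt:
  fixes R :: "real^2^2"
  shows "lattice R = pt (R$1$1, R$2$1) (R$1$2, R$2$2) ` latt"
proof -
  have e: "((R *v z) $ 1, (R *v z) $ 2) = pt (R$1$1, R$2$1) (R$1$2, R$2$2) (z$1, z$2)" for z :: "real^2"
    unfolding matrix_vector_mult_def pt_def by (simp add: sum_2)
  show ?thesis
  proof (intro equalityI subsetI)
    fix p assume "p \<in> lattice R"
    then obtain z :: "real^2" where z: "p = pt (R$1$1, R$2$1) (R$1$2, R$2$2) (z$1, z$2)" "\<forall>i. z$i \<in> \<int>"
      unfolding Defs.lattice_def e by blast
    show "p \<in> pt (R$1$1, R$2$1) (R$1$2, R$2$2) ` latt"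
      unfolding z(1) by (rule imageI) (use z(2) in \<open>simp add: latt_def\<close>)
  next
    fix p assume "p \<in> pt (R$1$1, R$2$1) (R$1$2, R$2$2) ` latt"
    then obtain x where x: "x \<in> latt" "p = pt (R$1$1, R$2$1) (R$1$2, R$2$2) x" by blast
    define z :: "real^2" where "z = vector [fst x, snd x]"
    have z: "z$1 = fst x" "z$2 = snd x" by (simp_all add: z_def)
    have "\<forall>i. z$i \<in> \<int>" using x(1) by (simp add: forall_2 z latt_def)
    moreover have "p = ((R *v z) $ 1, (R *v z) $ 2)" unfolding e z x(2) by simp
    ultimately show "p \<in> lattice R" unfolding Defs.lattice_def by blast
  qed
qed

lemma sigma_columns:
  fixes R :: "real^2^2"
  shows "sigma (R$1$1, R$2$1) (R$1$2, R$2$2) = - det R"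
  by (simp add: sigma_def det_2)

lemma lattice_density_det:
  fixes R :: "real^2^2"
  assumes "lattice_density R \<in> \<rat>" "det R \<noteq> 0"
  shows "det R \<in> \<rat>"
proof -
  have "\<not> rank R < 2" using assms(2) det_eq_0_rank[of R] by simp
  moreover have "rank R \<le> 2" using rank_bound[of R] by simp
  ultimately have "rank R = 2" by simp
  then have "inverse \<bar>det R\<bar> \<in> \<rat>" using assms(1) by (simp add: lattice_density_def)
  then have "\<bar>det R\<bar> \<in> \<rat>" using Rats_inverse by fastforce
  then show ?thesis by (simp add: abs_if split: if_splits)
qed

lemma rectangular_lattice_pt:
  "range (\<lambda>m::int. \<alpha> * of_int m) \<times> range (\<lambda>n::int. \<beta> * of_int n) = pt (\<alpha>, 0) (0, \<beta>) ` latt"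
proof -
  have "pt (\<alpha>, 0) (0, \<beta>) x = (\<alpha> * fst x, \<beta> * snd x)" for x by (simp add: pt_def)
  note e = this
  show ?thesis
  proof (intro equalityI subsetI)
    fix p assume "p \<in> range (\<lambda>m::int. \<alpha> * of_int m) \<times> range (\<lambda>n::int. \<beta> * of_int n)"
    then obtain m n :: int where "p = (\<alpha> * of_int m, \<beta> * of_int n)" by blast
    then have "p = pt (\<alpha>, 0) (0, \<beta>) (of_int m, of_int n)" by (simp add: e)
    moreover have "(of_int m, of_int n) \<in> latt" by (simp add: latt_def)
    ultimately show "p \<in> pt (\<alpha>, 0) (0, \<beta>) ` latt" by blast
  next
    fix p assume "p \<in> pt (\<alpha>, 0) (0, \<beta>) ` latt"
    then obtain x where x: "x \<in> latt" "p = pt (\<alpha>, 0) (0, \<beta>) x" by blast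
    then obtain m l :: int where "fst x = of_int m" "snd x = of_int l" by (auto simp: latt_def elim!: Ints_cases)
    then have "p = (\<alpha> * of_int m, \<beta> * of_int l)" using x(2) by (simp add: e)
    then show "p \<in> range (\<lambda>m::int. \<alpha> * of_int m) \<times> range (\<lambda>n::int. \<beta> * of_int n)" by blast
  qed
qed

text \<open>The rectangular generators are integer combinations of the given ones, so \<alpha>
  \<beta> is an integer multiple of the given area. As \<alpha> \<beta> is not 0, neither is that
  area, which is therefore rational.\<close>

lemma rectangular_lattice_area_rational:
  assumes L: "pt v1 v2 ` latt = pt (\<alpha>, 0) (0, \<beta>) ` latt" and ab: "\<alpha> > 0" "\<beta> > 0"
    and rat: "sigma v1 v2 \<noteq> 0 \<Longrightarrow> sigma v1 v2 \<in> \<rat>"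
  shows "\<alpha> * \<beta> \<in> \<rat>"
proof -
  have l: "(1, 0) \<in> latt" "(0, 1) \<in> latt" by (simp_all add: latt_def)
  have "pt (\<alpha>, 0) (0, \<beta>) (1, 0) \<in> pt v1 v2 ` latt" "pt (\<alpha>, 0) (0, \<beta>) (0, 1) \<in> pt v1 v2 ` latt"
    unfolding L using l by blast+
  then obtain x y where xy: "x \<in> latt" "y \<in> latt" "pt (\<alpha>, 0) (0, \<beta>) (1, 0) = pt v1 v2 x" "pt (\<alpha>, 0) (0, \<beta>) (0, 1) = pt v1 v2 y"
    by blast
  have "sigma (\<alpha>, 0) (0, \<beta>) = sigma (pt v1 v2 x) (pt v1 v2 y)"
    unfolding xy(3,4)[symmetric] sigma_pt by (simp add: wedge_def)
  then have e: "\<alpha> * \<beta> = - (sigma v1 v2 * wedge x y)" unfolding sigma_pt by (simp add: sigma_def)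
  moreover have "\<alpha> * \<beta> \<noteq> 0" using ab by simp
  ultimately have "sigma v1 v2 \<noteq> 0" by auto
  moreover have "wedge x y \<in> \<rat>"
  proof -
    have "wedge x y \<in> \<int>" using xy(1,2) unfolding latt_def wedge_def by (auto intro!: Ints_diff Ints_mult)
    then show ?thesis using Ints_subset_Rats by blast
  qed
  ultimately show ?thesis unfolding e using rat by simp
qed

theorem theorem1:
  fixes \<phi> :: "real \<Rightarrow> complex" and R :: "real^2^2" and \<Lambda> :: "(real \<times> real) set"
  assumes "\<phi> \<in> L2"
    and "\<Lambda> = lattice R"
    and "lattice_density R \<in> \<rat>"
    and "riesz_basis \<Lambda> (\<lambda>p. tf_shift p \<phi>) (gabor_space \<phi> \<Lambda>)"
  shows "(\<phi> \<in> feichtinger_algebra \<longrightarrow>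
            (\<forall>u \<eta>. (u, \<eta>) \<notin> \<Lambda> \<longrightarrow> tf_shift (u, \<eta>) \<phi> \<notin> gabor_space \<phi> \<Lambda>)) \<and>
         (\<forall>\<alpha> \<beta>. \<alpha> > 0 \<longrightarrow> \<beta> > 0 \<longrightarrow>
            \<Lambda> = range (\<lambda>m::int. \<alpha> * of_int m) \<times> range (\<lambda>n::int. \<beta> * of_int n) \<longrightarrow>
            zak_transform_continuous \<alpha> \<phi> \<longrightarrow>
            (\<forall>u \<eta>. (u, \<eta>) \<notin> \<Lambda> \<longrightarrow> tf_shift (u, \<eta>) \<phi> \<notin> gabor_space \<phi> \<Lambda>))"
proof -
  define v1 where "v1 = (R$1$1, R$2$1)"
  define v2 where "v2 = (R$1$2, R$2$2)"
  have L: "\<Lambda> = pt v1 v2 ` latt" unfolding assms(2) v1_def v2_def by (rule lattice_eq_pt)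
  \<comment> \<open>For rank below two the density is 0 by convention and says nothing about the
    generators, so rationality is claimed only for nonzero area.\<close>
  have rat: "sigma v1 v2 \<in> \<rat>" if "sigma v1 v2 \<noteq> 0"
    using that lattice_density_det[OF assms(3)] unfolding v1_def v2_def sigma_columns by simp
  obtain A where A: "A > 0" "lower_riesz A \<phi> \<Lambda>" using riesz_basis_lower[OF assms(4)] by blast
  have part1: "p \<in> \<Lambda>" if phi: "\<phi> \<in> feichtinger_algebra" and mem: "tf_shift p \<phi> \<in> gabor_space \<phi> \<Lambda>" for p
  proof (cases "sigma v1 v2 = 0")
    case True
    show ?thesis unfolding L
      by (rule feichtinger_degenerate_case[OF phi True A(2)[unfolded L] A(1) mem[unfolded L]])
  next
    case False
    show ?thesis unfolding L
      by (rule feichtinger_case[OF phi rat[OF False] False A(2)[unfolded L] A(1) mem[unfolded L]])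
  qed
  have part2: "p \<in> \<Lambda>" if ab: "\<alpha> > 0" "\<beta> > 0"
    and Lab: "\<Lambda> = range (\<lambda>m::int. \<alpha> * of_int m) \<times> range (\<lambda>n::int. \<beta> * of_int n)"
    and zak: "zak_transform_continuous \<alpha> \<phi>" and mem: "tf_shift p \<phi> \<in> gabor_space \<phi> \<Lambda>" for \<alpha> \<beta> p
  proof -
    have L': "\<Lambda> = pt (\<alpha>, 0) (0, \<beta>) ` latt" unfolding Lab by (rule rectangular_lattice_pt)
    have "\<alpha> * \<beta> \<in> \<rat>" by (rule rectangular_lattice_area_rational[OF trans[OF L[symmetric] L'] ab rat])
    then show ?thesis unfolding L'
      by (rule zak_case[OF assms(1) ab _ A(2)[unfolded L'] A(1) zak mem[unfolded L']])
  qed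
  show ?thesis using part1 part2 by blast
qed

end
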